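(* Let $m\ge 1$ and let $\mathcal{H}$ be a family of measurable functions $h:\mathbb{R}^m\to\mathbb{R}$ with $|h|\le H$ for all $h\in\mathcal{H}$, where $H(y_1,\dots,y_m)=V(y_1)\cdots V(y_m)$. Suppose that: (i) $f$ is absolutely continuous with almost everywhere derivative $f'$ and $\int \ell^2(y)f(y)\,dy<\infty$, where $\ell=-f'/f$; (ii) the kernel $k$ is a symmetric, twice continuously differentiable density with compact support $[-1,1]$; (iii) the bandwidth satisfies $nb_n^4\to 0$ and $nb_n^{d_*}\to\infty$ with $d_*=(50+20d)/(14+5d)$; (iv) $\tau\mapsto r_\tau(\mathbf{x})$ is continuously differentiable for all $\mathbf{x}$ with gradient $\tau\mapsto\dot r_\tau(\mathbf{x})$; for each constant $C$, $\sup_{|\tau-\vartheta|\le Cn^{-1/2}}\sum_{i=1}^n\big(r_\tau(\mathbf{X}_{i-1})-r_\vartheta(\mathbf{X}_{i-1})-\dot r_\vartheta(\mathbf{X}_{i-1})^\top(\tau-\vartheta)\big)^2=O_p(n^{-2/3})$; $E[|\dot r_\vartheta(\mathbf{X})|^{5/2}]<\infty$; and the matrix $E[\dot r_\vartheta(\mathbf{X})\dot r_\vartheta(\mathbf{X})^\top]$ is positive definite; (v) $V:\mathbb{R}\to\mathbb{R}$ is measurable, $V\ge 1$, $\int(1+|y|)^\alpha V^2(y)f(y)\,dy<\infty$ for some $\alpha>1$, and the function $D(s)=\sup_{y\in\mathbb{R}}|V(y+s)-V(y)|/V(y)$ is bounded on compacts and satisfies $D(s)\to0$ as $s\to0$.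 Then $$\sup_{h\in\mathcal{H}}\Big|\psi(h,\tilde f)-\psi(h,f)-\frac1n\sum_{i=1}^n\bar h^*(\varepsilon_i)+B(\bar h^* )^\top(\tilde\vartheta-\vartheta)-U_n(\bar h)\Big|=o_p(n^{-1/2})$$ and $$\sup_{h\in\mathcal{H}}\Big|\psi(h,\tilde f_w)-\psi(h,f)-\frac1n\sum_{i=1}^n\bar h^{\#}(\varepsilon_i)+B(\bar h^{\#})^\top(\tilde\vartheta-\vartheta)-U_n(\bar h)\Big|=o_p(n^{-1/2}).$$
   Context: Model: $X_{1-p},\dots,X_n$ are observations from a stationary and ergodic real-valued process with $X_i=r_\vartheta(\mathbf{X}_{i-1})+\varepsilon_i$, $\mathbf{X}_{i-1}=(X_{i-p},\dots,X_{i-1})$, where $r_\tau:\mathbb{R}^p\to\mathbb{R}$ is a family of functions indexed by a $d$-dimensional parameter $\tau$ and $\vartheta$ is the true parameter. The innovations $\varepsilon_i$ are i.i.d. with mean zero, finite variance $\sigma^2$ and positive density $f$ and are independent of $\mathbf{X}_0$. $(\mathbf{X},\varepsilon)$ has the joint distribution of $(\mathbf{X}_{i-1},\varepsilon_i)$; $F$ is the distribution function of $\varepsilon$. Estimators: $\tilde\vartheta$ is a $n^{1/2}$-consistent estimator of $\vartheta$ (i.e. $\tilde\vartheta-\vartheta=O_p(n^{-1/2})$). Residuals: $\tilde\varepsilon_i=X_i-r_{\tilde\vartheta}(\mathbf{X}_{i-1})$. With $k_{b_n}(y)=k(y/b_n)/b_n$, set $\tilde f(y)=\frac1n\sum_{i=1}^nk_{b_n}(y-\tilde\varepsilon_i)$,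 $\tilde f_w(y)=\frac1n\sum_{i=1}^nw_ik_{b_n}(y-\tilde\varepsilon_i)$ and $\hat f(y)=\frac1n\sum_{i=1}^nk_{b_n}(y-\varepsilon_i)$. The weights are $w_i=1/(1+\tilde\lambda\tilde\varepsilon_i)$, with $\tilde\lambda$ chosen so that the $w_i$ are positive and $\sum_{i=1}^nw_i\tilde\varepsilon_i=0$; when there is no such $\tilde\lambda$, set $\tilde\lambda=0$. Notation: for a density (or density estimator) $g$, $\psi(h,g)=\int\cdots\int h(y_1,\dots,y_m)\prod_{j=1}^mg(y_j)\,dy_j$. For $h:\mathbb{R}^m\to\mathbb{R}$, $\bar h=\bar h_1+\cdots+\bar h_m$ with $\bar h_j(y_j)=\int\cdots\int h(y_1,\dots,y_m)\prod_{k\ne j}f(y_k)\,dy_k$. For $g\in L_2(F)$: $g^*(y)=g(y)-E[g(\varepsilon)]$; $g^{\#}(y)=g(y)-E[g(\varepsilon)]-\sigma^{-2}E[\varepsilon g(\varepsilon)]\,y$; $B(g)=E[g(\varepsilon)\ell(\varepsilon)]\,E[\dot r_\vartheta(\mathbf{X})]$; $U_n(g)=\int g(y)\hat f(y)\,dy-\frac1n\sum_{i=1}^ng(\varepsilon_i)$. *)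

theory Defs
  imports "HOL-Probability.Probability"
begin

section \<open>Stochastic orders\<close>

text \<open>
  Suprema over uncountable families need not be measurable. Random quantities are therefore
  allowed to be arbitrary functions into the extended nonnegative reals, and probabilities of events
  are outer probabilities, which coincide with probabilities for measurable events.
\<close>

definition bigO_prob :: "'a measure \<Rightarrow> (nat \<Rightarrow> 'a \<Rightarrow> ennreal) \<Rightarrow> (nat \<Rightarrow> real) \<Rightarrow> bool" where
  "bigO_prob M Z a \<longleftrightarrow>
     (\<forall>e>0. \<exists>K::real. \<forall>\<^sub>F n in sequentially.
        outer_measure_of M {\<omega> \<in> space M. Z n \<omega> > ennreal (K * a n)} \<le> ennreal e)"

definition smallo_prob :: "'a measure \<Rightarrow> (nat \<Rightarrow> 'a \<Rightarrow> ennreal) \<Rightarrow> (nat \<Rightarrow> real) \<Rightarrow> bool" where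
  "smallo_prob M Z a \<longleftrightarrow>
     (\<forall>e>0. (\<lambda>n. outer_measure_of M {\<omega> \<in> space M. Z n \<omega> > ennreal (e * a n)}) \<longlonglongrightarrow> 0)"

section \<open>Analytic notions\<close>

definition abs_continuous_on :: "real set \<Rightarrow> (real \<Rightarrow> real) \<Rightarrow> bool" where
  "abs_continuous_on S g \<longleftrightarrow>
     (\<forall>e>0. \<exists>d>0. \<forall>(N::nat) u v.
        (\<forall>i<N. u i \<le> v i \<and> {u i..v i} \<subseteq> S) \<and>
        disjoint_family_on (\<lambda>i. {u i<..<v i}) {..<N} \<and>
        (\<Sum>i<N. v i - u i) < d
        \<longrightarrow> (\<Sum>i<N. \<bar>g (v i) - g (u i)\<bar>) < e)"

definition kernel_C2 :: "(real \<Rightarrow> real) \<Rightarrow> bool" where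
  "kernel_C2 k \<longleftrightarrow>
     (\<forall>y. k (- y) = k y) \<and>
     (\<exists>k' k''. (\<forall>y. (k has_real_derivative k' y) (at y)) \<and>
               (\<forall>y. (k' has_real_derivative k'' y) (at y)) \<and>
               continuous_on UNIV k'') \<and>
     (\<forall>y. 0 \<le> k y) \<and> has_bochner_integral lborel k 1 \<and>
     closure {y. k y \<noteq> 0} = {-1..1}"

definition pos_definite :: "real^'d^'d \<Rightarrow> bool" where
  "pos_definite A \<longleftrightarrow> transpose A = A \<and> (\<forall>v. v \<noteq> 0 \<longrightarrow> 0 < v \<bullet> (A *v v))"

definition growth_modulus :: "(real \<Rightarrow> real) \<Rightarrow> real \<Rightarrow> ennreal" where
  "growth_modulus V s = (SUP y. ennreal (\<bar>V (y + s) - V y\<bar> / V y))"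

section \<open>The autoregressive model\<close>

text \<open>
  Points of $R^q$ are extensional functions on \<open>{1..q}\<close>, that is, elements of the space of
  \<open>Pi\<^sub>M {1..q} (\<lambda>_. borel)\<close>.
\<close>

text \<open>The lag vector $(X_{t-p+1},\dots,X_t)$.\<close>

definition lag :: "nat \<Rightarrow> (int \<Rightarrow> 'a \<Rightarrow> real) \<Rightarrow> int \<Rightarrow> 'a \<Rightarrow> nat \<Rightarrow> real" where
  "lag p X t \<omega> = (\<lambda>j\<in>{1..p}. X (t - int p + int j) \<omega>)"

text \<open>The sample $X_{1-p},\dots,X_n$.\<close>

definition sample :: "nat \<Rightarrow> (int \<Rightarrow> 'a \<Rightarrow> real) \<Rightarrow> nat \<Rightarrow> 'a \<Rightarrow> int \<Rightarrow> real" where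
  "sample p X n \<omega> = (\<lambda>i\<in>{1 - int p..int n}. X i \<omega>)"

text \<open>Strict stationarity and ergodicity of a sequence, via the shift on the path space.\<close>

definition stationary :: "'a measure \<Rightarrow> (nat \<Rightarrow> 'a \<Rightarrow> real) \<Rightarrow> bool" where
  "stationary M Y \<longleftrightarrow>
     (\<forall>k. Y k \<in> borel_measurable M) \<and>
     (\<forall>s. distr M (\<Pi>\<^sub>M k\<in>UNIV. borel) (\<lambda>\<omega> k. Y (k + s) \<omega>) =
          distr M (\<Pi>\<^sub>M k\<in>UNIV. borel) (\<lambda>\<omega> k. Y k \<omega>))"

definition ergodic :: "'a measure \<Rightarrow> (nat \<Rightarrow> 'a \<Rightarrow> real) \<Rightarrow> bool" where
  "ergodic M Y \<longleftrightarrow>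
     (\<forall>A \<in> sets (\<Pi>\<^sub>M k\<in>UNIV. borel). {y. (\<lambda>k. y (Suc k)) \<in> A} = A \<longrightarrow>
        measure M {\<omega> \<in> space M. (\<lambda>k. Y k \<omega>) \<in> A} \<in> {0, 1})"

text \<open>
  Only the values \<open>X i\<close> with \<open>i \<ge> 1 - p\<close> and \<open>eps i\<close> with \<open>i \<ge> 1\<close> are constrained.
\<close>

locale nonlinear_ar = prob_space M
  for M :: "'a measure" +
  fixes p :: nat
    and X :: "int \<Rightarrow> 'a \<Rightarrow> real"
    and eps :: "nat \<Rightarrow> 'a \<Rightarrow> real"
    and r :: "real^'d \<Rightarrow> (nat \<Rightarrow> real) \<Rightarrow> real"
    and \<theta> :: "real^'d"
    and f :: "real \<Rightarrow> real"
    and \<sigma> :: real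
  assumes lag_order: "1 \<le> p"
    and stationary: "stationary M (\<lambda>k. X (1 - int p + int k))"
    and ergodic: "ergodic M (\<lambda>k. X (1 - int p + int k))"
    and regression_measurable: "\<And>\<tau>. r \<tau> \<in> borel_measurable (\<Pi>\<^sub>M j\<in>{1..p}. borel)"
    and recursion: "\<And>i \<omega>. 1 \<le> i \<Longrightarrow> \<omega> \<in> space M \<Longrightarrow>
          X (int i) \<omega> = r \<theta> (lag p X (int i - 1) \<omega>) + eps i \<omega>"
    and innovations_indep: "indep_vars (\<lambda>_. borel) eps {1..}"
    and innovations_indep_start:
          "indep_var (\<Pi>\<^sub>M j\<in>{1..p}. borel) (lag p X 0)
                     (\<Pi>\<^sub>M i\<in>{1..}. borel) (\<lambda>\<omega>. \<lambda>i\<in>{1..}. eps i \<omega>)"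
    and innovations_density:
          "\<And>i. 1 \<le> i \<Longrightarrow> distributed M lborel (eps i) (\<lambda>y. ennreal (f y))"
    and density_pos: "\<And>y. 0 < f y"
    and innovations_sq_integrable: "\<And>i. 1 \<le> i \<Longrightarrow> integrable M (\<lambda>\<omega>. (eps i \<omega>)\<^sup>2)"
    and innovations_mean: "\<And>i. 1 \<le> i \<Longrightarrow> expectation (eps i) = 0"
    and innovations_variance: "\<And>i. 1 \<le> i \<Longrightarrow> variance (eps i) = \<sigma>\<^sup>2"

section \<open>Estimators\<close>

definition residual ::
  "nat \<Rightarrow> (real^'d \<Rightarrow> (nat \<Rightarrow> real) \<Rightarrow> real) \<Rightarrow> (int \<Rightarrow> 'a \<Rightarrow> real) \<Rightarrow> real^'d \<Rightarrow> 'a \<Rightarrow> nat \<Rightarrow> real"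
  where "residual p r X \<tau> \<omega> i = X (int i) \<omega> - r \<tau> (lag p X (int i - 1) \<omega>)"

definition scaled_kernel :: "(real \<Rightarrow> real) \<Rightarrow> real \<Rightarrow> real \<Rightarrow> real" where
  "scaled_kernel k b y = k (y / b) / b"

definition kde :: "(real \<Rightarrow> real) \<Rightarrow> real \<Rightarrow> nat \<Rightarrow> (nat \<Rightarrow> real) \<Rightarrow> real \<Rightarrow> real" where
  "kde k b n e y = (\<Sum>i=1..n. scaled_kernel k b (y - e i)) / real n"

definition valid_multiplier :: "nat \<Rightarrow> (nat \<Rightarrow> real) \<Rightarrow> real \<Rightarrow> bool" where
  "valid_multiplier n e l \<longleftrightarrow>
     (\<forall>i\<in>{1..n}. 0 < 1 / (1 + l * e i)) \<and> (\<Sum>i=1..n. 1 / (1 + l * e i) * e i) = 0"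

text \<open>
  A valid multiplier is unique unless \<open>e 1, \<dots>, e n\<close> all vanish, and then every choice gives
  unit weights; hence the choice made here does not affect the weights.
\<close>

definition multiplier :: "nat \<Rightarrow> (nat \<Rightarrow> real) \<Rightarrow> real" where
  "multiplier n e =
     (if \<exists>l. valid_multiplier n e l then SOME l. valid_multiplier n e l else 0)"

definition el_weight :: "nat \<Rightarrow> (nat \<Rightarrow> real) \<Rightarrow> nat \<Rightarrow> real" where
  "el_weight n e i = 1 / (1 + multiplier n e * e i)"

definition weighted_kde :: "(real \<Rightarrow> real) \<Rightarrow> real \<Rightarrow> nat \<Rightarrow> (nat \<Rightarrow> real) \<Rightarrow> real \<Rightarrow> real" where
  "weighted_kde k b n e y =
     (\<Sum>i=1..n. el_weight n e i * scaled_kernel k b (y - e i)) / real n"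

section \<open>Functionals of densities and the expansion terms\<close>

definition psi :: "nat \<Rightarrow> ((nat \<Rightarrow> real) \<Rightarrow> real) \<Rightarrow> (real \<Rightarrow> real) \<Rightarrow> real" where
  "psi m h g = (\<integral>y. h y * (\<Prod>j=1..m. g (y j)) \<partial>(\<Pi>\<^sub>M j\<in>{1..m}. lborel))"

definition h_bar_j ::
  "nat \<Rightarrow> (real \<Rightarrow> real) \<Rightarrow> ((nat \<Rightarrow> real) \<Rightarrow> real) \<Rightarrow> nat \<Rightarrow> real \<Rightarrow> real" where
  "h_bar_j m f h j t =
     (\<integral>y. h (y(j := t)) * (\<Prod>k\<in>{1..m} - {j}. f (y k)) \<partial>(\<Pi>\<^sub>M k\<in>{1..m} - {j}. lborel))"

definition h_bar :: "nat \<Rightarrow> (real \<Rightarrow> real) \<Rightarrow> ((nat \<Rightarrow> real) \<Rightarrow> real) \<Rightarrow> real \<Rightarrow> real" where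
  "h_bar m f h t = (\<Sum>j=1..m. h_bar_j m f h j t)"

text \<open>The expectation $E[g(\varepsilon)]$ for an innovation with density \<open>f\<close>.\<close>

definition innov_mean :: "(real \<Rightarrow> real) \<Rightarrow> (real \<Rightarrow> real) \<Rightarrow> real" where
  "innov_mean f g = (\<integral>y. g y * f y \<partial>lborel)"

definition g_star :: "(real \<Rightarrow> real) \<Rightarrow> (real \<Rightarrow> real) \<Rightarrow> real \<Rightarrow> real" where
  "g_star f g y = g y - innov_mean f g"

definition g_sharp :: "(real \<Rightarrow> real) \<Rightarrow> real \<Rightarrow> (real \<Rightarrow> real) \<Rightarrow> real \<Rightarrow> real" where
  "g_sharp f \<sigma> g y = g y - innov_mean f g - innov_mean f (\<lambda>x. x * g x) / \<sigma>\<^sup>2 * y"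

text \<open>Here \<open>mu\<close> stands for the mean of the gradient of the regression function at \<open>\<theta>\<close>.\<close>

definition B_vec :: "(real \<Rightarrow> real) \<Rightarrow> (real \<Rightarrow> real) \<Rightarrow> real^'d \<Rightarrow> (real \<Rightarrow> real) \<Rightarrow> real^'d" where
  "B_vec f l mu g = innov_mean f (\<lambda>y. g y * l y) *\<^sub>R mu"

definition U_stat ::
  "(real \<Rightarrow> real) \<Rightarrow> real \<Rightarrow> nat \<Rightarrow> (nat \<Rightarrow> real) \<Rightarrow> (real \<Rightarrow> real) \<Rightarrow> real" where
  "U_stat k b n e g =
     (\<integral>y. g y * kde k b n e y \<partial>lborel) - (\<Sum>i=1..n. g (e i)) / real n"

end

theory Submission imports Defs
begin

text \<open>
  Distances between densities are measured by $\|g\|_V = \int V|g|$. Expanding $\prod_j g(y_j)$ around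
  \<open>f\<close> gives $\psi(h,g) = \psi(h,f) + \int \bar h\,(g-f) + O(\|g-f\|_V^2)$ uniformly in $h \in \mathcal H$,
  so it is enough that $\tilde f$ and $\tilde f_w$ are within $o_p(n^{-1/4})$ of \<open>f\<close> and that, up to
  $o_p(n^{-1/2})$ in this norm, $\tilde f = \hat f + f'\,\mu\cdot(\tilde\vartheta-\vartheta)$ and
  $\tilde f_w = \tilde f - \sigma^{-2}(\bar\varepsilon_n - \mu\cdot(\tilde\vartheta-\vartheta))\,y f(y)$, where \<open>\<mu>\<close> is
  the mean of the gradient and $\bar\varepsilon_n$ the mean of the innovations. Integrating $\bar h$ against $f'$ and $y f$ produces the vectors
  \<open>B\<close>, because $\int f' = 0$ and $\int y f' = -1$.

  For the first expansion, the linearised estimator minus $\hat f$ is the integral over $u \in [0,1]$ of the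
  score averages $n^{-1}\sum_i \dot r_i\,k_b'(y-\varepsilon_i+\dot r_i\cdot s)$ at $s = u(\tilde\vartheta-\vartheta)$, and these
  converge to $f'\mu$ uniformly in $|s|\le Cn^{-1/2}$: the martingale part is controlled by Chebyshev's
  inequality on a grid, and the compensator by continuity of translations in the norm together with the
  ergodic theorem. For the second one, monotonicity and the intermediate value theorem locate the
  multiplier: $\tilde\lambda = \sigma^{-2}\,n^{-1}\sum_i\tilde\varepsilon_i + o_p(n^{-1/2})$.
\<close>

section \<open>Absolute continuity and translations\<close>

text \<open>The estimator depends on the whole sample, so it cannot be substituted into a martingale
  sum. Probabilistic bounds are therefore proved for the sample alone or for all shifts in a ball of
  radius of order n^(-1/2), and the estimator enters only pathwise, on an event of high outer
  probability. The norm is of L1 type because \<open>psi\<close> is controlled by it uniformly over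
  the family, while variances are L2 quantities; the Cauchy-Schwarz inequality with the weight (1 +
  |y|)^\<alpha> V^2 passes from one to the other, and \<alpha> > 1 makes the price finite. The score
  averages have a Lipschitz constant of order b^(-2) in the shift, which fixes the mesh of the grid
  at a small multiple of b^2. The number of grid points times the variance bound 1/(n b^3) then
  vanishes when n b^q tends to infinity with q = (6 + 4d)/(2 + d), and this q is at most d_*. For
  the weights the obstacle is that only the second moment of the innovations is used, so the largest
  residual is merely o_p(n^(1/2)); multiplied by the multiplier, of order n^(-1/2), it still
  vanishes.\<close>

lemma abs_continuous_has_integral:
  fixes u u' :: "real \<Rightarrow> real"
  assumes "a \<le> b" and ac: "abs_continuous_on {a..b} u"
    and N: "N \<in> null_sets lborel"
    and der: "\<And>x. x \<in> {a..b} \<Longrightarrow> x \<notin> N \<Longrightarrow> (u has_real_derivative u' x) (at x)"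
  shows "(u' has_integral (u b - u a)) {a..b}"
proof -
  define g where "g x = (if x \<in> N then 0 else u' x)" for x
  \<comment> \<open>Henstock-Kurzweil argument: a fine tagged division is split by whether the tag
    lies in \<open>N\<close>. Off \<open>N\<close> differentiability controls each increment of
    \<open>u\<close>; the intervals tagged in \<open>N\<close> fit into an open set of measure below
    the \<open>d\<close> of absolute continuity, so their increments are small in total. Making
    \<open>g\<close> vanish on \<open>N\<close> removes these tags from the Riemann sum.\<close>
  have "(g has_integral (u b - u a)) (cbox a b)"
    unfolding has_integral
  proof (intro allI impI)
    fix e :: real assume "e > 0"
    define e1 where "e1 = e / (2 * (b - a + 1))"
    have "e1 > 0" using \<open>e > 0\<close> \<open>a \<le> b\<close> by (simp add: e1_def)
    have e1ba: "e1 * (b - a) < e / 2"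
      using \<open>e > 0\<close> \<open>a \<le> b\<close> by (simp add: e1_def field_simps)
    obtain d where "d > 0" and d: "\<And>(n::nat) l r.
        (\<forall>i<n. l i \<le> r i \<and> {l i..r i} \<subseteq> {a..b}) \<Longrightarrow>
        disjoint_family_on (\<lambda>i. {l i<..<r i}) {..<n} \<Longrightarrow> (\<Sum>i<n. r i - l i) < d \<Longrightarrow>
        (\<Sum>i<n. \<bar>u (r i) - u (l i)\<bar>) < e / 2"
      using ac[unfolded abs_continuous_on_def, rule_format, OF half_gt_zero[OF \<open>e > 0\<close>]] by blast
    have Nb: "N \<in> sets borel" using N by (auto simp: null_sets_def)
    obtain U where U: "open U" "N \<subseteq> U" "emeasure lborel (U - N) < ennreal d"
      using outer_regular_lborel[OF Nb \<open>d > 0\<close>] by auto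
    have UN: "emeasure lborel U < ennreal d"
    proof -
      have "emeasure lborel (U - N) = emeasure lborel U"
        using N U(1) by (intro emeasure_Diff_null_set) auto
      thus ?thesis using U(3) by simp
    qed
    \<comment> \<open>The gauge: at a tag in \<open>N\<close> the ball stays inside
      \<open>U\<close>; elsewhere it is the radius on which the linear approximation of
      \<open>u\<close> has relative error \<open>e1\<close>.\<close>
    have "\<exists>c. x \<in> {a..b} \<longrightarrow> c > 0 \<and> (x \<in> N \<longrightarrow> ball x c \<subseteq> U) \<and>
        (x \<notin> N \<longrightarrow> (\<forall>y. \<bar>y - x\<bar> < c \<longrightarrow> \<bar>u y - u x - (y - x) * u' x\<bar> \<le> e1 * \<bar>y - x\<bar>))" for x
    proof (cases "x \<in> {a..b}")
      case xab: True
      show ?thesis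
      proof (cases "x \<in> N")
        case True
        then obtain c where "c > 0" "ball x c \<subseteq> U" using U by (meson openE subsetD)
        thus ?thesis using True by auto
      next
        case False
        have "(u has_derivative (\<lambda>h. h * u' x)) (at x within UNIV)"
          using der[OF xab False] by (simp add: has_field_derivative_def mult_commute_abs)
        then obtain c where "c > 0" "\<And>y. norm (y - x) < c \<Longrightarrow> norm (u y - u x - (y - x) * u' x) \<le> e1 * norm (y - x)"
          unfolding has_derivative_within_alt using \<open>e1 > 0\<close> by blast
        thus ?thesis using False by (auto simp: real_norm_def)
      qed
    qed auto
    then obtain c0 where c0: "\<And>x. x \<in> {a..b} \<Longrightarrow> c0 x > 0" "\<And>x. x \<in> {a..b} \<Longrightarrow> x \<in> N \<Longrightarrow> ball x (c0 x) \<subseteq> U"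
      "\<And>x y. x \<in> {a..b} \<Longrightarrow> x \<notin> N \<Longrightarrow> \<bar>y - x\<bar> < c0 x \<Longrightarrow> \<bar>u y - u x - (y - x) * u' x\<bar> \<le> e1 * \<bar>y - x\<bar>"
      by metis
    define c where "c x = (if x \<in> {a..b} then c0 x else 1)" for x
    have cpos: "c x > 0" for x using c0(1) by (auto simp: c_def)
    show "\<exists>\<gamma>. gauge \<gamma> \<and> (\<forall>\<D>. \<D> tagged_division_of cbox a b \<and> \<gamma> fine \<D> \<longrightarrow>
             norm ((\<Sum>(x, k)\<in>\<D>. measure lborel k *\<^sub>R g x) - (u b - u a)) < e)"
    proof (intro exI[of _ "\<lambda>x. ball x (c x)"] conjI allI impI; (elim conjE)?)
      show "gauge (\<lambda>x. ball x (c x))" using cpos by (rule gauge_ball_dependent[rule_format])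
      fix p assume p: "p tagged_division_of cbox a b" and fine: "(\<lambda>x. ball x (c x)) fine p"
      have fin: "finite p" using p by auto
      have ub: "u b - u a = (\<Sum>(x,K)\<in>p. u (Sup K) - u (Inf K))"
        using additive_tagged_division_1[OF \<open>a \<le> b\<close>, of p u] p by simp
      have struct: "\<exists>l r. K = {l..r} \<and> l \<le> r \<and> x \<in> {l..r} \<and> {l..r} \<subseteq> {a..b} \<and> {l..r} \<subseteq> ball x (c0 x)"
        if xK: "(x, K) \<in> p" for x K
      proof -
        have "x \<in> K" "K \<subseteq> {a..b}" using p that by (auto simp: tagged_division_of_def tagged_partial_division_of_def)
        moreover obtain l r where "K = {l..r}"
          using tagged_division_ofD(4)[OF p xK] by (auto simp: box_real)
        moreover have "K \<subseteq> ball x (c x)" using fine that by (auto simp: fine_def)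
        moreover have "c x = c0 x" using \<open>x \<in> K\<close> \<open>K \<subseteq> {a..b}\<close> by (auto simp: c_def)
        ultimately show ?thesis by (metis atLeastAtMost_iff order_trans)
      qed
      define q where "q = {z \<in> p. fst z \<in> N}"
      have qp: "q \<subseteq> p" and finq: "finite q" using fin by (auto simp: q_def)
      have A: "\<bar>\<Sum>(x,K)\<in>p-q. measure lborel K * g x - (u (Sup K) - u (Inf K))\<bar> \<le> e1 * (b - a)"
      proof -
        have "\<bar>\<Sum>(x,K)\<in>p-q. measure lborel K * g x - (u (Sup K) - u (Inf K))\<bar>
           \<le> (\<Sum>(x,K)\<in>p-q. e1 * measure lborel K)"
        proof (rule order_trans[OF sum_abs], rule sum_mono, safe)
          fix x K assume xK: "(x, K) \<in> p" "(x, K) \<notin> q"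
          then have xN: "x \<notin> N" by (auto simp: q_def)
          obtain l r where K: "K = {l..r}" "l \<le> r" "x \<in> {l..r}" "{l..r} \<subseteq> {a..b}" "{l..r} \<subseteq> ball x (c0 x)"
            using struct[OF xK(1)] by blast
          have xab: "x \<in> {a..b}" using K by auto
          have "l \<in> ball x (c0 x)" "r \<in> ball x (c0 x)" using K(2) K(5) by auto
          hence "\<bar>l - x\<bar> < c0 x" "\<bar>r - x\<bar> < c0 x" by (auto simp: dist_real_def abs_minus_commute)
          hence 1: "\<bar>u l - u x - (l - x) * u' x\<bar> \<le> e1 * \<bar>l - x\<bar>" "\<bar>u r - u x - (r - x) * u' x\<bar> \<le> e1 * \<bar>r - x\<bar>"
            using c0(3)[OF xab xN] by auto
          \<comment> \<open>Both endpoints are compared with the tag; as \<open>x\<close> lies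
            between them, the two errors add up to \<open>e1\<close> times the length of the
            interval.\<close>
          have "\<bar>(r - l) * u' x - (u r - u l)\<bar> = \<bar>(u l - u x - (l - x) * u' x) - (u r - u x - (r - x) * u' x)\<bar>"
            by (simp add: algebra_simps)
          also have "\<dots> \<le> e1 * \<bar>l - x\<bar> + e1 * \<bar>r - x\<bar>" using 1 by linarith
          also have "\<dots> = e1 * (r - l)" using K(3) by (simp add: algebra_simps abs_if)
          finally show "\<bar>measure lborel K * g x - (u (Sup K) - u (Inf K))\<bar> \<le> e1 * measure lborel K"
            using K(1,2) xN by (simp add: g_def)
        qed
        also have "\<dots> \<le> (\<Sum>(x,K)\<in>p. e1 * measure lborel K)"
          using fin \<open>e1 > 0\<close> by (intro sum_mono2) auto
        also have "\<dots> = e1 * (b - a)"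
          using additive_content_tagged_division[OF p] \<open>a \<le> b\<close>
          by (simp add: case_prod_unfold flip: sum_distrib_left)
        finally show ?thesis .
      qed
      have B: "\<bar>\<Sum>(x,K)\<in>q. measure lborel K * g x - (u (Sup K) - u (Inf K))\<bar> < e / 2"
      proof -
        \<comment> \<open>\<open>abs_continuous_on\<close> quantifies over families indexed by
          naturals, so the intervals tagged in \<open>N\<close> are enumerated; the division
          property makes their interiors disjoint.\<close>
        obtain h where h: "bij_betw h {..<card q} q"
          using ex_bij_betw_nat_finite[OF finq] by (auto simp: atLeast0LessThan)
        define l where "l i = Inf (snd (h i))" for i
        define r where "r i = Sup (snd (h i))" for i
        have hq: "h i \<in> q" if "i < card q" for i using h that by (auto simp: bij_betw_def)
        have st: "snd (h i) = {l i..r i} \<and> l i \<le> r i \<and> {l i..r i} \<subseteq> {a..b} \<and> {l i..r i} \<subseteq> U" if "i < card q" for i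
        proof -
          have m: "(fst (h i), snd (h i)) \<in> p" "fst (h i) \<in> N" using hq[OF that] by (auto simp: q_def)
          obtain l' r' where K: "snd (h i) = {l'..r'}" "l' \<le> r'" "fst (h i) \<in> {l'..r'}" "{l'..r'} \<subseteq> {a..b}" "{l'..r'} \<subseteq> ball (fst (h i)) (c0 (fst (h i)))"
            using struct[OF m(1)] by blast
          have "ball (fst (h i)) (c0 (fst (h i))) \<subseteq> U" using c0(2) m(2) K by blast
          thus ?thesis using K by (simp add: l_def r_def)
        qed
        have disj: "disjoint_family_on (\<lambda>i. {l i<..<r i}) {..<card q}"
        proof (unfold disjoint_family_on_def, intro ballI impI)
          fix i j assume ij: "i \<in> {..<card q}" "j \<in> {..<card q}" "i \<noteq> j"
          then have "h i \<noteq> h j" using h by (auto simp: bij_betw_def inj_on_def)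
          moreover have "h i \<in> p" "h j \<in> p" using hq ij qp by auto
          ultimately have "interior (snd (h i)) \<inter> interior (snd (h j)) = {}"
            using p unfolding tagged_division_of_def tagged_partial_division_of_def
            by (metis prod.collapse)
          thus "{l i<..<r i} \<inter> {l j<..<r j} = {}" using st ij by (simp add: interior_atLeastAtMost_real)
        qed
        have "ennreal (\<Sum>i<card q. r i - l i) = (\<Sum>i<card q. emeasure lborel {l i<..<r i})"
          using st by (subst sum_ennreal[symmetric]) auto
        also have "\<dots> = emeasure lborel (\<Union>i<card q. {l i<..<r i})"
          using disj by (intro sum_emeasure) auto
        also have "\<dots> \<le> emeasure lborel U"
          using st U(1) by (intro emeasure_mono UN_least) (force simp: subset_iff)+
        also have "\<dots> < ennreal d" by (rule UN)
        finally have len: "(\<Sum>i<card q. r i - l i) < d"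
          using st by (subst (asm) ennreal_less_iff) (auto intro!: sum_nonneg)
        have "\<bar>\<Sum>(x,K)\<in>q. measure lborel K * g x - (u (Sup K) - u (Inf K))\<bar> \<le> (\<Sum>(x,K)\<in>q. \<bar>u (Sup K) - u (Inf K)\<bar>)"
          by (rule order_trans[OF sum_abs], rule sum_mono) (auto simp: q_def g_def)
        also have "\<dots> = (\<Sum>i<card q. \<bar>u (r i) - u (l i)\<bar>)"
          by (subst sum.reindex_bij_betw[OF h, symmetric]) (simp add: case_prod_unfold l_def r_def)
        also have "\<dots> < e / 2" using st disj len by (intro d) auto
        finally show ?thesis .
      qed
      have "(\<Sum>(x, k)\<in>p. measure lborel k *\<^sub>R g x) - (u b - u a) = (\<Sum>(x,K)\<in>p. measure lborel K * g x - (u (Sup K) - u (Inf K)))"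
        unfolding ub by (simp add: case_prod_unfold sum_subtractf)
      also have "\<dots> = (\<Sum>(x,K)\<in>p-q. measure lborel K * g x - (u (Sup K) - u (Inf K))) + (\<Sum>(x,K)\<in>q. measure lborel K * g x - (u (Sup K) - u (Inf K)))"
        by (rule sum.subset_diff[OF qp fin])
      finally show "norm ((\<Sum>(x, k)\<in>p. measure lborel k *\<^sub>R g x) - (u b - u a)) < e"
        using A B e1ba by (simp add: real_norm_def)
    qed
  qed
  then show ?thesis
    using has_integral_spike[of N "cbox a b" u' g] N
    by (auto simp: g_def negligible_iff_null_sets null_sets_completionI)
qed

lemma nn_integral_shift:
  fixes F :: "real \<Rightarrow> ennreal"
  assumes [measurable]: "F \<in> borel_measurable borel"
  shows "(\<integral>\<^sup>+y. F (y + s) \<partial>lborel) = (\<integral>\<^sup>+y. F y \<partial>lborel)"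
  using nn_integral_real_affine[of F 1 s] by (simp add: add.commute)

text \<open>Induction over integrable functions. An indicator of finite measure is replaced by that
  of an open superset with small excess, for which lower semicontinuity gives convergence; sums and
  dominated limits follow from the triangle inequality.\<close>

lemma translation_continuous_L1:
  fixes g :: "real \<Rightarrow> real"
  assumes "integrable lborel g" and "e > 0"
  shows "\<exists>d>0. \<forall>s. \<bar>s\<bar> < d \<longrightarrow> (\<integral>\<^sup>+y. ennreal \<bar>g (y + s) - g y\<bar> \<partial>lborel) \<le> ennreal e"
proof -
  let ?N = "\<lambda>g s. (\<integral>\<^sup>+y. ennreal \<bar>g (y + s) - g y\<bar> \<partial>lborel)"
  have tri: "?N (\<lambda>y. g y + h y) s \<le> ?N g s + ?N h s"
    if [measurable]: "g \<in> borel_measurable borel" "h \<in> borel_measurable borel" for g h :: "real \<Rightarrow> real" and s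
    by (subst nn_integral_add[symmetric]) (auto intro!: nn_integral_mono simp: ennreal_plus[symmetric] simp del: ennreal_plus)
  have "\<forall>e>0. \<exists>d>0. \<forall>s. \<bar>s\<bar> < d \<longrightarrow> ?N g s \<le> ennreal e"
    using assms(1)
  proof (induction rule: integrable_induct)
    case (base A c)
    have Ab[measurable]: "A \<in> sets borel" using base by simp
    show ?case
    proof (intro allI impI)
      fix e :: real assume "e > 0"
      define e1 where "e1 = e / (4 * (\<bar>c\<bar> + 1))"
      have "e1 > 0" using \<open>e > 0\<close> by (simp add: e1_def)
      obtain U where U: "open U" "A \<subseteq> U" "emeasure lborel (U - A) < ennreal e1"
        using outer_regular_lborel[OF Ab \<open>e1 > 0\<close>] by auto
      have [measurable]: "U \<in> sets borel" using U by auto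
      have Ufin: "emeasure lborel U < \<infinity>"
      proof -
        have "emeasure lborel U \<le> emeasure lborel A + emeasure lborel (U - A)"
          using emeasure_subadditive[of A lborel "U - A"] U by (simp add: Un_absorb1)
        also have "\<dots> < \<infinity>" using base U(3) by (simp add: less_top[symmetric]) auto
        finally show ?thesis .
      qed
      let ?u = "indicator U :: real \<Rightarrow> real"
      \<comment> \<open>Only the part where the indicator drops: a point of the open set stays in it
        under small shifts, so dominated convergence applies with the indicator of \<open>U\<close>
        as dominating function.\<close>
      define h where "h s = (\<integral>\<^sup>+y. ennreal (max 0 (?u y - ?u (y + s))) \<partial>lborel)" for s
      have h0: "(\<lambda>n. h (s n)) \<longlonglongrightarrow> 0" if s: "s \<longlonglongrightarrow> 0" for s :: "nat \<Rightarrow> real"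
      proof -
        have "(\<lambda>n. h (s n)) \<longlonglongrightarrow> (\<integral>\<^sup>+y. 0 \<partial>(lborel :: real measure))"
          unfolding h_def
        proof (rule nn_integral_dominated_convergence)
          show "(\<integral>\<^sup>+y. indicator U y \<partial>lborel) < \<infinity>" using Ufin by simp
          show "AE y in lborel. (\<lambda>n. ennreal (max 0 (?u y - ?u (y + s n)))) \<longlonglongrightarrow> 0"
          proof (rule AE_I2)
            fix y :: real
            have "\<forall>\<^sub>F n in sequentially. ennreal (max 0 (?u y - ?u (y + s n))) = 0"
            proof (cases "y \<in> U")
              case True
              have "(\<lambda>n. y + s n) \<longlonglongrightarrow> y + 0" by (intro tendsto_intros s)
              then have "\<forall>\<^sub>F n in sequentially. y + s n \<in> U"
                using topological_tendstoD[OF _ U(1), of "\<lambda>n. y + s n" y] True by simp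
              then show ?thesis by eventually_elim (simp add: True)
            qed (auto simp: indicator_def)
            then show "(\<lambda>n. ennreal (max 0 (?u y - ?u (y + s n)))) \<longlonglongrightarrow> 0"
              by (rule tendsto_eventually)
          qed
        qed (auto simp: indicator_def ennreal_neg)
        then show ?thesis by simp
      qed
      \<comment> \<open>The rising part is the dropping part for the opposite shift, after
        translating the variable.\<close>
      have Nu: "?N ?u s = h s + h (- s)" for s
      proof -
        have "h (-s) = (\<integral>\<^sup>+y. ennreal (max 0 (?u (y + s) - ?u (y + s + (-s)))) \<partial>lborel)"
          unfolding h_def by (subst nn_integral_shift[symmetric, where s=s]) auto
        then have "h s + h (-s) = (\<integral>\<^sup>+y. ennreal (max 0 (?u y - ?u (y + s))) + ennreal (max 0 (?u (y + s) - ?u y)) \<partial>lborel)"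
          by (simp add: h_def nn_integral_add)
        also have "\<dots> = ?N ?u s"
          by (intro nn_integral_cong) (auto simp: max_def simp flip: ennreal_plus)
        finally show ?thesis by simp
      qed
      have NUA: "?N (indicator (U - A)) s \<le> ennreal (2 * e1)" for s
      proof -
        have "?N (indicator (U - A)) s \<le> (\<integral>\<^sup>+y. indicator (U - A) (y + s) + indicator (U - A) y \<partial>lborel)"
          by (intro nn_integral_mono) (auto simp: indicator_def)
        also have "\<dots> = 2 * emeasure lborel (U - A)"
          by (subst nn_integral_add) (auto simp: nn_integral_shift mult_2)
        also have "\<dots> \<le> 2 * ennreal e1" using U(3) by (intro mult_left_mono) auto
        finally show ?thesis using \<open>e1 > 0\<close> by (simp add: ennreal_mult)
      qed
      have NA: "?N (\<lambda>y. indicator A y *\<^sub>R c) s \<le> ennreal \<bar>c\<bar> * (?N ?u s + ennreal (2 * e1))" for s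
      proof -
        have "?N (\<lambda>y. indicator A y *\<^sub>R c) s = ennreal \<bar>c\<bar> * ?N (indicator A) s"
          by (subst nn_integral_cmult[symmetric])
            (auto intro!: nn_integral_cong simp: abs_mult mult.commute[of _ c] simp flip: ennreal_mult right_diff_distrib)
        also have "?N (indicator A) s \<le> ?N ?u s + ?N (indicator (U - A)) s"
        proof (subst nn_integral_add[symmetric])
          show "?N (indicator A) s \<le> (\<integral>\<^sup>+y. ennreal \<bar>?u (y + s) - ?u y\<bar> + ennreal \<bar>indicator (U - A) (y + s) - indicator (U - A) y\<bar> \<partial>lborel)"
            using U(2) by (intro nn_integral_mono) (auto simp: indicator_def simp flip: ennreal_plus)
        qed auto
        also have "\<dots> \<le> ?N ?u s + ennreal (2 * e1)" by (intro add_left_mono NUA)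
        finally show ?thesis by (simp add: mult_left_mono)
      qed
      show "\<exists>d>0. \<forall>s. \<bar>s\<bar> < d \<longrightarrow> ?N (\<lambda>y. indicator A y *\<^sub>R c) s \<le> ennreal e"
      \<comment> \<open>Dominated convergence works along sequences, hence the passage to a null
        sequence of shifts on which the bound fails.\<close>
      proof (rule ccontr)
        assume neg: "\<not> ?thesis"
        have "\<forall>n. \<exists>s. \<bar>s\<bar> < inverse (real (Suc n)) \<and> \<not> ?N (\<lambda>y. indicator A y *\<^sub>R c) s \<le> ennreal e"
          (is "\<forall>n. ?Q n")
        proof
          fix n
          have "inverse (real (Suc n)) > 0" by simp
          with neg show "?Q n" by blast
        qed
        then obtain s where s: "\<And>n. \<bar>s n\<bar> < inverse (real (Suc n))" "\<And>n. \<not> ?N (\<lambda>y. indicator A y *\<^sub>R c) (s n) \<le> ennreal e"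
          by metis
        have s0: "s \<longlonglongrightarrow> 0"
          by (rule Lim_null_comparison[OF _ LIMSEQ_inverse_real_of_nat]) (use s(1) in \<open>auto intro!: always_eventually less_imp_le\<close>)
        then have "(\<lambda>n. - s n) \<longlonglongrightarrow> 0" using tendsto_minus[OF s0] by simp
        then have "(\<lambda>n. h (s n) + h (- s n)) \<longlonglongrightarrow> 0 + 0" by (intro tendsto_add h0 s0)
        then have "\<forall>\<^sub>F n in sequentially. h (s n) + h (- s n) < ennreal e1"
          using \<open>e1 > 0\<close> by (intro order_tendstoD(2)) auto
        then obtain n where n: "h (s n) + h (- s n) < ennreal e1" by (auto simp: eventually_sequentially)
        have "?N (\<lambda>y. indicator A y *\<^sub>R c) (s n) \<le> ennreal \<bar>c\<bar> * (ennreal e1 + ennreal (2 * e1))"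
          by (rule order_trans[OF NA]) (intro mult_left_mono add_right_mono, insert n, auto simp: Nu)
        also have "\<dots> = ennreal (\<bar>c\<bar> * (3 * e1))" using \<open>e1 > 0\<close> by (subst ennreal_plus[symmetric]) (auto simp flip: ennreal_mult)
        also have "\<dots> \<le> ennreal e"
        proof (intro ennreal_leI)
          have "\<bar>c\<bar> * (3 * e1) \<le> (\<bar>c\<bar> + 1) * (4 * e1)" using \<open>e1 > 0\<close> by (intro mult_mono) auto
          also have "\<dots> = e" by (simp add: e1_def field_simps)
          finally show "\<bar>c\<bar> * (3 * e1) \<le> e" .
        qed
        finally show False using s(2) by blast
      qed
    qed
  next
    case (add g h)
    show ?case
    proof (intro allI impI)
      fix e :: real assume "e > 0"
      then have "e / 2 > 0" by simp
      obtain d1 where d1: "d1 > 0" "\<And>s. \<bar>s\<bar> < d1 \<Longrightarrow> ?N g s \<le> ennreal (e/2)"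
        using add(3)[rule_format, OF \<open>e / 2 > 0\<close>] by blast
      obtain d2 where d2: "d2 > 0" "\<And>s. \<bar>s\<bar> < d2 \<Longrightarrow> ?N h s \<le> ennreal (e/2)"
        using add(4)[rule_format, OF \<open>e / 2 > 0\<close>] by blast
      note d = d1 d2
      have [measurable]: "g \<in> borel_measurable borel" "h \<in> borel_measurable borel"
        using add by auto
      show "\<exists>d>0. \<forall>s. \<bar>s\<bar> < d \<longrightarrow> ?N (\<lambda>y. g y + h y) s \<le> ennreal e"
      proof (intro exI[of _ "min d1 d2"] conjI allI impI)
        fix s assume "\<bar>s\<bar> < min d1 d2"
        then have "?N (\<lambda>y. g y + h y) s \<le> ennreal (e/2) + ennreal (e/2)"
          by (intro order_trans[OF tri] add_mono d) auto
        then show "?N (\<lambda>y. g y + h y) s \<le> ennreal e" using \<open>e > 0\<close> by (simp flip: ennreal_plus)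
      qed (use d in auto)
    qed
  next
    case (lim g s)
    have [measurable]: "g \<in> borel_measurable borel" "\<And>i. s i \<in> borel_measurable borel"
      using lim by auto
    show ?case
    proof (intro allI impI)
      fix e :: real assume "e > 0"
      have "(\<lambda>i. \<integral>\<^sup>+y. ennreal (norm (g y - s i y)) \<partial>lborel) \<longlonglongrightarrow> 0"
      proof (rule nn_integral_dominated_convergence_norm[where w="\<lambda>x. 2 * norm (g x)"])
        show "AE x in lborel. (\<lambda>i. s i x) \<longlonglongrightarrow> g x" "\<And>j. AE x in lborel. norm (s j x) \<le> 2 * norm (g x)"
          using lim by auto
        show "(\<integral>\<^sup>+ x. ennreal (2 * norm (g x)) \<partial>lborel) < \<infinity>"
          using lim(4) by (simp add: integrable_iff_bounded ennreal_mult nn_integral_cmult ennreal_mult_less_top)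
      qed auto
      then have "\<forall>\<^sub>F i in sequentially. (\<integral>\<^sup>+y. ennreal (norm (g y - s i y)) \<partial>lborel) < ennreal (e/4)"
        using \<open>e > 0\<close> by (intro order_tendstoD(2)) auto
      then obtain i where i: "(\<integral>\<^sup>+y. ennreal \<bar>g y - s i y\<bar> \<partial>lborel) \<le> ennreal (e/4)"
        by (auto simp: eventually_sequentially abs_minus_commute intro: less_imp_le)
      obtain d where d: "d > 0" "\<And>t. \<bar>t\<bar> < d \<Longrightarrow> ?N (s i) t \<le> ennreal (e/2)"
        using lim(5)[of i, rule_format, of "e / 2"] \<open>e > 0\<close> by auto
      show "\<exists>d>0. \<forall>t. \<bar>t\<bar> < d \<longrightarrow> ?N g t \<le> ennreal e"
      proof (intro exI[of _ d] conjI allI impI)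
        fix t assume t: "\<bar>t\<bar> < d"
        have "?N g t \<le> ?N (\<lambda>y. g y - s i y) t + ?N (s i) t"
          using tri[of "\<lambda>y. g y - s i y" "s i" t] by simp
        also have "?N (\<lambda>y. g y - s i y) t \<le> (\<integral>\<^sup>+y. ennreal \<bar>g (y + t) - s i (y + t)\<bar> + ennreal \<bar>g y - s i y\<bar> \<partial>lborel)"
          by (intro nn_integral_mono) (auto simp flip: ennreal_plus)
        also have "\<dots> = (\<integral>\<^sup>+y. ennreal \<bar>g y - s i y\<bar> \<partial>lborel) + (\<integral>\<^sup>+y. ennreal \<bar>g y - s i y\<bar> \<partial>lborel)"
          by (subst nn_integral_add) (auto simp: nn_integral_shift[of "\<lambda>y. ennreal \<bar>g y - s i y\<bar>"])
        finally have tt: "?N g t \<le> (\<integral>\<^sup>+y. ennreal \<bar>g y - s i y\<bar> \<partial>lborel) + (\<integral>\<^sup>+y. ennreal \<bar>g y - s i y\<bar> \<partial>lborel) + ?N (s i) t"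
          by (simp add: add_right_mono)
        have "?N g t \<le> (ennreal (e/4) + ennreal (e/4)) + ennreal (e/2)"
          using add_mono[OF add_mono[OF i i] d(2)[OF t]] tt by (rule order_trans[rotated])
        then show "?N g t \<le> ennreal e" using \<open>e > 0\<close> by (simp flip: ennreal_plus)
      qed (rule d)
    qed
  qed
  thus ?thesis using assms(2) by blast
qed

text \<open>On a compact interval the C^1 factor is Lipschitz and both factors are bounded, so the
  product formula for increments suffices. The result is local because \<open>\<phi>\<close> and its
  derivative may be unbounded on the line.\<close>

lemma abs_continuous_mult_C1:
  fixes f \<phi> \<phi>' :: "real \<Rightarrow> real"
  assumes ac: "abs_continuous_on UNIV f"
    and der: "\<And>x. (\<phi> has_real_derivative \<phi>' x) (at x)" and cont: "continuous_on UNIV \<phi>'"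
  shows "abs_continuous_on {a..b} (\<lambda>x. \<phi> x * f x)"
proof -
  have "continuous_on UNIV f"
    unfolding continuous_on_iff
  proof (intro ballI allI impI)
    fix x e :: real assume "e > 0"
    obtain d where d: "d > 0" "\<And>(n::nat) l r. (\<forall>i<n. l i \<le> r i \<and> {l i..r i} \<subseteq> UNIV) \<and>
        disjoint_family_on (\<lambda>i. {l i<..<r i}) {..<n} \<and> (\<Sum>i<n. r i - l i) < d \<Longrightarrow>
        (\<Sum>i<n. \<bar>f (r i) - f (l i)\<bar>) < e"
      using ac[unfolded abs_continuous_on_def, rule_format, OF \<open>e > 0\<close>] by blast
    \<comment> \<open>A single interval, regarded as a family of length one, already gives
      continuity of \<open>f\<close>.\<close>
    have "dist (f y) (f x) < e" if "dist y x < d" for y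
      using d(2)[of "Suc 0" "\<lambda>_. min x y" "\<lambda>_. max x y"] that
      by (auto simp: disjoint_family_on_def dist_real_def min_def max_def abs_if split: if_splits)
    then show "\<exists>d>0. \<forall>x'\<in>UNIV. dist x' x < d \<longrightarrow> dist (f x') (f x) < e" using d(1) by auto
  qed
  then have cf: "continuous_on {a..b} f" by (rule continuous_on_subset) simp
  have c\<phi>: "continuous_on {a..b} \<phi>"
    using der by (intro continuous_at_imp_continuous_on ballI DERIV_isCont)
  have cd: "continuous_on {a..b} \<phi>'" using cont by (rule continuous_on_subset) simp
  have bd: "\<exists>B>0. \<forall>x\<in>{a..b}. \<bar>g x\<bar> \<le> B" if "continuous_on {a..b} g" for g :: "real \<Rightarrow> real"
  proof -
    have "bounded (g ` {a..b})" using that by (intro compact_imp_bounded compact_continuous_image) auto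
    then obtain B where "\<forall>x\<in>{a..b}. \<bar>g x\<bar> \<le> B" unfolding bounded_iff by auto
    then show ?thesis by (intro exI[of _ "\<bar>B\<bar> + 1"]) force
  qed
  obtain Bf where Bf: "Bf > 0" "\<And>x. x \<in> {a..b} \<Longrightarrow> \<bar>f x\<bar> \<le> Bf" using bd[OF cf] by blast
  obtain Bp where Bp: "Bp > 0" "\<And>x. x \<in> {a..b} \<Longrightarrow> \<bar>\<phi> x\<bar> \<le> Bp" using bd[OF c\<phi>] by blast
  obtain L where L: "L > 0" "\<And>x. x \<in> {a..b} \<Longrightarrow> \<bar>\<phi>' x\<bar> \<le> L" using bd[OF cd] by blast
  have lip: "\<bar>\<phi> r - \<phi> l\<bar> \<le> L * (r - l)" if "l \<le> r" "{l..r} \<subseteq> {a..b}" for l r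
    using field_differentiable_bound[of "{l..r}" \<phi> \<phi>' L r l] that der L(2)
    by (auto simp: has_field_derivative_at_within subset_iff)
  show ?thesis
    unfolding abs_continuous_on_def
  proof (intro allI impI)
    fix e :: real assume "e > 0"
    then have e1: "e / (2 * Bp) > 0" using Bp by simp
    obtain d where d: "d > 0" "\<And>(n::nat) l r. (\<forall>i<n. l i \<le> r i \<and> {l i..r i} \<subseteq> UNIV) \<and>
        disjoint_family_on (\<lambda>i. {l i<..<r i}) {..<n} \<and> (\<Sum>i<n. r i - l i) < d \<Longrightarrow>
        (\<Sum>i<n. \<bar>f (r i) - f (l i)\<bar>) < e / (2 * Bp)"
      using ac[unfolded abs_continuous_on_def, rule_format, OF e1] by blast
    show "\<exists>d>0. \<forall>(N::nat) u v. (\<forall>i<N. u i \<le> v i \<and> {u i..v i} \<subseteq> {a..b}) \<and>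
              disjoint_family_on (\<lambda>i. {u i<..<v i}) {..<N} \<and> (\<Sum>i<N. v i - u i) < d \<longrightarrow>
              (\<Sum>i<N. \<bar>\<phi> (v i) * f (v i) - \<phi> (u i) * f (u i)\<bar>) < e"
    \<comment> \<open>The two bounds on the total length give e/2 for the part with increments of
      \<open>f\<close> and e/2 for the part with increments of \<open>\<phi>\<close>.\<close>
    proof (intro exI[of _ "min d (e / (2 * Bf * L))"] conjI allI impI; (elim conjE)?)
      show "0 < min d (e / (2 * Bf * L))" using d Bf L \<open>e > 0\<close> by simp
      fix N :: nat and u v :: "nat \<Rightarrow> real"
      assume uv: "\<forall>i<N. u i \<le> v i \<and> {u i..v i} \<subseteq> {a..b}"
        and disj: "disjoint_family_on (\<lambda>i. {u i<..<v i}) {..<N}"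
        and len: "(\<Sum>i<N. v i - u i) < min d (e / (2 * Bf * L))"
      have 1: "(\<Sum>i<N. \<bar>f (v i) - f (u i)\<bar>) < e / (2 * Bp)"
        using d(2)[of N u v] uv disj len by simp
      have "(\<Sum>i<N. \<bar>\<phi> (v i) * f (v i) - \<phi> (u i) * f (u i)\<bar>)
          \<le> (\<Sum>i<N. Bp * \<bar>f (v i) - f (u i)\<bar> + Bf * L * (v i - u i))"
      proof (rule sum_mono)
        fix i assume "i \<in> {..<N}"
        then have i: "u i \<le> v i" "{u i..v i} \<subseteq> {a..b}" using uv by auto
        then have ui: "u i \<in> {a..b}" and vi: "v i \<in> {a..b}" by auto
        have "\<phi> (v i) * f (v i) - \<phi> (u i) * f (u i) = \<phi> (v i) * (f (v i) - f (u i)) + (\<phi> (v i) - \<phi> (u i)) * f (u i)"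
          by (simp add: algebra_simps)
        also have "\<bar>\<dots>\<bar> \<le> \<bar>\<phi> (v i)\<bar> * \<bar>f (v i) - f (u i)\<bar> + \<bar>\<phi> (v i) - \<phi> (u i)\<bar> * \<bar>f (u i)\<bar>"
          by (rule order_trans[OF abs_triangle_ineq]) (simp add: abs_mult)
        also have "\<dots> \<le> Bp * \<bar>f (v i) - f (u i)\<bar> + (L * (v i - u i)) * Bf"
          using Bp(2)[OF vi] Bf(2)[OF ui] lip[OF i] L(1) i(1)
          by (intro add_mono mult_mono) auto
        finally show "\<bar>\<phi> (v i) * f (v i) - \<phi> (u i) * f (u i)\<bar> \<le> Bp * \<bar>f (v i) - f (u i)\<bar> + Bf * L * (v i - u i)"
          by (simp add: algebra_simps)
      qed
      also have "\<dots> = Bp * (\<Sum>i<N. \<bar>f (v i) - f (u i)\<bar>) + Bf * L * (\<Sum>i<N. v i - u i)"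
        by (simp add: sum.distrib sum_distrib_left)
      also have "\<dots> < Bp * (e / (2 * Bp)) + Bf * L * (e / (2 * Bf * L))"
        using 1 len Bp Bf L by (intro add_strict_mono mult_strict_left_mono) auto
      also have "\<dots> = e" using Bp Bf L by (simp add: field_simps)
      finally show "(\<Sum>i<N. \<bar>\<phi> (v i) * f (v i) - \<phi> (u i) * f (u i)\<bar>) < e" .
    qed
  qed
qed

text \<open>Integrating $u(y+1) - u(y)$, with \<open>u\<close> the product, over the line gives zero on one side and
  $\int u'$ on the other.\<close>

lemma integral_by_parts_zero:
  fixes f f' \<phi> \<phi>' :: "real \<Rightarrow> real"
  assumes ac: "abs_continuous_on UNIV f"
    and fder: "AE y in lborel. (f has_real_derivative f' y) (at y)"
    and der: "\<And>x. (\<phi> has_real_derivative \<phi>' x) (at x)" and cont: "continuous_on UNIV \<phi>'"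
    and int: "integrable lborel (\<lambda>x. \<phi> x * f x)" "integrable lborel (\<lambda>x. \<phi>' x * f x + \<phi> x * f' x)"
  shows "(\<integral>x. \<phi>' x * f x + \<phi> x * f' x \<partial>lborel) = 0"
proof -
  define u where "u x = \<phi> x * f x" for x
  define w where "w x = \<phi>' x * f x + \<phi> x * f' x" for x
  have wint: "integrable lborel w" using int(2) by (simp add: w_def[abs_def])
  have uint: "integrable lborel u" using int(1) by (simp add: u_def[abs_def])
  have [measurable]: "w \<in> borel_measurable borel" "u \<in> borel_measurable borel" using wint uint by auto
  obtain N where N: "N \<in> null_sets lborel" "\<And>x. x \<notin> N \<Longrightarrow> (f has_real_derivative f' x) (at x)"
    using fder by (auto elim!: AE_E3)
  \<comment> \<open>Increments over unit intervals avoid any limit of \<open>u\<close> at infinity;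
    integrability alone makes the translated integrals cancel.\<close>
  have diff: "u (y + 1) - u y = (\<integral>s. indicator {0..1} s * w (y + s) \<partial>lborel)" for y
  proof -
    have "(w has_integral (u (y + 1) - u y)) {y..y+1}"
    proof (rule abs_continuous_has_integral)
      show "abs_continuous_on {y..y + 1} u" unfolding u_def by (rule abs_continuous_mult_C1[OF ac der cont])
      show "N \<in> null_sets lborel" by (rule N)
      fix x assume "x \<notin> N"
      from DERIV_mult[OF der N(2)[OF this]]
      show "(u has_real_derivative w x) (at x)" unfolding u_def w_def by (simp add: algebra_simps)
    qed simp
    moreover have "set_integrable lborel {y..y+1} w"
      unfolding set_integrable_def by (intro integrable_mult_indicator wint) auto
    ultimately have "u (y + 1) - u y = (\<integral>x. indicator {y..y+1} x * w x \<partial>lborel)"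
      using set_borel_integral_eq_integral(2)[of "{y..y+1}" w] by (simp add: set_lebesgue_integral_def integral_unique)
    also have "\<dots> = (\<integral>s. indicator {y..y+1} (y + s) * w (y + s) \<partial>lborel)"
      using lborel_integral_real_affine[of 1 "\<lambda>x. indicator {y..y+1} x * w x" y] by simp
    also have "\<dots> = (\<integral>s. indicator {0..1} s * w (y + s) \<partial>lborel)"
      by (intro Bochner_Integration.integral_cong) (auto simp: indicator_def)
    finally show ?thesis .
  qed
  \<comment> \<open>Absolute integrability for Fubini: for fixed \<open>s\<close> the inner integral
    is translation invariant, and \<open>s\<close> runs over a unit interval.\<close>
  have pint: "integrable (lborel \<Otimes>\<^sub>M lborel) (\<lambda>(y, s). indicator {0..1} s * w (y + s))"
  proof (rule integrableI_bounded)
    have "(\<integral>\<^sup>+x. ennreal (norm (case x of (y, s) \<Rightarrow> indicator {0..1} s * w (y + s))) \<partial>(lborel \<Otimes>\<^sub>M lborel))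
      = (\<integral>\<^sup>+s. (\<integral>\<^sup>+y. ennreal (norm (indicator {0..1} s * w (y + s))) \<partial>lborel) \<partial>lborel)"
      by (subst lborel_pair.nn_integral_snd[symmetric]) auto
    also have "\<dots> = (\<integral>\<^sup>+s. indicator {0..1::real} s * (\<integral>\<^sup>+y. ennreal (norm (w (y + s))) \<partial>lborel) \<partial>lborel)"
      by (intro nn_integral_cong, subst nn_integral_cmult[symmetric]) (auto intro!: nn_integral_cong split: split_indicator)
    also have "\<dots> = (\<integral>\<^sup>+s. indicator {0..1::real} s * (\<integral>\<^sup>+y. ennreal (norm (w y)) \<partial>lborel) \<partial>lborel)"
      by (subst nn_integral_shift) auto
    also have "\<dots> = (\<integral>\<^sup>+y. ennreal (norm (w y)) \<partial>lborel)"
      by (subst nn_integral_multc) auto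
    also have "\<dots> < \<infinity>" using wint by (simp add: integrable_iff_bounded)
    finally show "(\<integral>\<^sup>+x. ennreal (norm (case x of (y, s) \<Rightarrow> indicator {0..1} s * w (y + s))) \<partial>(lborel \<Otimes>\<^sub>M lborel)) < \<infinity>" .
  qed measurable
  have shiftI: "(\<integral>y. g (y + s) \<partial>lborel) = (\<integral>y. g y \<partial>lborel)" for g :: "real \<Rightarrow> real" and s
    using lborel_integral_real_affine[of 1 g s] by (simp add: add.commute)
  have "(\<integral>y. (\<integral>s. indicator {0..1} s * w (y + s) \<partial>lborel) \<partial>lborel)
      = (\<integral>s. (\<integral>y. indicator {0..1} s * w (y + s) \<partial>lborel) \<partial>lborel)"
    by (rule lborel_pair.Fubini_integral[symmetric]) (rule pint)
  also have "\<dots> = (\<integral>s. indicator {0..1::real} s * (\<integral>y. w y \<partial>lborel) \<partial>lborel)"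
    by (simp add: shiftI)
  also have "\<dots> = (\<integral>y. w y \<partial>lborel)" by simp
  finally have "(\<integral>y. w y \<partial>lborel) = (\<integral>y. u (y + 1) - u y \<partial>lborel)" by (simp add: diff)
  also have "\<dots> = (\<integral>y. u (y + 1) \<partial>lborel) - (\<integral>y. u y \<partial>lborel)"
    using lborel_integrable_real_affine[of u 1 1] uint by (intro Bochner_Integration.integral_diff) (auto simp: add.commute)
  also have "\<dots> = 0" by (simp add: shiftI)
  finally show ?thesis by (simp add: w_def)
qed

text \<open>The scaling to \<open>u\<close> in [0,1] makes the domain of integration independent of
  \<open>y\<close> and \<open>a\<close>, so that the bound can afterwards be integrated against V in
  \<open>y\<close> by Tonelli.\<close>

lemma abs_continuous_increment_le:
  fixes f f' :: "real \<Rightarrow> real"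
  assumes ac: "abs_continuous_on UNIV f"
    and fder: "AE y in lborel. (f has_real_derivative f' y) (at y)"
    and int: "integrable lborel f'"
  shows "ennreal \<bar>f (y + a) - f y\<bar> \<le> (\<integral>\<^sup>+u. ennreal \<bar>a\<bar> * (indicator {0..1} u * ennreal \<bar>f' (y + u * a)\<bar>) \<partial>lborel)"
proof (cases "a = 0")
  case False
  have [measurable]: "f' \<in> borel_measurable borel" using int by auto
  obtain N where N: "N \<in> null_sets lborel" "\<And>x. x \<notin> N \<Longrightarrow> (f has_real_derivative f' x) (at x)"
    using fder by (auto elim!: AE_E3)
  define l where "l = min y (y + a)"
  define r where "r = max y (y + a)"
  have lr: "l \<le> r" by (simp add: l_def r_def)
  have "(f' has_integral (f r - f l)) {l..r}"
  proof (rule abs_continuous_has_integral[OF lr _ N(1)])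
    show "abs_continuous_on {l..r} f"
      using abs_continuous_mult_C1[OF ac, of "\<lambda>_. 1" "\<lambda>_. 0" l r] by simp
  qed (rule N(2))
  moreover have si: "set_integrable lborel {l..r} f'"
    unfolding set_integrable_def by (intro integrable_mult_indicator int) auto
  ultimately have "f r - f l = (\<integral>x. indicator {l..r} x * f' x \<partial>lborel)"
    using set_borel_integral_eq_integral(2)[of "{l..r}" f'] by (simp add: set_lebesgue_integral_def integral_unique)
  then have "ennreal \<bar>f r - f l\<bar> \<le> (\<integral>\<^sup>+x. ennreal \<bar>indicator {l..r} x * f' x\<bar> \<partial>lborel)"
    using integral_norm_bound_ennreal[of lborel "\<lambda>x. indicator {l..r} x * f' x"] si by (simp add: set_integrable_def)
  also have "\<dots> = (\<integral>\<^sup>+u. ennreal \<bar>a\<bar> * (ennreal \<bar>indicator {l..r} (y + a * u) * f' (y + a * u)\<bar>) \<partial>lborel)"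
    using False by (subst nn_integral_real_affine[where c=a and t=y]) (auto simp: nn_integral_cmult)
  also have "\<dots> = (\<integral>\<^sup>+u. ennreal \<bar>a\<bar> * (indicator {0..1} u * ennreal \<bar>f' (y + u * a)\<bar>) \<partial>lborel)"
  proof (intro nn_integral_cong)
    fix u
    have "y + a * u \<in> {l..r} \<longleftrightarrow> u \<in> {0..1}"
      using False by (cases "a > 0") (auto simp: l_def r_def min_def max_def mult_le_0_iff zero_le_mult_iff mult_le_cancel_left1 mult_le_cancel_left2)
    then show "ennreal \<bar>a\<bar> * (ennreal \<bar>indicator {l..r} (y + a * u) * f' (y + a * u)\<bar>) = ennreal \<bar>a\<bar> * (indicator {0..1} u * ennreal \<bar>f' (y + u * a)\<bar>)"
      by (auto simp: indicator_def mult.commute[of a u])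
  qed
  also have "\<bar>f r - f l\<bar> = \<bar>f (y + a) - f y\<bar>" by (auto simp: l_def r_def min_def max_def)
  finally show ?thesis .
qed simp

section \<open>The weighted norm\<close>

text \<open>Extended values allow bounds to be stated before integrability is known; a finite value
  means that V g is integrable, see \<open>nV_finite_iff\<close>.\<close>

definition vnorm :: "(real \<Rightarrow> real) \<Rightarrow> (real \<Rightarrow> real) \<Rightarrow> ennreal" where
  "vnorm V g = (\<integral>\<^sup>+y. ennreal (V y * \<bar>g y\<bar>) \<partial>lborel)"

locale weight =
  fixes V :: "real \<Rightarrow> real"
  assumes V_measurable[measurable]: "V \<in> borel_measurable borel"
    and V_ge_1: "\<And>y. 1 \<le> V y"
    and D_bounded: "\<And>K. compact K \<Longrightarrow> \<exists>c::real. \<forall>s\<in>K. growth_modulus V s \<le> ennreal c"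
    and D_zero: "(growth_modulus V \<longlongrightarrow> 0) (at 0)"
begin

abbreviation "nV \<equiv> vnorm V"

lemma V_pos: "0 < V y" and V_nonneg: "0 \<le> V y"
  using V_ge_1[of y] by linarith+

lemma growth_modulusD:
  assumes "growth_modulus V s \<le> ennreal c" "c \<ge> 0"
  shows "\<bar>V (y + s) - V y\<bar> \<le> c * V y"
proof -
  have "ennreal (\<bar>V (y + s) - V y\<bar> / V y) \<le> growth_modulus V s"
    unfolding growth_modulus_def by (rule SUP_upper) simp
  then have "ennreal (\<bar>V (y + s) - V y\<bar> / V y) \<le> ennreal c" using assms(1) by (rule order_trans)
  then have "\<bar>V (y + s) - V y\<bar> / V y \<le> c" using assms(2) by (subst (asm) ennreal_le_iff)
  then show ?thesis using V_pos[of y] by (simp add: divide_le_eq)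
qed

text \<open>A growth modulus bounded on compacts makes V comparable with its translates, so
  smoothing by the kernel and shifting by residual errors cost only a constant factor.\<close>

lemma V_shift:
  obtains c where "c \<ge> 1" "\<And>y s. \<bar>s\<bar> \<le> K \<Longrightarrow> V (y + s) \<le> c * V y"
proof -
  obtain c where c: "\<And>s. s \<in> {-K..K} \<Longrightarrow> growth_modulus V s \<le> ennreal c"
    using D_bounded[of "{-K..K}"] by blast
  have "V (y + s) \<le> (1 + \<bar>c\<bar>) * V y" if "\<bar>s\<bar> \<le> K" for y s
  proof -
    have "growth_modulus V s \<le> ennreal \<bar>c\<bar>"
      using c[of s] that by (auto intro: order_trans ennreal_leI simp: abs_le_iff)
    from growth_modulusD[OF this, of y] show ?thesis by (simp add: algebra_simps abs_le_iff)
  qed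
  then show ?thesis by (intro that[of "1 + \<bar>c\<bar>"]) auto
qed

lemma nV_triangle:
  assumes [measurable]: "g \<in> borel_measurable borel" "h \<in> borel_measurable borel"
  shows "nV (\<lambda>y. g y + h y) \<le> nV g + nV h"
  unfolding vnorm_def
  by (subst nn_integral_add[symmetric])
    (auto intro!: nn_integral_mono simp: V_nonneg distrib_left[symmetric] mult_left_mono simp flip: ennreal_plus)

lemma nV_cmult:
  assumes [measurable]: "g \<in> borel_measurable borel"
  shows "nV (\<lambda>y. c * g y) = ennreal \<bar>c\<bar> * nV g"
  unfolding vnorm_def
  by (subst nn_integral_cmult[symmetric])
    (auto intro!: nn_integral_cong simp: V_nonneg abs_mult ennreal_mult[symmetric] mult_ac)

lemma nV_mono:
  assumes "\<And>y. \<bar>g y\<bar> \<le> \<bar>h y\<bar>" shows "nV g \<le> nV h"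
  unfolding vnorm_def using assms by (auto intro!: nn_integral_mono ennreal_leI mult_left_mono simp: V_nonneg)

lemma nV_sum:
  assumes [measurable]: "\<And>i. i \<in> I \<Longrightarrow> g i \<in> borel_measurable borel"
  shows "nV (\<lambda>y. \<Sum>i\<in>I. g i y) \<le> (\<Sum>i\<in>I. nV (g i))"
  using assms
proof (induction I rule: infinite_finite_induct)
  case (insert i I)
  have "nV (\<lambda>y. \<Sum>i\<in>insert i I. g i y) = nV (\<lambda>y. g i y + (\<Sum>i\<in>I. g i y))" using insert by simp
  also have "\<dots> \<le> nV (g i) + nV (\<lambda>y. \<Sum>i\<in>I. g i y)" using insert by (intro nV_triangle) auto
  finally show ?case using insert by (auto intro: order_trans add_left_mono)
qed (auto simp: vnorm_def)

text \<open>Translation invariance moves the shift from the function to V, where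
  \<open>V_shift\<close> applies with the opposite sign.\<close>

lemma nV_shift:
  obtains c where "c \<ge> 1" "\<And>g s. g \<in> borel_measurable borel \<Longrightarrow> \<bar>s\<bar> \<le> K \<Longrightarrow> nV (\<lambda>y. g (y + s)) \<le> ennreal c * nV g"
proof -
  obtain c where c: "c \<ge> 1" "\<And>y s. \<bar>s\<bar> \<le> K \<Longrightarrow> V (y + s) \<le> c * V y" using V_shift by blast
  have "nV (\<lambda>y. g (y + s)) \<le> ennreal c * nV g" if [measurable]: "g \<in> borel_measurable borel" and s: "\<bar>s\<bar> \<le> K" for g s
  proof -
    have "nV (\<lambda>y. g (y + s)) \<le> (\<integral>\<^sup>+y. ennreal c * ennreal (V (y + s) * \<bar>g (y + s)\<bar>) \<partial>lborel)"
      unfolding vnorm_def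
    proof (intro nn_integral_mono)
      fix y
      have "V y \<le> c * V (y + s)" using c(2)[of "-s" "y + s"] s by simp
      then have "V y * \<bar>g (y + s)\<bar> \<le> c * V (y + s) * \<bar>g (y + s)\<bar>" by (intro mult_right_mono) auto
      then show "ennreal (V y * \<bar>g (y + s)\<bar>) \<le> ennreal c * ennreal (V (y + s) * \<bar>g (y + s)\<bar>)"
        using c(1) by (subst ennreal_mult[symmetric]) (auto simp: V_nonneg mult_ac intro!: ennreal_leI)
    qed
    also have "\<dots> = ennreal c * nV g"
      unfolding vnorm_def by (subst nn_integral_cmult) (auto simp: nn_integral_shift[of "\<lambda>y. ennreal (V y * \<bar>g y\<bar>)"])
    finally show ?thesis .
  qed
  then show ?thesis using that c(1) by blast
qed

lemma nV_finite_iff: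
  assumes [measurable]: "g \<in> borel_measurable borel"
  shows "integrable lborel (\<lambda>y. V y * g y) \<longleftrightarrow> nV g < \<infinity>"
  by (simp add: integrable_iff_bounded vnorm_def abs_mult V_nonneg)

text \<open>The weighted increment is split as ((V g)(y + s) - (V g)(y)) - (V(y + s) - V(y)) g(y +
  s). The first part is continuity of translations in L1 for V g; the second is at most the growth
  modulus, which tends to 0, times the norm of a shifted function.\<close>

lemma translation_continuous_nV:
  assumes int: "integrable lborel (\<lambda>y. V y * g y)" and [measurable]: "g \<in> borel_measurable borel" and "e > 0"
  shows "\<exists>d>0. \<forall>s. \<bar>s\<bar> < d \<longrightarrow> nV (\<lambda>y. g (y + s) - g y) \<le> ennreal e"
proof -
  obtain c where c: "c \<ge> 1" "\<And>g s. g \<in> borel_measurable borel \<Longrightarrow> \<bar>s\<bar> \<le> 1 \<Longrightarrow> nV (\<lambda>y. g (y + s)) \<le> ennreal c * nV g"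
    using nV_shift[of 1] by blast
  have "nV g < \<infinity>" using int nV_finite_iff[of g] by simp
  then obtain B where B: "nV g = ennreal B" "B \<ge> 0" by (cases "nV g") auto
  \<comment> \<open>Chosen so that \<open>\<delta> * (c * B)\<close> stays below e/2; the added 1
    keeps the quotient meaningful when the norm of \<open>g\<close> is zero.\<close>
  define \<delta> where "\<delta> = e / (2 * (c * B + 1))"
  have "\<delta> > 0" unfolding \<delta>_def using \<open>e > 0\<close> B c by (intro divide_pos_pos) (auto intro!: add_nonneg_pos mult_nonneg_nonneg)
  have "e / 2 > 0" using \<open>e > 0\<close> by simp
  obtain d1 where d1: "d1 > 0" "\<And>s. \<bar>s\<bar> < d1 \<Longrightarrow> (\<integral>\<^sup>+y. ennreal \<bar>V (y + s) * g (y + s) - V y * g y\<bar> \<partial>lborel) \<le> ennreal (e / 2)"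
    using translation_continuous_L1[OF int \<open>e / 2 > 0\<close>] by blast
  have "\<forall>\<^sub>F s in at 0. growth_modulus V s < ennreal \<delta>" using D_zero \<open>\<delta> > 0\<close> by (intro order_tendstoD) auto
  then obtain d2 where d2: "d2 > 0" "\<And>s. s \<noteq> 0 \<Longrightarrow> \<bar>s\<bar> < d2 \<Longrightarrow> growth_modulus V s < ennreal \<delta>"
    by (auto simp: eventually_at dist_real_def)
  show ?thesis
  proof (intro exI[of _ "min 1 (min d1 d2)"] conjI allI impI)
    show "0 < min 1 (min d1 d2)" using d1 d2 by simp
    fix s :: real assume s: "\<bar>s\<bar> < min 1 (min d1 d2)"
    have VV: "\<bar>V (y + s) - V y\<bar> \<le> \<delta> * V y" for y
      using growth_modulusD[of s \<delta> y] d2(2)[of s] s \<open>\<delta> > 0\<close> by (cases "s = 0") (auto simp: V_nonneg)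
    have "nV (\<lambda>y. g (y + s) - g y) \<le> (\<integral>\<^sup>+y. ennreal \<bar>V (y + s) * g (y + s) - V y * g y\<bar> + ennreal \<delta> * ennreal (V y * \<bar>g (y + s)\<bar>) \<partial>lborel)"
      unfolding vnorm_def
    proof (intro nn_integral_mono)
      fix y
      have "V y * \<bar>g (y + s) - g y\<bar> = \<bar>(V (y + s) * g (y + s) - V y * g y) - (V (y + s) - V y) * g (y + s)\<bar>"
      proof -
        have "(V (y + s) * g (y + s) - V y * g y) - (V (y + s) - V y) * g (y + s) = V y * (g (y + s) - g y)"
          by (simp add: algebra_simps)
        then show ?thesis using V_nonneg[of y] by (simp add: abs_mult)
      qed
      also have "\<dots> \<le> \<bar>V (y + s) * g (y + s) - V y * g y\<bar> + \<bar>V (y + s) - V y\<bar> * \<bar>g (y + s)\<bar>"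
        by (rule order_trans[OF abs_triangle_ineq4]) (simp add: abs_mult)
      also have "\<bar>V (y + s) - V y\<bar> * \<bar>g (y + s)\<bar> \<le> \<delta> * V y * \<bar>g (y + s)\<bar>"
        by (intro mult_right_mono VV) auto
      finally show "ennreal (V y * \<bar>g (y + s) - g y\<bar>) \<le> ennreal \<bar>V (y + s) * g (y + s) - V y * g y\<bar> + ennreal \<delta> * ennreal (V y * \<bar>g (y + s)\<bar>)"
        using \<open>\<delta> > 0\<close> V_nonneg[of y] by (auto simp: ennreal_mult[symmetric] mult.assoc simp flip: ennreal_plus)
    qed
    also have "\<dots> = (\<integral>\<^sup>+y. ennreal \<bar>V (y + s) * g (y + s) - V y * g y\<bar> \<partial>lborel) + ennreal \<delta> * nV (\<lambda>y. g (y + s))"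
      by (simp add: nn_integral_add nn_integral_cmult vnorm_def)
    also have "\<dots> \<le> ennreal (e / 2) + ennreal \<delta> * (ennreal c * nV g)"
      using s by (intro add_mono mult_left_mono d1 c) auto
    also have "\<dots> = ennreal (e / 2 + \<delta> * (c * B))"
      using \<open>\<delta> > 0\<close> \<open>e > 0\<close> c(1) B by (subst ennreal_plus) (auto simp: ennreal_mult)
    also have "\<dots> \<le> ennreal e"
    proof (rule ennreal_leI)
      have "\<delta> * (c * B) \<le> \<delta> * (c * B + 1)" using \<open>\<delta> > 0\<close> by simp
      also have "c * B + 1 > 0" using c B by (auto intro!: add_nonneg_pos mult_nonneg_nonneg)
      then have "\<delta> * (c * B + 1) = e / 2" by (simp add: \<delta>_def field_simps)
      finally show "e / 2 + \<delta> * (c * B) \<le> e" by simp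
    qed
    finally show "nV (\<lambda>y. g (y + s) - g y) \<le> ennreal e" .
  qed
qed

text \<open>Minkowski's inequality for integrals. Integrability in \<open>u\<close> need not be
  checked beforehand: a divergent Bochner integral has the value 0, which the right-hand side
  dominates.\<close>

lemma nV_integral:
  fixes K :: "'b \<Rightarrow> real \<Rightarrow> real"
  assumes "sigma_finite_measure N" and [measurable]: "case_prod K \<in> borel_measurable (N \<Otimes>\<^sub>M borel)"
  shows "nV (\<lambda>y. \<integral>u. K u y \<partial>N) \<le> (\<integral>\<^sup>+u. nV (K u) \<partial>N)"
proof -
  interpret N: sigma_finite_measure N by fact
  interpret P: pair_sigma_finite N lborel ..
  have [measurable]: "case_prod K \<in> borel_measurable (N \<Otimes>\<^sub>M lborel)"
    by (simp cong: measurable_cong_sets)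
  have *: "ennreal \<bar>\<integral>u. K u y \<partial>N\<bar> \<le> (\<integral>\<^sup>+u. ennreal \<bar>K u y\<bar> \<partial>N)" for y
  proof (cases "integrable N (\<lambda>u. K u y)")
    case True
    then show ?thesis using integral_norm_bound_ennreal[of N "\<lambda>u. K u y"] by simp
  qed (simp add: not_integrable_integral_eq)
  have "nV (\<lambda>y. \<integral>u. K u y \<partial>N) \<le> (\<integral>\<^sup>+y. (\<integral>\<^sup>+u. ennreal (V y) * ennreal \<bar>K u y\<bar> \<partial>N) \<partial>lborel)"
    unfolding vnorm_def
  proof (rule nn_integral_mono)
    fix y :: real
    have "ennreal (V y * \<bar>\<integral>u. K u y \<partial>N\<bar>) = ennreal (V y) * ennreal \<bar>\<integral>u. K u y \<partial>N\<bar>"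
      by (simp add: ennreal_mult V_nonneg)
    also have "\<dots> \<le> ennreal (V y) * (\<integral>\<^sup>+u. ennreal \<bar>K u y\<bar> \<partial>N)" by (intro mult_left_mono *) auto
    also have "\<dots> = (\<integral>\<^sup>+u. ennreal (V y) * ennreal \<bar>K u y\<bar> \<partial>N)" by (subst nn_integral_cmult) auto
    finally show "ennreal (V y * \<bar>\<integral>u. K u y \<partial>N\<bar>) \<le> (\<integral>\<^sup>+u. ennreal (V y) * ennreal \<bar>K u y\<bar> \<partial>N)" .
  qed
  also have "\<dots> = (\<integral>\<^sup>+u. (\<integral>\<^sup>+y. ennreal (V y) * ennreal \<bar>K u y\<bar> \<partial>lborel) \<partial>N)"
    by (rule P.Fubini') measurable
  also have "\<dots> = (\<integral>\<^sup>+u. nV (K u) \<partial>N)"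
    unfolding vnorm_def by (simp add: ennreal_mult V_nonneg)
  finally show ?thesis .
qed

end

section \<open>The pointwise ergodic theorem\<close>

definition birkhoff_sum :: "('b \<Rightarrow> 'b) \<Rightarrow> ('b \<Rightarrow> real) \<Rightarrow> nat \<Rightarrow> 'b \<Rightarrow> real" where
  "birkhoff_sum T g n y = (\<Sum>i<n. g ((T ^^ i) y))"

text \<open>This is the largest Birkhoff sum of length at most \<open>n\<close>, the empty sum
  included. The recursion through \<open>T\<close> replaces an explicit maximum, so that M_(n+1) -
  M_n o T can be read off as max(-M_n o T, g).\<close>

primrec birkhoff_max :: "('b \<Rightarrow> 'b) \<Rightarrow> ('b \<Rightarrow> real) \<Rightarrow> nat \<Rightarrow> 'b \<Rightarrow> real" where
  "birkhoff_max T g 0 y = 0"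
| "birkhoff_max T g (Suc n) y = max 0 (g y + birkhoff_max T g n (T y))"

lemma birkhoff_sum_Suc: "birkhoff_sum T g (Suc n) y = g y + birkhoff_sum T g n (T y)"
  by (simp add: birkhoff_sum_def sum.lessThan_Suc_shift funpow_swap1 del: sum.lessThan_Suc)

lemma birkhoff_max_nonneg: "0 \<le> birkhoff_max T g n y"
  by (cases n) auto

lemma birkhoff_sum_le_max: "birkhoff_sum T g n y \<le> birkhoff_max T g n y"
proof (induction n arbitrary: y)
  case (Suc n)
  from Suc[of "T y"] show ?case by (simp add: birkhoff_sum_Suc)
qed (simp add: birkhoff_sum_def)

lemma birkhoff_max_mono: "birkhoff_max T g n y \<le> birkhoff_max T g (Suc n) y"
proof (induction n arbitrary: y)
  case (Suc n)
  from Suc[of "T y"] show ?case by (simp add: max.coboundedI2)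
qed simp

locale ergodic_system = prob_space P for P :: "'b measure" +
  fixes T :: "'b \<Rightarrow> 'b"
  assumes T_measurable[measurable]: "T \<in> measurable P P"
    and T_preserving: "distr P P T = P"
    and T_ergodic: "\<And>A. A \<in> sets P \<Longrightarrow> T -` A \<inter> space P = A \<Longrightarrow> prob A \<in> {0, 1}"
begin

lemma integral_T:
  fixes h :: "'b \<Rightarrow> real"
  assumes [measurable]: "h \<in> borel_measurable P"
  shows "(\<integral>y. h (T y) \<partial>P) = (\<integral>y. h y \<partial>P)"
  using integral_distr[OF T_measurable, of h] T_preserving by simp

lemma integrable_T:
  fixes h :: "'b \<Rightarrow> real"
  assumes "integrable P h" shows "integrable P (\<lambda>y. h (T y))"
  using integrable_distr[OF T_measurable, of h] T_preserving assms by simp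

lemma birkhoff_sum_measurable[measurable]:
  assumes [measurable]: "g \<in> borel_measurable P"
  shows "birkhoff_sum T g n \<in> borel_measurable P"
  unfolding birkhoff_sum_def[abs_def] by measurable

lemma birkhoff_max_integrable:
  assumes g: "integrable P g"
  shows "integrable P (birkhoff_max T g n)"
proof (induction n)
  case (Suc n)
  have "integrable P (\<lambda>y. max 0 (g y + birkhoff_max T g n (T y)))"
    by (rule integrable_max[OF integrable_zero Bochner_Integration.integrable_add[OF g integrable_T[OF Suc]]])
  moreover have "birkhoff_max T g (Suc n) = (\<lambda>y. max 0 (g y + birkhoff_max T g n (T y)))" by (rule ext) simp
  ultimately show ?case by simp
qed simp

text \<open>The points with unbounded Birkhoff sums form an invariant set. If it had full measure, the running
  maxima $M_n$ would tend to infinity almost everywhere, so $M_{n+1} - M_n\circ T = \max(-M_n\circ T, g)$ would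
  tend to \<open>g\<close>; its integral is nonnegative by invariance, contradicting $\int g < 0$.\<close>

lemma birkhoff_sum_bounded_above:
  assumes g: "integrable P g" and neg: "(\<integral>y. g y \<partial>P) < 0"
  shows "AE y in P. \<exists>B::nat. \<forall>n. birkhoff_sum T g n y \<le> real B"
proof -
  have [measurable]: "g \<in> borel_measurable P" using g by auto
  define A where "A = {y \<in> space P. \<not> (\<exists>B::nat. \<forall>n. birkhoff_sum T g n y \<le> real B)}"
  have A[measurable]: "A \<in> sets P" unfolding A_def by measurable
  \<comment> \<open>Sums started at \<open>y\<close> and at \<open>T y\<close> differ by the term
    \<open>g y\<close> and a shift of the index, so they are bounded above together.\<close>
  have inv: "T -` A \<inter> space P = A"
  proof -
    have "(\<exists>B::nat. \<forall>n. birkhoff_sum T g n (T y) \<le> real B) \<longleftrightarrow> (\<exists>B::nat. \<forall>n. birkhoff_sum T g n y \<le> real B)" for y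
    proof
      assume "\<exists>B::nat. \<forall>n. birkhoff_sum T g n (T y) \<le> real B"
      then obtain B :: nat where B: "\<And>n. birkhoff_sum T g n (T y) \<le> real B" by auto
      obtain C :: nat where C: "\<bar>g y\<bar> \<le> real C" using real_arch_simple by blast
      have "birkhoff_sum T g n y \<le> real (B + C)" for n
        using B[of "n - 1"] C by (cases n) (auto simp: birkhoff_sum_Suc, simp add: birkhoff_sum_def)
      then show "\<exists>B::nat. \<forall>n. birkhoff_sum T g n y \<le> real B" by blast
    next
      assume "\<exists>B::nat. \<forall>n. birkhoff_sum T g n y \<le> real B"
      then obtain B :: nat where B: "\<And>n. birkhoff_sum T g n y \<le> real B" by auto
      obtain C :: nat where C: "\<bar>g y\<bar> \<le> real C" using real_arch_simple by blast
      have "birkhoff_sum T g n (T y) \<le> real (B + C)" for n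
        using B[of "Suc n"] C by (auto simp: birkhoff_sum_Suc)
      then show "\<exists>B::nat. \<forall>n. birkhoff_sum T g n (T y) \<le> real B" by blast
    qed
    then show ?thesis using measurable_space[OF T_measurable] unfolding A_def by blast
  qed
  have "prob A \<noteq> 1"
  proof
    assume "prob A = 1"
    then have AE_A: "AE y in P. y \<in> A" using prob_eq_1[OF A] by (simp add: A_def)
    define d where "d n y = birkhoff_max T g (Suc n) y - birkhoff_max T g n (T y)" for n y
    have d_eq: "d n y = max (- birkhoff_max T g n (T y)) (g y)" for n y
      by (simp add: d_def max_def)
    have [measurable]: "birkhoff_max T g n \<in> borel_measurable P" for n
      using birkhoff_max_integrable[OF g] by auto
    have "(\<lambda>n. \<integral>y. d n y \<partial>P) \<longlonglongrightarrow> (\<integral>y. g y \<partial>P)"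
    proof (rule integral_dominated_convergence)
      show "integrable P (\<lambda>y. \<bar>g y\<bar>)" using g by auto
      show "AE y in P. (\<lambda>n. d n y) \<longlonglongrightarrow> g y"
        using AE_A
      proof (rule AE_mp, intro AE_I2 impI)
        fix y assume y: "y \<in> space P" "y \<in> A"
        then have "T y \<in> A" using inv by blast
        then have unb: "\<not> (\<exists>B::nat. \<forall>n. birkhoff_sum T g n (T y) \<le> real B)" by (simp add: A_def)
        obtain B :: nat where B: "- g y \<le> real B" using real_arch_simple by blast
        obtain n0 where n0: "birkhoff_sum T g n0 (T y) > real B" using unb by (meson not_le)
        \<comment> \<open>Once the maximum along \<open>T y\<close> exceeds \<open>- g y\<close>,
          the branch \<open>g y\<close> is selected, and it stays selected because the maxima
          increase with \<open>n\<close>.\<close>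
        have "d n y = g y" if "n \<ge> n0" for n
        proof -
          have "birkhoff_max T g n0 (T y) \<le> birkhoff_max T g n (T y)"
            using that birkhoff_max_mono by (rule lift_Suc_mono_le[rotated])
          then have "- birkhoff_max T g n (T y) \<le> g y"
            using n0 birkhoff_sum_le_max[of T g n0 "T y"] B by linarith
          then show ?thesis by (simp add: d_eq)
        qed
        then have "\<forall>\<^sub>F n in sequentially. d n y = g y" by (auto simp: eventually_sequentially)
        then show "(\<lambda>n. d n y) \<longlonglongrightarrow> g y" by (rule tendsto_eventually)
      qed
      \<comment> \<open>As M_n o T is nonnegative, max(-M_n o T, g) lies between \<open>g\<close>
        and its positive part, which supplies the dominating function.\<close>
      show "AE y in P. norm (d n y) \<le> \<bar>g y\<bar>" for n
        using birkhoff_max_nonneg[of T g n "T _"] by (auto simp: d_eq max_def abs_if intro!: AE_I2) (smt (verit) birkhoff_max_nonneg)+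
      show "d n \<in> borel_measurable P" for n unfolding d_def[abs_def] by measurable
    qed (use g in auto)
    moreover have "(\<integral>y. d n y \<partial>P) \<ge> 0" for n
    proof -
      have "(\<integral>y. d n y \<partial>P) = (\<integral>y. birkhoff_max T g (Suc n) y \<partial>P) - (\<integral>y. birkhoff_max T g n (T y) \<partial>P)"
        unfolding d_def by (rule Bochner_Integration.integral_diff[OF birkhoff_max_integrable[OF g] integrable_T[OF birkhoff_max_integrable[OF g]]])
      also have "(\<integral>y. birkhoff_max T g n (T y) \<partial>P) = (\<integral>y. birkhoff_max T g n y \<partial>P)" by (rule integral_T) auto
      finally show ?thesis
        using integral_mono[OF birkhoff_max_integrable[OF g, of n] birkhoff_max_integrable[OF g, of "Suc n"] birkhoff_max_mono]
        by linarith
    qed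
    ultimately have "(\<integral>y. g y \<partial>P) \<ge> 0" by (intro LIMSEQ_le_const) auto
    then show False using neg by linarith
  qed
  then have "prob A = 0" using T_ergodic[OF A inv] by auto
  then have "AE y in P. y \<notin> A" by (simp add: prob_eq_0 A_def)
  then show ?thesis by (rule AE_mp) (auto intro!: AE_I2 simp: A_def)
qed

text \<open>Subtracting the mean plus e/2 makes the integral negative, so the sums of the centred
  function are bounded above, and their bound disappears after division by n.\<close>

lemma birkhoff_upper:
  assumes g: "integrable P g" and "e > 0"
  shows "AE y in P. \<forall>\<^sub>F n in sequentially. birkhoff_sum T g n y / real n \<le> (\<integral>y. g y \<partial>P) + e"
proof -
  define I where "I = (\<integral>y. g y \<partial>P)"
  define h where "h y = g y - I - e / 2" for y
  have hint: "integrable P h" unfolding h_def by (intro Bochner_Integration.integrable_diff g) auto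
  have "(\<integral>y. h y \<partial>P) = - e / 2"
    unfolding h_def using g by (simp add: I_def prob_space)
  then have "AE y in P. \<exists>B::nat. \<forall>n. birkhoff_sum T h n y \<le> real B"
    using \<open>e > 0\<close> by (intro birkhoff_sum_bounded_above hint) auto
  then show ?thesis
  proof (rule AE_mp, intro AE_I2 impI)
    fix y assume "\<exists>B::nat. \<forall>n. birkhoff_sum T h n y \<le> real B"
    then obtain B :: nat where B: "\<And>n. birkhoff_sum T h n y \<le> real B" by auto
    have hs: "birkhoff_sum T h n y = birkhoff_sum T g n y - real n * (I + e / 2)" for n
      by (simp add: birkhoff_sum_def h_def sum_subtractf algebra_simps)
    have "(\<lambda>n. real B / real n) \<longlonglongrightarrow> 0" by (rule lim_const_over_n)
    then have "\<forall>\<^sub>F n in sequentially. real B / real n < e / 2" using \<open>e > 0\<close> by (intro order_tendstoD) auto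
    with eventually_gt_at_top[of 0]
    show "\<forall>\<^sub>F n in sequentially. birkhoff_sum T g n y / real n \<le> (\<integral>y. g y \<partial>P) + e"
    proof eventually_elim
      case (elim n)
      have "birkhoff_sum T g n y \<le> real B + real n * (I + e / 2)" using B[of n] by (simp add: hs)
      then have "birkhoff_sum T g n y / real n \<le> real B / real n + (I + e / 2)"
        using elim by (simp add: field_simps)
      then show ?case using elim(2) unfolding I_def by linarith
    qed
  qed
qed

text \<open>The upper estimate is applied to \<open>g\<close> and to its negative, along the
  countably many tolerances 1/(j + 1), so that only one null set is excluded.\<close>

theorem birkhoff:
  assumes g: "integrable P g"
  shows "AE y in P. (\<lambda>n. birkhoff_sum T g n y / real n) \<longlonglongrightarrow> (\<integral>y. g y \<partial>P)"
proof -
  have 1: "AE y in P. \<forall>j. \<forall>\<^sub>F n in sequentially. birkhoff_sum T g n y / real n \<le> (\<integral>y. g y \<partial>P) + inverse (real (Suc j))"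
    by (intro AE_all_countable[THEN iffD2] allI birkhoff_upper g) auto
  have 2: "AE y in P. \<forall>j. \<forall>\<^sub>F n in sequentially. birkhoff_sum T (\<lambda>y. - g y) n y / real n \<le> (\<integral>y. - g y \<partial>P) + inverse (real (Suc j))"
    by (intro AE_all_countable[THEN iffD2] allI birkhoff_upper Bochner_Integration.integrable_minus g) auto
  show ?thesis
    using 1 2
  proof eventually_elim
    case (elim y)
    show ?case
    proof (rule tendstoI)
      fix e :: real assume "e > 0"
      then obtain j where j: "inverse (real (Suc j)) < e" using reals_Archimedean by blast
      have m: "birkhoff_sum T (\<lambda>y. - g y) n y = - birkhoff_sum T g n y" for n
        by (simp add: birkhoff_sum_def sum_negf)
      show "\<forall>\<^sub>F n in sequentially. dist (birkhoff_sum T g n y / real n) (\<integral>y. g y \<partial>P) < e"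
        using elim(1)[rule_format, of j] elim(2)[rule_format, of j]
        by eventually_elim (use j in \<open>auto simp: m dist_real_def abs_if\<close>)
    qed
  qed
qed

end

text \<open>The underlying space carries no transformation, so the law of the sequence on path
  space, with the shift, serves as the dynamical system. \<open>G\<close> may look at the whole
  path, which covers functions of a lag vector together with the next observation.\<close>

lemma stationary_ergodic_average:
  fixes Y :: "nat \<Rightarrow> 'a \<Rightarrow> real"
  assumes "prob_space M" and stat: "stationary M Y" and erg: "ergodic M Y"
    and G[measurable]: "G \<in> borel_measurable (\<Pi>\<^sub>M k\<in>(UNIV::nat set). borel)"
    and int: "integrable M (\<lambda>\<omega>. G (\<lambda>k. Y k \<omega>))"
  shows "AE \<omega> in M. (\<lambda>n. (\<Sum>i<n. G (\<lambda>k. Y (k + i) \<omega>)) / real n) \<longlonglongrightarrow> (\<integral>\<omega>. G (\<lambda>k. Y k \<omega>) \<partial>M)"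
proof -
  interpret prob_space M by fact
  let ?S = "\<Pi>\<^sub>M k\<in>(UNIV::nat set). (borel :: real measure)"
  define T :: "(nat \<Rightarrow> real) \<Rightarrow> nat \<Rightarrow> real" where "T y = (\<lambda>k. y (Suc k))" for y
  define P where "P = distr M ?S (\<lambda>\<omega> k. Y k \<omega>)"
  have Ym[measurable]: "Y k \<in> borel_measurable M" for k using stat by (simp add: stationary_def)
  have YM: "(\<lambda>\<omega> k. Y (k + i) \<omega>) \<in> measurable M ?S" for i
    by (rule measurable_PiM_single') auto
  have Y0: "(\<lambda>\<omega> k. Y k \<omega>) \<in> measurable M ?S" using YM[of 0] by simp
  have TM: "T \<in> measurable ?S ?S"
    unfolding T_def by (rule measurable_PiM_single') auto
  have spP: "space P = UNIV" by (auto simp: P_def space_PiM)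
  have setsP: "sets P = sets ?S" by (simp add: P_def)
  interpret P: prob_space P unfolding P_def by (rule prob_space_distr[OF Y0])
  interpret ergodic_system P T
  proof
    show TP: "T \<in> measurable P P" using TM by (simp add: P_def)
    have "distr P P T = distr P ?S T" using setsP by (intro distr_cong) auto
    also have "\<dots> = distr M ?S (T \<circ> (\<lambda>\<omega> k. Y k \<omega>))" unfolding P_def by (rule distr_distr[OF TM Y0])
    also have "T \<circ> (\<lambda>\<omega> k. Y k \<omega>) = (\<lambda>\<omega> k. Y (k + 1) \<omega>)" by (simp add: T_def comp_def)
    also have "distr M ?S \<dots> = P" using stat unfolding stationary_def P_def by blast
    finally show "distr P P T = P" .
    fix A assume A: "A \<in> sets P" "T -` A \<inter> space P = A"
    have "{y. (\<lambda>k. y (Suc k)) \<in> A} = A" using A(2) spP by (auto simp: T_def)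
    then have "measure M {\<omega> \<in> space M. (\<lambda>k. Y k \<omega>) \<in> A} \<in> {0, 1}"
      using erg A(1) setsP unfolding ergodic_def by blast
    also have "measure M {\<omega> \<in> space M. (\<lambda>k. Y k \<omega>) \<in> A} = measure P A"
      using A(1) setsP unfolding P_def by (subst measure_distr[OF Y0]) (auto intro!: arg_cong[where f="measure M"])
    finally show "measure P A \<in> {0, 1}" .
  qed
  have Tpow: "(T ^^ i) y = (\<lambda>k. y (k + i))" for i y
    by (induction i) (auto simp: T_def)
  have intP: "integrable P G" unfolding P_def using int by (subst integrable_distr_eq[OF Y0 G])
  have IP: "(\<integral>y. G y \<partial>P) = (\<integral>\<omega>. G (\<lambda>k. Y k \<omega>) \<partial>M)" unfolding P_def by (rule integral_distr[OF Y0 G])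
  have "AE y in P. (\<lambda>n. birkhoff_sum T G n y / real n) \<longlonglongrightarrow> (\<integral>y. G y \<partial>P)" by (rule birkhoff[OF intP])
  then have "AE y in P. (\<lambda>n. (\<Sum>i<n. G (\<lambda>k. y (k + i))) / real n) \<longlonglongrightarrow> (\<integral>\<omega>. G (\<lambda>k. Y k \<omega>) \<partial>M)"
    by (simp add: birkhoff_sum_def Tpow IP)
  then show ?thesis unfolding P_def by (rule AE_distrD[OF Y0])
qed

section \<open>Stochastic orders\<close>

text \<open>A property that fails with outer probability at most \<open>e\<close> for all large
  \<open>n\<close>. Outer measure is forced by suprema over uncountable sets and by substituting the
  estimator pathwise. Failure probabilities add under conjunction, and this replaces the calculus of
  o_p and O_p.\<close>

definition mostly :: "'a measure \<Rightarrow> real \<Rightarrow> (nat \<Rightarrow> 'a \<Rightarrow> bool) \<Rightarrow> bool" where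
  "mostly M e P \<longleftrightarrow> (\<forall>\<^sub>F n in sequentially. outer_measure_of M {\<omega> \<in> space M. \<not> P n \<omega>} \<le> ennreal e)"

text \<open>Each set has a measurable hull of the same outer measure, and the hulls obey ordinary
  subadditivity.\<close>

lemma outer_measure_of_subadditive:
  assumes "A \<subseteq> space M" "B \<subseteq> space M"
  shows "outer_measure_of M (A \<union> B) \<le> outer_measure_of M A + outer_measure_of M B"
proof -
  obtain E F where E: "E \<in> sets M" "A \<subseteq> E" "outer_measure_of M A = emeasure M E"
    and F: "F \<in> sets M" "B \<subseteq> F" "outer_measure_of M B = emeasure M F"
    using outer_measure_of_attain assms by metis
  have "outer_measure_of M (A \<union> B) \<le> outer_measure_of M (E \<union> F)"
    using E F by (intro outer_measure_of_mono) auto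
  also have "\<dots> = emeasure M (E \<union> F)" using E F by simp
  also have "\<dots> \<le> emeasure M E + emeasure M F" using E F by (intro emeasure_subadditive)
  finally show ?thesis using E F by simp
qed

lemma mostly_mono:
  assumes "mostly M e P" "\<forall>\<^sub>F n in sequentially. \<forall>\<omega>\<in>space M. P n \<omega> \<longrightarrow> Q n \<omega>" "e \<le> e'"
  shows "mostly M e' Q"
  unfolding mostly_def using assms(1)[unfolded mostly_def] assms(2)
proof eventually_elim
  case (elim n)
  have "outer_measure_of M {\<omega> \<in> space M. \<not> Q n \<omega>} \<le> outer_measure_of M {\<omega> \<in> space M. \<not> P n \<omega>}"
    using elim by (intro outer_measure_of_mono) auto
  also have "\<dots> \<le> ennreal e'" using elim assms(3) by (auto intro: order_trans ennreal_leI)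
  finally show ?case .
qed

lemma mostly_conj:
  assumes "mostly M e1 P" "mostly M e2 Q" "0 \<le> e1" "0 \<le> e2"
  shows "mostly M (e1 + e2) (\<lambda>n \<omega>. P n \<omega> \<and> Q n \<omega>)"
  unfolding mostly_def using assms(1,2)[unfolded mostly_def]
proof eventually_elim
  case (elim n)
  have "outer_measure_of M {\<omega> \<in> space M. \<not> (P n \<omega> \<and> Q n \<omega>)}
     \<le> outer_measure_of M ({\<omega> \<in> space M. \<not> P n \<omega>} \<union> {\<omega> \<in> space M. \<not> Q n \<omega>})"
    by (intro outer_measure_of_mono) auto
  also have "\<dots> \<le> outer_measure_of M {\<omega> \<in> space M. \<not> P n \<omega>} + outer_measure_of M {\<omega> \<in> space M. \<not> Q n \<omega>}"
    by (intro outer_measure_of_subadditive) auto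
  also have "\<dots> \<le> ennreal e1 + ennreal e2" by (intro add_mono elim)
  finally show ?case using assms by simp
qed

lemma mostly_Markov:
  fixes Z :: "nat \<Rightarrow> 'a \<Rightarrow> ennreal"
  assumes [measurable]: "\<And>n. Z n \<in> borel_measurable M" and "c > 0" "e \<ge> 0"
    and bd: "\<forall>\<^sub>F n in sequentially. (\<integral>\<^sup>+\<omega>. Z n \<omega> \<partial>M) \<le> ennreal (e * c)"
  shows "mostly M e (\<lambda>n \<omega>. Z n \<omega> \<le> ennreal c)"
  unfolding mostly_def using bd
proof eventually_elim
  case (elim n)
  have "{\<omega> \<in> space M. \<not> Z n \<omega> \<le> ennreal c} \<subseteq> {\<omega> \<in> space M. 1 \<le> ennreal (1 / c) * Z n \<omega>}"
  proof safe
    fix \<omega> assume "\<not> Z n \<omega> \<le> ennreal c"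
    then have "ennreal c \<le> Z n \<omega>" by simp
    then have "ennreal (1 / c) * ennreal c \<le> ennreal (1 / c) * Z n \<omega>" by (rule mult_left_mono) simp
    then show "1 \<le> ennreal (1 / c) * Z n \<omega>" using \<open>c > 0\<close> by (simp add: ennreal_mult[symmetric])
  qed
  then have "outer_measure_of M {\<omega> \<in> space M. \<not> Z n \<omega> \<le> ennreal c} \<le> outer_measure_of M {\<omega> \<in> space M. 1 \<le> ennreal (1 / c) * Z n \<omega>}"
    by (rule outer_measure_of_mono)
  also have "\<dots> = emeasure M {\<omega> \<in> space M. 1 \<le> ennreal (1 / c) * Z n \<omega>}"
    by (rule outer_measure_of_eq) measurable
  also have "\<dots> \<le> ennreal (1 / c) * (\<integral>\<^sup>+\<omega>. Z n \<omega> \<partial>M)"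
    using nn_integral_Markov_inequality[of "Z n" "space M" M "ennreal (1 / c)"]
    by (simp cong: conj_cong nn_integral_cong)
  also have "\<dots> \<le> ennreal (1 / c) * ennreal (e * c)" by (intro mult_left_mono elim) simp
  also have "\<dots> = ennreal e" using \<open>c > 0\<close> \<open>e \<ge> 0\<close> by (simp add: ennreal_mult[symmetric])
  finally show ?case .
qed

lemma mostly_tight:
  fixes Z :: "nat \<Rightarrow> 'a \<Rightarrow> ennreal"
  assumes [measurable]: "\<And>n. Z n \<in> borel_measurable M" and "e > 0"
    and bd: "\<forall>\<^sub>F n in sequentially. (\<integral>\<^sup>+\<omega>. Z n \<omega> \<partial>M) \<le> ennreal C"
  shows "\<exists>K>0. mostly M e (\<lambda>n \<omega>. Z n \<omega> \<le> ennreal K)"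
proof (intro exI conjI mostly_Markov)
  show pos: "(\<bar>C\<bar> + 1) / e > 0" using \<open>e > 0\<close> by simp
  show "\<forall>\<^sub>F n in sequentially. (\<integral>\<^sup>+\<omega>. Z n \<omega> \<partial>M) \<le> ennreal (e * ((\<bar>C\<bar> + 1) / e))"
    using bd
  proof eventually_elim
    case (elim n)
    also have "ennreal C \<le> ennreal (e * ((\<bar>C\<bar> + 1) / e))" using \<open>e > 0\<close> by (intro ennreal_leI) simp
    finally show ?case .
  qed
  show "(\<bar>C\<bar> + 1) / e > 0" by (rule pos)
qed (use \<open>e > 0\<close> in auto)

text \<open>Almost sure convergence passes to probability through the bounded quantity min(1, |Z -
  c|): its mean tends to 0 by dominated convergence, and Markov's inequality does the rest.\<close>

lemma mostly_AE_tendsto: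
  fixes Z :: "nat \<Rightarrow> 'a \<Rightarrow> real"
  assumes "prob_space M" and [measurable]: "\<And>n. Z n \<in> borel_measurable M"
    and lim: "AE \<omega> in M. (\<lambda>n. Z n \<omega>) \<longlonglongrightarrow> c" and "\<delta> > 0" "e > 0"
  shows "mostly M e (\<lambda>n \<omega>. \<bar>Z n \<omega> - c\<bar> \<le> \<delta>)"
proof -
  interpret prob_space M by fact
  \<comment> \<open>Kept below 1, so that the cut-off at 1 is inactive on the event
    obtained.\<close>
  define \<delta>' where "\<delta>' = min \<delta> (1/2)"
  have "\<delta>' > 0" using \<open>\<delta> > 0\<close> by (simp add: \<delta>'_def)
  have "(\<lambda>n. \<integral>\<^sup>+\<omega>. ennreal (min 1 \<bar>Z n \<omega> - c\<bar>) \<partial>M) \<longlonglongrightarrow> (\<integral>\<^sup>+\<omega>. 0 \<partial>M)"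
  proof (rule nn_integral_dominated_convergence[where w="\<lambda>_. 1"])
    show "AE \<omega> in M. (\<lambda>n. ennreal (min 1 \<bar>Z n \<omega> - c\<bar>)) \<longlonglongrightarrow> 0"
      using lim
    proof eventually_elim
      case (elim \<omega>)
      then have "(\<lambda>n. ennreal (min 1 \<bar>Z n \<omega> - c\<bar>)) \<longlonglongrightarrow> ennreal (min 1 \<bar>c - c\<bar>)"
        by (intro tendsto_intros)
      then show ?case by simp
    qed
  qed (auto simp: emeasure_space_1)
  then have "\<forall>\<^sub>F n in sequentially. (\<integral>\<^sup>+\<omega>. ennreal (min 1 \<bar>Z n \<omega> - c\<bar>) \<partial>M) < ennreal (e * \<delta>')"
    using \<open>e > 0\<close> \<open>\<delta>' > 0\<close> by (intro order_tendstoD) auto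
  then have "\<forall>\<^sub>F n in sequentially. (\<integral>\<^sup>+\<omega>. ennreal (min 1 \<bar>Z n \<omega> - c\<bar>) \<partial>M) \<le> ennreal (e * \<delta>')"
    by eventually_elim simp
  then have "mostly M e (\<lambda>n \<omega>. ennreal (min 1 \<bar>Z n \<omega> - c\<bar>) \<le> ennreal \<delta>')"
    using \<open>e > 0\<close> \<open>\<delta>' > 0\<close> by (intro mostly_Markov) auto
  then show ?thesis
    by (rule mostly_mono) (use \<open>\<delta>' > 0\<close> in \<open>auto simp: ennreal_le_iff \<delta>'_def min_def split: if_splits\<close>)
qed

lemma smallo_probI:
  assumes "\<And>e c. e > 0 \<Longrightarrow> c > 0 \<Longrightarrow> mostly M e (\<lambda>n \<omega>. Z n \<omega> \<le> ennreal (c * a n))"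
  shows "smallo_prob M Z a"
  unfolding smallo_prob_def
proof (intro allI impI)
  fix c :: real assume "c > 0"
  show "(\<lambda>n. outer_measure_of M {\<omega> \<in> space M. ennreal (c * a n) < Z n \<omega>}) \<longlonglongrightarrow> 0"
  proof (rule order_tendstoI)
    fix x :: ennreal assume "0 < x"
    then obtain e where e: "e > 0" "ennreal e < x"
      by (metis dense ennreal_cases ennreal_less_zero_iff less_top_ennreal top.not_eq_extremum order_less_le_trans top_greatest)
    have "\<forall>\<^sub>F n in sequentially. outer_measure_of M {\<omega> \<in> space M. \<not> Z n \<omega> \<le> ennreal (c * a n)} \<le> ennreal e"
      using assms[OF e(1) \<open>c > 0\<close>] unfolding mostly_def .
    then show "\<forall>\<^sub>F n in sequentially. outer_measure_of M {\<omega> \<in> space M. ennreal (c * a n) < Z n \<omega>} < x"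
      by eventually_elim (use e in \<open>auto simp: not_le intro: order_le_less_trans\<close>)
  qed auto
qed

lemma bigO_probD:
  assumes "bigO_prob M Z a" "e > 0"
  shows "\<exists>K>0. mostly M e (\<lambda>n \<omega>. Z n \<omega> \<le> ennreal (K * \<bar>a n\<bar>))"
proof -
  obtain K where K: "\<forall>\<^sub>F n in sequentially. outer_measure_of M {\<omega> \<in> space M. Z n \<omega> > ennreal (K * a n)} \<le> ennreal e"
    using assms unfolding bigO_prob_def by blast
  have "mostly M e (\<lambda>n \<omega>. Z n \<omega> \<le> ennreal (K * a n))"
    using K unfolding mostly_def by (simp add: not_le)
  \<comment> \<open>The constant supplied by \<open>bigO_prob\<close> may be zero or negative;
    enlarging it makes it positive without losing the bound.\<close>
  then have "mostly M e (\<lambda>n \<omega>. Z n \<omega> \<le> ennreal ((\<bar>K\<bar> + 1) * \<bar>a n\<bar>))"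
  proof (rule mostly_mono)
    have "K * a n \<le> (\<bar>K\<bar> + 1) * \<bar>a n\<bar>" for n
    proof -
      have "K * a n \<le> \<bar>K\<bar> * \<bar>a n\<bar>" by (metis abs_ge_self abs_mult)
      also have "\<dots> \<le> (\<bar>K\<bar> + 1) * \<bar>a n\<bar>" by (intro mult_right_mono) auto
      finally show ?thesis .
    qed
    then show "\<forall>\<^sub>F n in sequentially. \<forall>\<omega>\<in>space M. Z n \<omega> \<le> ennreal (K * a n) \<longrightarrow> Z n \<omega> \<le> ennreal ((\<bar>K\<bar> + 1) * \<bar>a n\<bar>)"
      by (auto intro!: always_eventually intro: order_trans ennreal_leI)
  qed simp
  then show ?thesis by (intro exI[of _ "\<bar>K\<bar> + 1"]) auto
qed

section \<open>The autoregressive process\<close>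

declare One_nat_def [simp del]

lemma (in prob_space) distr_pair_indep_compose:
  assumes ind: "indep_var S Y T Z" and g[measurable]: "g \<in> measurable S S'" and h[measurable]: "h \<in> measurable T T'"
  shows "distr M (S' \<Otimes>\<^sub>M T') (\<lambda>\<omega>. (g (Y \<omega>), h (Z \<omega>))) = distr M S' (\<lambda>\<omega>. g (Y \<omega>)) \<Otimes>\<^sub>M distr M T' (\<lambda>\<omega>. h (Z \<omega>))"
proof -
  have Y[measurable]: "Y \<in> measurable M S" and Z[measurable]: "Z \<in> measurable M T"
    using ind indep_var_rv1 indep_var_rv2 by auto
  interpret Y: prob_space "distr M S' (\<lambda>\<omega>. g (Y \<omega>))" by (rule prob_space_distr) simp
  interpret Z: prob_space "distr M T' (\<lambda>\<omega>. h (Z \<omega>))" by (rule prob_space_distr) simp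
  show ?thesis
  proof (rule pair_measure_eqI[symmetric])
    show "sigma_finite_measure (distr M S' (\<lambda>\<omega>. g (Y \<omega>)))" "sigma_finite_measure (distr M T' (\<lambda>\<omega>. h (Z \<omega>)))" ..
    show "sets (distr M S' (\<lambda>\<omega>. g (Y \<omega>)) \<Otimes>\<^sub>M distr M T' (\<lambda>\<omega>. h (Z \<omega>))) = sets (distr M (S' \<Otimes>\<^sub>M T') (\<lambda>\<omega>. (g (Y \<omega>), h (Z \<omega>))))"
      by (simp cong: sets_pair_measure_cong)
    fix A B assume "A \<in> sets (distr M S' (\<lambda>\<omega>. g (Y \<omega>)))" "B \<in> sets (distr M T' (\<lambda>\<omega>. h (Z \<omega>)))"
    then have A[measurable]: "A \<in> sets S'" and B[measurable]: "B \<in> sets T'" by auto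
    have gA: "g -` A \<inter> space S \<in> sets S" and hB: "h -` B \<inter> space T \<in> sets T" by measurable
    have Ysp: "\<omega> \<in> space M \<Longrightarrow> Y \<omega> \<in> space S" and Zsp: "\<omega> \<in> space M \<Longrightarrow> Z \<omega> \<in> space T" for \<omega>
      using measurable_space[OF Y] measurable_space[OF Z] by auto
    have "prob (Y -` (g -` A \<inter> space S) \<inter> Z -` (h -` B \<inter> space T) \<inter> space M) = prob ((\<lambda>x. (Y x, Z x)) -` ((g -` A \<inter> space S) \<times> (h -` B \<inter> space T)) \<inter> space M)"
      by (intro arg_cong[where f=prob]) auto
    also have "\<dots> = prob (Y -` (g -` A \<inter> space S) \<inter> space M) * prob (Z -` (h -` B \<inter> space T) \<inter> space M)"
      by (rule indep_varD[OF ind gA hB])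
    finally have fin: "prob (Y -` (g -` A \<inter> space S) \<inter> Z -` (h -` B \<inter> space T) \<inter> space M) = prob (Y -` (g -` A \<inter> space S) \<inter> space M) * prob (Z -` (h -` B \<inter> space T) \<inter> space M)" .
    have *: "prob ((\<lambda>\<omega>. (g (Y \<omega>), h (Z \<omega>))) -` (A \<times> B) \<inter> space M)
      = prob ((\<lambda>\<omega>. g (Y \<omega>)) -` A \<inter> space M) * prob ((\<lambda>\<omega>. h (Z \<omega>)) -` B \<inter> space M)"
    proof -
      have "Y -` (g -` A \<inter> space S) \<inter> Z -` (h -` B \<inter> space T) \<inter> space M = (\<lambda>\<omega>. (g (Y \<omega>), h (Z \<omega>))) -` (A \<times> B) \<inter> space M"
        "Y -` (g -` A \<inter> space S) \<inter> space M = (\<lambda>\<omega>. g (Y \<omega>)) -` A \<inter> space M"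
        "Z -` (h -` B \<inter> space T) \<inter> space M = (\<lambda>\<omega>. h (Z \<omega>)) -` B \<inter> space M"
        using Ysp Zsp by auto
      then show ?thesis using fin by simp
    qed
    show "emeasure (distr M S' (\<lambda>\<omega>. g (Y \<omega>))) A * emeasure (distr M T' (\<lambda>\<omega>. h (Z \<omega>))) B = emeasure (distr M (S' \<Otimes>\<^sub>M T') (\<lambda>\<omega>. (g (Y \<omega>), h (Z \<omega>)))) (A \<times> B)"
      using * by (simp add: emeasure_distr emeasure_eq_measure ennreal_mult[symmetric])
  qed
qed

context nonlinear_ar
begin

text \<open>The covariate that belongs to \<open>eps i\<close>. All averages run over the pairs of
  \<open>Lg i\<close> and \<open>eps i\<close> with i from 1, so \<open>Lg 1\<close> is the starting
  lag vector.\<close>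

definition Lg :: "nat \<Rightarrow> 'a \<Rightarrow> nat \<Rightarrow> real" where "Lg i = lag p X (int i - 1)"

abbreviation "LS \<equiv> (\<Pi>\<^sub>M j\<in>{1..p}. (borel :: real measure))"
definition F :: "real measure" where "F = density lborel (\<lambda>y. ennreal (f y))"

lemma X_measurable: assumes "t \<ge> 1 - int p" shows "X t \<in> borel_measurable M"
proof -
  have "X (1 - int p + int k) \<in> borel_measurable M" for k
    using stationary by (simp add: stationary_def)
  from this[of "nat (t - (1 - int p))"] show ?thesis using assms by simp
qed

lemma eps_measurable[measurable]: "1 \<le> i \<Longrightarrow> eps i \<in> borel_measurable M"
  using innovations_density[of i] by (auto simp: distributed_def)

lemma Lg_measurable[measurable]: assumes "1 \<le> i" shows "Lg i \<in> measurable M LS"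
  unfolding Lg_def lag_def[abs_def]
  by (rule measurable_restrict) (use assms in \<open>auto intro!: X_measurable\<close>)

lemma X_eq: "1 \<le> i \<Longrightarrow> \<omega> \<in> space M \<Longrightarrow> X (int i) \<omega> = r \<theta> (Lg i \<omega>) + eps i \<omega>"
  using recursion by (simp add: Lg_def)

lemma f_measurable[measurable]: "f \<in> borel_measurable borel"
  using distributed_real_measurable[OF _ innovations_density[of 1]] density_pos
  by (simp add: less_imp_le)

lemma f_nonneg: "0 \<le> f y" using density_pos[of y] by simp

lemma distr_eps: "1 \<le> i \<Longrightarrow> distr M borel (eps i) = F"
proof -
  assume "1 \<le> i"
  from distributed_distr_eq_density[OF innovations_density[OF this]]
  have "distr M lborel (eps i) = F" by (simp add: F_def)
  moreover have "distr M borel (eps i) = distr M lborel (eps i)" by (rule distr_cong) auto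
  ultimately show ?thesis by simp
qed

lemma sets_F[measurable_cong, simp]: "sets F = sets borel" and space_F[simp]: "space F = UNIV" by (auto simp: F_def)

lemma prob_space_F: "prob_space F"
  using prob_space_distr[of "eps 1" borel] distr_eps[of 1] by simp

sublocale F: prob_space F by (rule prob_space_F)

lemma nn_integral_F: "g \<in> borel_measurable borel \<Longrightarrow> (\<integral>\<^sup>+e. g e \<partial>F) = (\<integral>\<^sup>+y. ennreal (f y) * g y \<partial>lborel)"
  unfolding F_def by (rule nn_integral_density) auto

lemma integral_F: fixes g :: "real \<Rightarrow> real" shows "g \<in> borel_measurable borel \<Longrightarrow> (\<integral>e. g e \<partial>F) = (\<integral>y. g y * f y \<partial>lborel)"
  unfolding F_def by (subst integral_density) (auto simp: f_nonneg mult.commute)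

lemma integrable_F: fixes g :: "real \<Rightarrow> real" shows "g \<in> borel_measurable borel \<Longrightarrow> integrable F g \<longleftrightarrow> integrable lborel (\<lambda>y. g y * f y)"
  unfolding F_def by (subst integrable_density) (auto simp: f_nonneg mult.commute)

lemma nn_integral_eps:
  assumes "1 \<le> i" and [measurable]: "g \<in> borel_measurable borel"
  shows "(\<integral>\<^sup>+\<omega>. g (eps i \<omega>) \<partial>M) = (\<integral>\<^sup>+e. g e \<partial>F)"
  using nn_integral_distr[of "eps i" M borel g] assms by (simp add: distr_eps)

text \<open>A concrete substitute for the sigma-algebra of the past: the starting lag vector and the
  innovations before time \<open>j\<close>. Conditioning on the past becomes integration over a
  product space.\<close>

definition hist :: "nat \<Rightarrow> 'a \<Rightarrow> (nat \<Rightarrow> real) \<times> (nat \<Rightarrow> real)" where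
  "hist j \<omega> = (lag p X 0 \<omega>, \<lambda>i\<in>{1..<j}. eps i \<omega>)"

abbreviation "HS j \<equiv> LS \<Otimes>\<^sub>M (\<Pi>\<^sub>M i\<in>{1..<j}. (borel :: real measure))"

lemma lag0: "lag p X 0 = Lg 1" by (simp add: Lg_def)

lemma hist_measurable[measurable]: "hist j \<in> measurable M (HS j)"
  unfolding hist_def[abs_def] lag0
  by (intro measurable_Pair Lg_measurable measurable_restrict eps_measurable) auto

lemma eps_hist: "1 \<le> i \<Longrightarrow> i < j \<Longrightarrow> eps i \<omega> = snd (hist j \<omega>) i"
  by (simp add: hist_def)

text \<open>Induction along the recursion: times up to 0 are coordinates of the starting vector; a
  later observation is the regression function at earlier ones plus an innovation that precedes time
  \<open>j\<close>.\<close>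

lemma X_hist:
  assumes "1 - int p \<le> t" "t < int j"
  shows "\<exists>\<xi>\<in>borel_measurable (HS j). \<forall>\<omega>\<in>space M. X t \<omega> = \<xi> (hist j \<omega>)"
  using assms
proof (induction "nat (t + int p)" arbitrary: t rule: less_induct)
  case less
  show ?case
  proof (cases "t \<le> 0")
    case True
    \<comment> \<open>Component \<open>q\<close> of the starting vector is the observation at time q
      - p.\<close>
    define q where "q = nat (t + int p)"
    have q: "q \<in> {1..p}" "t = int q - int p" using True less.prems by (auto simp: q_def)
    show ?thesis
    proof (intro bexI[of _ "\<lambda>h. fst h q"] ballI)
      show "X t \<omega> = fst (hist j \<omega>) q" for \<omega> using q by (simp add: hist_def lag_def)
      show "(\<lambda>h. fst h q) \<in> borel_measurable (HS j)"
        using q(1) by (intro measurable_compose[OF measurable_fst measurable_component_singleton]) auto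
    qed
  next
    case False
    define i where "i = nat t"
    have i: "1 \<le> i" "t = int i" "i < j" using False less.prems by (auto simp: i_def)
    have "\<exists>\<xi>\<in>borel_measurable (HS j). \<forall>\<omega>\<in>space M. X (t - 1 - int p + int q) \<omega> = \<xi> (hist j \<omega>)" if "q \<in> {1..p}" for q
      using that less.prems False by (intro less.hyps) auto
    then obtain \<xi> where \<xi>: "\<And>q. q \<in> {1..p} \<Longrightarrow> \<xi> q \<in> borel_measurable (HS j)"
       "\<And>q \<omega>. q \<in> {1..p} \<Longrightarrow> \<omega> \<in> space M \<Longrightarrow> X (t - 1 - int p + int q) \<omega> = \<xi> q (hist j \<omega>)" by metis
    have L: "Lg i \<omega> = (\<lambda>q\<in>{1..p}. \<xi> q (hist j \<omega>))" if "\<omega> \<in> space M" for \<omega>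
      unfolding Lg_def lag_def using \<xi>(2)[OF _ that] i by (intro restrict_ext) auto
    have m: "(\<lambda>h. \<lambda>q\<in>{1..p}. \<xi> q h) \<in> measurable (HS j) LS" by (rule measurable_restrict) (rule \<xi>(1))
    show ?thesis
    proof (intro bexI[of _ "\<lambda>h. r \<theta> (\<lambda>q\<in>{1..p}. \<xi> q h) + snd h i"] ballI)
      show "X t \<omega> = r \<theta> (\<lambda>q\<in>{1..p}. \<xi> q (hist j \<omega>)) + snd (hist j \<omega>) i" if "\<omega> \<in> space M" for \<omega>
        using X_eq[OF i(1) that] L[OF that] i by (simp add: eps_hist)
      have "(\<lambda>h. snd h i) \<in> borel_measurable (HS j)"
        using i by (intro measurable_compose[OF measurable_snd measurable_component_singleton]) auto
      then show "(\<lambda>h. r \<theta> (\<lambda>q\<in>{1..p}. \<xi> q h) + snd h i) \<in> borel_measurable (HS j)"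
        by (intro borel_measurable_add measurable_compose[OF m regression_measurable])
    qed
  qed
qed

lemma Lg_hist:
  assumes "1 \<le> i" "i \<le> j"
  shows "\<exists>\<xi>\<in>measurable (HS j) LS. \<forall>\<omega>\<in>space M. Lg i \<omega> = \<xi> (hist j \<omega>)"
proof -
  have "\<exists>\<xi>\<in>borel_measurable (HS j). \<forall>\<omega>\<in>space M. X (int i - 1 - int p + int q) \<omega> = \<xi> (hist j \<omega>)" if "q \<in> {1..p}" for q
    using that assms by (intro X_hist) auto
  then obtain \<xi> where \<xi>: "\<And>q. q \<in> {1..p} \<Longrightarrow> \<xi> q \<in> borel_measurable (HS j)"
     "\<And>q \<omega>. q \<in> {1..p} \<Longrightarrow> \<omega> \<in> space M \<Longrightarrow> X (int i - 1 - int p + int q) \<omega> = \<xi> q (hist j \<omega>)" by metis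
  show ?thesis
  proof (intro bexI[of _ "\<lambda>h. \<lambda>q\<in>{1..p}. \<xi> q h"] ballI)
    show "(\<lambda>h. \<lambda>q\<in>{1..p}. \<xi> q h) \<in> measurable (HS j) LS" by (rule measurable_restrict) (rule \<xi>(1))
    show "Lg i \<omega> = (\<lambda>q\<in>{1..p}. \<xi> q (hist j \<omega>))" if "\<omega> \<in> space M" for \<omega>
      unfolding Lg_def lag_def using \<xi>(2)[OF _ that] by (intro restrict_ext) auto
  qed
qed

text \<open>Three independent blocks are involved: the starting vector, the innovations before
  \<open>j\<close>, and \<open>eps j\<close>. The two independence assumptions of the model
  factorise their joint law.\<close>

lemma distr_hist_eps:
  assumes j: "1 \<le> j"
  shows "distr M (HS j \<Otimes>\<^sub>M borel) (\<lambda>\<omega>. (hist j \<omega>, eps j \<omega>)) = distr M (HS j) (hist j) \<Otimes>\<^sub>M F"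
proof -
  let ?ES = "\<Pi>\<^sub>M i\<in>{1::nat..}. (borel :: real measure)"
  let ?US = "\<Pi>\<^sub>M i\<in>{1..<j}. (borel :: real measure)"
  define U where "U \<omega> = (\<lambda>i\<in>{1..<j}. eps i \<omega>)" for \<omega>
  have Um[measurable]: "U \<in> measurable M ?US" unfolding U_def by (intro measurable_restrict) auto
  have em[measurable]: "eps j \<in> borel_measurable M" using j by simp
  have lm[measurable]: "Lg 1 \<in> measurable M LS" by simp
  have i1: "indep_var ?US U (\<Pi>\<^sub>M i\<in>{j}. borel) (\<lambda>\<omega>. restrict (\<lambda>i. eps i \<omega>) {j})"
    unfolding U_def using j by (intro indep_var_restrict[OF innovations_indep]) auto
  \<comment> \<open>Reading both blocks off the whole innovation sequence makes the independence of
    that sequence from the starting vector apply to the pair.\<close>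
  define \<phi> where "\<phi> e = ((\<lambda>i\<in>{1..<j}. e i), e j)" for e :: "nat \<Rightarrow> real"
  have \<phi>m: "\<phi> \<in> measurable ?ES (?US \<Otimes>\<^sub>M borel)"
    unfolding \<phi>_def using j
    by (intro measurable_Pair measurable_restrict measurable_component_singleton) auto
  have \<phi>m': "(\<lambda>e. \<lambda>i\<in>{1..<j}. e i) \<in> measurable ?ES ?US"
    by (intro measurable_restrict measurable_component_singleton) auto
  have \<phi>e: "\<phi> (\<lambda>i\<in>{1..}. eps i \<omega>) = (U \<omega>, eps j \<omega>)" "(\<lambda>i\<in>{1..<j}. (\<lambda>i\<in>{1..}. eps i \<omega>) i) = U \<omega>" for \<omega>
    using j by (auto simp: fun_eq_iff \<phi>_def U_def restrict_def)
  define P0 where "P0 = distr M LS (Lg 1)"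
  define PU where "PU = distr M ?US U"
  interpret P0: prob_space P0 unfolding P0_def by (rule prob_space_distr) simp
  interpret PU: prob_space PU unfolding PU_def by (rule prob_space_distr) simp
  interpret PF: pair_prob_space PU F ..
  interpret P0U: pair_prob_space P0 PU ..
  interpret W: prob_space "distr M (HS j) (hist j)" by (rule prob_space_distr) simp
  have [measurable_cong]: "sets P0 = sets LS" "sets PU = sets ?US" by (simp_all add: P0_def PU_def)
  have d1: "distr M (?US \<Otimes>\<^sub>M borel) (\<lambda>\<omega>. (U \<omega>, eps j \<omega>)) = PU \<Otimes>\<^sub>M F"
    using distr_pair_indep_compose[OF i1, of "\<lambda>x. x" ?US "\<lambda>x. x j" borel] distr_eps[OF j] by (simp add: PU_def)
  have d2: "distr M (LS \<Otimes>\<^sub>M (?US \<Otimes>\<^sub>M borel)) (\<lambda>\<omega>. (Lg 1 \<omega>, (U \<omega>, eps j \<omega>))) = P0 \<Otimes>\<^sub>M (PU \<Otimes>\<^sub>M F)"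
    using distr_pair_indep_compose[OF innovations_indep_start _ \<phi>m, of "\<lambda>x. x" LS] d1
    by (simp add: P0_def \<phi>e lag0[symmetric])
  have d3: "distr M (HS j) (hist j) = P0 \<Otimes>\<^sub>M PU"
    using distr_pair_indep_compose[OF innovations_indep_start _ \<phi>m', of "\<lambda>x. x" LS]
    by (simp only: \<phi>e hist_def[abs_def] lag0 U_def[symmetric] P0_def PU_def) simp
  have hist_eq: "hist j \<omega> = (Lg 1 \<omega>, U \<omega>)" for \<omega> by (simp add: hist_def lag0 U_def)
  show ?thesis
  \<comment> \<open>The factorisation is available with the last two blocks grouped; testing on
    rectangles regroups it so that the first two form \<open>hist j\<close>.\<close>
  proof (rule pair_measure_eqI[symmetric])
    show "sigma_finite_measure (distr M (HS j) (hist j))" ..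
    show "sigma_finite_measure F" ..
    show "sets (distr M (HS j) (hist j) \<Otimes>\<^sub>M F) = sets (distr M (HS j \<Otimes>\<^sub>M borel) (\<lambda>\<omega>. (hist j \<omega>, eps j \<omega>)))"
      by (simp cong: sets_pair_measure_cong)
    fix A B assume AB: "A \<in> sets (distr M (HS j) (hist j))" "B \<in> sets F"
    have A[measurable]: "A \<in> sets (HS j)" and B[measurable]: "B \<in> sets borel" using AB by auto
    have "emeasure (distr M (HS j \<Otimes>\<^sub>M borel) (\<lambda>\<omega>. (hist j \<omega>, eps j \<omega>))) (A \<times> B)
      = (\<integral>\<^sup>+z. indicator (A \<times> B) z \<partial>distr M (HS j \<Otimes>\<^sub>M borel) (\<lambda>\<omega>. (hist j \<omega>, eps j \<omega>)))"
      by (rule nn_integral_indicator[symmetric]) simp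
    also have "\<dots> = (\<integral>\<^sup>+\<omega>. indicator A (Lg 1 \<omega>, U \<omega>) * indicator B (eps j \<omega>) \<partial>M)"
      by (subst nn_integral_distr) (auto intro!: nn_integral_cong simp: hist_eq indicator_def)
    also have "\<dots> = (\<integral>\<^sup>+z. indicator A (fst z, fst (snd z)) * indicator B (snd (snd z)) \<partial>distr M (LS \<Otimes>\<^sub>M (?US \<Otimes>\<^sub>M borel)) (\<lambda>\<omega>. (Lg 1 \<omega>, (U \<omega>, eps j \<omega>))))"
      by (subst nn_integral_distr) auto
    also have "\<dots> = (\<integral>\<^sup>+x. \<integral>\<^sup>+v. indicator A (x, fst v) * indicator B (snd v) \<partial>(PU \<Otimes>\<^sub>M F) \<partial>P0)" (is "_ = (\<integral>\<^sup>+x. ?J x \<partial>P0)")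
      unfolding d2 by (subst PF.nn_integral_fst[symmetric]) auto
    also have "\<dots> = (\<integral>\<^sup>+x. (\<integral>\<^sup>+u. indicator A (x, u) \<partial>PU) * emeasure F B \<partial>P0)"
    proof (rule nn_integral_cong)
      fix x assume "x \<in> space P0"
      then have x: "x \<in> space LS" by (simp add: P0_def)
      have Ax[measurable]: "(\<lambda>u. indicator A (x, u) :: ennreal) \<in> borel_measurable PU"
        using measurable_compose[OF measurable_Pair1'[OF x, of ?US] borel_measurable_indicator[OF A]]
        unfolding PU_def measurable_distr_eq1 .
      have "?J x = (\<integral>\<^sup>+u. \<integral>\<^sup>+e. indicator A (x, u) * indicator B e \<partial>F \<partial>PU)"
        by (subst F.nn_integral_fst[symmetric]) (auto intro!: borel_measurable_times measurable_compose[OF measurable_fst Ax])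
      also have "\<dots> = (\<integral>\<^sup>+u. indicator A (x, u) * emeasure F B \<partial>PU)"
        by (intro nn_integral_cong) (simp add: nn_integral_cmult)
      also have "\<dots> = (\<integral>\<^sup>+u. indicator A (x, u) \<partial>PU) * emeasure F B" by (rule nn_integral_multc) simp
      finally show "?J x = (\<integral>\<^sup>+u. indicator A (x, u) \<partial>PU) * emeasure F B" .
    qed
    also have "\<dots> = (\<integral>\<^sup>+x. \<integral>\<^sup>+u. indicator A (x, u) \<partial>PU \<partial>P0) * emeasure F B"
      by (rule nn_integral_multc) (rule PU.borel_measurable_nn_integral, simp)
    also have "(\<integral>\<^sup>+x. \<integral>\<^sup>+u. indicator A (x, u) \<partial>PU \<partial>P0) = emeasure (P0 \<Otimes>\<^sub>M PU) A"
      by (subst PU.nn_integral_fst) auto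
    finally show "emeasure (distr M (HS j) (hist j)) A * emeasure F B = emeasure (distr M (HS j \<Otimes>\<^sub>M borel) (\<lambda>\<omega>. (hist j \<omega>, eps j \<omega>))) (A \<times> B)"
      by (simp add: d3)
  qed
qed

text \<open>This plays the part of conditional expectation given the past: the inner integral over
  the innovation law, with the past held fixed.\<close>

lemma nn_integral_hist_eps:
  assumes j: "1 \<le> j" and [measurable]: "G \<in> borel_measurable (HS j \<Otimes>\<^sub>M borel)"
  shows "(\<integral>\<^sup>+\<omega>. G (hist j \<omega>, eps j \<omega>) \<partial>M) = (\<integral>\<^sup>+\<omega>. \<integral>\<^sup>+e. G (hist j \<omega>, e) \<partial>F \<partial>M)"
proof -
  have [measurable]: "eps j \<in> borel_measurable M" using j by simp
  have [measurable]: "G \<in> borel_measurable (distr M (HS j) (hist j) \<Otimes>\<^sub>M F)" by measurable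
  have "(\<integral>\<^sup>+\<omega>. G (hist j \<omega>, eps j \<omega>) \<partial>M) = (\<integral>\<^sup>+z. G z \<partial>(distr M (HS j) (hist j) \<Otimes>\<^sub>M F))"
    by (subst distr_hist_eps[OF j, symmetric], subst nn_integral_distr) auto
  also have "\<dots> = (\<integral>\<^sup>+h. \<integral>\<^sup>+e. G (h, e) \<partial>F \<partial>distr M (HS j) (hist j))"
    by (rule F.nn_integral_fst[symmetric]) simp
  also have "\<dots> = (\<integral>\<^sup>+\<omega>. \<integral>\<^sup>+e. G (hist j \<omega>, e) \<partial>F \<partial>M)"
    by (subst nn_integral_distr) auto
  finally show ?thesis .
qed

text \<open>For signed integrands Fubini requires integrability on the product, which the uniform
  bound supplies.\<close>

lemma integral_hist_eps:
  fixes G :: "_ \<Rightarrow> real"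
  assumes j: "1 \<le> j" and [measurable]: "G \<in> borel_measurable (HS j \<Otimes>\<^sub>M borel)" and bd: "\<And>z. \<bar>G z\<bar> \<le> B"
  shows "(\<integral>\<omega>. G (hist j \<omega>, eps j \<omega>) \<partial>M) = (\<integral>\<omega>. \<integral>e. G (hist j \<omega>, e) \<partial>F \<partial>M)"
proof -
  have [measurable]: "eps j \<in> borel_measurable M" using j by simp
  interpret W: prob_space "distr M (HS j) (hist j)" by (rule prob_space_distr) simp
  interpret WF: pair_prob_space "distr M (HS j) (hist j)" F ..
  have [measurable]: "G \<in> borel_measurable (distr M (HS j) (hist j) \<Otimes>\<^sub>M F)" by measurable
  have int: "integrable (distr M (HS j) (hist j) \<Otimes>\<^sub>M F) G"
    by (rule WF.integrable_const_bound[where B=B]) (auto simp: bd)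
  have "(\<integral>\<omega>. G (hist j \<omega>, eps j \<omega>) \<partial>M) = (\<integral>z. G z \<partial>(distr M (HS j) (hist j) \<Otimes>\<^sub>M F))"
    by (subst distr_hist_eps[OF j, symmetric], subst integral_distr) auto
  also have "\<dots> = (\<integral>h. \<integral>e. G (h, e) \<partial>F \<partial>distr M (HS j) (hist j))"
    by (rule WF.integral_fst'[OF int, symmetric])
  also have "\<dots> = (\<integral>\<omega>. \<integral>e. G (hist j \<omega>, e) \<partial>F \<partial>M)"
  proof (rule integral_distr)
    show "(\<lambda>h. \<integral>e. G (h, e) \<partial>F) \<in> borel_measurable (HS j)"
      by (rule F.borel_measurable_lebesgue_integral) simp
  qed simp
  finally show ?thesis .
qed

lemma nn_integral_Lg_eps:
  assumes i: "1 \<le> i" and [measurable]: "G \<in> borel_measurable (LS \<Otimes>\<^sub>M borel)"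
  shows "(\<integral>\<^sup>+\<omega>. G (Lg i \<omega>, eps i \<omega>) \<partial>M) = (\<integral>\<^sup>+\<omega>. \<integral>\<^sup>+e. G (Lg i \<omega>, e) \<partial>F \<partial>M)"
proof -
  obtain \<xi> where \<xi>[measurable]: "\<xi> \<in> measurable (HS i) LS" and eq: "\<forall>\<omega>\<in>space M. Lg i \<omega> = \<xi> (hist i \<omega>)"
    using Lg_hist[OF i order.refl] by blast
  have "(\<integral>\<^sup>+\<omega>. G (Lg i \<omega>, eps i \<omega>) \<partial>M) = (\<integral>\<^sup>+\<omega>. (\<lambda>z. G (\<xi> (fst z), snd z)) (hist i \<omega>, eps i \<omega>) \<partial>M)"
    using eq by (intro nn_integral_cong) simp
  also have "\<dots> = (\<integral>\<^sup>+\<omega>. \<integral>\<^sup>+e. (\<lambda>z. G (\<xi> (fst z), snd z)) (hist i \<omega>, e) \<partial>F \<partial>M)"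
    by (rule nn_integral_hist_eps[OF i]) measurable
  also have "\<dots> = (\<integral>\<^sup>+\<omega>. \<integral>\<^sup>+e. G (Lg i \<omega>, e) \<partial>F \<partial>M)"
    using eq by (intro nn_integral_cong) simp
  finally show ?thesis .
qed

text \<open>At the later time everything except \<open>eps j\<close> is a function of
  \<open>hist j\<close>. The inner integral is therefore the first factor times the conditional mean
  of the second, which is zero.\<close>

lemma orthogonality:
  fixes A \<Psi> :: "(nat \<Rightarrow> real) \<times> real \<Rightarrow> real"
  assumes ij: "1 \<le> i" "i < j" and [measurable]: "A \<in> borel_measurable (LS \<Otimes>\<^sub>M borel)" "\<Psi> \<in> borel_measurable (LS \<Otimes>\<^sub>M borel)"
    and bd: "\<And>z. \<bar>A z\<bar> \<le> B" "\<And>z. \<bar>\<Psi> z\<bar> \<le> B" and zero: "\<And>x. x \<in> space LS \<Longrightarrow> (\<integral>e. \<Psi> (x, e) \<partial>F) = 0"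
  shows "(\<integral>\<omega>. A (Lg i \<omega>, eps i \<omega>) * \<Psi> (Lg j \<omega>, eps j \<omega>) \<partial>M) = 0"
proof -
  obtain \<xi> where \<xi>[measurable]: "\<xi> \<in> measurable (HS j) LS" and eqi: "\<forall>\<omega>\<in>space M. Lg i \<omega> = \<xi> (hist j \<omega>)"
    using Lg_hist[OF ij(1) less_imp_le[OF ij(2)]] by blast
  obtain \<zeta> where \<zeta>[measurable]: "\<zeta> \<in> measurable (HS j) LS" and eqj: "\<forall>\<omega>\<in>space M. Lg j \<omega> = \<zeta> (hist j \<omega>)"
    using Lg_hist[OF order.trans[OF ij(1) less_imp_le[OF ij(2)]] order.refl] by blast
  have si[measurable]: "(\<lambda>h. snd h i) \<in> borel_measurable (HS j)"
    using ij by (intro measurable_compose[OF measurable_snd measurable_component_singleton]) auto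
  let ?G = "\<lambda>z. A (\<xi> (fst z), snd (fst z) i) * \<Psi> (\<zeta> (fst z), snd z)"
  have "(\<lambda>z. snd (fst z) i) \<in> borel_measurable (HS j \<Otimes>\<^sub>M borel)"
    using measurable_compose[OF measurable_fst si] by simp
  then have Gm: "?G \<in> borel_measurable (HS j \<Otimes>\<^sub>M borel)" by measurable
  have "(\<integral>\<omega>. A (Lg i \<omega>, eps i \<omega>) * \<Psi> (Lg j \<omega>, eps j \<omega>) \<partial>M) = (\<integral>\<omega>. ?G (hist j \<omega>, eps j \<omega>) \<partial>M)"
    using eqi eqj ij by (intro Bochner_Integration.integral_cong) (auto simp: eps_hist)
  also have "\<dots> = (\<integral>\<omega>. \<integral>e. ?G (hist j \<omega>, e) \<partial>F \<partial>M)"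
  proof (rule integral_hist_eps[OF _ Gm, where B="B * B"])
    show "\<bar>?G z\<bar> \<le> B * B" for z
      unfolding abs_mult using bd(1)[of "(\<xi> (fst z), snd (fst z) i)"] by (intro mult_mono bd) auto
  qed (use ij in auto)
  also have "\<dots> = (\<integral>\<omega>. 0 \<partial>M)"
    using eqj measurable_space[OF Lg_measurable[of j]] ij
    by (intro Bochner_Integration.integral_cong) (auto intro!: zero simp del: eqj)
  finally show ?thesis by simp
qed

text \<open>Coordinate 0 of a path is the observation at time 1 - p, hence the offset by one: the
  first p coordinates of the path shifted by i form the lag vector of observation i + 1.\<close>

definition path_lag :: "(nat \<Rightarrow> real) \<Rightarrow> nat \<Rightarrow> real" where "path_lag y = (\<lambda>j\<in>{1..p}. y (j - 1))"

lemma path_lag_measurable[measurable]: "path_lag \<in> measurable (\<Pi>\<^sub>M k\<in>(UNIV::nat set). borel) LS"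
  unfolding path_lag_def by (intro measurable_restrict) auto

lemma Lg_path: "Lg (Suc i) \<omega> = path_lag (\<lambda>k. X (1 - int p + int (k + i)) \<omega>)"
  unfolding Lg_def lag_def path_lag_def by (intro restrict_ext) (auto intro!: arg_cong[where f="\<lambda>t. X t \<omega>"])

text \<open>The innovation is recovered from p + 1 consecutive observations, so every
  covariate-innovation pair is one fixed function of the shifted path. Stationarity and ergodicity
  of the observations thereby carry over to the pairs.\<close>

lemma eps_path: "\<omega> \<in> space M \<Longrightarrow> eps (Suc i) \<omega> = X (1 - int p + int (p + i)) \<omega> - r \<theta> (path_lag (\<lambda>k. X (1 - int p + int (k + i)) \<omega>))"
  using X_eq[of "Suc i" \<omega>] by (simp add: Lg_path add.commute)

lemma path_fun_measurable:
  assumes [measurable]: "G \<in> borel_measurable (LS \<Otimes>\<^sub>M borel)"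
  shows "(\<lambda>y. G (path_lag y, y p - r \<theta> (path_lag y))) \<in> borel_measurable (\<Pi>\<^sub>M k\<in>(UNIV::nat set). borel)"
proof -
  note regression_measurable[of \<theta>, measurable]
  show ?thesis by measurable
qed

lemma nn_integral_stationary:
  assumes i: "1 \<le> i" and G[measurable]: "G \<in> borel_measurable (LS \<Otimes>\<^sub>M borel)"
  shows "(\<integral>\<^sup>+\<omega>. G (Lg i \<omega>, eps i \<omega>) \<partial>M) = (\<integral>\<^sup>+\<omega>. G (Lg 1 \<omega>, eps 1 \<omega>) \<partial>M)"
proof -
  obtain q where q: "i = Suc q" using i by (cases i) auto
  define g where "g y = G (path_lag y, y p - r \<theta> (path_lag y))" for y
  have gm[measurable]: "g \<in> borel_measurable (\<Pi>\<^sub>M k\<in>(UNIV::nat set). borel)"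
    unfolding g_def by (rule path_fun_measurable) simp
  have Ym: "(\<lambda>\<omega> k. X (1 - int p + int (k + s)) \<omega>) \<in> measurable M (\<Pi>\<^sub>M k\<in>(UNIV::nat set). borel)" for s
    by (rule measurable_PiM_single') (auto intro: X_measurable)
  have eq: "(\<integral>\<^sup>+\<omega>. G (Lg (Suc s) \<omega>, eps (Suc s) \<omega>) \<partial>M) = (\<integral>\<^sup>+y. g y \<partial>distr M (\<Pi>\<^sub>M k\<in>UNIV. borel) (\<lambda>\<omega> k. X (1 - int p + int (k + s)) \<omega>))" for s
    by (subst nn_integral_distr[OF Ym]) (auto intro!: nn_integral_cong simp: g_def eps_path Lg_path)
  show ?thesis
    using stationary eq[of q] eq[of 0] unfolding q stationary_def by (simp flip: One_nat_def)
qed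

lemma average_converges:
  assumes G[measurable]: "G \<in> borel_measurable (LS \<Otimes>\<^sub>M borel)"
    and int: "integrable M (\<lambda>\<omega>. G (Lg 1 \<omega>, eps 1 \<omega>))" and "\<delta> > 0" "e > 0"
  shows "mostly M e (\<lambda>n \<omega>. \<bar>(\<Sum>i=1..n. G (Lg i \<omega>, eps i \<omega>)) / real n - (\<integral>\<omega>. G (Lg 1 \<omega>, eps 1 \<omega>) \<partial>M)\<bar> \<le> \<delta>)"
proof (rule mostly_AE_tendsto)
  show "prob_space M" by (rule prob_space_axioms)
  define g where "g y = G (path_lag y, y p - r \<theta> (path_lag y))" for y
  have gm[measurable]: "g \<in> borel_measurable (\<Pi>\<^sub>M k\<in>(UNIV::nat set). borel)"
    unfolding g_def by (rule path_fun_measurable) simp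
  let ?Y = "\<lambda>k. X (1 - int p + int k)"
  have g_eq: "\<omega> \<in> space M \<Longrightarrow> G (Lg (Suc i) \<omega>, eps (Suc i) \<omega>) = g (\<lambda>k. ?Y (k + i) \<omega>)" for i \<omega>
    by (simp add: g_def eps_path Lg_path)
  have g_eq1: "\<omega> \<in> space M \<Longrightarrow> G (Lg 1 \<omega>, eps 1 \<omega>) = g (\<lambda>k. ?Y k \<omega>)" for \<omega>
    using g_eq[of \<omega> 0] by (simp flip: One_nat_def)
  have int': "integrable M (\<lambda>\<omega>. g (\<lambda>k. ?Y k \<omega>))"
    using int by (subst (asm) Bochner_Integration.integrable_cong[OF refl g_eq1]) auto
  have I: "(\<integral>\<omega>. g (\<lambda>k. ?Y k \<omega>) \<partial>M) = (\<integral>\<omega>. G (Lg 1 \<omega>, eps 1 \<omega>) \<partial>M)"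
    by (intro Bochner_Integration.integral_cong refl g_eq1[symmetric])
  have "AE \<omega> in M. (\<lambda>n. (\<Sum>i<n. g (\<lambda>k. ?Y (k + i) \<omega>)) / real n) \<longlonglongrightarrow> (\<integral>\<omega>. G (Lg 1 \<omega>, eps 1 \<omega>) \<partial>M)"
    using stationary_ergodic_average[OF prob_space_axioms stationary ergodic gm int'] I by simp
  then show "AE \<omega> in M. (\<lambda>n. (\<Sum>i=1..n. G (Lg i \<omega>, eps i \<omega>)) / real n) \<longlonglongrightarrow> (\<integral>\<omega>. G (Lg 1 \<omega>, eps 1 \<omega>) \<partial>M)"
  proof (rule AE_mp, intro AE_I2 impI)
    fix \<omega> assume \<omega>: "\<omega> \<in> space M" and lim: "(\<lambda>n. (\<Sum>i<n. g (\<lambda>k. ?Y (k + i) \<omega>)) / real n) \<longlonglongrightarrow> (\<integral>\<omega>. G (Lg 1 \<omega>, eps 1 \<omega>) \<partial>M)"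
    have "(\<Sum>i<n. g (\<lambda>k. ?Y (k + i) \<omega>)) = (\<Sum>i=1..n. G (Lg i \<omega>, eps i \<omega>))" for n
      by (simp add: sum.atLeast1_atMost_eq One_nat_def g_eq[OF \<omega>])
    with lim show "(\<lambda>n. (\<Sum>i=1..n. G (Lg i \<omega>, eps i \<omega>)) / real n) \<longlonglongrightarrow> (\<integral>\<omega>. G (Lg 1 \<omega>, eps 1 \<omega>) \<partial>M)" by simp
  qed
  show "(\<lambda>\<omega>. (\<Sum>i=1..n. G (Lg i \<omega>, eps i \<omega>)) / real n) \<in> borel_measurable M" for n
    by (intro borel_measurable_divide borel_measurable_sum measurable_compose[OF _ G] measurable_Pair) auto
qed fact+

text \<open>Centred by the conditional mean given the covariate, the terms are martingale
  differences. Mixed products vanish by orthogonality, and by stationarity each of the n squares has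
  the same bound. Boundedness of \<open>\<Phi>\<close> makes all products integrable.\<close>

lemma martingale_second_moment:
  fixes \<Phi> :: "(nat \<Rightarrow> real) \<times> real \<Rightarrow> real"
  assumes [measurable]: "\<Phi> \<in> borel_measurable (LS \<Otimes>\<^sub>M borel)" and bd: "\<And>z. \<bar>\<Phi> z\<bar> \<le> B"
  shows "(\<integral>\<^sup>+\<omega>. ennreal ((\<Sum>i=1..n. \<Phi> (Lg i \<omega>, eps i \<omega>) - (\<integral>e. \<Phi> (Lg i \<omega>, e) \<partial>F))\<^sup>2) \<partial>M)
    \<le> of_nat n * (\<integral>\<^sup>+\<omega>. ennreal ((\<Phi> (Lg 1 \<omega>, eps 1 \<omega>))\<^sup>2) \<partial>M)"
proof -
  define c where "c x = (\<integral>e. \<Phi> (x, e) \<partial>F)" for x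
  define \<Psi> where "\<Psi> z = \<Phi> z - c (fst z)" for z
  have \<Phi>F[measurable]: "\<Phi> \<in> borel_measurable (LS \<Otimes>\<^sub>M F)" by measurable
  have cm[measurable]: "c \<in> borel_measurable LS"
    unfolding c_def by (rule F.borel_measurable_lebesgue_integral) simp
  have \<Psi>m[measurable]: "\<Psi> \<in> borel_measurable (LS \<Otimes>\<^sub>M borel)" unfolding \<Psi>_def by measurable
  have cb: "\<bar>c x\<bar> \<le> B" for x
  proof -
    have "\<bar>c x\<bar> \<le> (\<integral>e. B \<partial>F)"
    proof (cases "integrable F (\<lambda>e. \<Phi> (x, e))")
      case True
      have "\<bar>c x\<bar> \<le> (\<integral>e. \<bar>\<Phi> (x, e)\<bar> \<partial>F)" unfolding c_def by (rule integral_abs_bound)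
      also have "\<dots> \<le> (\<integral>e. B \<partial>F)" using True bd by (intro integral_mono) auto
      finally show ?thesis .
    next
      case False
      then show ?thesis using bd[of undefined] by (simp add: c_def not_integrable_integral_eq F.prob_space)
    qed
    then show ?thesis by (simp add: F.prob_space[unfolded space_F])
  qed
  have \<Psi>b: "\<bar>\<Psi> z\<bar> \<le> 2 * B" for z using bd[of z] cb[of "fst z"] unfolding \<Psi>_def by linarith
  have xm: "(\<lambda>e. \<Phi> (x, e)) \<in> borel_measurable F" if "x \<in> space LS" for x
    using measurable_Pair2[OF \<Phi>F that] by simp
  have xint: "integrable F (\<lambda>e. \<Phi> (x, e))" if "x \<in> space LS" for x
    by (rule F.integrable_const_bound[where B=B]) (auto simp: bd xm[OF that])
  have zero: "(\<integral>e. \<Psi> (x, e) \<partial>F) = 0" if "x \<in> space LS" for x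
    using xint[OF that] by (simp add: \<Psi>_def c_def F.prob_space[unfolded space_F])
  define Z where "Z i \<omega> = \<Psi> (Lg i \<omega>, eps i \<omega>)" for i \<omega>
  have Zm[measurable]: "1 \<le> i \<Longrightarrow> Z i \<in> borel_measurable M" for i
    unfolding Z_def by (intro measurable_compose[OF _ \<Psi>m] measurable_Pair) auto
  have Zb: "\<bar>Z i \<omega>\<bar> \<le> 2 * B" for i \<omega> unfolding Z_def by (rule \<Psi>b)
  have B0: "B \<ge> 0" using bd[of undefined] by linarith
  have ZZint: "integrable M (\<lambda>\<omega>. Z i \<omega> * Z j \<omega>)" if "1 \<le> i" "1 \<le> j" for i j
  proof (rule integrable_const_bound[where B="(2 * B) * (2 * B)"])
    have "norm (Z i \<omega> * Z j \<omega>) \<le> (2 * B) * (2 * B)" for \<omega>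
      unfolding real_norm_def abs_mult using B0 by (intro mult_mono Zb) auto
    then show "AE \<omega> in M. norm (Z i \<omega> * Z j \<omega>) \<le> (2 * B) * (2 * B)" by simp
  qed (use that in measurable)
  have orth: "(\<integral>\<omega>. Z i \<omega> * Z j \<omega> \<partial>M) = 0" if "1 \<le> i" "1 \<le> j" "i \<noteq> j" for i j
  proof (cases "i < j")
    case True
    then show ?thesis unfolding Z_def using that by (intro orthogonality[OF _ _ _ _ \<Psi>b \<Psi>b zero]) auto
  next
    case False
    then have "(\<integral>\<omega>. Z j \<omega> * Z i \<omega> \<partial>M) = 0"
      unfolding Z_def using that by (intro orthogonality[OF _ _ _ _ \<Psi>b \<Psi>b zero]) auto
    then show ?thesis by (simp add: mult.commute)
  qed
  have diag: "(\<integral>\<^sup>+\<omega>. ennreal (Z i \<omega> * Z i \<omega>) \<partial>M) \<le> (\<integral>\<^sup>+\<omega>. ennreal ((\<Phi> (Lg 1 \<omega>, eps 1 \<omega>))\<^sup>2) \<partial>M)" if i: "1 \<le> i" for i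
  proof -
    have "(\<integral>\<^sup>+\<omega>. ennreal (Z i \<omega> * Z i \<omega>) \<partial>M) = (\<integral>\<^sup>+\<omega>. \<integral>\<^sup>+e. ennreal ((\<Psi> (Lg i \<omega>, e))\<^sup>2) \<partial>F \<partial>M)"
      unfolding Z_def using nn_integral_Lg_eps[OF i, of "\<lambda>z. ennreal ((\<Psi> z)\<^sup>2)"] by (simp add: power2_eq_square)
    \<comment> \<open>For a fixed covariate this says that a variance under the innovation law is at
      most the second moment.\<close>
    also have "\<dots> \<le> (\<integral>\<^sup>+\<omega>. \<integral>\<^sup>+e. ennreal ((\<Phi> (Lg i \<omega>, e))\<^sup>2) \<partial>F \<partial>M)"
    proof (rule nn_integral_mono)
      fix \<omega> assume "\<omega> \<in> space M"
      define x where "x = Lg i \<omega>"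
      have x: "x \<in> space LS" unfolding x_def using measurable_space[OF Lg_measurable[OF i] \<open>\<omega> \<in> space M\<close>] .
      have i1: "integrable F (\<lambda>e. (\<Phi> (x, e))\<^sup>2)"
      proof (rule F.integrable_const_bound[where B="B\<^sup>2"])
        have "norm ((\<Phi> (x, e))\<^sup>2) \<le> B\<^sup>2" for e
          using power_mono[OF bd abs_ge_zero, of "(x, e)" 2] by simp
        then show "AE e in F. norm ((\<Phi> (x, e))\<^sup>2) \<le> B\<^sup>2" by simp
      qed (use xm[OF x] in measurable)
      have i2: "integrable F (\<lambda>e. (\<Psi> (x, e))\<^sup>2)"
      proof (rule F.integrable_const_bound[where B="(2 * B)\<^sup>2"])
        have "norm ((\<Psi> (x, e))\<^sup>2) \<le> (2 * B)\<^sup>2" for e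
          using power_mono[OF \<Psi>b abs_ge_zero, of "(x, e)" 2] by simp
        then show "AE e in F. norm ((\<Psi> (x, e))\<^sup>2) \<le> (2 * B)\<^sup>2" by simp
        show "(\<lambda>e. (\<Psi> (x, e))\<^sup>2) \<in> borel_measurable F" unfolding \<Psi>_def using xm[OF x] by simp
      qed
      have "(\<integral>e. (\<Psi> (x, e))\<^sup>2 \<partial>F) = (\<integral>e. (\<Phi> (x, e))\<^sup>2 \<partial>F) - (c x)\<^sup>2"
        using F.variance_eq[OF xint[OF x] i1] by (simp add: \<Psi>_def c_def)
      then have "(\<integral>e. (\<Psi> (x, e))\<^sup>2 \<partial>F) \<le> (\<integral>e. (\<Phi> (x, e))\<^sup>2 \<partial>F)" by simp
      then show "(\<integral>\<^sup>+e. ennreal ((\<Psi> (Lg i \<omega>, e))\<^sup>2) \<partial>F) \<le> (\<integral>\<^sup>+e. ennreal ((\<Phi> (Lg i \<omega>, e))\<^sup>2) \<partial>F)"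
        using i1 i2 unfolding x_def by (simp add: nn_integral_eq_integral ennreal_leI)
    qed
    also have "\<dots> = (\<integral>\<^sup>+\<omega>. ennreal ((\<Phi> (Lg i \<omega>, eps i \<omega>))\<^sup>2) \<partial>M)"
      using nn_integral_Lg_eps[OF i, of "\<lambda>z. ennreal ((\<Phi> z)\<^sup>2)"] by simp
    also have "\<dots> = (\<integral>\<^sup>+\<omega>. ennreal ((\<Phi> (Lg 1 \<omega>, eps 1 \<omega>))\<^sup>2) \<partial>M)"
      using nn_integral_stationary[OF i, of "\<lambda>z. ennreal ((\<Phi> z)\<^sup>2)"] by simp
    finally show ?thesis .
  qed
  have sq: "(\<Sum>i=1..n. Z i \<omega>)\<^sup>2 = (\<Sum>i=1..n. \<Sum>j=1..n. Z i \<omega> * Z j \<omega>)" for \<omega>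
    by (simp add: power2_eq_square sum_product)
  have "(\<integral>\<^sup>+\<omega>. ennreal ((\<Sum>i=1..n. Z i \<omega>)\<^sup>2) \<partial>M) = ennreal (\<integral>\<omega>. (\<Sum>i=1..n. Z i \<omega>)\<^sup>2 \<partial>M)"
  proof (rule nn_integral_eq_integral)
    show "integrable M (\<lambda>\<omega>. (\<Sum>i=1..n. Z i \<omega>)\<^sup>2)"
      unfolding sq by (auto intro!: Bochner_Integration.integrable_sum ZZint)
  qed simp
  also have "(\<integral>\<omega>. (\<Sum>i=1..n. Z i \<omega>)\<^sup>2 \<partial>M) = (\<Sum>i=1..n. \<Sum>j=1..n. (\<integral>\<omega>. Z i \<omega> * Z j \<omega> \<partial>M))"
    unfolding sq by (subst Bochner_Integration.integral_sum) (auto intro!: Bochner_Integration.integrable_sum ZZint sum.cong Bochner_Integration.integral_sum)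
  also have "\<dots> = (\<Sum>i=1..n. \<Sum>j=1..n. if i = j then (\<integral>\<omega>. Z i \<omega> * Z i \<omega> \<partial>M) else 0)"
    by (intro sum.cong refl) (auto simp: orth)
  also have "\<dots> = (\<Sum>i=1..n. (\<integral>\<omega>. Z i \<omega> * Z i \<omega> \<partial>M))" by (intro sum.cong refl) simp
  also have "ennreal \<dots> = (\<Sum>i=1..n. \<integral>\<^sup>+\<omega>. ennreal (Z i \<omega> * Z i \<omega>) \<partial>M)"
  proof -
    have "(\<Sum>i=1..n. \<integral>\<^sup>+\<omega>. ennreal (Z i \<omega> * Z i \<omega>) \<partial>M) = (\<Sum>i=1..n. ennreal (\<integral>\<omega>. Z i \<omega> * Z i \<omega> \<partial>M))"
      by (intro sum.cong refl nn_integral_eq_integral ZZint) auto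
    also have "\<dots> = ennreal (\<Sum>i=1..n. (\<integral>\<omega>. Z i \<omega> * Z i \<omega> \<partial>M))" by (rule sum_ennreal) simp
    finally show ?thesis by simp
  qed
  also have "\<dots> \<le> (\<Sum>i=1..n. (\<integral>\<^sup>+\<omega>. ennreal ((\<Phi> (Lg 1 \<omega>, eps 1 \<omega>))\<^sup>2) \<partial>M))"
    by (intro sum_mono diag) auto
  finally show ?thesis by (simp add: Z_def \<Psi>_def c_def)
qed

text \<open>Tonelli brings the bound for each fixed \<open>y\<close> under the weighted integral; n
  terms against the factor n^(-2) leave 1/n.\<close>

lemma martingale_weighted:
  fixes \<Phi> :: "real \<Rightarrow> (nat \<Rightarrow> real) \<times> real \<Rightarrow> real" and w :: "real \<Rightarrow> real"
  assumes m[measurable]: "case_prod \<Phi> \<in> borel_measurable (borel \<Otimes>\<^sub>M (LS \<Otimes>\<^sub>M borel))"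
    and bd: "\<And>y z. \<bar>\<Phi> y z\<bar> \<le> B"
    and w[measurable]: "w \<in> borel_measurable borel" and wnn: "\<And>y. 0 \<le> w y" and n: "n \<ge> 1"
  defines "G \<equiv> \<lambda>n \<omega> y. (\<Sum>i=1..n. \<Phi> y (Lg i \<omega>, eps i \<omega>) - (\<integral>e. \<Phi> y (Lg i \<omega>, e) \<partial>F)) / real n"
  shows "case_prod (G n) \<in> borel_measurable (M \<Otimes>\<^sub>M borel)"
    and "(\<integral>\<^sup>+\<omega>. \<integral>\<^sup>+y. ennreal (w y * (G n \<omega> y)\<^sup>2) \<partial>lborel \<partial>M)
      \<le> ennreal (1 / real n) * (\<integral>\<^sup>+\<omega>. \<integral>\<^sup>+y. ennreal (w y * (\<Phi> y (Lg 1 \<omega>, eps 1 \<omega>))\<^sup>2) \<partial>lborel \<partial>M)"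
proof -
  interpret P: pair_sigma_finite M lborel ..
  have t1: "(\<lambda>x. \<Phi> (snd x) (Lg i (fst x), eps i (fst x))) \<in> borel_measurable (M \<Otimes>\<^sub>M borel)" if "1 \<le> i" for i
  proof -
    have [measurable]: "Lg i \<in> measurable M LS" "eps i \<in> borel_measurable M" using that by auto
    have "(\<lambda>x. (snd x, (Lg i (fst x), eps i (fst x)))) \<in> measurable (M \<Otimes>\<^sub>M borel) (borel \<Otimes>\<^sub>M (LS \<Otimes>\<^sub>M borel))" by measurable
    from measurable_compose[OF this m] show ?thesis by simp
  qed
  have t2: "(\<lambda>x. \<integral>e. \<Phi> (snd x) (Lg i (fst x), e) \<partial>F) \<in> borel_measurable (M \<Otimes>\<^sub>M borel)" if "1 \<le> i" for i
  proof (rule F.borel_measurable_lebesgue_integral)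
    have [measurable]: "Lg i \<in> measurable M LS" using that by auto
    have "(\<lambda>x. (snd (fst x), (Lg i (fst (fst x)), snd x))) \<in> measurable ((M \<Otimes>\<^sub>M borel) \<Otimes>\<^sub>M F) (borel \<Otimes>\<^sub>M (LS \<Otimes>\<^sub>M borel))" by measurable
    from measurable_compose[OF this m] show "(\<lambda>(x, e). \<Phi> (snd x) (Lg i (fst x), e)) \<in> borel_measurable ((M \<Otimes>\<^sub>M borel) \<Otimes>\<^sub>M F)"
      by (simp add: case_prod_unfold)
  qed
  show Gm: "case_prod (G n) \<in> borel_measurable (M \<Otimes>\<^sub>M borel)"
    unfolding G_def case_prod_unfold
    by (intro borel_measurable_divide borel_measurable_sum borel_measurable_diff t1 t2) auto
  have Gm': "(\<lambda>x. G n (fst x) (snd x)) \<in> borel_measurable (M \<Otimes>\<^sub>M lborel)"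
    using Gm by (simp add: case_prod_unfold cong: measurable_cong_sets)
  have "(\<integral>\<^sup>+\<omega>. \<integral>\<^sup>+y. ennreal (w y * (G n \<omega> y)\<^sup>2) \<partial>lborel \<partial>M) = (\<integral>\<^sup>+y. \<integral>\<^sup>+\<omega>. ennreal (w y * (G n \<omega> y)\<^sup>2) \<partial>M \<partial>lborel)"
    by (rule P.Fubini'[symmetric]) (use Gm' in \<open>simp add: case_prod_unfold\<close>)
  also have "\<dots> \<le> (\<integral>\<^sup>+y. ennreal (1 / real n) * (\<integral>\<^sup>+\<omega>. ennreal (w y * (\<Phi> y (Lg 1 \<omega>, eps 1 \<omega>))\<^sup>2) \<partial>M) \<partial>lborel)"
  proof (rule nn_integral_mono)
    fix y :: real
    have \<Phi>y[measurable]: "\<Phi> y \<in> borel_measurable (LS \<Otimes>\<^sub>M borel)"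
      using measurable_compose[OF measurable_Pair1' m, of y] by simp
    have [measurable]: "Lg 1 \<in> measurable M LS" "eps 1 \<in> borel_measurable M" by auto
    have Gy: "(\<lambda>\<omega>. \<Sum>i=1..n. \<Phi> y (Lg i \<omega>, eps i \<omega>) - (\<integral>e. \<Phi> y (Lg i \<omega>, e) \<partial>F)) \<in> borel_measurable M"
      using measurable_compose[OF measurable_Pair2'[of y borel M] t1] measurable_compose[OF measurable_Pair2'[of y borel M] t2]
      by (intro borel_measurable_sum borel_measurable_diff) auto
    have "(\<integral>\<^sup>+\<omega>. ennreal (w y * (G n \<omega> y)\<^sup>2) \<partial>M)
       = ennreal (w y / (real n)\<^sup>2) * (\<integral>\<^sup>+\<omega>. ennreal ((\<Sum>i=1..n. \<Phi> y (Lg i \<omega>, eps i \<omega>) - (\<integral>e. \<Phi> y (Lg i \<omega>, e) \<partial>F))\<^sup>2) \<partial>M)"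
      using Gy wnn[of y] by (subst nn_integral_cmult[symmetric]) (auto intro!: nn_integral_cong simp: G_def power_divide ennreal_mult[symmetric])
    also have "\<dots> \<le> ennreal (w y / (real n)\<^sup>2) * (of_nat n * (\<integral>\<^sup>+\<omega>. ennreal ((\<Phi> y (Lg 1 \<omega>, eps 1 \<omega>))\<^sup>2) \<partial>M))"
      by (intro mult_left_mono martingale_second_moment[OF \<Phi>y bd]) simp
    also have "\<dots> = ennreal (w y / real n) * (\<integral>\<^sup>+\<omega>. ennreal ((\<Phi> y (Lg 1 \<omega>, eps 1 \<omega>))\<^sup>2) \<partial>M)"
    proof -
      have "ennreal (w y / (real n)\<^sup>2) * of_nat n = ennreal (w y / (real n)\<^sup>2) * ennreal (real n)" by (simp add: ennreal_of_nat_eq_real_of_nat)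
      also have "\<dots> = ennreal (w y / real n)" using n wnn[of y] by (simp add: ennreal_mult[symmetric] power2_eq_square)
      finally show ?thesis by (simp add: mult.assoc[symmetric])
    qed
    also have "\<dots> = ennreal (1 / real n) * (\<integral>\<^sup>+\<omega>. ennreal (w y * (\<Phi> y (Lg 1 \<omega>, eps 1 \<omega>))\<^sup>2) \<partial>M)"
    proof -
      have "(\<integral>\<^sup>+\<omega>. ennreal (w y * (\<Phi> y (Lg 1 \<omega>, eps 1 \<omega>))\<^sup>2) \<partial>M) = ennreal (w y) * (\<integral>\<^sup>+\<omega>. ennreal ((\<Phi> y (Lg 1 \<omega>, eps 1 \<omega>))\<^sup>2) \<partial>M)"
        using wnn[of y] by (simp add: ennreal_mult nn_integral_cmult)
      moreover have "ennreal (w y / real n) = ennreal (1 / real n) * ennreal (w y)"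
        using wnn[of y] by (subst ennreal_mult[symmetric]) auto
      ultimately show ?thesis by (simp add: mult.assoc)
    qed
    finally show "(\<integral>\<^sup>+\<omega>. ennreal (w y * (G n \<omega> y)\<^sup>2) \<partial>M) \<le> ennreal (1 / real n) * (\<integral>\<^sup>+\<omega>. ennreal (w y * (\<Phi> y (Lg 1 \<omega>, eps 1 \<omega>))\<^sup>2) \<partial>M)" .
  qed
  also have "\<dots> = ennreal (1 / real n) * (\<integral>\<^sup>+y. (\<integral>\<^sup>+\<omega>. ennreal (w y * (\<Phi> y (Lg 1 \<omega>, eps 1 \<omega>))\<^sup>2) \<partial>M) \<partial>lborel)"
  proof (rule nn_integral_cmult)
    have "(\<lambda>(y, \<omega>). ennreal (w y * (\<Phi> y (Lg 1 \<omega>, eps 1 \<omega>))\<^sup>2)) \<in> borel_measurable (lborel \<Otimes>\<^sub>M M)"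
      using measurable_compose[OF measurable_pair_swap' t1[of 1]] by (simp add: case_prod_unfold)
    then show "(\<lambda>y. \<integral>\<^sup>+\<omega>. ennreal (w y * (\<Phi> y (Lg 1 \<omega>, eps 1 \<omega>))\<^sup>2) \<partial>M) \<in> borel_measurable lborel"
      by (rule borel_measurable_nn_integral)
  qed
  also have "(\<integral>\<^sup>+y. (\<integral>\<^sup>+\<omega>. ennreal (w y * (\<Phi> y (Lg 1 \<omega>, eps 1 \<omega>))\<^sup>2) \<partial>M) \<partial>lborel)
     = (\<integral>\<^sup>+\<omega>. \<integral>\<^sup>+y. ennreal (w y * (\<Phi> y (Lg 1 \<omega>, eps 1 \<omega>))\<^sup>2) \<partial>lborel \<partial>M)"
    by (rule P.Fubini') (use t1[of 1] in \<open>simp add: case_prod_unfold cong: measurable_cong_sets\<close>)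
  finally show "(\<integral>\<^sup>+\<omega>. \<integral>\<^sup>+y. ennreal (w y * (G n \<omega> y)\<^sup>2) \<partial>lborel \<partial>M)
      \<le> ennreal (1 / real n) * (\<integral>\<^sup>+\<omega>. \<integral>\<^sup>+y. ennreal (w y * (\<Phi> y (Lg 1 \<omega>, eps 1 \<omega>))\<^sup>2) \<partial>lborel \<partial>M)" .
qed

end

section \<open>Kernels and their bias\<close>

text \<open>The first factor of the Cauchy-Schwarz bound \<open>nV_sq_le\<close>; \<alpha> > 1 is
  what makes it finite.\<close>

lemma nn_integral_decay:
  fixes \<alpha> :: real assumes "1 < \<alpha>"
  shows "(\<integral>\<^sup>+y. ennreal ((1 + \<bar>y\<bar>) powr (- \<alpha>)) \<partial>lborel) \<le> ennreal (2 / (\<alpha> - 1))"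
proof -
  let ?g = "\<lambda>y. ennreal ((1 + y) powr (- \<alpha>)) * indicator {0..} y"
  have "(\<integral>\<^sup>+y. ?g y \<partial>lborel) = ennreal (0 - (- ((1 + 0) powr (1 - \<alpha>)) / (\<alpha> - 1)))"
  proof (rule nn_integral_FTC_atLeast)
    show "((\<lambda>y. - ((1 + y) powr (1 - \<alpha>)) / (\<alpha> - 1)) has_real_derivative (1 + x) powr (- \<alpha>)) (at x)" if "0 \<le> x" for x
    proof -
      have "((\<lambda>y. (1 + y) powr (1 - \<alpha>)) has_real_derivative (1 - \<alpha>) * (1 + x) powr (- \<alpha>)) (at x)"
        using that by (auto intro!: derivative_eq_intros)
      from DERIV_cdivide[OF DERIV_minus[OF this], of "\<alpha> - 1"] show ?thesis
      proof (rule DERIV_cong)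
        have "- ((1 - \<alpha>) * z) / (\<alpha> - 1) = z" for z using assms by (simp add: divide_eq_eq algebra_simps)
        then show "- ((1 - \<alpha>) * (1 + x) powr (- \<alpha>)) / (\<alpha> - 1) = (1 + x) powr (- \<alpha>)" .
      qed
    qed
    have "((\<lambda>y::real. (1 + y) powr (1 - \<alpha>)) \<longlongrightarrow> 0) at_top"
      using assms by (intro tendsto_neg_powr filterlim_tendsto_add_at_top[OF tendsto_const filterlim_ident]) auto
    then have "((\<lambda>y::real. - ((1 + y) powr (1 - \<alpha>)) / (\<alpha> - 1)) \<longlongrightarrow> - 0 / (\<alpha> - 1)) at_top"
      using assms by (intro tendsto_intros) auto
    then show "((\<lambda>y. - ((1 + y) powr (1 - \<alpha>)) / (\<alpha> - 1)) \<longlongrightarrow> 0) at_top" by simp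
  qed (use assms in auto)
  then have 1: "(\<integral>\<^sup>+y. ?g y \<partial>lborel) = ennreal (1 / (\<alpha> - 1))" by simp
  have "(\<integral>\<^sup>+y. ennreal ((1 + \<bar>y\<bar>) powr (- \<alpha>)) \<partial>lborel) \<le> (\<integral>\<^sup>+y. ?g y + ?g (- y) \<partial>lborel)"
    by (intro nn_integral_mono) (auto simp: indicator_def)
  also have "\<dots> = (\<integral>\<^sup>+y. ?g y \<partial>lborel) + (\<integral>\<^sup>+y. ?g (- y) \<partial>lborel)" by (rule nn_integral_add) auto
  also have "(\<integral>\<^sup>+y. ?g (- y) \<partial>lborel) = (\<integral>\<^sup>+y. ?g y \<partial>lborel)"
    using nn_integral_real_affine[of ?g "-1" 0] by simp
  finally show ?thesis using assms by (simp add: 1 flip: ennreal_plus)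
qed

text \<open>An integral over a fixed interval is the shape to which Minkowski's inequality
  \<open>nV_integral\<close> applies.\<close>

lemma C1_increment:
  fixes \<phi> \<phi>' :: "real \<Rightarrow> real"
  assumes der: "\<And>x. (\<phi> has_real_derivative \<phi>' x) (at x)" and cont: "continuous_on UNIV \<phi>'"
  shows "\<phi> (x + a) - \<phi> x = (\<integral>u. indicator {0..1} u * (a * \<phi>' (x + u * a)) \<partial>lborel)"
proof -
  have "(\<integral>u. (a * \<phi>' (x + u * a)) * indicator {0..1} u \<partial>lborel) = \<phi> (x + 1 * a) - \<phi> (x + 0 * a)"
  proof (rule integral_FTC_Icc_real)
    show "((\<lambda>u. \<phi> (x + u * a)) has_real_derivative a * \<phi>' (x + u * a)) (at u)" for u
      by (rule DERIV_cong[OF DERIV_chain2[OF der]]) (auto intro!: derivative_eq_intros)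
    have "isCont \<phi>' z" for z using cont by (simp add: continuous_on_eq_continuous_at)
    then show "isCont (\<lambda>u. a * \<phi>' (x + u * a)) u" for u
      by (intro continuous_intros isCont_o2[where g=\<phi>' and f="\<lambda>u. x + u * a"]) auto
  qed simp
  then show ?thesis by (simp add: mult.commute)
qed

text \<open>After the substitution y = e - a + b v only |v| \<le> 1 counts, and there the argument
  of \<open>u\<close> differs from \<open>e\<close> by at most |a| + b \<le> 2. This is the origin
  of the shift range 2 in later comparisons of weights.\<close>

lemma nn_integral_local:
  fixes \<phi> u :: "real \<Rightarrow> real"
  assumes [measurable]: "\<phi> \<in> borel_measurable borel" "u \<in> borel_measurable borel"
    and supp: "\<And>v. \<bar>v\<bar> > 1 \<Longrightarrow> \<phi> v = 0" and u: "\<And>y. 0 \<le> u y" "\<And>y s. \<bar>s\<bar> \<le> 2 \<Longrightarrow> u (y + s) \<le> c * u y"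
    and b: "0 < b" "b \<le> 1" and a: "\<bar>a\<bar> \<le> 1"
  shows "(\<integral>\<^sup>+y. ennreal (u y * \<bar>\<phi> ((y - e + a) / b)\<bar>) \<partial>lborel) \<le> ennreal (c * u e * b) * (\<integral>\<^sup>+v. ennreal \<bar>\<phi> v\<bar> \<partial>lborel)"
proof -
  have cu: "0 \<le> c * u e" using u(2)[of 0 e] u(1)[of e] by simp
  have "(\<integral>\<^sup>+y. ennreal (u y * \<bar>\<phi> ((y - e + a) / b)\<bar>) \<partial>lborel)
     = ennreal b * (\<integral>\<^sup>+v. ennreal (u (e - a + b * v) * \<bar>\<phi> v\<bar>) \<partial>lborel)"
    using b by (subst nn_integral_real_affine[where c=b and t="e - a"]) auto
  also have "\<dots> \<le> ennreal b * (\<integral>\<^sup>+v. ennreal (c * u e) * ennreal \<bar>\<phi> v\<bar> \<partial>lborel)"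
  proof (intro mult_left_mono nn_integral_mono)
    fix v :: real
    show "ennreal (u (e - a + b * v) * \<bar>\<phi> v\<bar>) \<le> ennreal (c * u e) * ennreal \<bar>\<phi> v\<bar>"
    proof (cases "\<bar>v\<bar> \<le> 1")
      case True
      have "\<bar>b * v\<bar> \<le> 1" using True b by (simp add: abs_mult mult_le_one)
      then have "\<bar>- a + b * v\<bar> \<le> 2" using a by linarith
      from u(2)[OF this, of e] have "u (e - a + b * v) \<le> c * u e" by (simp add: algebra_simps)
      then have "u (e - a + b * v) * \<bar>\<phi> v\<bar> \<le> (c * u e) * \<bar>\<phi> v\<bar>" by (rule mult_right_mono) simp
      then show ?thesis
        using cu by (subst ennreal_mult[symmetric]) (auto intro!: ennreal_leI)
    qed (simp add: supp)
  qed simp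
  also have "\<dots> = ennreal (c * u e * b) * (\<integral>\<^sup>+v. ennreal \<bar>\<phi> v\<bar> \<partial>lborel)"
  proof -
    have "ennreal b * ennreal (c * u e) = ennreal (c * u e * b)"
      using b cu by (subst ennreal_mult[symmetric]) (auto simp: mult.commute)
    then show ?thesis by (simp add: nn_integral_cmult mult.assoc[symmetric])
  qed
  finally show ?thesis .
qed

text \<open>Model, weight and smoothing without an estimator: what is proved here concerns the
  sample alone or holds uniformly over deterministic shifts.\<close>

locale ar_kde = nonlinear_ar M p X eps r \<theta> f \<sigma> + weight V
  for M :: "'a measure" and p :: nat and X :: "int \<Rightarrow> 'a \<Rightarrow> real" and eps :: "nat \<Rightarrow> 'a \<Rightarrow> real"
    and r :: "real^'d \<Rightarrow> (nat \<Rightarrow> real) \<Rightarrow> real" and \<theta> :: "real^'d" and f :: "real \<Rightarrow> real" and \<sigma> :: real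
    and V :: "real \<Rightarrow> real" +
  fixes r_dot :: "real^'d \<Rightarrow> (nat \<Rightarrow> real) \<Rightarrow> real^'d" and f' l k :: "real \<Rightarrow> real" and \<alpha> :: real and b :: "nat \<Rightarrow> real"
  assumes f_ac: "abs_continuous_on UNIV f"
    and f'_measurable[measurable]: "f' \<in> borel_measurable borel"
    and f_deriv: "AE y in lborel. (f has_real_derivative f' y) (at y)"
    and l: "\<And>y. l y = - f' y / f y"
    and fisher: "integrable lborel (\<lambda>y. (l y)\<^sup>2 * f y)"
    and kernel: "kernel_C2 k"
    and b_pos: "\<And>n. 1 \<le> n \<Longrightarrow> 0 < b n"
    and b_upper: "(\<lambda>n. real n * b n ^ 4) \<longlonglongrightarrow> 0"
    and b_lower: "filterlim (\<lambda>n. real n * b n powr ((50 + 20 * real CARD('d)) / (14 + 5 * real CARD('d)))) at_top sequentially"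
    and r_gradient: "\<And>\<tau> x. x \<in> space (\<Pi>\<^sub>M j\<in>{1..p}. borel) \<Longrightarrow> GDERIV (\<lambda>t. r t x) \<tau> :> r_dot \<tau> x"
    and r_remainder: "\<And>C. bigO_prob M
          (\<lambda>n \<omega>. SUP \<tau>\<in>{\<tau>. norm (\<tau> - \<theta>) \<le> C * real n powr (-1/2)}.
             ennreal (\<Sum>i=1..n.
               (r \<tau> (lag p X (int i - 1) \<omega>) - r \<theta> (lag p X (int i - 1) \<omega>)
                 - r_dot \<theta> (lag p X (int i - 1) \<omega>) \<bullet> (\<tau> - \<theta>))\<^sup>2))
          (\<lambda>n. real n powr (-2/3))"
    and r_moment: "integrable M (\<lambda>\<omega>. norm (r_dot \<theta> (lag p X 0 \<omega>)) powr (5/2))"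
    and \<alpha>: "1 < \<alpha>"
    and V_moment: "integrable lborel (\<lambda>y. (1 + \<bar>y\<bar>) powr \<alpha> * (V y)\<^sup>2 * f y)"
begin

text \<open>The weight of the L2 norm that dominates \<open>nV\<close>. Its mean under the
  innovation law is the moment assumed finite.\<close>

definition w :: "real \<Rightarrow> real" where "w y = (1 + \<bar>y\<bar>) powr \<alpha> * (V y)\<^sup>2"

lemma w_measurable[measurable]: "w \<in> borel_measurable borel" unfolding w_def by measurable

lemma l_measurable[measurable]: "l \<in> borel_measurable borel"
proof -
  have "l = (\<lambda>y. - f' y / f y)" using l by (rule ext)
  then show ?thesis by simp
qed

lemma f'_eq: "f' y = - (l y * f y)" using density_pos[of y] by (simp add: l)

lemma V_sq_le_w: "(V y)\<^sup>2 \<le> w y" and absV_le_w: "(1 + \<bar>y\<bar>) * V y \<le> w y" and w_nonneg: "0 \<le> w y"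
proof -
  have p1: "1 + \<bar>y\<bar> \<le> (1 + \<bar>y\<bar>) powr \<alpha>" using powr_mono[of 1 \<alpha> "1 + \<bar>y\<bar>"] \<alpha> by simp
  have V2: "V y \<le> (V y)\<^sup>2" using V_ge_1[of y] by (simp add: power2_eq_square)
  have "1 * (V y)\<^sup>2 \<le> w y" unfolding w_def using p1 by (intro mult_right_mono) auto
  then show "(V y)\<^sup>2 \<le> w y" by simp
  show "(1 + \<bar>y\<bar>) * V y \<le> w y" unfolding w_def using p1 V2 V_nonneg[of y] by (intro mult_mono) auto
  show "0 \<le> w y" by (simp add: w_def)
qed

lemma w_F: "integrable F w"
  using V_moment by (subst integrable_F) (auto simp: w_def)

lemma F_mono: "integrable F g" if "integrable F h" "g \<in> borel_measurable borel" "\<And>y. \<bar>g y\<bar> \<le> h y" for g h :: "real \<Rightarrow> real"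
proof (rule Bochner_Integration.integrable_bound[OF that(1)])
  show "AE x in F. norm (g x) \<le> norm (h x)" using that(3) by (intro AE_I2) (auto intro: order_trans abs_ge_self)
qed (use that(2) in simp)

lemma absV_F: "integrable F (\<lambda>y. (1 + \<bar>y\<bar>) * V y)"
  by (rule F_mono[OF w_F]) (auto simp: abs_mult V_nonneg absV_le_w intro: order_trans)

lemma V_sq_F: "integrable F (\<lambda>y. (V y)\<^sup>2)"
  by (rule F_mono[OF w_F]) (auto simp: V_sq_le_w)

lemma V_F: "integrable F V"
proof (rule F_mono[OF absV_F])
  show "\<bar>V y\<bar> \<le> (1 + \<bar>y\<bar>) * V y" for y using V_nonneg[of y] by (simp add: distrib_right)
qed auto

lemma sq_F: "integrable F (\<lambda>y. y\<^sup>2)" and mean_F: "(\<integral>y. y \<partial>F) = 0" and var_F: "(\<integral>y. y\<^sup>2 \<partial>F) = \<sigma>\<^sup>2"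
proof -
  have m: "eps 1 \<in> borel_measurable M" by simp
  show "integrable F (\<lambda>y. y\<^sup>2)"
    using integrable_distr_eq[OF m, of "\<lambda>y. y\<^sup>2"] innovations_sq_integrable[of 1] by (simp add: distr_eps)
  show "(\<integral>y. y \<partial>F) = 0"
    using integral_distr[OF m, of "\<lambda>y. y"] innovations_mean[of 1] by (simp add: distr_eps)
  show "(\<integral>y. y\<^sup>2 \<partial>F) = \<sigma>\<^sup>2"
    using integral_distr[OF m, of "\<lambda>y. y\<^sup>2"] innovations_variance[of 1] innovations_mean[of 1] by (simp add: distr_eps)
qed

lemma id_F: "integrable F (\<lambda>y. y)"
proof (rule F_mono[OF absV_F])
  show "\<bar>y\<bar> \<le> (1 + \<bar>y\<bar>) * V y" for y
  proof -
    have "\<bar>y\<bar> * 1 \<le> (1 + \<bar>y\<bar>) * V y" using V_ge_1[of y] by (intro mult_mono) auto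
    then show ?thesis by simp
  qed
qed auto

text \<open>A law with a density is not concentrated at one point, so its variance may serve as a
  divisor.\<close>

lemma \<sigma>_pos: "0 < \<sigma>\<^sup>2"
proof (rule ccontr)
  assume "\<not> 0 < \<sigma>\<^sup>2"
  then have "\<sigma>\<^sup>2 = 0" by (simp add: not_less)
  then have "AE y in F. y\<^sup>2 = 0" using integral_nonneg_eq_0_iff_AE[OF sq_F] var_F by simp
  then have "AE y in lborel. ennreal (f y) > 0 \<longrightarrow> y = 0"
    unfolding F_def by (subst (asm) AE_density) auto
  then have "AE y in lborel. y = (0::real)" using density_pos by simp
  then have "emeasure lborel (UNIV - {0::real}) = 0"
    by (subst (asm) AE_iff_measurable[of "UNIV - {0}"]) auto
  moreover have "emeasure lborel {1..2::real} \<le> emeasure lborel (UNIV - {0::real})" by (intro emeasure_mono) auto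
  ultimately show False by simp
qed

lemma l_sq_F: "integrable F (\<lambda>y. (l y)\<^sup>2)" using fisher by (subst integrable_F) auto

lemma prod_F: "integrable F (\<lambda>y. g y * h y)" if "integrable F (\<lambda>y. (g y)\<^sup>2)" "integrable F (\<lambda>y. (h y)\<^sup>2)"
   "g \<in> borel_measurable borel" "h \<in> borel_measurable borel" for g h :: "real \<Rightarrow> real"
proof (rule F_mono[OF Bochner_Integration.integrable_add[OF that(1,2)]])
  show "\<bar>g y * h y\<bar> \<le> (g y)\<^sup>2 + (h y)\<^sup>2" for y
    using sum_squares_bound[of "\<bar>g y\<bar>" "\<bar>h y\<bar>"] mult_nonneg_nonneg[OF abs_ge_zero[of "g y"] abs_ge_zero[of "h y"]]
    unfolding abs_mult power2_abs by linarith
qed (use that in measurable)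

lemma Vl_F: "integrable F (\<lambda>y. V y * l y)" and yl_F: "integrable F (\<lambda>y. y * l y)" and l_F: "integrable F l"
proof -
  show "integrable F (\<lambda>y. V y * l y)" "integrable F (\<lambda>y. y * l y)"
    using prod_F[OF V_sq_F l_sq_F] prod_F[OF sq_F l_sq_F] by auto
  show "integrable F l" using prod_F[of "\<lambda>_. 1" l] l_sq_F by simp
qed

text \<open>Since f' is -l f, these are mixed moments of the score \<open>l\<close> with V, with the
  identity and with 1, all of which are square integrable under the innovation law.\<close>

lemma Vf'_integrable: "integrable lborel (\<lambda>y. V y * f' y)" and yf'_integrable: "integrable lborel (\<lambda>y. y * f' y)"
  and f'_integrable: "integrable lborel f'"
proof -
  have 1: "integrable lborel (\<lambda>y. (V y * l y) * f y)" using integrable_F[of "\<lambda>y. V y * l y"] Vl_F by simp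
  have 2: "integrable lborel (\<lambda>y. (y * l y) * f y)" using integrable_F[of "\<lambda>y. y * l y"] yl_F by simp
  have 3: "integrable lborel (\<lambda>y. l y * f y)" using integrable_F[of l] l_F by simp
  show "integrable lborel (\<lambda>y. V y * f' y)" "integrable lborel (\<lambda>y. y * f' y)" "integrable lborel f'"
    using Bochner_Integration.integrable_minus[OF 1] Bochner_Integration.integrable_minus[OF 2] Bochner_Integration.integrable_minus[OF 3]
    by (simp_all add: f'_eq[abs_def] mult.assoc)
qed

lemma f_integrable: "integrable lborel f" using integrable_F[of "\<lambda>_. 1"] by simp
lemma yf_integrable: "integrable lborel (\<lambda>y. y * f y)" by (rule iffD1[OF integrable_F]) (measurable, rule id_F)
lemma Vf_integrable: "integrable lborel (\<lambda>y. V y * f y)" using integrable_F[of V] V_F by simp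
lemma absVf_integrable: "integrable lborel (\<lambda>y. (1 + \<bar>y\<bar>) * V y * f y)" using integrable_F[of "\<lambda>y. (1 + \<bar>y\<bar>) * V y"] absV_F by simp

lemma integral_f: "(\<integral>y. f y \<partial>lborel) = 1"
  using integral_F[of "\<lambda>_. 1"] F.prob_space by simp

lemma integral_f': "(\<integral>y. f' y \<partial>lborel) = 0"
  using integral_by_parts_zero[OF f_ac f_deriv, of "\<lambda>_. 1" "\<lambda>_. 0"] f_integrable f'_integrable by simp

lemma integral_yf': "(\<integral>y. y * f' y \<partial>lborel) = -1"
proof -
  have "(\<integral>y. 1 * f y + y * f' y \<partial>lborel) = 0"
    by (rule integral_by_parts_zero[OF f_ac f_deriv]) (use f_integrable yf_integrable yf'_integrable in auto)
  then show ?thesis using integral_f f_integrable yf'_integrable by simp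
qed

lemma nVf': "nV f' < \<infinity>" using nV_finite_iff[of f'] Vf'_integrable by simp
lemma nVf: "nV f < \<infinity>" using nV_finite_iff[of f] Vf_integrable by simp

text \<open>One constant serves the three weights in use. The quotient of 1 + |y + s| and 1 + |y| is
  at most 3 for |s| \<le> 2, and V is controlled by \<open>V_shift\<close>.\<close>

lemma shift_const: "\<exists>c\<ge>1. (\<forall>y s. \<bar>s\<bar> \<le> 2 \<longrightarrow> V (y + s) \<le> c * V y) \<and> (\<forall>y s. \<bar>s\<bar> \<le> 2 \<longrightarrow> w (y + s) \<le> c * w y)
   \<and> (\<forall>y s. \<bar>s\<bar> \<le> 2 \<longrightarrow> (1 + \<bar>y + s\<bar>) * V (y + s) \<le> c * ((1 + \<bar>y\<bar>) * V y))"
proof -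
  obtain c where c: "c \<ge> 1" "\<And>y s. \<bar>s\<bar> \<le> 2 \<Longrightarrow> V (y + s) \<le> c * V y" using V_shift[of 2] by blast
  have p: "1 + \<bar>y + s\<bar> \<le> 3 * (1 + \<bar>y\<bar>)" if "\<bar>s\<bar> \<le> 2" for y s :: real
    using that abs_triangle_ineq[of y s] abs_ge_zero[of y] unfolding distrib_left by linarith
  have 1: "w (y + s) \<le> (3 powr \<alpha> * c\<^sup>2) * w y" if s: "\<bar>s\<bar> \<le> 2" for y s
  proof -
    have "(1 + \<bar>y + s\<bar>) powr \<alpha> \<le> (3 * (1 + \<bar>y\<bar>)) powr \<alpha>" using p[OF s] \<alpha> by (intro powr_mono2) auto
    also have "\<dots> = 3 powr \<alpha> * (1 + \<bar>y\<bar>) powr \<alpha>" by (rule powr_mult)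
    finally have "w (y + s) \<le> (3 powr \<alpha> * (1 + \<bar>y\<bar>) powr \<alpha>) * (c * V y)\<^sup>2"
      unfolding w_def using c(2)[OF s, of y] V_nonneg by (intro mult_mono power_mono) auto
    then show ?thesis by (simp add: w_def power_mult_distrib mult_ac)
  qed
  have 2: "(1 + \<bar>y + s\<bar>) * V (y + s) \<le> (3 * c) * ((1 + \<bar>y\<bar>) * V y)" if s: "\<bar>s\<bar> \<le> 2" for y s
  proof -
    have "(1 + \<bar>y + s\<bar>) * V (y + s) \<le> (3 * (1 + \<bar>y\<bar>)) * (c * V y)"
      using p[OF s] c(2)[OF s] V_nonneg by (intro mult_mono) auto
    then show ?thesis by (simp add: mult_ac)
  qed
  define c' where "c' = max (max c (3 powr \<alpha> * c\<^sup>2)) (3 * c)"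
  have "c' \<ge> 1" using c(1) by (simp add: c'_def)
  moreover have "V (y + s) \<le> c' * V y" if "\<bar>s\<bar> \<le> 2" for y s
    using order_trans[OF c(2)[OF that, of y] mult_right_mono[of c c' "V y"]] V_nonneg by (simp add: c'_def)
  moreover have "w (y + s) \<le> c' * w y" if "\<bar>s\<bar> \<le> 2" for y s
    using order_trans[OF 1[OF that, of y] mult_right_mono[of _ c' "w y"]] w_nonneg by (simp add: c'_def)
  moreover have "(1 + \<bar>y + s\<bar>) * V (y + s) \<le> c' * ((1 + \<bar>y\<bar>) * V y)" if "\<bar>s\<bar> \<le> 2" for y s
    using order_trans[OF 2[OF that, of y] mult_right_mono[of _ c' "(1 + \<bar>y\<bar>) * V y"]] V_nonneg by (simp add: c'_def)
  ultimately show ?thesis by blast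
qed

definition cs :: real where "cs = (SOME c. c \<ge> 1 \<and> (\<forall>y s. \<bar>s\<bar> \<le> 2 \<longrightarrow> V (y + s) \<le> c * V y) \<and> (\<forall>y s. \<bar>s\<bar> \<le> 2 \<longrightarrow> w (y + s) \<le> c * w y)
   \<and> (\<forall>y s. \<bar>s\<bar> \<le> 2 \<longrightarrow> (1 + \<bar>y + s\<bar>) * V (y + s) \<le> c * ((1 + \<bar>y\<bar>) * V y)))"

lemma cs: "cs \<ge> 1" "\<bar>s\<bar> \<le> 2 \<Longrightarrow> V (y + s) \<le> cs * V y" "\<bar>s\<bar> \<le> 2 \<Longrightarrow> w (y + s) \<le> cs * w y"
  "\<bar>s\<bar> \<le> 2 \<Longrightarrow> (1 + \<bar>y + s\<bar>) * V (y + s) \<le> cs * ((1 + \<bar>y\<bar>) * V y)"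
  using someI_ex[OF shift_const] unfolding cs_def by blast+

text \<open>Cauchy-Schwarz after splitting off (1 + |y|)^(-\<alpha>/2). The left side is the norm
  that the functionals see, the right side is what second moments of martingale sums
  control.\<close>

lemma nV_sq_le:
  assumes [measurable]: "g \<in> borel_measurable borel"
  shows "(nV g)\<^sup>2 \<le> ennreal (2 / (\<alpha> - 1)) * (\<integral>\<^sup>+y. ennreal (w y * (g y)\<^sup>2) \<partial>lborel)"
proof -
  define p1 where "p1 y = ennreal ((1 + \<bar>y\<bar>) powr (- \<alpha> / 2))" for y :: real
  define p2 where "p2 y = ennreal ((1 + \<bar>y\<bar>) powr (\<alpha> / 2) * (V y * \<bar>g y\<bar>))" for y :: real
  have [measurable]: "p1 \<in> borel_measurable lborel" "p2 \<in> borel_measurable lborel" unfolding p1_def p2_def by measurable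
  have pp: "p1 y * p2 y = ennreal (V y * \<bar>g y\<bar>)" for y
  proof -
    have "(1 + \<bar>y\<bar>) powr (- \<alpha> / 2) * (1 + \<bar>y\<bar>) powr (\<alpha> / 2) = 1" by (simp add: powr_add[symmetric])
    then show ?thesis unfolding p1_def p2_def by (subst ennreal_mult[symmetric]) (auto simp: V_nonneg mult.assoc[symmetric])
  qed
  have sq1: "(p1 y)\<^sup>2 = ennreal ((1 + \<bar>y\<bar>) powr (- \<alpha>))" for y
  proof -
    have "((1 + \<bar>y\<bar>) powr (- \<alpha> / 2))\<^sup>2 = (1 + \<bar>y\<bar>) powr (- \<alpha>)" by (simp add: power2_eq_square powr_add[symmetric])
    then show ?thesis by (simp add: p1_def ennreal_power)
  qed
  have sq2: "(p2 y)\<^sup>2 = ennreal (w y * (g y)\<^sup>2)" for y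
  proof -
    have "((1 + \<bar>y\<bar>) powr (\<alpha> / 2))\<^sup>2 = (1 + \<bar>y\<bar>) powr \<alpha>" by (simp add: power2_eq_square powr_add[symmetric])
    then show ?thesis by (simp add: p2_def w_def ennreal_power V_nonneg power_mult_distrib mult.assoc)
  qed
  have "(nV g)\<^sup>2 = (\<integral>\<^sup>+y. p1 y * p2 y \<partial>lborel)\<^sup>2" by (simp add: vnorm_def pp)
  also have "\<dots> \<le> (\<integral>\<^sup>+y. (p1 y)\<^sup>2 \<partial>lborel) * (\<integral>\<^sup>+y. (p2 y)\<^sup>2 \<partial>lborel)"
    by (rule Cauchy_Schwarz_nn_integral) auto
  also have "\<dots> \<le> ennreal (2 / (\<alpha> - 1)) * (\<integral>\<^sup>+y. ennreal (w y * (g y)\<^sup>2) \<partial>lborel)"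
    unfolding sq1 sq2 by (intro mult_right_mono nn_integral_decay \<alpha>) simp
  finally show ?thesis .
qed

section \<open>Derivatives of the kernel and the norms of their scaled versions\<close>

definition k1 where "k1 = deriv k"
definition k2 where "k2 = deriv k1"

lemma k_deriv: "(k has_real_derivative k1 x) (at x)" and k1_deriv: "(k1 has_real_derivative k2 x) (at x)" and k2_cont: "continuous_on UNIV k2"
proof -
  obtain k' k'' where k: "\<And>y. (k has_real_derivative k' y) (at y)" "\<And>y. (k' has_real_derivative k'' y) (at y)" "continuous_on UNIV k''"
    using kernel unfolding kernel_C2_def by blast
  have "k1 = k'" unfolding k1_def using DERIV_imp_deriv[OF k(1)] by (rule ext)
  moreover have "k2 = k''" unfolding k2_def \<open>k1 = k'\<close> using DERIV_imp_deriv[OF k(2)] by (rule ext)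
  ultimately show "(k has_real_derivative k1 x) (at x)" "(k1 has_real_derivative k2 x) (at x)" "continuous_on UNIV k2" using k by auto
qed

lemma k_cont: "continuous_on UNIV k" and k1_cont: "continuous_on UNIV k1"
  using k_deriv k1_deriv by (auto intro!: continuous_at_imp_continuous_on DERIV_isCont)

lemma k_measurable[measurable]: "k \<in> borel_measurable borel" "k1 \<in> borel_measurable borel" "k2 \<in> borel_measurable borel"
  using k_cont k1_cont k2_cont by (auto intro: borel_measurable_continuous_onI)

lemma k_nonneg: "0 \<le> k y" and k_int: "integrable lborel k" and k_integral: "(\<integral>y. k y \<partial>lborel) = 1"
  using kernel by (auto simp: kernel_C2_def has_bochner_integral_iff)

lemma k_supp: "\<bar>v\<bar> > 1 \<Longrightarrow> k v = 0"
proof -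
  assume v: "\<bar>v\<bar> > 1"
  have "closure {y. k y \<noteq> 0} = {-1..1}" using kernel unfolding kernel_C2_def by blast
  then have "{y. k y \<noteq> 0} \<subseteq> {-1..1}" using closure_subset[of "{y. k y \<noteq> 0}"] by simp
  moreover have "v \<notin> {-1..1}" using v by (auto simp: abs_le_iff not_le)
  ultimately show "k v = 0" by blast
qed

lemma deriv_supp:
  assumes d: "\<And>x. (g has_real_derivative g' x) (at x)" and g: "\<And>v. \<bar>v\<bar> > 1 \<Longrightarrow> g v = (0::real)" and v: "\<bar>v\<bar> > 1"
  shows "g' v = 0"
proof -
  have "open {x::real. \<bar>x\<bar> > 1}" by (intro open_Collect_less continuous_intros)
  then have "((\<lambda>_. 0) has_real_derivative g' v) (at v)"
    by (rule has_field_derivative_transform_within_open[OF d[of v]]) (use v g in auto)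
  then show ?thesis by (rule DERIV_unique) simp
qed

lemma k1_supp: "\<bar>v\<bar> > 1 \<Longrightarrow> k1 v = 0" by (rule deriv_supp[OF k_deriv k_supp])
lemma k2_supp: "\<bar>v\<bar> > 1 \<Longrightarrow> k2 v = 0" by (rule deriv_supp[OF k1_deriv k1_supp])

lemma supp_bounded:
  fixes g :: "real \<Rightarrow> real"
  assumes "continuous_on UNIV g" "\<And>v. \<bar>v\<bar> > 1 \<Longrightarrow> g v = 0"
  shows "\<exists>C\<ge>1. \<forall>v. \<bar>g v\<bar> \<le> C"
proof -
  have "bounded (g ` {-1..1})"
    using assms(1) by (intro compact_imp_bounded compact_continuous_image) (auto intro: continuous_on_subset)
  then obtain B where B: "\<forall>v\<in>{-1..1}. \<bar>g v\<bar> \<le> B" unfolding bounded_iff by auto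
  have "\<bar>g v\<bar> \<le> max 1 B" for v
  proof (cases "\<bar>v\<bar> \<le> 1")
    case True
    then have "\<bar>g v\<bar> \<le> B" using B by (auto simp: abs_le_iff)
    then show ?thesis by simp
  qed (simp add: assms(2))
  then show ?thesis by (intro exI[of _ "max 1 B"]) auto
qed

lemma ex_KK: "\<exists>C\<ge>1. \<forall>v. \<bar>k v\<bar> \<le> C \<and> \<bar>k1 v\<bar> \<le> C \<and> \<bar>k2 v\<bar> \<le> C"
proof -
  obtain A B C where "A \<ge> 1" "B \<ge> 1" "C \<ge> 1" "\<And>v. \<bar>k v\<bar> \<le> A" "\<And>v. \<bar>k1 v\<bar> \<le> B" "\<And>v. \<bar>k2 v\<bar> \<le> C"
    using supp_bounded[OF k_cont k_supp] supp_bounded[OF k1_cont k1_supp] supp_bounded[OF k2_cont k2_supp] by blast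
  then show ?thesis by (intro exI[of _ "max A (max B C)"]) (auto simp: le_max_iff_disj)
qed

definition KK :: real where "KK = (SOME C. C \<ge> 1 \<and> (\<forall>v. \<bar>k v\<bar> \<le> C \<and> \<bar>k1 v\<bar> \<le> C \<and> \<bar>k2 v\<bar> \<le> C))"

lemma KK: "KK \<ge> 1" "\<bar>k v\<bar> \<le> KK" "\<bar>k1 v\<bar> \<le> KK" "\<bar>k2 v\<bar> \<le> KK"
  using someI_ex[OF ex_KK] unfolding KK_def by blast+

lemma supp_integral:
  fixes g :: "real \<Rightarrow> real"
  assumes "\<And>v. \<bar>v\<bar> > 1 \<Longrightarrow> g v = (0::real)" "\<And>v. \<bar>g v\<bar> \<le> C"
  shows "(\<integral>\<^sup>+v. ennreal \<bar>g v\<bar> \<partial>lborel) \<le> ennreal (2 * C)"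
proof -
  have C0: "0 \<le> C" using assms(2)[of 0] by linarith
  have "(\<integral>\<^sup>+v. ennreal \<bar>g v\<bar> \<partial>lborel) \<le> (\<integral>\<^sup>+v. ennreal C * indicator {-1..1::real} v \<partial>lborel)"
  proof (rule nn_integral_mono)
    fix v show "ennreal \<bar>g v\<bar> \<le> ennreal C * indicator {-1..1} v"
      using assms(2)[of v] assms(1)[of v] by (cases "\<bar>v\<bar> \<le> 1") (auto simp: indicator_def intro!: ennreal_leI)
  qed
  also have "\<dots> = ennreal C * 2" by (subst nn_integral_cmult_indicator) auto
  also have "\<dots> = ennreal (2 * C)" using C0 by (simp add: ennreal_mult mult.commute)
  finally show ?thesis .
qed

abbreviation kb :: "real \<Rightarrow> real \<Rightarrow> real" where "kb \<equiv> scaled_kernel k"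
text \<open>With \<open>kb2\<close>, the first two derivatives in \<open>y\<close> of the scaled
  kernel; the powers of \<open>\<beta>\<close> come from the chain rule.\<close>

definition kb1 :: "real \<Rightarrow> real \<Rightarrow> real" where "kb1 \<beta> y = k1 (y / \<beta>) / \<beta>\<^sup>2"
definition kb2 :: "real \<Rightarrow> real \<Rightarrow> real" where "kb2 \<beta> y = k2 (y / \<beta>) / \<beta>^3"

lemma kb_measurable[measurable]: "kb \<beta> \<in> borel_measurable borel" "kb1 \<beta> \<in> borel_measurable borel" "kb2 \<beta> \<in> borel_measurable borel"
  unfolding scaled_kernel_def[abs_def] kb1_def[abs_def] kb2_def[abs_def] by measurable

lemma kb_deriv: "0 < \<beta> \<Longrightarrow> (kb \<beta> has_real_derivative kb1 \<beta> x) (at x)"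
  and kb1_deriv: "0 < \<beta> \<Longrightarrow> (kb1 \<beta> has_real_derivative kb2 \<beta> x) (at x)"
proof -
  assume "0 < \<beta>"
  have d: "((\<lambda>y. y / \<beta>) has_real_derivative 1 / \<beta>) (at x)" using \<open>0 < \<beta>\<close> by (auto intro!: derivative_eq_intros)
  show "(kb \<beta> has_real_derivative kb1 \<beta> x) (at x)"
    unfolding scaled_kernel_def[abs_def] kb1_def
    by (rule DERIV_cong[OF DERIV_cdivide[OF DERIV_chain2[OF k_deriv d]]]) (simp add: power2_eq_square)
  show "(kb1 \<beta> has_real_derivative kb2 \<beta> x) (at x)"
    unfolding kb1_def[abs_def] kb2_def
    by (rule DERIV_cong[OF DERIV_cdivide[OF DERIV_chain2[OF k1_deriv d]]]) (simp add: power2_eq_square power3_eq_cube)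
qed

lemma kb1_cont: "0 < \<beta> \<Longrightarrow> continuous_on UNIV (kb1 \<beta>)" and kb2_cont: "0 < \<beta> \<Longrightarrow> continuous_on UNIV (kb2 \<beta>)"
  unfolding kb1_def[abs_def] kb2_def[abs_def]
  by (auto intro!: continuous_intros continuous_on_compose2[OF k1_cont] continuous_on_compose2[OF k2_cont])

text \<open>One substitution serves all cases and gains \<open>\<beta>\<close> against
  \<open>\<beta> ^ q\<close>: q is 1, 2, 3 for the kernel and its two derivatives, and 2, 4 for the
  squares of the kernel and of its first derivative.\<close>

lemma scaled_bound:
  assumes \<phi>[measurable]: "\<phi> \<in> borel_measurable borel" and supp: "\<And>v. \<bar>v\<bar> > 1 \<Longrightarrow> \<phi> v = (0::real)" and bd: "\<And>v. \<bar>\<phi> v\<bar> \<le> C"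
    and u[measurable]: "u \<in> borel_measurable borel" and u0: "\<And>y. 0 \<le> u y" and us: "\<And>y s. \<bar>s\<bar> \<le> 2 \<Longrightarrow> u (y + s) \<le> cs * u y"
    and b: "0 < \<beta>" "\<beta> \<le> 1" and a: "\<bar>a\<bar> \<le> 1"
  shows "(\<integral>\<^sup>+y. ennreal (u y * \<bar>\<phi> ((y - e + a) / \<beta>) / \<beta> ^ q\<bar>) \<partial>lborel) \<le> ennreal (2 * C * cs * u e * \<beta> / \<beta> ^ q)"
proof -
  have C0: "0 \<le> C" using bd[of 0] by linarith
  have "(\<integral>\<^sup>+y. ennreal (u y * \<bar>\<phi> ((y - e + a) / \<beta>) / \<beta> ^ q\<bar>) \<partial>lborel)
    = (\<integral>\<^sup>+y. ennreal (1 / \<beta> ^ q) * ennreal (u y * \<bar>\<phi> ((y - e + a) / \<beta>)\<bar>) \<partial>lborel)"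
    using b u0 by (intro nn_integral_cong) (simp add: ennreal_mult[symmetric])
  also have "\<dots> = ennreal (1 / \<beta> ^ q) * (\<integral>\<^sup>+y. ennreal (u y * \<bar>\<phi> ((y - e + a) / \<beta>)\<bar>) \<partial>lborel)"
    by (rule nn_integral_cmult) measurable
  also have "\<dots> \<le> ennreal (1 / \<beta> ^ q) * (ennreal (cs * u e * \<beta>) * ennreal (2 * C))"
    by (intro mult_left_mono order_trans[OF nn_integral_local[OF _ _ supp u0 us b a]] supp_integral supp bd) auto
  also have "\<dots> = ennreal (2 * C * cs * u e * \<beta> / \<beta> ^ q)"
    using b u0[of e] cs(1) C0 by (simp add: ennreal_mult[symmetric] mult_ac)
  finally show ?thesis .
qed

lemma nV_kb: assumes "0 < \<beta>" "\<beta> \<le> 1" "\<bar>a\<bar> \<le> 1"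
  shows "nV (\<lambda>y. kb \<beta> (y - e + a)) \<le> ennreal (2 * KK * cs * V e)"
  unfolding vnorm_def scaled_kernel_def
  using scaled_bound[OF k_measurable(1) k_supp KK(2) V_measurable V_nonneg cs(2) assms, where q=1 and e=e] assms by simp

lemma nV_kb1: assumes "0 < \<beta>" "\<beta> \<le> 1" "\<bar>a\<bar> \<le> 1"
  shows "nV (\<lambda>y. kb1 \<beta> (y - e + a)) \<le> ennreal (2 * KK * cs * V e / \<beta>)"
  unfolding vnorm_def kb1_def
  using scaled_bound[OF k_measurable(2) k1_supp KK(3) V_measurable V_nonneg cs(2) assms, where q=2 and e=e] assms
  by (simp add: power2_eq_square)

lemma nV_kb2: assumes "0 < \<beta>" "\<beta> \<le> 1" "\<bar>a\<bar> \<le> 1"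
  shows "nV (\<lambda>y. kb2 \<beta> (y - e + a)) \<le> ennreal (2 * KK * cs * V e / \<beta>\<^sup>2)"
  unfolding vnorm_def kb2_def
  using scaled_bound[OF k_measurable(3) k2_supp KK(4) V_measurable V_nonneg cs(2) assms, where q=3 and e=e] assms
  by (simp add: power2_eq_square power3_eq_cube)

lemma absV_kb: assumes "0 < \<beta>" "\<beta> \<le> 1" "\<bar>a\<bar> \<le> 1"
  shows "(\<integral>\<^sup>+y. ennreal ((1 + \<bar>y\<bar>) * V y * \<bar>kb \<beta> (y - e + a)\<bar>) \<partial>lborel) \<le> ennreal (2 * KK * cs * ((1 + \<bar>e\<bar>) * V e))"
proof -
  have "(\<integral>\<^sup>+y. ennreal ((1 + \<bar>y\<bar>) * V y * \<bar>k ((y - e + a) / \<beta>) / \<beta> ^ 1\<bar>) \<partial>lborel) \<le> ennreal (2 * KK * cs * ((1 + \<bar>e\<bar>) * V e) * \<beta> / \<beta> ^ 1)"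
    by (rule scaled_bound[OF k_measurable(1) k_supp KK(2) _ _ cs(4) assms]) (auto simp: V_nonneg)
  then show ?thesis using assms by (simp add: scaled_kernel_def)
qed

lemma w_kb_sq: assumes "0 < \<beta>" "\<beta> \<le> 1" "\<bar>a\<bar> \<le> 1"
  shows "(\<integral>\<^sup>+y. ennreal (w y * (kb \<beta> (y - e + a))\<^sup>2) \<partial>lborel) \<le> ennreal (2 * KK\<^sup>2 * cs * w e / \<beta>)"
proof -
  have "(\<integral>\<^sup>+y. ennreal (w y * \<bar>(k ((y - e + a) / \<beta>))\<^sup>2 / \<beta> ^ 2\<bar>) \<partial>lborel) \<le> ennreal (2 * KK\<^sup>2 * cs * w e * \<beta> / \<beta> ^ 2)"
    by (rule scaled_bound[where \<phi>="\<lambda>v. (k v)\<^sup>2", OF _ _ _ w_measurable w_nonneg cs(3) assms])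
      (use power_mono[OF KK(2), of _ 2] in \<open>auto simp: k_supp\<close>)
  then show ?thesis using assms by (simp add: scaled_kernel_def power_divide power2_eq_square)
qed

lemma w_kb1_sq: assumes "0 < \<beta>" "\<beta> \<le> 1" "\<bar>a\<bar> \<le> 1"
  shows "(\<integral>\<^sup>+y. ennreal (w y * (kb1 \<beta> (y - e + a))\<^sup>2) \<partial>lborel) \<le> ennreal (2 * KK\<^sup>2 * cs * w e / \<beta>^3)"
proof -
  have "(\<integral>\<^sup>+y. ennreal (w y * \<bar>(k1 ((y - e + a) / \<beta>))\<^sup>2 / \<beta> ^ 4\<bar>) \<partial>lborel) \<le> ennreal (2 * KK\<^sup>2 * cs * w e * \<beta> / \<beta> ^ 4)"
    by (rule scaled_bound[where \<phi>="\<lambda>v. (k1 v)\<^sup>2", OF _ _ _ w_measurable w_nonneg cs(3) assms])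
      (use power_mono[OF KK(3), of _ 2] in \<open>auto simp: k1_supp\<close>)
  then show ?thesis using assms by (simp add: kb1_def power_divide power4_eq_xxxx power3_eq_cube power2_eq_square mult_ac)
qed

text \<open>A mean value theorem in the norm. The derivative is controlled only for shifts in
  [-1,1], and the segment between two such shifts does not leave that interval.\<close>

lemma nV_increment:
  assumes der: "\<And>x. (\<phi> has_real_derivative \<phi>' x) (at x)" and cont: "continuous_on UNIV \<phi>'"
    and [measurable]: "\<phi>' \<in> borel_measurable borel"
    and bd: "\<And>a. \<bar>a\<bar> \<le> 1 \<Longrightarrow> nV (\<lambda>y. \<phi>' (y - e + a)) \<le> ennreal C" and "C \<ge> 0" and a: "\<bar>a\<bar> \<le> 1" "\<bar>a'\<bar> \<le> 1"
  shows "nV (\<lambda>y. \<phi> (y - e + a) - \<phi> (y - e + a')) \<le> ennreal (C * \<bar>a - a'\<bar>)"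
proof -
  have "nV (\<lambda>y. \<phi> (y - e + a) - \<phi> (y - e + a')) = nV (\<lambda>y. \<integral>u. indicator {0..1} u * ((a - a') * \<phi>' (y - e + a' + u * (a - a'))) \<partial>lborel)"
    using C1_increment[OF der cont, of "_ - e + a'" "a - a'"] by (simp add: algebra_simps)
  also have "\<dots> \<le> (\<integral>\<^sup>+u. nV (\<lambda>y. indicator {0..1} u * ((a - a') * \<phi>' (y - e + a' + u * (a - a')))) \<partial>lborel)"
    by (rule nV_integral) (auto simp: lborel.sigma_finite_measure_axioms)
  also have "\<dots> \<le> (\<integral>\<^sup>+u. ennreal (C * \<bar>a - a'\<bar>) * indicator {0..1::real} u \<partial>lborel)"
  proof (rule nn_integral_mono)
    fix u :: real
    show "nV (\<lambda>y. indicator {0..1} u * ((a - a') * \<phi>' (y - e + a' + u * (a - a')))) \<le> ennreal (C * \<bar>a - a'\<bar>) * indicator {0..1} u"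
    proof (cases "u \<in> {0..1}")
      case True
      have "a' + u * (a - a') = (1 - u) * a' + u * a" by (simp add: algebra_simps)
      also have "\<bar>\<dots>\<bar> \<le> (1 - u) * \<bar>a'\<bar> + u * \<bar>a\<bar>" using True by (intro order_trans[OF abs_triangle_ineq]) (simp add: abs_mult)
      also have "\<dots> \<le> (1 - u) * 1 + u * 1" using True a by (intro add_mono mult_left_mono) auto
      finally have "\<bar>a' + u * (a - a')\<bar> \<le> 1" by simp
      from bd[OF this] have "nV (\<lambda>y. (a - a') * \<phi>' (y - e + (a' + u * (a - a')))) \<le> ennreal \<bar>a - a'\<bar> * ennreal C"
        by (subst nV_cmult) (auto intro!: mult_left_mono)
      then show ?thesis using True \<open>C \<ge> 0\<close> by (simp add: ennreal_mult[symmetric] mult.commute add.assoc)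
    qed (simp add: vnorm_def)
  qed
  also have "\<dots> = ennreal (C * \<bar>a - a'\<bar>)" by (subst nn_integral_cmult_indicator) auto
  finally show ?thesis .
qed

lemma nV_kb_diff: assumes "0 < \<beta>" "\<beta> \<le> 1" "\<bar>a\<bar> \<le> 1" "\<bar>a'\<bar> \<le> 1"
  shows "nV (\<lambda>y. kb \<beta> (y - e + a) - kb \<beta> (y - e + a')) \<le> ennreal (2 * KK * cs * V e / \<beta> * \<bar>a - a'\<bar>)"
  by (rule nV_increment[OF kb_deriv kb1_cont]) (use assms KK(1) cs(1) V_nonneg[of e] in \<open>auto intro!: nV_kb1\<close>)

lemma nV_kb1_diff: assumes "0 < \<beta>" "\<beta> \<le> 1" "\<bar>a\<bar> \<le> 1" "\<bar>a'\<bar> \<le> 1"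
  shows "nV (\<lambda>y. kb1 \<beta> (y - e + a) - kb1 \<beta> (y - e + a')) \<le> ennreal (2 * KK * cs * V e / \<beta>\<^sup>2 * \<bar>a - a'\<bar>)"
  by (rule nV_increment[OF kb1_deriv kb2_cont]) (use assms KK(1) cs(1) V_nonneg[of e] in \<open>auto intro!: nV_kb2\<close>)

lemma kb_bound: "0 < \<beta> \<Longrightarrow> \<bar>kb \<beta> y\<bar> \<le> KK / \<beta>" and kb1_bound: "0 < \<beta> \<Longrightarrow> \<bar>kb1 \<beta> y\<bar> \<le> KK / \<beta>\<^sup>2"
  using KK by (auto simp: scaled_kernel_def kb1_def divide_right_mono)

section \<open>Smoothing bias of the density and of its derivative\<close>

lemma f'_times_bounded: "integrable lborel (\<lambda>e. g e * f' e)" if [measurable]: "g \<in> borel_measurable borel" and "\<And>e. \<bar>g e\<bar> \<le> C" for g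
proof (rule Bochner_Integration.integrable_bound)
  show "integrable lborel (\<lambda>e. C * f' e)" using f'_integrable by simp
  have "0 \<le> C" using that(2)[of 0] by linarith
  then show "AE x in lborel. norm (g x * f' x) \<le> norm (C * f' x)" using that(2) by (auto simp: abs_mult intro!: mult_right_mono)
qed simp

lemma f_times_bounded: "integrable lborel (\<lambda>e. g e * f e)" if [measurable]: "g \<in> borel_measurable borel" and "\<And>e. \<bar>g e\<bar> \<le> C" for g
proof (rule Bochner_Integration.integrable_bound)
  show "integrable lborel (\<lambda>e. C * f e)" using f_integrable by simp
  have "0 \<le> C" using that(2)[of 0] by linarith
  then show "AE x in lborel. norm (g x * f x) \<le> norm (C * f x)" using that(2) by (auto simp: abs_mult intro!: mult_right_mono)
qed simp

lemma conv_kb: "0 < \<beta> \<Longrightarrow> (\<integral>e. kb \<beta> (z - e) * g e \<partial>lborel) = (\<integral>v. k v * g (z - \<beta> * v) \<partial>lborel)"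
  using lborel_integral_real_affine[of "- \<beta>" "\<lambda>e. kb \<beta> (z - e) * g e" z]
  by (simp add: scaled_kernel_def field_simps)

text \<open>Integration by parts moves the derivative from the kernel to the density, so the
  compensator of the score is f' smoothed by \<open>k\<close> and carries no negative power of the
  bandwidth.\<close>

lemma conv_kb1:
  assumes "0 < \<beta>"
  shows "(\<integral>e. kb1 \<beta> (z - e) \<partial>F) = (\<integral>v. k v * f' (z - \<beta> * v) \<partial>lborel)"
proof -
  have i1: "integrable lborel (\<lambda>e. kb1 \<beta> (z - e) * f e)" using assms by (intro f_times_bounded[of _ "KK / \<beta>\<^sup>2"] kb1_bound) auto
  have i2: "integrable lborel (\<lambda>e. kb \<beta> (z - e) * f' e)" using assms by (intro f'_times_bounded[of _ "KK / \<beta>"] kb_bound) auto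
  have "(\<integral>e. (- kb1 \<beta> (z - e)) * f e + kb \<beta> (z - e) * f' e \<partial>lborel) = 0"
  proof (rule integral_by_parts_zero[OF f_ac f_deriv])
    show "((\<lambda>e. kb \<beta> (z - e)) has_real_derivative - kb1 \<beta> (z - x)) (at x)" for x
      by (rule DERIV_cong[OF DERIV_chain2[OF kb_deriv[OF assms]]]) (auto intro!: derivative_eq_intros)
    show "continuous_on UNIV (\<lambda>e. - kb1 \<beta> (z - e))"
      by (intro continuous_intros continuous_on_compose2[OF kb1_cont[OF assms]]) auto
    show "integrable lborel (\<lambda>x. kb \<beta> (z - x) * f x)" using assms by (intro f_times_bounded[of _ "KK / \<beta>"] kb_bound) auto
    show "integrable lborel (\<lambda>x. - kb1 \<beta> (z - x) * f x + kb \<beta> (z - x) * f' x)"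
      using i1 i2 by (intro Bochner_Integration.integrable_add) auto
  qed
  then have "(\<integral>e. kb1 \<beta> (z - e) * f e \<partial>lborel) = (\<integral>e. kb \<beta> (z - e) * f' e \<partial>lborel)"
    using i1 i2 by simp
  then show ?thesis using assms by (simp add: integral_F conv_kb)
qed

text \<open>The kernel has mass one, so the difference is a \<open>k\<close>-average of increments
  of \<open>g\<close>; the support of \<open>k\<close> limits the extra shift to
  \<open>\<beta>\<close>.\<close>

lemma conv_minus:
  assumes g: "integrable lborel g" and gm[measurable]: "g \<in> borel_measurable borel" and \<beta>: "0 < \<beta>" "\<beta> \<le> 1"
    and bd: "\<And>s. \<bar>s\<bar> \<le> \<beta> \<Longrightarrow> nV (\<lambda>y. g (y + (a + s)) - g y) \<le> ennreal \<eta>" and "\<eta> \<ge> 0"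
    and int: "\<And>z. integrable lborel (\<lambda>v. k v * g (z - \<beta> * v))"
  shows "nV (\<lambda>y. (\<integral>v. k v * g (y + a - \<beta> * v) \<partial>lborel) - g y) \<le> ennreal \<eta>"
proof -
  have "(\<integral>v. k v * g (y + a - \<beta> * v) \<partial>lborel) - g y = (\<integral>v. k v * (g (y + a - \<beta> * v) - g y) \<partial>lborel)" for y
    using int[of "y + a"] k_int k_integral by (simp add: right_diff_distrib)
  then have "nV (\<lambda>y. (\<integral>v. k v * g (y + a - \<beta> * v) \<partial>lborel) - g y) = nV (\<lambda>y. \<integral>v. k v * (g (y + a - \<beta> * v) - g y) \<partial>lborel)" by simp
  also have "\<dots> \<le> (\<integral>\<^sup>+v. nV (\<lambda>y. k v * (g (y + a - \<beta> * v) - g y)) \<partial>lborel)"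
    by (rule nV_integral) (auto simp: lborel.sigma_finite_measure_axioms)
  also have "\<dots> \<le> (\<integral>\<^sup>+v. ennreal (k v) * ennreal \<eta> \<partial>lborel)"
  proof (rule nn_integral_mono)
    fix v
    show "nV (\<lambda>y. k v * (g (y + a - \<beta> * v) - g y)) \<le> ennreal (k v) * ennreal \<eta>"
    proof (cases "\<bar>v\<bar> \<le> 1")
      case True
      then have "\<bar>- \<beta> * v\<bar> \<le> \<beta>" using \<beta> by (simp add: abs_mult mult_left_le)
      from bd[OF this] show ?thesis
        by (subst nV_cmult) (auto simp: k_nonneg add_diff_eq intro!: mult_left_mono)
    qed (simp add: k_supp vnorm_def)
  qed
  also have "\<dots> = ennreal \<eta> * (\<integral>\<^sup>+v. ennreal (k v) \<partial>lborel)" by (subst nn_integral_multc) (auto simp: mult.commute)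
  also have "(\<integral>\<^sup>+v. ennreal (k v) \<partial>lborel) = 1" using k_int k_integral k_nonneg by (subst nn_integral_eq_integral) auto
  finally show ?thesis by simp
qed

lemma conv_int:
  assumes g: "integrable lborel g" and \<beta>: "0 < \<beta>"
  shows "integrable lborel (\<lambda>v. k v * g (z - \<beta> * v))"
proof -
  have "integrable lborel (\<lambda>v. g (z + (- \<beta>) * v))" using g \<beta> by (subst lborel_integrable_real_affine_iff) auto
  then have "integrable lborel (\<lambda>v. KK * g (z - \<beta> * v))" by simp
  then show ?thesis
  proof (rule Bochner_Integration.integrable_bound)
    have "(\<lambda>v. g (z - \<beta> * v)) \<in> borel_measurable lborel" using \<open>integrable lborel (\<lambda>v. g (z + (- \<beta>) * v))\<close> by auto
    then show "(\<lambda>v. k v * g (z - \<beta> * v)) \<in> borel_measurable lborel" by simp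
    show "AE v in lborel. norm (k v * g (z - \<beta> * v)) \<le> norm (KK * g (z - \<beta> * v))"
      using KK by (auto simp: abs_mult intro!: mult_right_mono)
  qed
qed

text \<open>No rate is claimed, since for f' only continuity of translations is known. The term gets
  multiplied by the estimation error, of order n^(-1/2), so o(1) is enough.\<close>

lemma bias1: assumes "\<eta> > 0"
  shows "\<exists>d>0. \<forall>\<beta> a. 0 < \<beta> \<longrightarrow> \<beta> \<le> 1 \<longrightarrow> \<beta> + \<bar>a\<bar> < d \<longrightarrow> nV (\<lambda>y. (\<integral>e. kb1 \<beta> (y - e + a) \<partial>F) - f' y) \<le> ennreal \<eta>"
proof -
  obtain d where d: "d > 0" "\<And>s. \<bar>s\<bar> < d \<Longrightarrow> nV (\<lambda>y. f' (y + s) - f' y) \<le> ennreal \<eta>"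
    using translation_continuous_nV[OF Vf'_integrable f'_measurable \<open>\<eta> > 0\<close>] by blast
  show ?thesis
  proof (intro exI[of _ d] conjI allI impI)
    fix \<beta> a :: real assume \<beta>: "0 < \<beta>" "\<beta> \<le> 1" "\<beta> + \<bar>a\<bar> < d"
    have "(\<integral>e. kb1 \<beta> (y - e + a) \<partial>F) = (\<integral>v. k v * f' (y + a - \<beta> * v) \<partial>lborel)" for y
      using conv_kb1[OF \<beta>(1), of "y + a"] by (simp add: algebra_simps)
    then show "nV (\<lambda>y. (\<integral>e. kb1 \<beta> (y - e + a) \<partial>F) - f' y) \<le> ennreal \<eta>"
      using conv_minus[OF f'_integrable f'_measurable \<beta>(1,2), of a \<eta>] \<beta> d(2) \<open>\<eta> > 0\<close> conv_int[OF f'_integrable \<beta>(1)] by simp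
  qed (rule d(1))
qed

text \<open>The increment is an integral of f' along the shift, and f' has finite norm; hence a
  linear rate for \<open>f\<close>, in contrast to f' itself.\<close>

lemma f_increment: "\<exists>C\<ge>0. \<forall>a. \<bar>a\<bar> \<le> 1 \<longrightarrow> nV (\<lambda>y. f (y + a) - f y) \<le> ennreal (C * \<bar>a\<bar>)"
proof -
  obtain c where c: "c \<ge> 1" "\<And>g s. g \<in> borel_measurable borel \<Longrightarrow> \<bar>s\<bar> \<le> 1 \<Longrightarrow> nV (\<lambda>y. g (y + s)) \<le> ennreal c * nV g"
    using nV_shift[of 1] by blast
  obtain B where B: "nV f' = ennreal B" "B \<ge> 0" using nVf' by (cases "nV f'") auto

  have "nV (\<lambda>y. f (y + a) - f y) \<le> ennreal (c * B * \<bar>a\<bar>)" if a: "\<bar>a\<bar> \<le> 1" for a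
  proof -
    have "nV (\<lambda>y. f (y + a) - f y) \<le> (\<integral>\<^sup>+y. ennreal (V y) * (\<integral>\<^sup>+u. ennreal \<bar>a\<bar> * (indicator {0..1} u * ennreal \<bar>f' (y + u * a)\<bar>) \<partial>lborel) \<partial>lborel)"
      unfolding vnorm_def using V_nonneg
      by (intro nn_integral_mono) (auto simp: ennreal_mult intro!: mult_left_mono abs_continuous_increment_le f_ac f_deriv f'_integrable)
    also have "\<dots> = (\<integral>\<^sup>+y. \<integral>\<^sup>+u. ennreal (V y) * (ennreal \<bar>a\<bar> * (indicator {0..1} u * ennreal \<bar>f' (y + u * a)\<bar>)) \<partial>lborel \<partial>lborel)"
      by (subst nn_integral_cmult) auto
    also have "\<dots> = (\<integral>\<^sup>+u. \<integral>\<^sup>+y. ennreal (V y) * (ennreal \<bar>a\<bar> * (indicator {0..1} u * ennreal \<bar>f' (y + u * a)\<bar>)) \<partial>lborel \<partial>lborel)"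
      by (rule lborel_pair.Fubini') measurable
    also have "\<dots> = (\<integral>\<^sup>+u. (ennreal \<bar>a\<bar> * indicator {0..1} u) * nV (\<lambda>y. f' (y + u * a)) \<partial>lborel)"
      unfolding vnorm_def
      by (intro nn_integral_cong, subst nn_integral_cmult[symmetric]) (auto intro!: nn_integral_cong simp: ennreal_mult V_nonneg mult_ac)
    also have "\<dots> \<le> (\<integral>\<^sup>+u. (ennreal \<bar>a\<bar> * indicator {0..1::real} u) * ennreal (c * B) \<partial>lborel)"
    proof (rule nn_integral_mono)
      fix u :: real
      show "(ennreal \<bar>a\<bar> * indicator {0..1} u) * nV (\<lambda>y. f' (y + u * a)) \<le> (ennreal \<bar>a\<bar> * indicator {0..1} u) * ennreal (c * B)"
      proof (cases "u \<in> {0..1}")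
        case True
        then have "\<bar>u * a\<bar> \<le> 1" using a by (auto simp: abs_mult intro!: mult_le_one)
        from c(2)[OF f'_measurable this] show ?thesis using True B c(1) by (auto simp: ennreal_mult intro!: mult_left_mono)
      qed simp
    qed
    also have "\<dots> = ennreal (c * B * \<bar>a\<bar>)"
      using B c(1) by (simp add: nn_integral_multc nn_integral_cmult ennreal_mult[symmetric] mult.commute)
    finally show ?thesis .
  qed
  then show ?thesis using B c(1) by (intro exI[of _ "c * B"]) auto
qed

text \<open>The linear rate matters: as n b_n^4 tends to 0, a bias of order b_n is o(n^(-1/4)),
  which is what the quadratic error of \<open>psi\<close> tolerates.\<close>

lemma bias0: "\<exists>C\<ge>0. \<forall>\<beta>. 0 < \<beta> \<longrightarrow> \<beta> \<le> 1 \<longrightarrow> nV (\<lambda>y. (\<integral>e. kb \<beta> (y - e) \<partial>F) - f y) \<le> ennreal (C * \<beta>)"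
proof -
  obtain C where C: "C \<ge> 0" "\<And>a. \<bar>a\<bar> \<le> 1 \<Longrightarrow> nV (\<lambda>y. f (y + a) - f y) \<le> ennreal (C * \<bar>a\<bar>)" using f_increment by blast
  show ?thesis
  proof (intro exI[of _ C] conjI allI impI)
    fix \<beta> :: real assume \<beta>: "0 < \<beta>" "\<beta> \<le> 1"
    have eq: "(\<integral>e. kb \<beta> (y - e) \<partial>F) = (\<integral>v. k v * f (y + 0 - \<beta> * v) \<partial>lborel)" for y
      using conv_kb[OF \<beta>(1), of y f] by (simp add: integral_F)
    show "nV (\<lambda>y. (\<integral>e. kb \<beta> (y - e) \<partial>F) - f y) \<le> ennreal (C * \<beta>)"
      unfolding eq
    proof (rule conv_minus[OF f_integrable f_measurable \<beta>])
      show "nV (\<lambda>y. f (y + (0 + s)) - f y) \<le> ennreal (C * \<beta>)" if "\<bar>s\<bar> \<le> \<beta>" for s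
        using C(2)[of s] that \<beta> C(1) by (auto intro: order_trans ennreal_leI mult_left_mono)
    qed (use C(1) \<beta> conv_int[OF f_integrable] in auto)
  qed (rule C(1))
qed

end

section \<open>Averages of gradients and innovations\<close>

lemma mostly_True: "0 \<le> e \<Longrightarrow> (\<And>n \<omega>. \<omega> \<in> space M \<Longrightarrow> P n \<omega>) \<Longrightarrow> mostly M e P"
proof -
  assume e: "0 \<le> e" and P: "\<And>n \<omega>. \<omega> \<in> space M \<Longrightarrow> P n \<omega>"
  have E: "{\<omega> \<in> space M. \<not> P n \<omega>} = {}" for n using P by auto
  then show "mostly M e P" unfolding mostly_def E using outer_measure_of_eq[of "{}" M] by simp
qed

lemma powr_neg_half: "real n powr (-1/2) = 1 / sqrt (real n)"
proof -
  have "real n powr (-1/2) = inverse (real n powr (1/2))" using powr_minus[of "real n" "1/2"] by simp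
  also have "\<dots> = 1 / sqrt (real n)" by (simp only: powr_half_sqrt[OF of_nat_0_le_iff] inverse_eq_divide)
  finally show ?thesis .
qed

text \<open>Coordinates are rounded down to multiples of \<open>\<delta> / CARD('d)\<close>, and the
  sum of the coordinate errors bounds the norm. The 3 in the count comes from indices between -N and
  N, with N one above the ceiling.\<close>

lemma finite_cover:
  fixes R \<delta> :: real
  assumes "R \<ge> 0" "\<delta> > 0"
  shows "\<exists>G :: (real^'d) set. finite G \<and> card G \<le> (2 * nat \<lceil>R * real CARD('d) / \<delta>\<rceil> + 3) ^ CARD('d) \<and>
     (\<forall>s. norm s \<le> R \<longrightarrow> (\<exists>g\<in>G. norm (s - g) \<le> \<delta>))"
proof -
  define d where "d = \<delta> / real CARD('d)"
  have "d > 0" using assms by (simp add: d_def)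
  define N where "N = int (nat \<lceil>R / d\<rceil>) + 1"
  have Nd: "R / d = R * real CARD('d) / \<delta>" by (simp add: d_def)
  have NR: "R / d \<le> real_of_int (N - 1)" using assms \<open>d > 0\<close> by (simp add: N_def)
  define G :: "(real^'d) set" where "G = (\<lambda>z. \<chi> j. d * real_of_int (z j)) ` (PiE UNIV (\<lambda>_. {-N..N}))"
  have fin: "finite (PiE (UNIV :: 'd set) (\<lambda>_. {-N..N}))" by (intro finite_PiE) auto
  have "card G \<le> card (PiE (UNIV :: 'd set) (\<lambda>_. {-N..N}))" unfolding G_def by (rule card_image_le[OF fin])
  also have "\<dots> = (nat (2 * N + 1)) ^ CARD('d)" by (subst card_PiE) auto
  also have "nat (2 * N + 1) = 2 * nat \<lceil>R * real CARD('d) / \<delta>\<rceil> + 3"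
    unfolding N_def Nd by (simp add: nat_add_distrib nat_mult_distrib)
  finally have card: "card G \<le> (2 * nat \<lceil>R * real CARD('d) / \<delta>\<rceil> + 3) ^ CARD('d)" .
  have cover: "\<exists>g\<in>G. norm (s - g) \<le> \<delta>" if s: "norm s \<le> R" for s :: "real^'d"
  proof -
    define z where "z j = \<lfloor>s $ j / d\<rfloor>" for j
    have zb: "z j \<in> {-N..N}" for j
    proof -
      have "\<bar>s $ j\<bar> \<le> R" using component_le_norm_cart[of s j] s by linarith
      then have "\<bar>s $ j / d\<bar> \<le> R / d" using \<open>d > 0\<close> by (simp add: divide_right_mono)
      then have "\<bar>s $ j / d\<bar> \<le> real_of_int (N - 1)" using NR by linarith
      then have "- real_of_int N \<le> s $ j / d" "s $ j / d < real_of_int N + 1" by linarith+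
      then show ?thesis unfolding z_def by (auto simp: le_floor_iff floor_le_iff)
    qed
    have "norm (s - (\<chi> j. d * real_of_int (z j))) \<le> (\<Sum>j\<in>UNIV. \<bar>(s - (\<chi> j. d * real_of_int (z j))) $ j\<bar>)"
      by (rule norm_le_l1_cart)
    also have "\<dots> \<le> (\<Sum>j\<in>(UNIV :: 'd set). d)"
    proof (rule sum_mono)
      fix j
      have "z j \<le> s $ j / d" "s $ j / d \<le> z j + 1" unfolding z_def by linarith+
      then have "d * z j \<le> s $ j" "s $ j \<le> d * z j + d" using \<open>d > 0\<close> by (auto simp: field_simps)
      then show "\<bar>(s - (\<chi> j. d * real_of_int (z j))) $ j\<bar> \<le> d" by simp
    qed
    also have "\<dots> = \<delta>" by (simp add: d_def)
    finally show ?thesis using zb by (auto simp: G_def intro!: bexI image_eqI)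
  qed
  show ?thesis using fin card cover by (intro exI[of _ G]) (auto simp: G_def)
qed

context ar_kde
begin

definition gd :: "nat \<Rightarrow> 'a \<Rightarrow> real^'d" where "gd i \<omega> = r_dot \<theta> (Lg i \<omega>)"
definition \<mu> :: "real^'d" where "\<mu> = (\<integral>\<omega>. gd 1 \<omega> \<partial>M)"

lemma gd1: "gd 1 \<omega> = r_dot \<theta> (lag p X 0 \<omega>)" by (simp add: gd_def lag0)

text \<open>The gradient is a pointwise limit of difference quotients of \<open>r\<close> along the
  axes, so measurability is inherited from the regression functions.\<close>

lemma r_dot_measurable[measurable]: "r_dot \<theta> \<in> borel_measurable LS"
proof -
  have "(\<lambda>x. r_dot \<theta> x $ j) \<in> borel_measurable LS" for j
  proof (rule borel_measurable_LIMSEQ_metric)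
    fix i :: nat
    note regression_measurable[measurable]
    show "(\<lambda>x. (r (\<theta> + inverse (real (Suc i)) *\<^sub>R axis j 1) x - r \<theta> x) / inverse (real (Suc i))) \<in> borel_measurable LS"
      by measurable
  next
    fix x assume x: "x \<in> space LS"
    have "((\<lambda>t. r t x) has_derivative (\<lambda>h. h \<bullet> r_dot \<theta> x)) (at (\<theta> + 0 *\<^sub>R axis j 1))"
      using r_gradient[OF x, of \<theta>] by (simp add: gderiv_def)
    moreover have "((\<lambda>t. \<theta> + t *\<^sub>R axis j 1) has_derivative (\<lambda>t. t *\<^sub>R axis j 1)) (at 0)"
      by (auto intro!: derivative_eq_intros)
    ultimately have "((\<lambda>t. r (\<theta> + t *\<^sub>R axis j 1) x) has_derivative (\<lambda>t. (t *\<^sub>R axis j 1) \<bullet> r_dot \<theta> x)) (at 0)"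
      by (rule has_derivative_compose[rotated])
    then have "((\<lambda>t. r (\<theta> + t *\<^sub>R axis j 1) x) has_real_derivative r_dot \<theta> x $ j) (at 0)"
      by (simp add: has_field_derivative_def inner_axis' mult_commute_abs mult.commute)
    then have "(\<lambda>h. (r (\<theta> + h *\<^sub>R axis j 1) x - r \<theta> x) / h) \<midarrow>0\<rightarrow> r_dot \<theta> x $ j"
      by (simp add: DERIV_def)
    moreover have "filterlim (\<lambda>i. inverse (real (Suc i))) (at 0) sequentially"
      by (rule filterlim_atI[OF LIMSEQ_inverse_real_of_nat]) (auto intro: always_eventually)
    ultimately show "(\<lambda>i. (r (\<theta> + inverse (real (Suc i)) *\<^sub>R axis j 1) x - r \<theta> x) / inverse (real (Suc i))) \<longlonglongrightarrow> r_dot \<theta> x $ j"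
      by (rule filterlim_compose)
  qed
  then show ?thesis by (subst borel_measurable_euclidean_space) (auto simp: Basis_vec_def inner_axis)
qed

lemma gd_measurable[measurable]: "1 \<le> i \<Longrightarrow> gd i \<in> borel_measurable M"
  unfolding gd_def[abs_def] by measurable

lemma average_tight:
  assumes G[measurable]: "G \<in> borel_measurable (LS \<Otimes>\<^sub>M borel)"
    and int: "integrable M (\<lambda>\<omega>. G (Lg 1 \<omega>, eps 1 \<omega>))" and "e > 0"
  shows "\<exists>K>0. mostly M e (\<lambda>n \<omega>. (\<Sum>i=1..n. G (Lg i \<omega>, eps i \<omega>)) / real n \<le> K)"
proof (intro exI conjI)
  show "\<bar>\<integral>\<omega>. G (Lg 1 \<omega>, eps 1 \<omega>) \<partial>M\<bar> + 1 > 0" by linarith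
  show "mostly M e (\<lambda>n \<omega>. (\<Sum>i=1..n. G (Lg i \<omega>, eps i \<omega>)) / real n \<le> \<bar>\<integral>\<omega>. G (Lg 1 \<omega>, eps 1 \<omega>) \<partial>M\<bar> + 1)"
    by (rule mostly_mono[OF average_converges[OF G int zero_less_one \<open>e > 0\<close>]]) (auto intro!: always_eventually)
qed

lemma integrable_eps:
  fixes g :: "real \<Rightarrow> real"
  assumes "integrable F g" "g \<in> borel_measurable borel" "1 \<le> i"
  shows "integrable M (\<lambda>\<omega>. g (eps i \<omega>))" and "(\<integral>\<omega>. g (eps i \<omega>) \<partial>M) = (\<integral>y. g y \<partial>F)"
  using integrable_distr_eq[OF eps_measurable[OF assms(3)], of g] integral_distr[OF eps_measurable[OF assms(3)], of g] assms
  by (simp_all add: distr_eps)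

lemma gd_pow: "integrable M (\<lambda>\<omega>. norm (gd 1 \<omega>) powr (5/2))"
  using r_moment by (simp add: gd1)

lemma gd_sq: "integrable M (\<lambda>\<omega>. (norm (gd 1 \<omega>))\<^sup>2)"
proof (rule Bochner_Integration.integrable_bound)
  show "integrable M (\<lambda>\<omega>. 1 + norm (gd 1 \<omega>) powr (5/2))" using gd_pow by simp
  show "AE \<omega> in M. norm ((norm (gd 1 \<omega>))\<^sup>2) \<le> norm (1 + norm (gd 1 \<omega>) powr (5/2))"
  proof (rule AE_I2)
    fix \<omega>
    have "x\<^sup>2 \<le> 1 + x powr (5/2)" if "0 \<le> x" for x :: real
    proof (cases "x \<le> 1")
      case True
      then have "x\<^sup>2 \<le> 1" using that by (simp add: power_le_one)
      then show ?thesis by (simp add: add_increasing2)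
    next
      case False
      then have "x powr 2 \<le> x powr (5/2)" by (intro powr_mono) auto
      then show ?thesis using False by (simp add: powr_numeral)
    qed
    from this[of "norm (gd 1 \<omega>)"] show "norm ((norm (gd 1 \<omega>))\<^sup>2) \<le> norm (1 + norm (gd 1 \<omega>) powr (5/2))" by simp
  qed
qed simp

lemma gd_int: "integrable M (\<lambda>\<omega>. norm (gd 1 \<omega>))"
proof (rule Bochner_Integration.integrable_bound)
  show "integrable M (\<lambda>\<omega>. 1 + (norm (gd 1 \<omega>))\<^sup>2)" using gd_sq by simp
  show "AE \<omega> in M. norm (norm (gd 1 \<omega>)) \<le> norm (1 + (norm (gd 1 \<omega>))\<^sup>2)"
  proof (rule AE_I2)
    fix \<omega>
    have "2 * norm (gd 1 \<omega>) * 1 \<le> (norm (gd 1 \<omega>))\<^sup>2 + 1\<^sup>2" by (rule sum_squares_bound)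
    then show "norm (norm (gd 1 \<omega>)) \<le> norm (1 + (norm (gd 1 \<omega>))\<^sup>2)"
      using norm_ge_zero[of "gd 1 \<omega>"] by (simp del: norm_ge_zero)
  qed
qed simp

lemma mu_nth: "\<mu> $ j = (\<integral>\<omega>. gd 1 \<omega> $ j \<partial>M)"
proof -
  have "integrable M (gd 1)" using gd_int by (simp add: integrable_norm_iff)
  then show ?thesis unfolding \<mu>_def using integral_inner_left[of "axis j 1" M "gd 1"] by (simp add: inner_axis)
qed

text \<open>Covariate and innovation of the same time are independent, so the mean factorises into
  two finite moments.\<close>

lemma gd_sq_V: "integrable M (\<lambda>\<omega>. (norm (gd 1 \<omega>))\<^sup>2 * V (eps 1 \<omega>))"
proof (rule integrableI_bounded)
  have "(\<integral>\<^sup>+\<omega>. ennreal (norm ((norm (gd 1 \<omega>))\<^sup>2 * V (eps 1 \<omega>))) \<partial>M)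
     = (\<integral>\<^sup>+\<omega>. (\<lambda>z. ennreal ((norm (r_dot \<theta> (fst z)))\<^sup>2) * ennreal (V (snd z))) (Lg 1 \<omega>, eps 1 \<omega>) \<partial>M)"
    by (intro nn_integral_cong) (simp add: gd_def abs_mult V_nonneg ennreal_mult)
  also have "\<dots> = (\<integral>\<^sup>+\<omega>. \<integral>\<^sup>+e. (\<lambda>z. ennreal ((norm (r_dot \<theta> (fst z)))\<^sup>2) * ennreal (V (snd z))) (Lg 1 \<omega>, e) \<partial>F \<partial>M)"
    by (rule nn_integral_Lg_eps) auto
  also have "\<dots> = (\<integral>\<^sup>+\<omega>. ennreal ((norm (gd 1 \<omega>))\<^sup>2) * (\<integral>\<^sup>+e. ennreal (V e) \<partial>F) \<partial>M)"
    by (intro nn_integral_cong) (simp add: nn_integral_cmult gd_def)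
  also have "\<dots> = (\<integral>\<^sup>+\<omega>. ennreal ((norm (gd 1 \<omega>))\<^sup>2) \<partial>M) * (\<integral>\<^sup>+e. ennreal (V e) \<partial>F)"
    by (rule nn_integral_multc) simp
  also have "\<dots> < \<infinity>"
    using gd_sq V_F V_nonneg by (simp add: integrable_iff_bounded ennreal_mult_less_top)
  finally show "(\<integral>\<^sup>+\<omega>. ennreal (norm ((norm (gd 1 \<omega>))\<^sup>2 * V (eps 1 \<omega>))) \<partial>M) < \<infinity>" .
qed simp

text \<open>Markov's inequality is applied to n^(-9/8) times the sum of the powers 5/2, whose mean
  is of order n^(-1/8). A single gradient above n^(9/20) would push this quantity above 1, because
  9/20 times 5/2 is 9/8.\<close>

lemma max_gd:
  assumes "e > 0"
  shows "mostly M e (\<lambda>n \<omega>. \<forall>i\<in>{1..n}. norm (gd i \<omega>) \<le> real n powr (9/20))"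
proof -
  obtain m where m: "(\<integral>\<^sup>+\<omega>. ennreal (norm (gd 1 \<omega>) powr (5/2)) \<partial>M) = ennreal m" "m \<ge> 0"
    using gd_pow by (cases "\<integral>\<^sup>+\<omega>. ennreal (norm (gd 1 \<omega>) powr (5/2)) \<partial>M") (auto simp: integrable_iff_bounded)
  define Z where "Z n \<omega> = ennreal (real n powr (-9/8)) * (\<Sum>i=1..n. ennreal (norm (gd i \<omega>) powr (5/2)))" for n \<omega>
  have gm: "(\<lambda>\<omega>. ennreal (norm (gd i \<omega>) powr (5/2))) \<in> borel_measurable M" if "1 \<le> i" for i
    using gd_measurable[OF that] by measurable
  have Zm: "Z n \<in> borel_measurable M" for n unfolding Z_def using gm by (auto intro!: borel_measurable_sum borel_measurable_times simp del: sum_ennreal)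
  have st: "(\<integral>\<^sup>+\<omega>. ennreal (norm (gd i \<omega>) powr (5/2)) \<partial>M) = ennreal m" if "1 \<le> i" for i
    using nn_integral_stationary[OF that, of "\<lambda>z. ennreal (norm (r_dot \<theta> (fst z)) powr (5/2))"] m(1) by (simp add: gd_def)
  have EZ: "(\<integral>\<^sup>+\<omega>. Z n \<omega> \<partial>M) = ennreal (m * (real n powr (-9/8) * real n))" for n
  proof -
    have "(\<integral>\<^sup>+\<omega>. Z n \<omega> \<partial>M) = ennreal (real n powr (-9/8)) * (\<Sum>i=1..n. (\<integral>\<^sup>+\<omega>. ennreal (norm (gd i \<omega>) powr (5/2)) \<partial>M))"
    proof -
      show ?thesis
        unfolding Z_def using gm by (subst nn_integral_cmult) (auto intro!: borel_measurable_sum arg_cong2[where f="(*)"] nn_integral_sum simp del: sum_ennreal)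
    qed
    also have "(\<Sum>i=1..n. (\<integral>\<^sup>+\<omega>. ennreal (norm (gd i \<omega>) powr (5/2)) \<partial>M)) = ennreal (real n * m)"
      using m(2) by (simp add: st ennreal_of_nat_eq_real_of_nat ennreal_mult)
    finally show ?thesis using m(2) by (simp add: ennreal_mult[symmetric] mult_ac)
  qed
  have "(\<lambda>n. m * (real n powr (-9/8) * real n)) \<longlonglongrightarrow> 0"
  proof -
    have "(\<lambda>n. m * (real n powr (-1/8))) \<longlonglongrightarrow> m * 0"
      by (intro tendsto_intros tendsto_neg_powr filterlim_real_sequentially) simp
    moreover have "real n powr (-9/8) * real n = real n powr (-1/8)" for n
      using powr_add[of "real n" "-9/8" 1] by (cases "n = 0") auto
    ultimately show ?thesis by simp
  qed
  then have "\<forall>\<^sub>F n in sequentially. m * (real n powr (-9/8) * real n) < e * 1" using \<open>e > 0\<close> by (intro order_tendstoD) auto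
  then have "\<forall>\<^sub>F n in sequentially. (\<integral>\<^sup>+\<omega>. Z n \<omega> \<partial>M) \<le> ennreal (e * 1)" unfolding EZ by eventually_elim (intro ennreal_leI, simp)
  then have "mostly M e (\<lambda>n \<omega>. Z n \<omega> \<le> ennreal 1)"
    using \<open>e > 0\<close> by (intro mostly_Markov Zm) auto
  note ev = this
  show ?thesis
  proof (rule mostly_mono[OF ev], use eventually_gt_at_top[of 0] in \<open>eventually_elim, intro ballI impI\<close>)
    fix n \<omega> i assume n: "0 < n" and Z: "Z n \<omega> \<le> ennreal 1" and i: "i \<in> {1..n}"
    have "ennreal (norm (gd i \<omega>) powr (5/2)) \<le> (\<Sum>i=1..n. ennreal (norm (gd i \<omega>) powr (5/2)))"
      using i by (intro member_le_sum) auto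
    then have "ennreal (real n powr (-9/8)) * ennreal (norm (gd i \<omega>) powr (5/2)) \<le> ennreal 1"
      using Z unfolding Z_def by (meson mult_left_mono order_trans zero_le)
    then have 1: "real n powr (-9/8) * norm (gd i \<omega>) powr (5/2) \<le> 1" by (simp add: ennreal_mult[symmetric])
    show "norm (gd i \<omega>) \<le> real n powr (9/20)"
    proof (rule ccontr)
      assume "\<not> ?thesis"
      then have "(real n powr (9/20)) powr (5/2) < norm (gd i \<omega>) powr (5/2)" by (intro powr_less_mono2) auto
      then have "real n powr (9/8) < norm (gd i \<omega>) powr (5/2)" by (simp add: powr_powr)
      then have "real n powr (-9/8) * real n powr (9/8) < real n powr (-9/8) * norm (gd i \<omega>) powr (5/2)"
        using n by (intro mult_strict_left_mono) auto
      then show False using 1 n by (simp add: powr_add[symmetric])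
    qed
  qed simp
qed

lemma eps_orth: assumes "1 \<le> i" "1 \<le> j" "i \<noteq> j" shows "(\<integral>\<omega>. eps i \<omega> * eps j \<omega> \<partial>M) = 0" "integrable M (\<lambda>\<omega>. eps i \<omega> * eps j \<omega>)"
proof -
  have "indep_var (\<Pi>\<^sub>M a\<in>{i}. borel) (\<lambda>\<omega>. restrict (\<lambda>a. eps a \<omega>) {i}) (\<Pi>\<^sub>M a\<in>{j}. borel) (\<lambda>\<omega>. restrict (\<lambda>a. eps a \<omega>) {j})"
    using assms by (intro indep_var_restrict[OF innovations_indep]) auto
  then have "indep_var borel ((\<lambda>x. x i) \<circ> (\<lambda>\<omega>. restrict (\<lambda>a. eps a \<omega>) {i})) borel ((\<lambda>x. x j) \<circ> (\<lambda>\<omega>. restrict (\<lambda>a. eps a \<omega>) {j}))"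
    by (rule indep_var_compose) auto
  then have ind: "indep_var borel (eps i) borel (eps j)" by (simp add: comp_def)
  have int: "integrable M (eps i)" "integrable M (eps j)" using integrable_eps(1)[OF id_F] assms by auto
  show "(\<integral>\<omega>. eps i \<omega> * eps j \<omega> \<partial>M) = 0" "integrable M (\<lambda>\<omega>. eps i \<omega> * eps j \<omega>)"
    using indep_var_lebesgue_integral[OF ind int] indep_var_integrable[OF ind int] innovations_mean assms by auto
qed

lemma sum_eps_sq: "(\<integral>\<^sup>+\<omega>. ennreal ((\<Sum>i=1..n. eps i \<omega>)\<^sup>2) \<partial>M) = ennreal (real n * \<sigma>\<^sup>2)"
proof -
  have int: "integrable M (\<lambda>\<omega>. eps i \<omega> * eps j \<omega>)" if "1 \<le> i" "1 \<le> j" for i j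
    using eps_orth(2)[OF that] innovations_sq_integrable[OF that(1)] by (cases "i = j") (auto simp: power2_eq_square)
  have E: "(\<integral>\<omega>. eps i \<omega> * eps j \<omega> \<partial>M) = (if i = j then \<sigma>\<^sup>2 else 0)" if "1 \<le> i" "1 \<le> j" for i j
    using eps_orth(1)[OF that] innovations_variance[OF that(1)] innovations_mean[OF that(1)] by (auto simp: power2_eq_square)
  have sq: "(\<Sum>i=1..n. eps i \<omega>)\<^sup>2 = (\<Sum>i=1..n. \<Sum>j=1..n. eps i \<omega> * eps j \<omega>)" for \<omega>
    by (simp add: power2_eq_square sum_product)
  have "(\<integral>\<^sup>+\<omega>. ennreal ((\<Sum>i=1..n. eps i \<omega>)\<^sup>2) \<partial>M) = ennreal (\<integral>\<omega>. (\<Sum>i=1..n. eps i \<omega>)\<^sup>2 \<partial>M)"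
  proof (rule nn_integral_eq_integral)
    show "integrable M (\<lambda>\<omega>. (\<Sum>i=1..n. eps i \<omega>)\<^sup>2)"
      unfolding sq by (auto intro!: Bochner_Integration.integrable_sum int)
  qed simp
  also have "(\<integral>\<omega>. (\<Sum>i=1..n. eps i \<omega>)\<^sup>2 \<partial>M) = (\<Sum>i=1..n. \<Sum>j=1..n. (\<integral>\<omega>. eps i \<omega> * eps j \<omega> \<partial>M))"
    unfolding sq by (subst Bochner_Integration.integral_sum) (auto intro!: Bochner_Integration.integrable_sum int sum.cong Bochner_Integration.integral_sum)
  also have "\<dots> = (\<Sum>i=1..n. \<Sum>j=1..n. if i = j then \<sigma>\<^sup>2 else 0)"
    by (intro sum.cong refl) (auto simp: E)
  also have "\<dots> = real n * \<sigma>\<^sup>2" by simp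
  finally show ?thesis .
qed

text \<open>Chebyshev's inequality; independence makes the second moment of the sum equal to n
  \<sigma>^2.\<close>

lemma mean_eps:
  assumes "e > 0"
  shows "\<exists>K>0. mostly M e (\<lambda>n \<omega>. \<bar>(\<Sum>i=1..n. eps i \<omega>) / real n\<bar> \<le> K * real n powr (-1/2))"
proof -
  define Z where "Z n \<omega> = ennreal ((\<Sum>i=1..n. eps i \<omega>)\<^sup>2 / real n)" for n \<omega>
  have Zm: "Z n \<in> borel_measurable M" for n unfolding Z_def by (auto intro!: measurable_compose[OF _ measurable_ennreal] borel_measurable_divide borel_measurable_power borel_measurable_sum)
  have "(\<integral>\<^sup>+\<omega>. Z n \<omega> \<partial>M) \<le> ennreal (\<sigma>\<^sup>2)" for n
  proof -
    have "(\<integral>\<^sup>+\<omega>. Z n \<omega> \<partial>M) = (\<integral>\<^sup>+\<omega>. ennreal (1 / real n) * ennreal ((\<Sum>i=1..n. eps i \<omega>)\<^sup>2) \<partial>M)"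
      unfolding Z_def by (intro nn_integral_cong) (simp add: ennreal_mult[symmetric])
    also have "\<dots> = ennreal (1 / real n) * (\<integral>\<^sup>+\<omega>. ennreal ((\<Sum>i=1..n. eps i \<omega>)\<^sup>2) \<partial>M)"
      by (rule nn_integral_cmult) (intro measurable_compose[OF _ measurable_ennreal] borel_measurable_power borel_measurable_sum, auto)
    also have "\<dots> \<le> ennreal (\<sigma>\<^sup>2)" unfolding sum_eps_sq by (cases "n = 0") (auto simp: ennreal_mult[symmetric])
    finally show ?thesis .
  qed
  then obtain K where K: "K > 0" "mostly M e (\<lambda>n \<omega>. Z n \<omega> \<le> ennreal K)"
    using mostly_tight[of Z M e "\<sigma>\<^sup>2"] Zm \<open>e > 0\<close> by (auto intro: always_eventually)
  show ?thesis
  proof (intro exI conjI)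
    show "sqrt K > 0" using K by simp
    show "mostly M e (\<lambda>n \<omega>. \<bar>(\<Sum>i=1..n. eps i \<omega>) / real n\<bar> \<le> sqrt K * real n powr (-1/2))"
    proof (rule mostly_mono[OF K(2)])
      show "\<forall>\<^sub>F n in sequentially. \<forall>\<omega>\<in>space M. Z n \<omega> \<le> ennreal K \<longrightarrow> \<bar>(\<Sum>i=1..n. eps i \<omega>) / real n\<bar> \<le> sqrt K * real n powr (-1/2)"
        using eventually_gt_at_top[of 0]
      proof (eventually_elim, intro ballI impI)
        fix n \<omega> assume n: "0 < (n::nat)" and "Z n \<omega> \<le> ennreal K"
        then have "(\<Sum>i=1..n. eps i \<omega>)\<^sup>2 / real n \<le> K" using K(1) by (simp add: Z_def ennreal_le_iff)
        then have "((\<Sum>i=1..n. eps i \<omega>) / real n)\<^sup>2 \<le> K / real n"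
          using n by (simp add: power_divide power2_eq_square divide_right_mono flip: divide_divide_eq_left)
        then have "\<bar>(\<Sum>i=1..n. eps i \<omega>) / real n\<bar> \<le> sqrt (K / real n)" by (metis power2_abs real_le_rsqrt)
        also have "\<dots> = sqrt K * real n powr (-1/2)"
          unfolding powr_neg_half real_sqrt_divide by simp
        finally show "\<bar>(\<Sum>i=1..n. eps i \<omega>) / real n\<bar> \<le> sqrt K * real n powr (-1/2)" .
      qed
    qed simp
  qed
qed

text \<open>Dominated convergence along integer radii, with \<open>g\<close> itself as dominating
  function.\<close>

lemma tail_small:
  fixes g :: "real \<Rightarrow> real"
  assumes g: "integrable F g" and [measurable]: "g \<in> borel_measurable borel" and nn: "\<And>y. 0 \<le> g y" and "\<eta> > 0"
  shows "\<exists>R\<ge>0. (\<integral>y. g y * indicator {y. \<bar>y\<bar> > R} y \<partial>F) < \<eta>"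
proof -
  have "(\<lambda>N. \<integral>y. g y * indicator {y. \<bar>y\<bar> > real N} y \<partial>F) \<longlonglongrightarrow> (\<integral>y. 0 \<partial>F)"
  proof (rule integral_dominated_convergence[where w=g])
    show "integrable F g" by (rule g)
    show "AE y in F. (\<lambda>N. g y * indicator {y. \<bar>y\<bar> > real N} y) \<longlonglongrightarrow> 0"
    proof (rule AE_I2)
      fix y :: real
      obtain N0 :: nat where N0: "\<bar>y\<bar> \<le> real N0" using real_arch_simple by blast
      have "\<forall>\<^sub>F N in sequentially. g y * indicator {y. \<bar>y\<bar> > real N} y = 0"
        using eventually_ge_at_top[of N0] by eventually_elim (use N0 in auto)
      then show "(\<lambda>N. g y * indicator {y. \<bar>y\<bar> > real N} y) \<longlonglongrightarrow> 0" by (rule tendsto_eventually)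
    qed
    show "AE y in F. norm (g y * indicator {y. \<bar>y\<bar> > real N} y) \<le> g y" for N
      using nn by (intro AE_I2) (auto simp: indicator_def)
  qed auto
  then have "\<forall>\<^sub>F N in sequentially. (\<integral>y. g y * indicator {y. \<bar>y\<bar> > real N} y \<partial>F) < \<eta>"
    using \<open>\<eta> > 0\<close> by (intro order_tendstoD) auto
  then obtain N where "(\<integral>y. g y * indicator {y. \<bar>y\<bar> > real N} y \<partial>F) < \<eta>" by (auto simp: eventually_sequentially)
  then show ?thesis by (intro exI[of _ "real N"]) auto
qed

text \<open>The radius is taken from the tail of the law with half of \<open>\<eta>\<close>; the
  other half is the error allowed in the ergodic theorem.\<close>

lemma tail_average:
  assumes "\<eta> > 0" "e > 0"
  shows "\<exists>R\<ge>0. mostly M e (\<lambda>n \<omega>. (\<Sum>i=1..n. (1 + \<bar>eps i \<omega>\<bar>) * V (eps i \<omega>) * indicator {y. \<bar>y\<bar> > R} (eps i \<omega>)) / real n \<le> \<eta>)"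
proof -
  have "\<eta> / 2 > 0" using assms by simp
  then obtain R where R: "R \<ge> 0" "(\<integral>y. (1 + \<bar>y\<bar>) * V y * indicator {y. \<bar>y\<bar> > R} y \<partial>F) < \<eta> / 2"
    using tail_small[OF absV_F _ _ \<open>\<eta> / 2 > 0\<close>] V_nonneg by auto
  define G where "G z = (1 + \<bar>snd z\<bar>) * V (snd z) * indicator {y. \<bar>y\<bar> > R} (snd z)" for z :: "(nat \<Rightarrow> real) \<times> real"
  have Gm: "G \<in> borel_measurable (LS \<Otimes>\<^sub>M borel)" unfolding G_def by measurable
  have "integrable F (\<lambda>y. (1 + \<bar>y\<bar>) * V y * indicator {y. \<bar>y\<bar> > R} y)"
    by (rule F_mono[OF absV_F]) (auto simp: indicator_def V_nonneg)
  note ie = integrable_eps[OF this, of 1]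
  have "integrable M (\<lambda>\<omega>. G (Lg 1 \<omega>, eps 1 \<omega>))" using ie(1) by (simp add: G_def)
  from average_converges[OF Gm this \<open>\<eta> / 2 > 0\<close> \<open>e > 0\<close>]
  have "mostly M e (\<lambda>n \<omega>. (\<Sum>i=1..n. G (Lg i \<omega>, eps i \<omega>)) / real n \<le> \<eta>)"
  proof (rule mostly_mono)
    have "(\<integral>\<omega>. G (Lg 1 \<omega>, eps 1 \<omega>) \<partial>M) < \<eta> / 2" using ie(2) R(2) by (simp add: G_def)
    then show "\<forall>\<^sub>F n in sequentially. \<forall>\<omega>\<in>space M. \<bar>(\<Sum>i=1..n. G (Lg i \<omega>, eps i \<omega>)) / real n - (\<integral>\<omega>. G (Lg 1 \<omega>, eps 1 \<omega>) \<partial>M)\<bar> \<le> \<eta> / 2 \<longrightarrow> (\<Sum>i=1..n. G (Lg i \<omega>, eps i \<omega>)) / real n \<le> \<eta>"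
      by (intro always_eventually allI ballI impI) linarith
  qed simp
  then show ?thesis using R(1) by (auto simp: G_def)
qed

text \<open>A finite second moment makes the maximum o_p(n^(1/2)): only innovations beyond a large
  \<open>R\<close> enter Markov's inequality, and their truncated second moment is below
  \<open>e * \<eta>\<^sup>2\<close>.\<close>

lemma max_eps:
  assumes "\<eta> > 0" "e > 0"
  shows "mostly M e (\<lambda>n \<omega>. \<forall>i\<in>{1..n}. \<bar>eps i \<omega>\<bar> \<le> \<eta> * sqrt (real n))"
proof -
  have "e * \<eta>\<^sup>2 > 0" using assms by simp
  then obtain R where R: "R \<ge> 0" "(\<integral>y. y\<^sup>2 * indicator {y. \<bar>y\<bar> > R} y \<partial>F) < e * \<eta>\<^sup>2"
    using tail_small[OF sq_F _ _ \<open>e * \<eta>\<^sup>2 > 0\<close>] by auto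
  define g where "g y = y\<^sup>2 * indicator {y. \<bar>y\<bar> > R} y" for y :: real
  have gm[measurable]: "g \<in> borel_measurable borel" unfolding g_def by measurable
  have g0: "0 \<le> g y" for y by (simp add: g_def)
  have "integrable F g" by (rule F_mono[OF sq_F]) (auto simp: g_def indicator_def)
  then have gI: "(\<integral>\<^sup>+y. ennreal (g y) \<partial>F) \<le> ennreal (e * \<eta>\<^sup>2)"
    using R(2) g0 by (subst nn_integral_eq_integral) (auto simp: g_def[abs_def] intro!: ennreal_leI)
  define Z where "Z n \<omega> = ennreal (1 / real n) * (\<Sum>i=1..n. ennreal (g (eps i \<omega>)))" for n \<omega>
  have Zm: "Z n \<in> borel_measurable M" for n unfolding Z_def by (auto intro!: borel_measurable_sum borel_measurable_times measurable_compose[OF _ measurable_ennreal] measurable_compose[OF _ gm] simp del: sum_ennreal)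
  have EZ: "(\<integral>\<^sup>+\<omega>. Z n \<omega> \<partial>M) \<le> ennreal (e * \<eta>\<^sup>2)" for n
  proof -
    have "(\<integral>\<^sup>+\<omega>. Z n \<omega> \<partial>M) = ennreal (1 / real n) * (\<Sum>i=1..n. (\<integral>\<^sup>+\<omega>. ennreal (g (eps i \<omega>)) \<partial>M))"
      unfolding Z_def
      by (subst nn_integral_cmult, (intro borel_measurable_sum measurable_compose[OF _ measurable_ennreal] measurable_compose[OF _ gm] eps_measurable, simp), subst nn_integral_sum)
        (intro measurable_compose[OF _ measurable_ennreal] measurable_compose[OF _ gm] eps_measurable, auto)
    also have "(\<Sum>i=1..n. (\<integral>\<^sup>+\<omega>. ennreal (g (eps i \<omega>)) \<partial>M)) = (\<Sum>i=1..n. (\<integral>\<^sup>+y. ennreal (g y) \<partial>F))"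
      by (intro sum.cong refl nn_integral_eps) auto
    also have "\<dots> \<le> (\<Sum>i=1..n. ennreal (e * \<eta>\<^sup>2))" by (intro sum_mono gI)
    also have "\<dots> = ennreal (real n * (e * \<eta>\<^sup>2))" using assms by (simp add: ennreal_of_nat_eq_real_of_nat ennreal_mult)
    finally have "(\<integral>\<^sup>+\<omega>. Z n \<omega> \<partial>M) \<le> ennreal (1 / real n) * ennreal (real n * (e * \<eta>\<^sup>2))" by (simp add: mult_left_mono)
    also have "\<dots> \<le> ennreal (e * \<eta>\<^sup>2)" using assms by (cases "n = 0") (auto simp: ennreal_mult[symmetric])
    finally show ?thesis .
  qed
  have "mostly M e (\<lambda>n \<omega>. Z n \<omega> \<le> ennreal (\<eta>\<^sup>2))"
    using assms EZ by (intro mostly_Markov Zm) auto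
  note ev = this
  \<comment> \<open>From this index on, \<open>R\<close> is at most \<open>\<eta>\<close> times the
    root of n, so innovations within the truncation satisfy the bound trivially.\<close>
  obtain N :: nat where N: "(R / \<eta>)\<^sup>2 \<le> real N" using real_arch_simple by blast
  show ?thesis
  proof (rule mostly_mono[OF ev], use eventually_gt_at_top[of 0] eventually_ge_at_top[of N] in \<open>eventually_elim, intro ballI impI\<close>)
    fix n \<omega> i assume n: "0 < (n::nat)" "N \<le> n" and Z: "Z n \<omega> \<le> ennreal (\<eta>\<^sup>2)" and i: "i \<in> {1..n}"
    have "ennreal (g (eps i \<omega>)) \<le> (\<Sum>i=1..n. ennreal (g (eps i \<omega>)))"
      using i by (intro member_le_sum) auto
    then have "ennreal (1 / real n) * ennreal (g (eps i \<omega>)) \<le> ennreal (\<eta>\<^sup>2)"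
      using Z unfolding Z_def by (meson mult_left_mono order_trans zero_le)
    then have "1 / real n * g (eps i \<omega>) \<le> \<eta>\<^sup>2" using g0 by (simp add: ennreal_mult[symmetric] ennreal_le_iff)
    then have 1: "g (eps i \<omega>) \<le> \<eta>\<^sup>2 * real n" using n by (simp add: divide_le_eq)
    show "\<bar>eps i \<omega>\<bar> \<le> \<eta> * sqrt (real n)"
    proof (cases "\<bar>eps i \<omega>\<bar> > R")
      case True
      then have "(eps i \<omega>)\<^sup>2 \<le> (\<eta> * sqrt (real n))\<^sup>2" using 1 by (simp add: g_def power_mult_distrib)
      then show ?thesis using assms by (simp add: abs_le_square_iff[symmetric])
    next
      case False
      have "R / \<eta> \<le> sqrt (real n)" using N n(2) by (intro real_le_rsqrt) linarith
      then show ?thesis using False assms by (simp add: divide_le_eq mult.commute)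
    qed
  qed simp
qed

end

section \<open>Uniform convergence of the score averages\<close>

text \<open>A union bound for index sets that do not vary with n. The grid of shifts, whose size
  grows, is handled by a sum inside Markov's inequality instead.\<close>

lemma mostly_finite_ball:
  assumes "finite J" "\<And>j. j \<in> J \<Longrightarrow> mostly M e (P j)" "0 \<le> e"
  shows "mostly M (real (card J) * e) (\<lambda>n \<omega>. \<forall>j\<in>J. P j n \<omega>)"
  using assms(1,2)
proof (induction J rule: finite_induct)
  case empty
  show ?case by (rule mostly_True) auto
next
  case (insert j J)
  have "mostly M (e + real (card J) * e) (\<lambda>n \<omega>. P j n \<omega> \<and> (\<forall>j\<in>J. P j n \<omega>))"
    using insert assms(3) by (intro mostly_conj) auto
  then show ?case using insert by (simp add: algebra_simps)
qed

context ar_kde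
begin

section \<open>Rates implied by the two bandwidth conditions\<close>

lemma b_small: assumes "\<eta> > 0" shows "\<forall>\<^sub>F n in sequentially. 0 < b n \<and> b n < \<eta>"
proof -
  have "\<forall>\<^sub>F n in sequentially. real n * b n ^ 4 < \<eta> ^ 4" using b_upper assms by (intro order_tendstoD) auto
  with eventually_ge_at_top[of 1] show ?thesis
  proof eventually_elim
    case (elim n)
    have "1 * b n ^ 4 \<le> real n * b n ^ 4" using elim by (intro mult_right_mono) auto
    then have "b n ^ 4 < \<eta> ^ 4" using elim by linarith
    then have "b n < \<eta>" using assms by (auto intro: power_less_imp_less_base)
    then show ?case using b_pos[of n] elim by simp
  qed
qed

text \<open>Eventually the bandwidth is below 1, so lowering the exponent only enlarges the
  power.\<close>

lemma rate: assumes "q \<le> ((50 + 20 * real CARD('d)) / (14 + 5 * real CARD('d)))" shows "filterlim (\<lambda>n. real n * b n powr q) at_top sequentially"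
proof (rule filterlim_at_top_mono[OF b_lower])
  show "\<forall>\<^sub>F n in sequentially. real n * b n powr ((50 + 20 * real CARD('d)) / (14 + 5 * real CARD('d))) \<le> real n * b n powr q"
    using b_small[of 1, simplified] by eventually_elim (use assms in \<open>auto intro!: mult_left_mono powr_mono'\<close>)
qed

text \<open>The first bound covers the exponents 2 and 3 that arise from the variance and from the
  linearisation error; the second one is the exponent required by the grid.\<close>

lemma dstar_ge: "7/2 \<le> ((50 + 20 * real CARD('d)) / (14 + 5 * real CARD('d)))" "(6 + 4 * real CARD('d)) / (2 + real CARD('d)) \<le> ((50 + 20 * real CARD('d)) / (14 + 5 * real CARD('d)))"
proof -
  have d: "real CARD('d) \<ge> 1" by (simp add: Suc_le_eq One_nat_def)
  show "7/2 \<le> ((50 + 20 * real CARD('d)) / (14 + 5 * real CARD('d)))" using d by (simp add: pos_le_divide_eq)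
  have "(6 + 4 * real CARD('d)) * (14 + 5 * real CARD('d)) \<le> (50 + 20 * real CARD('d)) * (2 + real CARD('d))" using d by (simp add: algebra_simps)
  then have "((6 + 4 * real CARD('d)) * (14 + 5 * real CARD('d)) - (50 + 20 * real CARD('d)) * (2 + real CARD('d))) / ((2 + real CARD('d)) * (14 + 5 * real CARD('d))) \<le> 0"
    using d by (intro divide_nonpos_pos mult_pos_pos) auto
  then show "(6 + 4 * real CARD('d)) / (2 + real CARD('d)) \<le> ((50 + 20 * real CARD('d)) / (14 + 5 * real CARD('d)))"
    using d by (subst frac_le_eq) auto
qed

lemma rate_inv: assumes "q \<le> ((50 + 20 * real CARD('d)) / (14 + 5 * real CARD('d)))" "0 < \<rho>" shows "(\<lambda>n. (real n * b n powr q) powr (- \<rho>)) \<longlonglongrightarrow> 0"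
  using assms by (intro tendsto_neg_powr rate) auto

text \<open>The linearisation error is n^(-1/2) times this ratio: n^(-1/3) is the root of the
  remainder sum of squares, and 1/b_n is the norm of the kernel derivative.\<close>

lemma rate_third: "(\<lambda>n. real n powr (-1/3) / b n) \<longlonglongrightarrow> 0"
proof (rule Lim_transform_eventually[OF rate_inv[of 3 "1/3"]])
  show "3 \<le> ((50 + 20 * real CARD('d)) / (14 + 5 * real CARD('d)))" using dstar_ge(1) by linarith
  show "\<forall>\<^sub>F n in sequentially. (real n * b n powr 3) powr (- (1/3)) = real n powr (-1/3) / b n"
    using b_small[OF zero_less_one]
  proof eventually_elim
    case (elim n)
    have "(real n * b n powr 3) powr (- (1/3)) = real n powr (- (1/3)) * b n powr (3 * (- (1/3)))"
      by (simp only: powr_mult powr_powr)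
    also have "3 * (- (1/3)) = (-1 :: real)" by simp
    also have "b n powr (-1) = 1 / b n" using elim by (simp add: powr_neg_one)
    finally show ?case by simp
  qed
qed simp

text \<open>The second moment bound for the kernel estimator is of order 1/(n b_n); compared with
  the squared target n^(-1/2) it is this ratio.\<close>

lemma rate_half: "(\<lambda>n. real n powr (-1/2) / b n) \<longlonglongrightarrow> 0"
proof (rule Lim_transform_eventually[OF rate_inv[of 2 "1/2"]])
  show "2 \<le> ((50 + 20 * real CARD('d)) / (14 + 5 * real CARD('d)))" using dstar_ge(1) by linarith
  show "\<forall>\<^sub>F n in sequentially. (real n * b n powr 2) powr (- (1/2)) = real n powr (-1/2) / b n"
    using b_small[OF zero_less_one]
  proof eventually_elim
    case (elim n)
    have "(real n * b n powr 2) powr (- (1/2)) = real n powr (- (1/2)) * b n powr (2 * (- (1/2)))"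
      by (simp only: powr_mult powr_powr)
    also have "2 * (- (1/2)) = (-1 :: real)" by simp
    also have "b n powr (-1) = 1 / b n" using elim by (simp add: powr_neg_one)
    finally show ?case by simp
  qed
qed simp

text \<open>The fourth root of the upper bandwidth condition; it makes the linear bias
  o(n^(-1/4)).\<close>

lemma rate_quarter: "(\<lambda>n. real n powr (1/4) * b n) \<longlonglongrightarrow> 0"
proof -
  have "(\<lambda>n. (real n * b n ^ 4) powr (1/4)) \<longlonglongrightarrow> 0 powr (1/4)"
    by (intro tendsto_powr2[OF b_upper tendsto_const]) (auto intro!: always_eventually)
  then have "(\<lambda>n. (real n * b n ^ 4) powr (1/4)) \<longlonglongrightarrow> 0" by simp
  then show ?thesis
  proof (rule Lim_transform_eventually)
    show "\<forall>\<^sub>F n in sequentially. (real n * b n ^ 4) powr (1/4) = real n powr (1/4) * b n"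
      using b_small[OF zero_less_one]
    proof eventually_elim
      case (elim n)
      have "b n ^ 4 = b n powr 4" using elim by (simp add: powr_numeral)
      then have "(real n * b n ^ 4) powr (1/4) = real n powr (1/4) * b n powr (4 * (1/4))" by (simp only: powr_mult powr_powr)
      then show ?case using elim by simp
    qed
  qed
qed

text \<open>The mesh of the grid, a multiple of b_n^2, is finer than the radius of the ball, of
  order n^(-1/2).\<close>

lemma rate_sq: "(\<lambda>n. sqrt (real n) * (b n)\<^sup>2) \<longlonglongrightarrow> 0"
proof -
  have "(\<lambda>n. sqrt (real n * b n ^ 4)) \<longlonglongrightarrow> sqrt 0" by (intro tendsto_real_sqrt b_upper)
  moreover have "sqrt (real n * b n ^ 4) = sqrt (real n) * (b n)\<^sup>2" for n
  proof -
    have "b n ^ 4 = ((b n)\<^sup>2)\<^sup>2" by (simp flip: power_mult)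
    then have "sqrt (real n * b n ^ 4) = sqrt (real n) * \<bar>(b n)\<^sup>2\<bar>" by (simp only: real_sqrt_mult real_sqrt_abs)
    then show ?thesis by simp
  qed
  ultimately show ?thesis by simp
qed

lemma rate_grid: "(\<lambda>n. 1 / ((sqrt (real n) * (b n)\<^sup>2) ^ CARD('d) * (real n * b n ^ 3))) \<longlonglongrightarrow> 0"
proof (rule Lim_transform_eventually[OF rate_inv[OF dstar_ge(2), of "1 + real CARD('d) / 2"]])
  have d: "real CARD('d) \<ge> 1" by (simp add: Suc_le_eq One_nat_def)
  \<comment> \<open>The power 1 + d/2 of n b^q with q = (6 + 4d)/(2 + d) is n^(1 + d/2) b^(3 + 2d),
    that is, (n^(1/2) b^2)^d times n b^3.\<close>
  have q: "(6 + 4 * real CARD('d)) / (2 + real CARD('d)) * (1 + real CARD('d) / 2) = 3 + 2 * real CARD('d)" using d by (simp add: field_simps)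
  show "\<forall>\<^sub>F n in sequentially. (real n * b n powr ((6 + 4 * real CARD('d)) / (2 + real CARD('d)))) powr - (1 + real CARD('d) / 2) =
        1 / ((sqrt (real n) * (b n)\<^sup>2) ^ CARD('d) * (real n * b n ^ 3))"
    using b_small[OF zero_less_one] eventually_gt_at_top[of 0]
  proof eventually_elim
    case (elim n)
    have b: "0 < b n" and n: "0 < real n" using elim by auto
    have "(real n * b n powr ((6 + 4 * real CARD('d)) / (2 + real CARD('d)))) powr (1 + real CARD('d) / 2) = real n powr (1 + real CARD('d) / 2) * b n powr (3 + 2 * real CARD('d))"
      by (simp only: powr_mult powr_powr q)
    also have "\<dots> = (real n powr (real CARD('d) / 2) * b n powr (2 * real CARD('d))) * (real n * b n powr 3)"
      using b n by (simp add: powr_add)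
    also have "b n powr 3 = b n ^ 3" using b by (simp add: powr_numeral)
    also have "real n powr (real CARD('d) / 2) * b n powr (2 * real CARD('d)) = (sqrt (real n) * (b n)\<^sup>2) ^ CARD('d)"
    proof -
      have "(sqrt (real n) * (b n)\<^sup>2) ^ CARD('d) = (real n powr (1/2) * b n powr 2) powr real CARD('d)"
        using b n by (simp add: powr_realpow powr_half_sqrt powr_numeral)
      also have "\<dots> = real n powr (real CARD('d) / 2) * b n powr (2 * real CARD('d))" by (simp add: powr_mult powr_powr)
      finally show ?thesis by simp
    qed
    finally have "(real n * b n powr ((6 + 4 * real CARD('d)) / (2 + real CARD('d)))) powr (1 + real CARD('d) / 2) = (sqrt (real n) * (b n)\<^sup>2) ^ CARD('d) * (real n * b n ^ 3)" .
    then show ?case by (simp only: powr_minus inverse_eq_divide)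
  qed
  show "0 < 1 + real CARD('d) / 2" using d by simp
qed

lemma nV_average:
  assumes [measurable]: "\<And>i. i \<in> {1..n} \<Longrightarrow> g i \<in> borel_measurable borel"
    and le: "\<And>i. i \<in> {1..n} \<Longrightarrow> nV (g i) \<le> ennreal (c i)" and c0: "\<And>i. i \<in> {1..n} \<Longrightarrow> 0 \<le> c i"
  shows "nV (\<lambda>y. (\<Sum>i=1..n. g i y) / real n) \<le> ennreal ((\<Sum>i=1..n. c i) / real n)"
proof -
  have "nV (\<lambda>y. (\<Sum>i=1..n. g i y) / real n) = nV (\<lambda>y. (1 / real n) * (\<Sum>i=1..n. g i y))" by simp
  also have "\<dots> = ennreal (1 / real n) * nV (\<lambda>y. \<Sum>i=1..n. g i y)" by (subst nV_cmult) auto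
  also have "\<dots> \<le> ennreal (1 / real n) * (\<Sum>i=1..n. ennreal (c i))"
    by (intro mult_left_mono order_trans[OF nV_sum] sum_mono le) auto
  also have "\<dots> = ennreal ((\<Sum>i=1..n. c i) / real n)"
  proof -
    have "(\<Sum>i=1..n. ennreal (c i)) = ennreal (\<Sum>i=1..n. c i)" by (rule sum_ennreal) (rule c0)
    then show ?thesis using sum_nonneg[of "{1..n}" c] c0 by (simp add: ennreal_mult[symmetric])
  qed
  finally show ?thesis .
qed

text \<open>Truncating at $n^{9/20}$ changes nothing with high probability, since the moment of order $5/2$
  makes the maximum of the gradients $o_p(n^{2/5})$, and it keeps the shifts $\dot r_i\cdot s$ negligible for $|s| \le Cn^{-1/2}$.\<close>

definition tr :: "nat \<Rightarrow> (nat \<Rightarrow> real) \<Rightarrow> real^'d" where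
  "tr n x = (if norm (r_dot \<theta> x) \<le> real n powr (9/20) then r_dot \<theta> x else 0)"

lemma tr_measurable[measurable]: "tr n \<in> borel_measurable LS" unfolding tr_def by measurable
lemma tr_le: "norm (tr n x) \<le> real n powr (9/20)" "norm (tr n x) \<le> norm (r_dot \<theta> x)" by (auto simp: tr_def)

text \<open>One coordinate of the derivative of a kernel term with respect to the shift, with the
  gradient truncated. \<open>mart\<close> is its average, centred by the conditional mean given the
  covariates.\<close>

definition score :: "nat \<Rightarrow> real^'d \<Rightarrow> 'd \<Rightarrow> real \<Rightarrow> (nat \<Rightarrow> real) \<times> real \<Rightarrow> real" where
  "score n s j y z = kb1 (b n) (y - snd z + tr n (fst z) \<bullet> s) * tr n (fst z) $ j"

definition mart :: "nat \<Rightarrow> real^'d \<Rightarrow> 'd \<Rightarrow> 'a \<Rightarrow> real \<Rightarrow> real" where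
  "mart n s j \<omega> y = (\<Sum>i=1..n. score n s j y (Lg i \<omega>, eps i \<omega>) - (\<integral>e. score n s j y (Lg i \<omega>, e) \<partial>F)) / real n"

lemma score_measurable: "case_prod (score n s j) \<in> borel_measurable (borel \<Otimes>\<^sub>M (LS \<Otimes>\<^sub>M borel))"
proof -
  have [measurable]: "(\<lambda>x. tr n x $ j) \<in> borel_measurable LS"
    by (rule measurable_compose[OF tr_measurable]) (intro borel_measurable_continuous_onI continuous_intros)
  show ?thesis unfolding score_def case_prod_unfold by measurable
qed

lemma score_bound: "1 \<le> n \<Longrightarrow> \<bar>score n s j y z\<bar> \<le> KK / (b n)\<^sup>2 * real n powr (9/20)"
  unfolding score_def abs_mult using KK(1) b_pos[of n]
  by (intro mult_mono kb1_bound order_trans[OF component_le_norm_cart tr_le(1)]) auto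

lemma gd_sq_times:
  fixes u :: "real \<Rightarrow> real"
  assumes "integrable F u" "\<And>y. 0 \<le> u y" and [measurable]: "u \<in> borel_measurable borel"
  shows "\<exists>m\<ge>0. (\<integral>\<^sup>+\<omega>. ennreal ((norm (gd 1 \<omega>))\<^sup>2 * u (eps 1 \<omega>)) \<partial>M) = ennreal m"
proof -
  have "(\<integral>\<^sup>+\<omega>. ennreal ((norm (gd 1 \<omega>))\<^sup>2 * u (eps 1 \<omega>)) \<partial>M)
     = (\<integral>\<^sup>+\<omega>. (\<lambda>z. ennreal ((norm (r_dot \<theta> (fst z)))\<^sup>2) * ennreal (u (snd z))) (Lg 1 \<omega>, eps 1 \<omega>) \<partial>M)"
    by (intro nn_integral_cong) (simp add: gd_def assms(2) ennreal_mult)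
  also have "\<dots> = (\<integral>\<^sup>+\<omega>. \<integral>\<^sup>+e. (\<lambda>z. ennreal ((norm (r_dot \<theta> (fst z)))\<^sup>2) * ennreal (u (snd z))) (Lg 1 \<omega>, e) \<partial>F \<partial>M)"
    by (rule nn_integral_Lg_eps) auto
  also have "\<dots> = (\<integral>\<^sup>+\<omega>. ennreal ((norm (gd 1 \<omega>))\<^sup>2) * (\<integral>\<^sup>+e. ennreal (u e) \<partial>F) \<partial>M)"
    by (intro nn_integral_cong) (simp add: nn_integral_cmult gd_def)
  also have "\<dots> = (\<integral>\<^sup>+\<omega>. ennreal ((norm (gd 1 \<omega>))\<^sup>2) \<partial>M) * (\<integral>\<^sup>+e. ennreal (u e) \<partial>F)"
    by (rule nn_integral_multc) simp
  also have "\<dots> < \<infinity>"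
    using gd_sq assms(1,2) by (simp add: integrable_iff_bounded ennreal_mult_less_top)
  finally show ?thesis by (cases "\<integral>\<^sup>+\<omega>. ennreal ((norm (gd 1 \<omega>))\<^sup>2 * u (eps 1 \<omega>)) \<partial>M") auto
qed

text \<open>The factor b^(-3) is the weighted integral of the squared kernel derivative,
  \<open>w_kb1_sq\<close>; independence separates gradient and weight. The condition on
  \<open>s\<close> keeps truncated shifts within [-1,1]. One constant serves all n, s and j, as the
  sum over the grid demands.\<close>

lemma mart_bound:
  "\<exists>C\<ge>0. \<forall>n s j. 1 \<le> n \<longrightarrow> b n \<le> 1 \<longrightarrow> real n powr (9/20) * norm s \<le> 1 \<longrightarrow>
     (\<integral>\<^sup>+\<omega>. \<integral>\<^sup>+y. ennreal (w y * (mart n s j \<omega> y)\<^sup>2) \<partial>lborel \<partial>M) \<le> ennreal (C / (real n * b n ^ 3))"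
proof -
  obtain m where m: "m \<ge> 0" "(\<integral>\<^sup>+\<omega>. ennreal ((norm (gd 1 \<omega>))\<^sup>2 * w (eps 1 \<omega>)) \<partial>M) = ennreal m"
    using gd_sq_times[OF w_F w_nonneg] by auto
  define C where "C = 2 * KK\<^sup>2 * cs * m"
  show ?thesis
  proof (intro exI[of _ C] conjI allI impI)
    show "C \<ge> 0" using m cs(1) by (simp add: C_def)
    fix n and s :: "real^'d" and j :: 'd assume n: "1 \<le> n" and b1: "b n \<le> 1" and ns: "real n powr (9/20) * norm s \<le> 1"
    have b0: "0 < b n" using b_pos n by simp
    have "(\<integral>\<^sup>+\<omega>. \<integral>\<^sup>+y. ennreal (w y * (mart n s j \<omega> y)\<^sup>2) \<partial>lborel \<partial>M)
      \<le> ennreal (1 / real n) * (\<integral>\<^sup>+\<omega>. \<integral>\<^sup>+y. ennreal (w y * (score n s j y (Lg 1 \<omega>, eps 1 \<omega>))\<^sup>2) \<partial>lborel \<partial>M)"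
      unfolding mart_def
      by (rule martingale_weighted(2)[OF score_measurable score_bound[OF n] w_measurable w_nonneg n])
    also have "\<dots> \<le> ennreal (1 / real n) * (\<integral>\<^sup>+\<omega>. ennreal (2 * KK\<^sup>2 * cs / b n ^ 3) * ennreal ((norm (gd 1 \<omega>))\<^sup>2 * w (eps 1 \<omega>)) \<partial>M)"
    proof (rule mult_left_mono[OF nn_integral_mono])
      fix \<omega>
      let ?t = "tr n (Lg 1 \<omega>)"
      have t1: "\<bar>?t \<bullet> s\<bar> \<le> 1"
      proof -
        have "\<bar>?t \<bullet> s\<bar> \<le> norm ?t * norm s" by (rule Cauchy_Schwarz_ineq2)
        also have "\<dots> \<le> real n powr (9/20) * norm s" by (intro mult_right_mono tr_le) auto
        finally show ?thesis using ns by linarith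
      qed
      have "(\<integral>\<^sup>+y. ennreal (w y * (score n s j y (Lg 1 \<omega>, eps 1 \<omega>))\<^sup>2) \<partial>lborel)
        = (\<integral>\<^sup>+y. ennreal ((?t $ j)\<^sup>2) * ennreal (w y * (kb1 (b n) (y - eps 1 \<omega> + ?t \<bullet> s))\<^sup>2) \<partial>lborel)"
        by (intro nn_integral_cong) (simp add: score_def power_mult_distrib ennreal_mult[symmetric] w_nonneg mult_ac)
      also have "\<dots> = ennreal ((?t $ j)\<^sup>2) * (\<integral>\<^sup>+y. ennreal (w y * (kb1 (b n) (y - eps 1 \<omega> + ?t \<bullet> s))\<^sup>2) \<partial>lborel)"
        by (rule nn_integral_cmult) measurable
      also have "\<dots> \<le> ennreal ((norm (gd 1 \<omega>))\<^sup>2) * ennreal (2 * KK\<^sup>2 * cs * w (eps 1 \<omega>) / b n ^ 3)"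
      proof (intro mult_mono ennreal_leI w_kb1_sq b0 b1 t1)
        have "\<bar>?t $ j\<bar> \<le> norm (gd 1 \<omega>)" using component_le_norm_cart[of ?t j] tr_le(2)[of n "Lg 1 \<omega>"] by (simp add: gd_def)
        then show "(?t $ j)\<^sup>2 \<le> (norm (gd 1 \<omega>))\<^sup>2" by (metis abs_ge_zero power2_abs power_mono)
      qed auto
      also have "\<dots> = ennreal (2 * KK\<^sup>2 * cs / b n ^ 3) * ennreal ((norm (gd 1 \<omega>))\<^sup>2 * w (eps 1 \<omega>))"
        using cs(1) b0 w_nonneg[of "eps 1 \<omega>"] by (simp add: ennreal_mult[symmetric] mult_ac)
      finally show "(\<integral>\<^sup>+y. ennreal (w y * (score n s j y (Lg 1 \<omega>, eps 1 \<omega>))\<^sup>2) \<partial>lborel)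
         \<le> ennreal (2 * KK\<^sup>2 * cs / b n ^ 3) * ennreal ((norm (gd 1 \<omega>))\<^sup>2 * w (eps 1 \<omega>))" .
    qed simp
    also have "\<dots> = ennreal (1 / real n) * (ennreal (2 * KK\<^sup>2 * cs / b n ^ 3) * ennreal m)"
      by (subst nn_integral_cmult) (auto simp: m(2))
    also have "\<dots> = ennreal (C / (real n * b n ^ 3))"
      using m(1) cs(1) b0 n by (simp add: ennreal_mult[symmetric] C_def mult_ac)
    finally show "(\<integral>\<^sup>+\<omega>. \<integral>\<^sup>+y. ennreal (w y * (mart n s j \<omega> y)\<^sup>2) \<partial>lborel \<partial>M) \<le> ennreal (C / (real n * b n ^ 3))" .
  qed
qed

lemma mart_measurable: assumes "1 \<le> n"
  shows "(\<lambda>\<omega>. \<integral>\<^sup>+y. ennreal (w y * (mart n s j \<omega> y)\<^sup>2) \<partial>lborel) \<in> borel_measurable M"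
    and "\<omega> \<in> space M \<Longrightarrow> mart n s j \<omega> \<in> borel_measurable borel"
proof -
  have m: "case_prod (mart n s j) \<in> borel_measurable (M \<Otimes>\<^sub>M borel)"
    unfolding mart_def[abs_def] by (rule martingale_weighted(1)[OF score_measurable score_bound[OF assms] w_measurable w_nonneg assms])
  then have [measurable]: "case_prod (mart n s j) \<in> borel_measurable (M \<Otimes>\<^sub>M lborel)" by (simp cong: measurable_cong_sets)
  show "(\<lambda>\<omega>. \<integral>\<^sup>+y. ennreal (w y * (mart n s j \<omega> y)\<^sup>2) \<partial>lborel) \<in> borel_measurable M" by measurable
  show "\<omega> \<in> space M \<Longrightarrow> mart n s j \<omega> \<in> borel_measurable borel"
    using measurable_compose[OF measurable_Pair1' m] by simp
qed

text \<open>The grid has $O((\sqrt n\,b_n^2)^{-d})$ points and Chebyshev's inequality costs $O(1/(nb_n^3))$ at each of them;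
  the lower bound on the bandwidth makes the product vanish.\<close>

lemma mart_grid:
  assumes "C > 0" "\<eta>0 > 0" "z > 0" "e > 0"
  shows "\<exists>G :: nat \<Rightarrow> (real^'d) set. (\<forall>n\<ge>1. \<forall>s. norm s \<le> C * real n powr (-1/2) \<longrightarrow> (\<exists>g\<in>G n. norm (s - g) \<le> \<eta>0 * (b n)\<^sup>2))
     \<and> mostly M e (\<lambda>n \<omega>. \<forall>g\<in>G n. norm g \<le> (C + 1) * real n powr (-1/2) \<longrightarrow> (\<forall>j. (\<integral>\<^sup>+y. ennreal (w y * (mart n g j \<omega> y)\<^sup>2) \<partial>lborel) \<le> ennreal z))"
proof -
  have "\<exists>G :: (real^'d) set. finite G \<and> card G \<le> (2 * nat \<lceil>(C * real n powr (-1/2)) * real CARD('d) / (\<eta>0 * (b n)\<^sup>2)\<rceil> + 3) ^ CARD('d) \<and>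
     (\<forall>s. norm s \<le> C * real n powr (-1/2) \<longrightarrow> (\<exists>g\<in>G. norm (s - g) \<le> \<eta>0 * (b n)\<^sup>2))" if "n \<ge> 1" for n
    by (rule finite_cover) (use assms b_pos[OF that] in auto)
  then obtain G :: "nat \<Rightarrow> (real^'d) set" where G: "\<And>n. n \<ge> 1 \<Longrightarrow> finite (G n)"
     "\<And>n. n \<ge> 1 \<Longrightarrow> card (G n) \<le> (2 * nat \<lceil>(C * real n powr (-1/2)) * real CARD('d) / (\<eta>0 * (b n)\<^sup>2)\<rceil> + 3) ^ CARD('d)"
     "\<And>n s. n \<ge> 1 \<Longrightarrow> norm s \<le> C * real n powr (-1/2) \<Longrightarrow> \<exists>g\<in>G n. norm (s - g) \<le> \<eta>0 * (b n)\<^sup>2"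
    by metis
  obtain Cm where Cm: "Cm \<ge> 0" "\<And>n s j. 1 \<le> n \<Longrightarrow> b n \<le> 1 \<Longrightarrow> real n powr (9/20) * norm s \<le> 1 \<Longrightarrow>
     (\<integral>\<^sup>+\<omega>. \<integral>\<^sup>+y. ennreal (w y * (mart n s j \<omega> y)\<^sup>2) \<partial>lborel \<partial>M) \<le> ennreal (Cm / (real n * b n ^ 3))"
    using mart_bound by blast
  \<comment> \<open>Grid points outside a slightly larger ball are dropped, since the second moment
    bound is for small shifts only. The set is empty at n = 0, so that measurability holds for every
    n.\<close>
  define H where "H n = (if n = 0 then {} else {g \<in> G n. norm g \<le> (C + 1) * real n powr (-1/2)})" for n
  have Hfin: "finite (H n)" for n using G(1)[of n] by (auto simp: H_def)
  have HG: "card (H n) \<le> card (G n)" if "n \<ge> 1" for n using that G(1)[of n] by (auto simp: H_def intro!: card_mono)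
  define Z where "Z n \<omega> = (\<Sum>g\<in>H n. \<Sum>j\<in>UNIV. \<integral>\<^sup>+y. ennreal (w y * (mart n g j \<omega> y)\<^sup>2) \<partial>lborel)" for n \<omega>
  have Hn: "g \<in> H n \<Longrightarrow> 1 \<le> n" for g n by (cases n) (auto simp: H_def)
  have Zm: "Z n \<in> borel_measurable M" for n
    unfolding Z_def by (intro borel_measurable_sum mart_measurable(1) Hn)
  \<comment> \<open>With x the radius divided by the coordinate spacing, each coordinate takes at
    most 2x + 5 values; as n^(1/2) b^2 is eventually below 1, the 5 is absorbed into the leading
    order.\<close>
  define A where "A = 2 * (C * real CARD('d) / \<eta>0) + 5"
  have d: "real CARD('d) \<ge> 1" by (simp add: Suc_le_eq One_nat_def)
  have A0: "A \<ge> 0" using assms by (simp add: A_def)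
  have EZ: "\<forall>\<^sub>F n in sequentially. (\<integral>\<^sup>+\<omega>. Z n \<omega> \<partial>M) \<le> ennreal (A ^ CARD('d) * real CARD('d) * Cm * (1 / ((sqrt (real n) * (b n)\<^sup>2) ^ CARD('d) * (real n * b n ^ 3))))"
  proof -
    have "(\<lambda>n. (C + 1) * real n powr (-1/20)) \<longlonglongrightarrow> (C + 1) * 0"
      by (intro tendsto_intros tendsto_neg_powr filterlim_real_sequentially) simp
    then have "\<forall>\<^sub>F n in sequentially. (C + 1) * real n powr (-1/20) < 1" by (intro order_tendstoD) auto
    moreover have "\<forall>\<^sub>F n in sequentially. sqrt (real n) * (b n)\<^sup>2 < 1" using rate_sq by (intro order_tendstoD) auto
    ultimately show ?thesis
      using b_small[OF zero_less_one] eventually_ge_at_top[of 1]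
    proof eventually_elim
      case (elim n)
      have n: "1 \<le> n" and b0: "0 < b n" "b n < 1" using elim by auto
      let ?q = "sqrt (real n) * (b n)\<^sup>2"
      have q: "0 < ?q" "?q < 1" using n b0 elim by auto
      have gn: "real n powr (9/20) * norm g \<le> 1" if "g \<in> H n" for g
      proof -
        have "norm g \<le> (C + 1) * real n powr (-1/2)" using that n by (auto simp: H_def)
        then have "real n powr (9/20) * norm g \<le> real n powr (9/20) * ((C + 1) * real n powr (-1/2))" by (intro mult_left_mono) auto
        also have "\<dots> = (C + 1) * (real n powr (9/20) * real n powr (-1/2))" by (simp add: mult_ac)
        also have "real n powr (9/20) * real n powr (-1/2) = real n powr (-1/20)" by (simp only: powr_add[symmetric]) simp
        finally show ?thesis using elim by linarith
      qed
      have "(\<integral>\<^sup>+\<omega>. Z n \<omega> \<partial>M) = (\<Sum>g\<in>H n. \<Sum>j\<in>UNIV. \<integral>\<^sup>+\<omega>. \<integral>\<^sup>+y. ennreal (w y * (mart n g j \<omega> y)\<^sup>2) \<partial>lborel \<partial>M)"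
        unfolding Z_def using n
        by (subst nn_integral_sum, (intro borel_measurable_sum mart_measurable(1), simp), intro sum.cong refl, subst nn_integral_sum)
          (auto intro: mart_measurable(1))
      also have "\<dots> \<le> (\<Sum>g\<in>H n. \<Sum>j\<in>(UNIV :: 'd set). ennreal (Cm / (real n * b n ^ 3)))"
        using n b0 by (intro sum_mono Cm gn) auto
      also have "\<dots> = ennreal (real (card (H n)) * real CARD('d) * (Cm / (real n * b n ^ 3)))"
        using Cm(1) n b0 by (simp only: sum_constant ennreal_of_nat_eq_real_of_nat mult.assoc) (simp add: ennreal_mult[symmetric])
      also have "\<dots> \<le> ennreal ((A / ?q) ^ CARD('d) * real CARD('d) * (Cm / (real n * b n ^ 3)))"
      proof (intro ennreal_leI mult_right_mono)
        define x where "x = (C * real n powr (-1/2)) * real CARD('d) / (\<eta>0 * (b n)\<^sup>2)"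
        have xq: "x = (C * real CARD('d) / \<eta>0) / ?q" unfolding x_def powr_neg_half by simp
        have x0: "x \<ge> 0" unfolding xq using assms q by simp
        have "real (2 * nat \<lceil>x\<rceil> + 3) \<le> 2 * x + 5" using x0 by (simp add: ceiling_correct) linarith
        also have "5 \<le> 5 / ?q" using q by (simp add: le_divide_eq)
        then have "2 * x + 5 \<le> 2 * x + 5 / ?q" by simp
        also have "\<dots> = A / ?q" unfolding xq A_def by (simp only: add_divide_distrib times_divide_eq_right)
        finally have "real ((2 * nat \<lceil>x\<rceil> + 3) ^ CARD('d)) \<le> (A / ?q) ^ CARD('d)"
          by (simp only: of_nat_power) (intro power_mono, auto)
        moreover have "card (H n) \<le> (2 * nat \<lceil>x\<rceil> + 3) ^ CARD('d)" using G(2)[OF n] HG[OF n] unfolding x_def by linarith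
        ultimately show "real (card (H n)) \<le> (A / ?q) ^ CARD('d)" by linarith
      qed (use Cm(1) n b0 in auto)
      also have "(A / ?q) ^ CARD('d) * real CARD('d) * (Cm / (real n * b n ^ 3)) = A ^ CARD('d) * real CARD('d) * Cm * (1 / (?q ^ CARD('d) * (real n * b n ^ 3)))"
        by (simp add: power_divide)
      finally show ?case .
    qed
  qed
  have "(\<lambda>n. A ^ CARD('d) * real CARD('d) * Cm * (1 / ((sqrt (real n) * (b n)\<^sup>2) ^ CARD('d) * (real n * b n ^ 3)))) \<longlonglongrightarrow> A ^ CARD('d) * real CARD('d) * Cm * 0"
    by (intro tendsto_mult tendsto_const rate_grid)
  then have "\<forall>\<^sub>F n in sequentially. A ^ CARD('d) * real CARD('d) * Cm * (1 / ((sqrt (real n) * (b n)\<^sup>2) ^ CARD('d) * (real n * b n ^ 3))) < e * z"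
    using assms by (intro order_tendstoD) auto
  with EZ have "\<forall>\<^sub>F n in sequentially. (\<integral>\<^sup>+\<omega>. Z n \<omega> \<partial>M) \<le> ennreal (e * z)"
    by eventually_elim (erule order_trans, intro ennreal_leI, simp)
  then have "mostly M e (\<lambda>n \<omega>. Z n \<omega> \<le> ennreal z)" using assms by (intro mostly_Markov Zm) auto
  then have "mostly M e (\<lambda>n \<omega>. \<forall>g\<in>G n. norm g \<le> (C + 1) * real n powr (-1/2) \<longrightarrow> (\<forall>j. (\<integral>\<^sup>+y. ennreal (w y * (mart n g j \<omega> y)\<^sup>2) \<partial>lborel) \<le> ennreal z))"
  proof (rule mostly_mono)
    show "\<forall>\<^sub>F n in sequentially. \<forall>\<omega>\<in>space M. Z n \<omega> \<le> ennreal z \<longrightarrow> (\<forall>g\<in>G n. norm g \<le> (C + 1) * real n powr (-1/2) \<longrightarrow> (\<forall>j. (\<integral>\<^sup>+y. ennreal (w y * (mart n g j \<omega> y)\<^sup>2) \<partial>lborel) \<le> ennreal z))"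
      using eventually_ge_at_top[of 1]
    proof (eventually_elim, intro ballI impI allI)
      fix n \<omega> g j assume n: "1 \<le> n" and Z: "Z n \<omega> \<le> ennreal z" and g: "g \<in> G n" "norm g \<le> (C + 1) * real n powr (-1/2)"
      have "(\<integral>\<^sup>+y. ennreal (w y * (mart n g j \<omega> y)\<^sup>2) \<partial>lborel) \<le> (\<Sum>j\<in>UNIV. \<integral>\<^sup>+y. ennreal (w y * (mart n g j \<omega> y)\<^sup>2) \<partial>lborel)"
        by (rule member_le_sum) auto
      also have "\<dots> \<le> Z n \<omega>" unfolding Z_def using g n Hfin[of n]
        by (intro member_le_sum[of g "H n" "\<lambda>g. \<Sum>j\<in>UNIV. \<integral>\<^sup>+y. ennreal (w y * (mart n g j \<omega> y)\<^sup>2) \<partial>lborel"]) (auto simp: H_def)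
      finally show "(\<integral>\<^sup>+y. ennreal (w y * (mart n g j \<omega> y)\<^sup>2) \<partial>lborel) \<le> ennreal z" using Z by (rule order_trans)
    qed
  qed simp
  then show ?thesis using G(3) by blast
qed

end

lemma ennreal_square_le:
  fixes x :: ennreal
  assumes "x\<^sup>2 \<le> ennreal (c\<^sup>2)" "0 \<le> c"
  shows "x \<le> ennreal c"
proof (cases x)
  case (real v)
  then have "v\<^sup>2 \<le> c\<^sup>2" using assms by (simp add: ennreal_power)
  then have "v \<le> c" using assms(2) by (rule power2_le_imp_le)
  then show ?thesis using real by (simp add: ennreal_leI)
next
  case top
  then have "ennreal (c\<^sup>2) = \<top>" using assms(1) by (simp add: top_unique power2_eq_square)
  then show ?thesis by simp
qed

context ar_kde
begin

text \<open>The score average with untruncated gradients, minus its limit. On the event of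
  \<open>max_gd\<close> the truncation changes nothing.\<close>

definition score_dev :: "nat \<Rightarrow> 'a \<Rightarrow> real^'d \<Rightarrow> 'd \<Rightarrow> real \<Rightarrow> real" where
  "score_dev n \<omega> s j y = (\<Sum>i=1..n. kb1 (b n) (y - eps i \<omega> + gd i \<omega> \<bullet> s) * gd i \<omega> $ j) / real n - f' y * \<mu> $ j"

lemma score_dev_measurable[measurable]: "score_dev n \<omega> s j \<in> borel_measurable borel"
  unfolding score_dev_def[abs_def] by measurable

lemma average_gd_nth:
  assumes "\<delta> > 0" "e > 0"
  shows "mostly M e (\<lambda>n \<omega>. \<forall>j. \<bar>(\<Sum>i=1..n. gd i \<omega> $ j) / real n - \<mu> $ j\<bar> \<le> \<delta>)"
proof -
  define e1 where "e1 = e / real CARD('d)"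
  have e1: "e1 > 0" "real CARD('d) * e1 = e" using assms by (auto simp: e1_def)
  have "mostly M e1 (\<lambda>n \<omega>. \<bar>(\<Sum>i=1..n. gd i \<omega> $ j) / real n - \<mu> $ j\<bar> \<le> \<delta>)" for j
  proof -
    define G where "G z = r_dot \<theta> (fst z) $ j" for z :: "(nat \<Rightarrow> real) \<times> real"
    have nth: "(\<lambda>v::real^'d. v $ j) \<in> borel_measurable borel" by (intro borel_measurable_continuous_onI continuous_intros)
    have Gm: "G \<in> borel_measurable (LS \<Otimes>\<^sub>M borel)"
      unfolding G_def by (rule measurable_compose[OF _ nth]) measurable
    have "integrable M (\<lambda>\<omega>. gd 1 \<omega> $ j)"
    proof (rule Bochner_Integration.integrable_bound[OF gd_int])
      show "(\<lambda>\<omega>. gd 1 \<omega> $ j) \<in> borel_measurable M" by (rule measurable_compose[OF _ nth]) simp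
      show "AE \<omega> in M. norm (gd 1 \<omega> $ j) \<le> norm (norm (gd 1 \<omega>))" by (intro AE_I2) (simp add: component_le_norm_cart)
    qed
    then have "integrable M (\<lambda>\<omega>. G (Lg 1 \<omega>, eps 1 \<omega>))" by (simp add: G_def gd_def)
    from average_converges[OF Gm this assms(1) e1(1)] show ?thesis
      by (simp add: G_def mu_nth gd_def)
  qed
  then have "mostly M (real (card (UNIV :: 'd set)) * e1) (\<lambda>n \<omega>. \<forall>j\<in>UNIV. \<bar>(\<Sum>i=1..n. gd i \<omega> $ j) / real n - \<mu> $ j\<bar> \<le> \<delta>)"
    using e1 by (intro mostly_finite_ball) auto
  then show ?thesis by (simp add: e1)
qed

lemma tight_gd_V: assumes "e > 0"
  shows "\<exists>K>0. mostly M e (\<lambda>n \<omega>. (\<Sum>i=1..n. (norm (gd i \<omega>))\<^sup>2 * V (eps i \<omega>)) / real n \<le> K)"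
  using average_tight[of "\<lambda>z. (norm (r_dot \<theta> (fst z)))\<^sup>2 * V (snd z)", OF _ _ assms] gd_sq_V by (simp add: gd_def)

lemma tight_gd: assumes "e > 0"
  shows "\<exists>K>0. mostly M e (\<lambda>n \<omega>. (\<Sum>i=1..n. norm (gd i \<omega>)) / real n \<le> K)"
  using average_tight[of "\<lambda>z. norm (r_dot \<theta> (fst z))", OF _ _ assms] gd_int by (simp add: gd_def)

lemma tight_V_sq: assumes "e > 0"
  shows "\<exists>K>0. mostly M e (\<lambda>n \<omega>. (\<Sum>i=1..n. (V (eps i \<omega>))\<^sup>2) / real n \<le> K)"
  using average_tight[of "\<lambda>z. (V (snd z))\<^sup>2", OF _ _ assms] integrable_eps(1)[OF V_sq_F] by simp

text \<open>A pathwise bound in four parts: moving the shift from \<open>s\<close> to a nearby point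
  \<open>g\<close>, the martingale part at \<open>g\<close>, the smoothing bias of the compensator,
  and the error of the average gradient.\<close>

lemma score_dev_bound:
  assumes n: "1 \<le> n" and \<omega>: "\<omega> \<in> space M" and bn: "b n \<le> 1"
    and max: "\<And>i. i \<in> {1..n} \<Longrightarrow> norm (gd i \<omega>) \<le> real n powr (9/20)"
    and s: "real n powr (9/20) * norm s \<le> 1" and g: "real n powr (9/20) * norm g \<le> 1"
    and sg: "norm (s - g) \<le> \<eta>0 * (b n)\<^sup>2"
    and K: "(\<Sum>i=1..n. (norm (gd i \<omega>))\<^sup>2 * V (eps i \<omega>)) / real n \<le> K"
    and K2: "(\<Sum>i=1..n. norm (gd i \<omega>)) / real n \<le> K2" and \<eta>2: "\<eta>2 \<ge> 0"
    and bias: "\<And>a. \<bar>a\<bar> \<le> real n powr (9/20) * norm g \<Longrightarrow> nV (\<lambda>y. (\<integral>e. kb1 (b n) (y - e + a) \<partial>F) - f' y) \<le> ennreal \<eta>2"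
    and av: "\<bar>(\<Sum>i=1..n. gd i \<omega> $ j) / real n - \<mu> $ j\<bar> \<le> \<eta>1" and Bf: "nV f' \<le> ennreal Bf" "Bf \<ge> 0"
    and Z: "(\<integral>\<^sup>+y. ennreal (w y * (mart n g j \<omega> y)\<^sup>2) \<partial>lborel) \<le> ennreal z" and z: "2 / (\<alpha> - 1) * z \<le> \<eta>3\<^sup>2" "0 \<le> \<eta>3" "0 \<le> z"
  shows "nV (score_dev n \<omega> s j) \<le> ennreal (2 * KK * cs * \<eta>0 * K + \<eta>3 + K2 * \<eta>2 + Bf * \<eta>1)"
proof -
  have b0: "0 < b n" using b_pos n by simp
  have trgd: "tr n (Lg i \<omega>) = gd i \<omega>" if "i \<in> {1..n}" for i using max[OF that] by (simp add: tr_def gd_def)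
  have inner_le: "\<bar>gd i \<omega> \<bullet> v\<bar> \<le> real n powr (9/20) * norm v" if "i \<in> {1..n}" for i v
    using order_trans[OF Cauchy_Schwarz_ineq2 mult_right_mono[OF max[OF that] norm_ge_zero]] .
  have nthle: "\<bar>gd i \<omega> $ j\<bar> \<le> norm (gd i \<omega>)" for i by (rule component_le_norm_cart)
  define A where "A y = (\<Sum>i=1..n. gd i \<omega> $ j * (kb1 (b n) (y - eps i \<omega> + gd i \<omega> \<bullet> s) - kb1 (b n) (y - eps i \<omega> + gd i \<omega> \<bullet> g))) / real n" for y
  define c where "c a y = (\<integral>e. kb1 (b n) (y - e + a) \<partial>F)" for a y
  have cm[measurable]: "c a \<in> borel_measurable borel" for a
    unfolding c_def by (intro F.borel_measurable_lebesgue_integral) measurable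
  define Cc where "Cc y = (\<Sum>i=1..n. gd i \<omega> $ j * (c (gd i \<omega> \<bullet> g) y - f' y)) / real n" for y
  define E where "E y = ((\<Sum>i=1..n. gd i \<omega> $ j) / real n - \<mu> $ j) * f' y" for y
  have [measurable]: "A \<in> borel_measurable borel" "Cc \<in> borel_measurable borel" "E \<in> borel_measurable borel"
    unfolding A_def[abs_def] Cc_def[abs_def] E_def[abs_def] by measurable
  have mm[measurable]: "mart n g j \<omega> \<in> borel_measurable borel" by (rule mart_measurable(2)[OF n \<omega>])
  \<comment> \<open>At this sample point no gradient exceeds the truncation level, so
    \<open>mart\<close> can be written with \<open>gd\<close>.\<close>
  have marteq: "mart n g j \<omega> y = (\<Sum>i=1..n. gd i \<omega> $ j * (kb1 (b n) (y - eps i \<omega> + gd i \<omega> \<bullet> g) - c (gd i \<omega> \<bullet> g) y)) / real n" for y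
    unfolding mart_def score_def c_def
    by (intro arg_cong2[where f="(/)"] sum.cong refl) (simp add: trgd right_diff_distrib mult.commute)
  have dec: "score_dev n \<omega> s j = (\<lambda>y. A y + (mart n g j \<omega> y + (Cc y + E y)))"
  proof
    fix y
    have "A y + (mart n g j \<omega> y + Cc y) = (\<Sum>i=1..n. gd i \<omega> $ j * (kb1 (b n) (y - eps i \<omega> + gd i \<omega> \<bullet> s) - f' y)) / real n"
      unfolding A_def marteq Cc_def add_divide_distrib[symmetric] sum.distrib[symmetric]
      by (intro arg_cong2[where f="(/)"] sum.cong refl) (simp add: algebra_simps)
    also have "\<dots> = (\<Sum>i=1..n. kb1 (b n) (y - eps i \<omega> + gd i \<omega> \<bullet> s) * gd i \<omega> $ j) / real n - f' y * ((\<Sum>i=1..n. gd i \<omega> $ j) / real n)"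
      by (simp add: right_diff_distrib sum_subtractf diff_divide_distrib sum_distrib_left mult.commute)
    finally show "score_dev n \<omega> s j y = A y + (mart n g j \<omega> y + (Cc y + E y))"
      by (simp add: score_dev_def E_def algebra_simps)
  qed
  have nA: "nV A \<le> ennreal (2 * KK * cs * \<eta>0 * K)"
  proof -
    have "nV A \<le> ennreal ((\<Sum>i=1..n. 2 * KK * cs * \<eta>0 * ((norm (gd i \<omega>))\<^sup>2 * V (eps i \<omega>))) / real n)"
      unfolding A_def
    proof (rule nV_average)
      fix i assume i: "i \<in> {1..n}"
      have sg0: "0 \<le> \<eta>0"
      proof -
        have "0 \<le> \<eta>0 * (b n)\<^sup>2" using sg norm_ge_zero[of "s - g"] by linarith
        then show ?thesis using b0 by (simp add: zero_le_mult_iff)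
      qed
      have i1: "\<bar>gd i \<omega> \<bullet> s\<bar> \<le> 1" "\<bar>gd i \<omega> \<bullet> g\<bar> \<le> 1" using inner_le[OF i] s g by (meson order_trans)+
      have "nV (\<lambda>y. gd i \<omega> $ j * (kb1 (b n) (y - eps i \<omega> + gd i \<omega> \<bullet> s) - kb1 (b n) (y - eps i \<omega> + gd i \<omega> \<bullet> g)))
        \<le> ennreal \<bar>gd i \<omega> $ j\<bar> * ennreal (2 * KK * cs * V (eps i \<omega>) / (b n)\<^sup>2 * \<bar>gd i \<omega> \<bullet> s - gd i \<omega> \<bullet> g\<bar>)"
        by (subst nV_cmult) (measurable, intro mult_left_mono nV_kb1_diff b0 bn i1 zero_le)
      also have "\<dots> = ennreal (\<bar>gd i \<omega> $ j\<bar> * (2 * KK * cs * V (eps i \<omega>) / (b n)\<^sup>2 * \<bar>gd i \<omega> \<bullet> (s - g)\<bar>))"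
        using KK(1) cs(1) V_nonneg by (simp add: ennreal_mult[symmetric] inner_diff_right)
      also have "\<dots> \<le> ennreal (norm (gd i \<omega>) * (2 * KK * cs * V (eps i \<omega>) / (b n)\<^sup>2 * (norm (gd i \<omega>) * (\<eta>0 * (b n)\<^sup>2))))"
        using KK(1) cs(1) V_nonneg b0 sg nthle
        by (intro ennreal_leI mult_mono order_trans[OF Cauchy_Schwarz_ineq2] mult_nonneg_nonneg divide_nonneg_nonneg) auto
      \<comment> \<open>The mesh cancels the factor b^(-2) contributed by the second kernel
        derivative.\<close>
      also have "\<dots> = ennreal (2 * KK * cs * \<eta>0 * ((norm (gd i \<omega>))\<^sup>2 * V (eps i \<omega>)))"
        using b0 by (simp add: power2_eq_square)  (simp add: mult_ac)
      finally show "nV (\<lambda>y. gd i \<omega> $ j * (kb1 (b n) (y - eps i \<omega> + gd i \<omega> \<bullet> s) - kb1 (b n) (y - eps i \<omega> + gd i \<omega> \<bullet> g)))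
        \<le> ennreal (2 * KK * cs * \<eta>0 * ((norm (gd i \<omega>))\<^sup>2 * V (eps i \<omega>)))" .
      show "0 \<le> 2 * KK * cs * \<eta>0 * ((norm (gd i \<omega>))\<^sup>2 * V (eps i \<omega>))" using KK(1) cs(1) V_nonneg sg0 by auto
    qed measurable
    also have "\<dots> = ennreal (2 * KK * cs * \<eta>0 * ((\<Sum>i=1..n. (norm (gd i \<omega>))\<^sup>2 * V (eps i \<omega>)) / real n))"
      by (simp add: sum_distrib_left)
    also have "\<dots> \<le> ennreal (2 * KK * cs * \<eta>0 * K)"
    proof (intro ennreal_leI mult_left_mono K)
      have "0 \<le> \<eta>0 * (b n)\<^sup>2" using sg norm_ge_zero[of "s - g"] by linarith
      then have "0 \<le> \<eta>0" using b0 by (simp add: zero_le_mult_iff)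
      then show "0 \<le> 2 * KK * cs * \<eta>0" using KK(1) cs(1) by simp
    qed
    finally show ?thesis .
  qed
  have nB: "nV (mart n g j \<omega>) \<le> ennreal \<eta>3"
  proof -
    have "(nV (mart n g j \<omega>))\<^sup>2 \<le> ennreal (2 / (\<alpha> - 1)) * ennreal z"
      by (rule order_trans[OF nV_sq_le[OF mm] mult_left_mono[OF Z]]) simp
    also have "\<dots> = ennreal (2 / (\<alpha> - 1) * z)" by (rule ennreal_mult[symmetric]) (use z(3) \<alpha> in simp_all)
    also have "\<dots> \<le> ennreal (\<eta>3\<^sup>2)" by (rule ennreal_leI[OF z(1)])
    finally show ?thesis by (rule ennreal_square_le) (rule z(2))
  qed
  have nC: "nV Cc \<le> ennreal (K2 * \<eta>2)"
  proof -
    have "nV Cc \<le> ennreal ((\<Sum>i=1..n. norm (gd i \<omega>) * \<eta>2) / real n)"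
      unfolding Cc_def
    proof (rule nV_average)
      fix i assume i: "i \<in> {1..n}"
      have "nV (\<lambda>y. gd i \<omega> $ j * (c (gd i \<omega> \<bullet> g) y - f' y)) \<le> ennreal \<bar>gd i \<omega> $ j\<bar> * ennreal \<eta>2"
        by (subst nV_cmult) (auto intro!: mult_left_mono bias inner_le[OF i] simp: c_def)
      also have "\<dots> \<le> ennreal (norm (gd i \<omega>) * \<eta>2)" using \<eta>2 nthle[of i]
        by (subst ennreal_mult[symmetric]) (auto intro!: ennreal_leI mult_right_mono)
      finally show "nV (\<lambda>y. gd i \<omega> $ j * (c (gd i \<omega> \<bullet> g) y - f' y)) \<le> ennreal (norm (gd i \<omega>) * \<eta>2)" .
    qed (use \<eta>2 in auto)
    also have "\<dots> = ennreal ((\<Sum>i=1..n. norm (gd i \<omega>)) / real n * \<eta>2)" by (simp add: sum_distrib_right)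
    also have "\<dots> \<le> ennreal (K2 * \<eta>2)" by (intro ennreal_leI mult_right_mono K2 \<eta>2)
    finally show ?thesis .
  qed
  have nE: "nV E \<le> ennreal (Bf * \<eta>1)"
  proof -
    have "nV E = ennreal \<bar>(\<Sum>i=1..n. gd i \<omega> $ j) / real n - \<mu> $ j\<bar> * nV f'" unfolding E_def by (rule nV_cmult) simp
    also have "\<dots> \<le> ennreal \<eta>1 * ennreal Bf" using av Bf by (intro mult_mono ennreal_leI) auto
    finally show ?thesis using av Bf(2) by (simp add: ennreal_mult[symmetric] mult.commute)
  qed
  have "nV (score_dev n \<omega> s j) \<le> nV A + (nV (mart n g j \<omega>) + (nV Cc + nV E))"
    unfolding dec by (intro order_trans[OF nV_triangle] add_left_mono) auto
  also have "\<dots> \<le> ennreal (2 * KK * cs * \<eta>0 * K) + (ennreal \<eta>3 + (ennreal (K2 * \<eta>2) + ennreal (Bf * \<eta>1)))"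
    by (intro add_mono nA nB nC nE)
  also have "\<dots> = ennreal (2 * KK * cs * \<eta>0 * K + \<eta>3 + K2 * \<eta>2 + Bf * \<eta>1)"
  proof -
    have "0 \<le> \<eta>0 * (b n)\<^sup>2" using sg norm_ge_zero[of "s - g"] by linarith
    then have "0 \<le> \<eta>0" using b0 by (simp add: zero_le_mult_iff)
    moreover have "0 \<le> K" using K V_nonneg by (intro order_trans[OF _ K] divide_nonneg_nonneg sum_nonneg) auto
    moreover have "0 \<le> K2" by (intro order_trans[OF _ K2] divide_nonneg_nonneg sum_nonneg) auto
    moreover have "0 \<le> \<eta>1" using av by linarith
    ultimately show ?thesis using KK(1) cs(1) z \<eta>2 Bf(2) by (simp add: add.assoc flip: ennreal_plus)
  qed
  finally show ?thesis .
qed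

text \<open>Probability is spent on five events and n is taken large; for each \<open>s\<close>
  there remains \<open>score_dev_bound\<close> with a grid point near \<open>s\<close>.\<close>

lemma score_dev_uniform:
  assumes C: "C > 0" and \<eta>: "\<eta> > 0" and e: "e > 0"
  shows "mostly M e (\<lambda>n \<omega>. \<forall>s. norm s \<le> C * real n powr (-1/2) \<longrightarrow> (\<forall>j. nV (score_dev n \<omega> s j) \<le> ennreal \<eta>))"
proof -
  have e5: "e / 5 > 0" using e by simp
  obtain K where K: "K > 0" "mostly M (e/5) (\<lambda>n \<omega>. (\<Sum>i=1..n. (norm (gd i \<omega>))\<^sup>2 * V (eps i \<omega>)) / real n \<le> K)"
    using tight_gd_V[OF e5] by blast
  obtain K2 where K2: "K2 > 0" "mostly M (e/5) (\<lambda>n \<omega>. (\<Sum>i=1..n. norm (gd i \<omega>)) / real n \<le> K2)"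
    using tight_gd[OF e5] by blast
  obtain Bf where Bf: "nV f' = ennreal Bf" "Bf \<ge> 0" using nVf' by (cases "nV f'") auto
  \<comment> \<open>Each of the four parts is to be at most \<eta>/4; the constants are solved from
    the terms of \<open>score_dev_bound\<close>.\<close>
  define \<eta>0 where "\<eta>0 = \<eta> / (8 * KK * cs * K)"
  have \<eta>0: "\<eta>0 > 0" "2 * KK * cs * \<eta>0 * K = \<eta> / 4" using \<eta> KK(1) cs(1) K(1) by (auto simp: \<eta>0_def field_simps)
  define \<eta>2 where "\<eta>2 = \<eta> / (4 * K2)"
  have \<eta>2: "\<eta>2 > 0" "K2 * \<eta>2 = \<eta> / 4" using \<eta> K2(1) by (auto simp: \<eta>2_def)
  define \<eta>1 where "\<eta>1 = \<eta> / (4 * (Bf + 1))"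
  have \<eta>1: "\<eta>1 > 0" "Bf * \<eta>1 \<le> \<eta> / 4"
  proof -
    show "\<eta>1 > 0" using \<eta> Bf(2) by (simp add: \<eta>1_def)
    then have "Bf * \<eta>1 \<le> (Bf + 1) * \<eta>1" by simp
    also have "\<dots> = \<eta> / 4" using Bf(2) by (simp add: \<eta>1_def field_simps)
    finally show "Bf * \<eta>1 \<le> \<eta> / 4" .
  qed
  \<comment> \<open>This inverts the Cauchy-Schwarz constant 2/(\<alpha> - 1), so that the
    martingale part has norm at most \<eta>/4.\<close>
  define z where "z = (\<eta> / 4)\<^sup>2 * (\<alpha> - 1) / 2"
  have z: "z > 0" "2 / (\<alpha> - 1) * z \<le> (\<eta> / 4)\<^sup>2" using \<eta> \<alpha> by (auto simp: z_def)
  obtain d0 where d0: "d0 > 0" "\<And>\<beta> a. 0 < \<beta> \<Longrightarrow> \<beta> \<le> 1 \<Longrightarrow> \<beta> + \<bar>a\<bar> < d0 \<Longrightarrow> nV (\<lambda>y. (\<integral>e. kb1 \<beta> (y - e + a) \<partial>F) - f' y) \<le> ennreal \<eta>2"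
    using bias1[OF \<eta>2(1)] by blast
  obtain G :: "nat \<Rightarrow> (real^'d) set" where G: "\<And>n s. n \<ge> 1 \<Longrightarrow> norm s \<le> C * real n powr (-1/2) \<Longrightarrow> \<exists>g\<in>G n. norm (s - g) \<le> \<eta>0 * (b n)\<^sup>2"
     and Gm: "mostly M (e/5) (\<lambda>n \<omega>. \<forall>g\<in>G n. norm g \<le> (C + 1) * real n powr (-1/2) \<longrightarrow> (\<forall>j. (\<integral>\<^sup>+y. ennreal (w y * (mart n g j \<omega> y)\<^sup>2) \<partial>lborel) \<le> ennreal z))"
    using mart_grid[OF C \<eta>0(1) z(1) e5] by blast
  note ev = mostly_conj[OF max_gd[OF e5] mostly_conj[OF K(2) mostly_conj[OF K2(2) mostly_conj[OF average_gd_nth[OF \<eta>1(1) e5] Gm]]]]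
  have "mostly M (e/5 + (e/5 + (e/5 + (e/5 + e/5)))) (\<lambda>n \<omega>. (\<forall>i\<in>{1..n}. norm (gd i \<omega>) \<le> real n powr (9/20)) \<and>
     (\<Sum>i=1..n. (norm (gd i \<omega>))\<^sup>2 * V (eps i \<omega>)) / real n \<le> K \<and> (\<Sum>i=1..n. norm (gd i \<omega>)) / real n \<le> K2 \<and>
     (\<forall>j. \<bar>(\<Sum>i=1..n. gd i \<omega> $ j) / real n - \<mu> $ j\<bar> \<le> \<eta>1) \<and>
     (\<forall>g\<in>G n. norm g \<le> (C + 1) * real n powr (-1/2) \<longrightarrow> (\<forall>j. (\<integral>\<^sup>+y. ennreal (w y * (mart n g j \<omega> y)\<^sup>2) \<partial>lborel) \<le> ennreal z)))" (is "mostly M _ ?ev")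
    using e by (intro ev) auto
  note ev = this
  have "(\<lambda>n. (C + 1) * real n powr (-1/20)) \<longlonglongrightarrow> (C + 1) * 0"
    by (intro tendsto_intros tendsto_neg_powr filterlim_real_sequentially) simp
  then have 1: "\<forall>\<^sub>F n in sequentially. (C + 1) * real n powr (-1/20) < min 1 (d0 / 2)" using d0(1) by (intro order_tendstoD) auto
  have 2: "\<forall>\<^sub>F n in sequentially. sqrt (real n) * (b n)\<^sup>2 < 1 / \<eta>0" using rate_sq \<eta>0(1) by (intro order_tendstoD) auto
  have 3: "\<forall>\<^sub>F n in sequentially. 0 < b n \<and> b n < min 1 (d0 / 2)" using d0(1) by (intro b_small) auto
  show ?thesis
  proof (rule mostly_mono[OF ev], use 1 2 3 eventually_ge_at_top[of 1] in \<open>eventually_elim, intro ballI impI allI; (elim conjE)?\<close>)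
    fix n \<omega> and s :: "real^'d" and j :: 'd
    assume a1: "(C + 1) * real n powr (-1/20) < min 1 (d0 / 2)" and a2: "sqrt (real n) * (b n)\<^sup>2 < 1 / \<eta>0"
      and b0: "0 < b n" and b1: "b n < min 1 (d0 / 2)" and n: "1 \<le> n" and \<omega>: "\<omega> \<in> space M" and s: "norm s \<le> C * real n powr (-1/2)"
      and E1: "\<forall>i\<in>{1..n}. norm (gd i \<omega>) \<le> real n powr (9/20)"
      and E2: "(\<Sum>i=1..n. (norm (gd i \<omega>))\<^sup>2 * V (eps i \<omega>)) / real n \<le> K" and E3: "(\<Sum>i=1..n. norm (gd i \<omega>)) / real n \<le> K2"
      and E4: "\<forall>j. \<bar>(\<Sum>i=1..n. gd i \<omega> $ j) / real n - \<mu> $ j\<bar> \<le> \<eta>1"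
      and E5: "\<forall>g\<in>G n. norm g \<le> (C + 1) * real n powr (-1/2) \<longrightarrow> (\<forall>j. (\<integral>\<^sup>+y. ennreal (w y * (mart n g j \<omega> y)\<^sup>2) \<partial>lborel) \<le> ennreal z)"
    obtain g where g: "g \<in> G n" "norm (s - g) \<le> \<eta>0 * (b n)\<^sup>2" using G[OF n s] by blast
    \<comment> \<open>The mesh is below the radius, so the grid point lies in the ball of radius (C
      + 1) n^(-1/2) in which \<open>mart\<close> is controlled.\<close>
    have "\<eta>0 * (b n)\<^sup>2 \<le> real n powr (-1/2)"
      using a2 \<eta>0(1) n unfolding powr_neg_half by (simp add: field_simps)
    moreover have "norm g \<le> norm s + norm (s - g)" by (metis norm_minus_commute norm_triangle_sub)
    ultimately have gC: "norm g \<le> (C + 1) * real n powr (-1/2)" using s g(2) by (simp add: distrib_right)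
    have sC: "norm s \<le> (C + 1) * real n powr (-1/2)" using s by (simp add: distrib_right) (smt (verit) powr_ge_zero)
    have bound: "real n powr (9/20) * norm v < min 1 (d0 / 2)" if "norm v \<le> (C + 1) * real n powr (-1/2)" for v :: "real^'d"
    proof -
      have "real n powr (9/20) * norm v \<le> real n powr (9/20) * ((C + 1) * real n powr (-1/2))" using that by (intro mult_left_mono) auto
      also have "\<dots> = (C + 1) * (real n powr (9/20) * real n powr (-1/2))" by (simp add: mult_ac)
      also have "real n powr (9/20) * real n powr (-1/2) = real n powr (-1/20)" by (simp only: powr_add[symmetric]) simp
      finally show ?thesis using a1 by linarith
    qed
    have "nV (score_dev n \<omega> s j) \<le> ennreal (2 * KK * cs * \<eta>0 * K + \<eta> / 4 + K2 * \<eta>2 + Bf * \<eta>1)"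
    proof (rule score_dev_bound[OF n \<omega> _ _ _ _ g(2) E2 E3])
      show "nV (\<lambda>y. (\<integral>e. kb1 (b n) (y - e + a) \<partial>F) - f' y) \<le> ennreal \<eta>2" if "\<bar>a\<bar> \<le> real n powr (9/20) * norm g" for a
        using bound[OF gC] that b0 b1 by (intro d0(2)) auto
      show "(\<integral>\<^sup>+y. ennreal (w y * (mart n g j \<omega> y)\<^sup>2) \<partial>lborel) \<le> ennreal z" using E5 g(1) gC by blast
      show "real n powr (9/20) * norm s \<le> 1" "real n powr (9/20) * norm g \<le> 1" using bound[OF sC] bound[OF gC] by linarith+
    qed (use E1 E4 b1 \<eta>2(1) Bf z \<eta> in auto)
    also have "\<dots> \<le> ennreal \<eta>" using \<eta>0(2) \<eta>1(2) \<eta>2(2) by (intro ennreal_leI) linarith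
    finally show "nV (score_dev n \<omega> s j) \<le> ennreal \<eta>" .
  qed (use e in auto)
qed

text \<open>The integral form needs the score bound along the whole segment from 0 to
  \<open>\<Delta>\<close>, which is why it was proved for a ball. Expanding the inner product over
  coordinates produces the factor \<open>CARD('d) * norm \<Delta>\<close>.\<close>

lemma linear_expansion:
  assumes n: "1 \<le> n" and s: "\<And>u j. 0 \<le> u \<Longrightarrow> u \<le> 1 \<Longrightarrow> nV (score_dev n \<omega> (u *\<^sub>R \<Delta>) j) \<le> ennreal \<eta>" and \<eta>: "\<eta> \<ge> 0"
  shows "nV (\<lambda>y. (\<Sum>i=1..n. kb (b n) (y - eps i \<omega> + gd i \<omega> \<bullet> \<Delta>)) / real n - (\<Sum>i=1..n. kb (b n) (y - eps i \<omega>)) / real n - f' y * (\<mu> \<bullet> \<Delta>))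
    \<le> ennreal (real CARD('d) * norm \<Delta> * \<eta>)"
proof -
  have b0: "0 < b n" using b_pos n by simp
  have int: "integrable lborel (\<lambda>u. indicator {0..1} u * (a * kb1 (b n) (x + u * a)))" for a x :: real
  proof -
    have "continuous_on {0..1} (\<lambda>u. a * kb1 (b n) (x + u * a))"
      by (intro continuous_intros continuous_on_compose2[OF kb1_cont[OF b0]]) auto
    from borel_integrable_atLeastAtMost'[OF this] show ?thesis by (simp add: set_integrable_def)
  qed
  \<comment> \<open>The derivative along the segment of the shifted estimator at the point
    \<open>u\<close>, minus its limit, assembled from the coordinates of
    \<open>score_dev\<close>.\<close>
  define H where "H u y = (\<Sum>j\<in>UNIV. \<Delta> $ j * score_dev n \<omega> (u *\<^sub>R \<Delta>) j y)" for u y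
  have Heq: "H u y = (\<Sum>i=1..n. (gd i \<omega> \<bullet> \<Delta>) * kb1 (b n) (y - eps i \<omega> + u * (gd i \<omega> \<bullet> \<Delta>))) / real n - f' y * (\<mu> \<bullet> \<Delta>)" for u y
  proof -
    have "H u y = (\<Sum>j\<in>UNIV. \<Delta> $ j * ((\<Sum>i=1..n. kb1 (b n) (y - eps i \<omega> + gd i \<omega> \<bullet> (u *\<^sub>R \<Delta>)) * gd i \<omega> $ j) / real n)) - (\<Sum>j\<in>UNIV. \<Delta> $ j * (f' y * \<mu> $ j))"
      by (simp add: H_def score_dev_def right_diff_distrib sum_subtractf)
    also have "(\<Sum>j\<in>UNIV. \<Delta> $ j * (f' y * \<mu> $ j)) = f' y * (\<mu> \<bullet> \<Delta>)"
      by (simp add: inner_vec_def sum_distrib_left mult_ac)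
    also have "(\<Sum>j\<in>UNIV. \<Delta> $ j * ((\<Sum>i=1..n. kb1 (b n) (y - eps i \<omega> + gd i \<omega> \<bullet> (u *\<^sub>R \<Delta>)) * gd i \<omega> $ j) / real n))
      = (\<Sum>i=1..n. \<Sum>j\<in>UNIV. \<Delta> $ j * (kb1 (b n) (y - eps i \<omega> + gd i \<omega> \<bullet> (u *\<^sub>R \<Delta>)) * gd i \<omega> $ j)) / real n"
      by (subst sum.swap) (simp add: sum_distrib_left sum_divide_distrib)
    also have "\<dots> = (\<Sum>i=1..n. (gd i \<omega> \<bullet> \<Delta>) * kb1 (b n) (y - eps i \<omega> + u * (gd i \<omega> \<bullet> \<Delta>))) / real n"
      by (intro arg_cong2[where f="(/)"] sum.cong refl) (simp add: inner_vec_def sum_distrib_left sum_distrib_right mult_ac)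
    finally show ?thesis .
  qed
  have Hint: "(\<Sum>i=1..n. kb (b n) (y - eps i \<omega> + gd i \<omega> \<bullet> \<Delta>)) / real n - (\<Sum>i=1..n. kb (b n) (y - eps i \<omega>)) / real n - f' y * (\<mu> \<bullet> \<Delta>)
     = (\<integral>u. indicator {0..1} u * H u y \<partial>lborel)" for y
  proof -
    have "(\<integral>u. indicator {0..1} u * H u y \<partial>lborel)
      = (\<integral>u. (\<Sum>i=1..n. indicator {0..1} u * ((gd i \<omega> \<bullet> \<Delta>) * kb1 (b n) (y - eps i \<omega> + u * (gd i \<omega> \<bullet> \<Delta>)))) / real n - indicator {0..1} u * (f' y * (\<mu> \<bullet> \<Delta>)) \<partial>lborel)"
      by (intro Bochner_Integration.integral_cong refl) (simp add: Heq right_diff_distrib sum_distrib_left)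
    also have "\<dots> = (\<integral>u. (\<Sum>i=1..n. indicator {0..1} u * ((gd i \<omega> \<bullet> \<Delta>) * kb1 (b n) (y - eps i \<omega> + u * (gd i \<omega> \<bullet> \<Delta>)))) / real n \<partial>lborel)
       - (\<integral>u. indicator {0..1::real} u * (f' y * (\<mu> \<bullet> \<Delta>)) \<partial>lborel)"
      by (rule Bochner_Integration.integral_diff)
        (intro integrable_divide_zero Bochner_Integration.integrable_sum int, simp)
    also have "(\<integral>u. indicator {0..1::real} u * (f' y * (\<mu> \<bullet> \<Delta>)) \<partial>lborel) = f' y * (\<mu> \<bullet> \<Delta>)" by simp
    also have "(\<integral>u. (\<Sum>i=1..n. indicator {0..1} u * ((gd i \<omega> \<bullet> \<Delta>) * kb1 (b n) (y - eps i \<omega> + u * (gd i \<omega> \<bullet> \<Delta>)))) / real n \<partial>lborel)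
      = (\<Sum>i=1..n. (\<integral>u. indicator {0..1} u * ((gd i \<omega> \<bullet> \<Delta>) * kb1 (b n) (y - eps i \<omega> + u * (gd i \<omega> \<bullet> \<Delta>))) \<partial>lborel)) / real n"
      by (subst integral_divide_zero, subst Bochner_Integration.integral_sum) (auto intro!: int)
    also have "\<dots> = (\<Sum>i=1..n. kb (b n) (y - eps i \<omega> + gd i \<omega> \<bullet> \<Delta>) - kb (b n) (y - eps i \<omega>)) / real n"
      by (intro arg_cong2[where f="(/)"] sum.cong refl C1_increment[OF kb_deriv[OF b0] kb1_cont[OF b0], symmetric])
    finally show ?thesis by (simp add: sum_subtractf diff_divide_distrib)
  qed
  have "nV (\<lambda>y. \<integral>u. indicator {0..1} u * H u y \<partial>lborel) \<le> (\<integral>\<^sup>+u. nV (\<lambda>y. indicator {0..1} u * H u y) \<partial>lborel)"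
    by (rule nV_integral) (auto simp: lborel.sigma_finite_measure_axioms Heq)
  also have "\<dots> \<le> (\<integral>\<^sup>+u. ennreal (real CARD('d) * norm \<Delta> * \<eta>) * indicator {0..1::real} u \<partial>lborel)"
  proof (rule nn_integral_mono)
    fix u :: real
    show "nV (\<lambda>y. indicator {0..1} u * H u y) \<le> ennreal (real CARD('d) * norm \<Delta> * \<eta>) * indicator {0..1} u"
    proof (cases "u \<in> {0..1}")
      case True
      have "nV (H u) \<le> (\<Sum>j\<in>UNIV. nV (\<lambda>y. \<Delta> $ j * score_dev n \<omega> (u *\<^sub>R \<Delta>) j y))"
        unfolding H_def by (rule nV_sum) measurable
      also have "\<dots> \<le> (\<Sum>j\<in>(UNIV :: 'd set). ennreal (norm \<Delta> * \<eta>))"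
      proof (rule sum_mono)
        fix j
        have "nV (\<lambda>y. \<Delta> $ j * score_dev n \<omega> (u *\<^sub>R \<Delta>) j y) \<le> ennreal \<bar>\<Delta> $ j\<bar> * ennreal \<eta>"
          using True s by (subst nV_cmult) (auto intro!: mult_left_mono)
        also have "\<dots> \<le> ennreal (norm \<Delta> * \<eta>)" using \<eta> component_le_norm_cart[of \<Delta> j]
          by (subst ennreal_mult[symmetric]) (auto intro!: ennreal_leI mult_right_mono)
        finally show "nV (\<lambda>y. \<Delta> $ j * score_dev n \<omega> (u *\<^sub>R \<Delta>) j y) \<le> ennreal (norm \<Delta> * \<eta>)" .
      qed
      also have "\<dots> = ennreal (real CARD('d) * norm \<Delta> * \<eta>)"
        using \<eta> by (simp only: sum_constant ennreal_of_nat_eq_real_of_nat) (simp add: ennreal_mult[symmetric] mult.assoc)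
      finally show ?thesis using True by simp
    qed (simp add: vnorm_def)
  qed
  also have "\<dots> = ennreal (real CARD('d) * norm \<Delta> * \<eta>)" by (subst nn_integral_cmult_indicator) auto
  finally show ?thesis unfolding Hint .
qed

definition rem :: "real^'d \<Rightarrow> nat \<Rightarrow> 'a \<Rightarrow> real" where
  "rem \<tau> i \<omega> = r \<tau> (Lg i \<omega>) - r \<theta> (Lg i \<omega>) - gd i \<omega> \<bullet> (\<tau> - \<theta>)"

lemma residual_eq: "1 \<le> i \<Longrightarrow> \<omega> \<in> space M \<Longrightarrow> residual p r X \<tau> \<omega> i = eps i \<omega> - gd i \<omega> \<bullet> (\<tau> - \<theta>) - rem \<tau> i \<omega>"
  using X_eq[of i \<omega>] by (simp add: residual_def rem_def Lg_def)

definition fhat :: "nat \<Rightarrow> 'a \<Rightarrow> real \<Rightarrow> real" where "fhat n \<omega> = kde k (b n) n (\<lambda>i. eps i \<omega>)"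

lemma kde_measurable[measurable]: "kde k \<beta> n e \<in> borel_measurable borel"
  unfolding kde_def[abs_def] by measurable

lemma fhat_measurable[measurable]: "fhat n \<omega> \<in> borel_measurable borel" unfolding fhat_def by measurable

text \<open>The martingale bound again, for kernel terms free of covariates: the weighted second
  moment is of order 1/(n b_n), hence o(n^(-1/2)), and its root has the required order.\<close>

lemma fhat_variance:
  assumes \<eta>: "\<eta> > 0" and e: "e > 0"
  shows "mostly M e (\<lambda>n \<omega>. nV (\<lambda>y. fhat n \<omega> y - (\<integral>e. kb (b n) (y - e) \<partial>F)) \<le> ennreal (\<eta> * real n powr (-1/4)))"
proof -
  define \<Phi> where "\<Phi> n y z = kb (b n) (y - snd z)" for n y and z :: "(nat \<Rightarrow> real) \<times> real"
  define G where "G n \<omega> y = (\<Sum>i=1..n. \<Phi> n y (Lg i \<omega>, eps i \<omega>) - (\<integral>e. \<Phi> n y (Lg i \<omega>, e) \<partial>F)) / real n" for n \<omega> y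
  have Gd: "G n \<omega> y = fhat n \<omega> y - (\<integral>e. kb (b n) (y - e) \<partial>F)" if "1 \<le> n" for n \<omega> y
    using that by (simp add: G_def \<Phi>_def fhat_def kde_def sum_subtractf diff_divide_distrib)
  have \<Phi>m: "case_prod (\<Phi> n) \<in> borel_measurable (borel \<Otimes>\<^sub>M (LS \<Otimes>\<^sub>M borel))" for n
    unfolding \<Phi>_def case_prod_unfold by measurable
  have \<Phi>b: "\<bar>\<Phi> n y z\<bar> \<le> KK / b n" if "1 \<le> n" for n y z
    unfolding \<Phi>_def using b_pos[OF that] by (rule kb_bound)
  obtain m where m: "(\<integral>\<^sup>+e. ennreal (w e) \<partial>F) = ennreal m" "m \<ge> 0"
    using w_F w_nonneg by (cases "\<integral>\<^sup>+e. ennreal (w e) \<partial>F") (auto simp: integrable_iff_bounded)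
  define Cm where "Cm = 2 * KK\<^sup>2 * cs * m"
  have Cm0: "Cm \<ge> 0" using m cs(1) by (simp add: Cm_def)
  define Q where "Q n \<omega> = (\<integral>\<^sup>+y. ennreal (w y * (G n \<omega> y)\<^sup>2) \<partial>lborel)" for n \<omega>
  have Gjm: "case_prod (G n) \<in> borel_measurable (M \<Otimes>\<^sub>M borel)" if "1 \<le> n" for n
    unfolding G_def[abs_def] by (rule martingale_weighted(1)[OF \<Phi>m \<Phi>b[OF that] w_measurable w_nonneg that])
  have Qm: "Q n \<in> borel_measurable M" if "1 \<le> n" for n
  proof -
    have [measurable]: "case_prod (G n) \<in> borel_measurable (M \<Otimes>\<^sub>M lborel)" using Gjm[OF that] by (simp cong: measurable_cong_sets)
    show ?thesis unfolding Q_def by measurable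
  qed
  have EQ: "(\<integral>\<^sup>+\<omega>. Q n \<omega> \<partial>M) \<le> ennreal (Cm / (real n * b n))" if n: "1 \<le> n" and b1: "b n \<le> 1" for n
  proof -
    have b0: "0 < b n" using b_pos n by simp
    have "(\<integral>\<^sup>+\<omega>. Q n \<omega> \<partial>M) \<le> ennreal (1 / real n) * (\<integral>\<^sup>+\<omega>. \<integral>\<^sup>+y. ennreal (w y * (\<Phi> n y (Lg 1 \<omega>, eps 1 \<omega>))\<^sup>2) \<partial>lborel \<partial>M)"
      unfolding Q_def G_def by (rule martingale_weighted(2)[OF \<Phi>m \<Phi>b[OF n] w_measurable w_nonneg n])
    also have "\<dots> \<le> ennreal (1 / real n) * (\<integral>\<^sup>+\<omega>. ennreal (2 * KK\<^sup>2 * cs / b n) * ennreal (w (eps 1 \<omega>)) \<partial>M)"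
    proof (rule mult_left_mono[OF nn_integral_mono])
      fix \<omega>
      have "(\<integral>\<^sup>+y. ennreal (w y * (kb (b n) (y - eps 1 \<omega> + 0))\<^sup>2) \<partial>lborel) \<le> ennreal (2 * KK\<^sup>2 * cs * w (eps 1 \<omega>) / b n)"
        by (rule w_kb_sq) (use b0 b1 in auto)
      also have "\<dots> = ennreal (2 * KK\<^sup>2 * cs / b n) * ennreal (w (eps 1 \<omega>))"
        using cs(1) b0 w_nonneg[of "eps 1 \<omega>"] by (simp add: ennreal_mult[symmetric] mult_ac)
      finally show "(\<integral>\<^sup>+y. ennreal (w y * (\<Phi> n y (Lg 1 \<omega>, eps 1 \<omega>))\<^sup>2) \<partial>lborel) \<le> ennreal (2 * KK\<^sup>2 * cs / b n) * ennreal (w (eps 1 \<omega>))"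
        by (simp add: \<Phi>_def)
    qed simp
    also have "\<dots> = ennreal (1 / real n) * (ennreal (2 * KK\<^sup>2 * cs / b n) * ennreal m)"
      using nn_integral_eps[of 1 "\<lambda>y. ennreal (w y)"] by (subst nn_integral_cmult) (auto simp: m(1))
    also have "\<dots> = ennreal (Cm / (real n * b n))"
      using m(2) cs(1) b0 n by (simp add: ennreal_mult[symmetric] Cm_def mult_ac)
    finally show ?thesis .
  qed
  define z where "z = \<eta>\<^sup>2 * (\<alpha> - 1) / 2"
  have z: "z > 0" "2 / (\<alpha> - 1) * z = \<eta>\<^sup>2" using \<eta> \<alpha> by (auto simp: z_def)
  \<comment> \<open>Scaled to the target order; the value at n = 0 is fixed by hand because the
    martingale bound starts at n = 1.\<close>
  define Z where "Z n \<omega> = (if n = 0 then 0 else ennreal (real n powr (1/2)) * Q n \<omega>)" for n \<omega>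
  have Zm: "Z n \<in> borel_measurable M" for n
    using Qm[of n] by (cases "n = 0") (auto simp: Z_def[abs_def] Suc_le_eq One_nat_def)
  have "mostly M e (\<lambda>n \<omega>. Z n \<omega> \<le> ennreal z)"
  proof (rule mostly_Markov[OF Zm z(1)])
    have "(\<lambda>n. Cm * (real n powr (-1/2) / b n)) \<longlonglongrightarrow> Cm * 0" by (intro tendsto_mult tendsto_const rate_half)
    then have "\<forall>\<^sub>F n in sequentially. Cm * (real n powr (-1/2) / b n) < e * z" using e z by (intro order_tendstoD) auto
    then show "\<forall>\<^sub>F n in sequentially. (\<integral>\<^sup>+\<omega>. Z n \<omega> \<partial>M) \<le> ennreal (e * z)"
      using b_small[OF zero_less_one] eventually_ge_at_top[of 1]
    proof eventually_elim
      case (elim n)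
      have "(\<integral>\<^sup>+\<omega>. Z n \<omega> \<partial>M) = ennreal (real n powr (1/2)) * (\<integral>\<^sup>+\<omega>. Q n \<omega> \<partial>M)"
        using elim(3) Qm[OF elim(3)] by (simp add: Z_def nn_integral_cmult)
      also have "\<dots> \<le> ennreal (real n powr (1/2)) * ennreal (Cm / (real n * b n))"
        using elim by (intro mult_left_mono EQ) auto
      also have "\<dots> = ennreal (Cm * (real n powr (1/2) / real n) / b n)"
        using Cm0 elim by (simp add: ennreal_mult[symmetric] mult_ac)
      also have "real n powr (1/2) / real n = real n powr (-1/2)"
        using elim(3) powr_diff[of "real n" "1/2" 1] by simp
      also have "ennreal (Cm * real n powr (-1/2) / b n) \<le> ennreal (e * z)" using elim(1) by (intro ennreal_leI) simp
      finally show ?case .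
    qed
  qed (use e in simp)
  note ev = this
  show ?thesis
  proof (rule mostly_mono[OF ev], use eventually_ge_at_top[of 1] in \<open>eventually_elim, intro ballI impI\<close>)
    fix n \<omega> assume n: "1 \<le> (n::nat)" and \<omega>: "\<omega> \<in> space M" and Z: "Z n \<omega> \<le> ennreal z"
    have gm: "G n \<omega> \<in> borel_measurable borel" using measurable_compose[OF measurable_Pair1'[OF \<omega>] Gjm[OF n]] by simp
    have np: "real n powr (-1/2) * real n powr (1/2) = 1" using n by (simp add: powr_add[symmetric])
    have "ennreal (real n powr (-1/2)) * (ennreal (real n powr (1/2)) * Q n \<omega>) \<le> ennreal (real n powr (-1/2)) * ennreal z"
      using Z n by (intro mult_left_mono) (auto simp: Z_def)
    then have Q: "Q n \<omega> \<le> ennreal (real n powr (-1/2) * z)"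
      using z(1) np by (simp add: mult.assoc[symmetric] ennreal_mult[symmetric])
    have "(nV (G n \<omega>))\<^sup>2 \<le> ennreal (2 / (\<alpha> - 1)) * ennreal (real n powr (-1/2) * z)"
      by (rule order_trans[OF nV_sq_le[OF gm] mult_left_mono[OF Q[unfolded Q_def]]]) simp
    also have "\<dots> = ennreal (2 / (\<alpha> - 1) * (real n powr (-1/2) * z))" by (rule ennreal_mult[symmetric]) (use z \<alpha> in simp_all)
    also have "2 / (\<alpha> - 1) * (real n powr (-1/2) * z) = (\<eta> * real n powr (-1/4))\<^sup>2"
    proof -
      have "(real n powr (-1/4))\<^sup>2 = real n powr (-1/2)" by (simp add: power2_eq_square powr_add[symmetric])
      moreover have "2 / (\<alpha> - 1) * (real n powr (-1/2) * z) = (2 / (\<alpha> - 1) * z) * real n powr (-1/2)" by simp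
      ultimately show ?thesis unfolding z(2) by (simp add: power_mult_distrib)
    qed
    finally have "nV (G n \<omega>) \<le> ennreal (\<eta> * real n powr (-1/4))" by (rule ennreal_square_le) (use \<eta> in simp)
    then show "nV (\<lambda>y. fhat n \<omega> y - (\<integral>e. kb (b n) (y - e) \<partial>F)) \<le> ennreal (\<eta> * real n powr (-1/4))"
      unfolding Gd[OF n, symmetric] .
  qed simp
qed

end

section \<open>The residual-based estimator\<close>

text \<open>The estimator enters through its rate and pathwise, by substitution into bounds that are
  uniform over a ball.\<close>

locale ar_kde_est = ar_kde M p X eps r \<theta> f \<sigma> V r_dot f' l k \<alpha> b
  for M :: "'a measure" and p :: nat and X :: "int \<Rightarrow> 'a \<Rightarrow> real" and eps :: "nat \<Rightarrow> 'a \<Rightarrow> real"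
    and r :: "real^'d \<Rightarrow> (nat \<Rightarrow> real) \<Rightarrow> real" and \<theta> :: "real^'d" and f :: "real \<Rightarrow> real" and \<sigma> :: real
    and V :: "real \<Rightarrow> real" and r_dot :: "real^'d \<Rightarrow> (nat \<Rightarrow> real) \<Rightarrow> real^'d" and f' l k :: "real \<Rightarrow> real"
    and \<alpha> :: real and b :: "nat \<Rightarrow> real" +
  fixes \<theta>t :: "nat \<Rightarrow> 'a \<Rightarrow> real^'d"
  assumes est_rate: "bigO_prob M (\<lambda>n \<omega>. ennreal (norm (\<theta>t n \<omega> - \<theta>))) (\<lambda>n. real n powr (-1/2))"
begin

definition \<Delta> :: "nat \<Rightarrow> 'a \<Rightarrow> real^'d" where "\<Delta> n \<omega> = \<theta>t n \<omega> - \<theta>"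
definition res :: "nat \<Rightarrow> 'a \<Rightarrow> nat \<Rightarrow> real" where "res n \<omega> = residual p r X (\<theta>t n \<omega>) \<omega>"
definition ft :: "nat \<Rightarrow> 'a \<Rightarrow> real \<Rightarrow> real" where "ft n \<omega> = kde k (b n) n (res n \<omega>)"
definition rm :: "nat \<Rightarrow> nat \<Rightarrow> 'a \<Rightarrow> real" where "rm n i \<omega> = rem (\<theta>t n \<omega>) i \<omega>"

lemma ft_measurable[measurable]: "ft n \<omega> \<in> borel_measurable borel" unfolding ft_def by measurable

lemma res_eq: "i \<in> {1..n} \<Longrightarrow> \<omega> \<in> space M \<Longrightarrow> res n \<omega> i = eps i \<omega> - gd i \<omega> \<bullet> \<Delta> n \<omega> - rm n i \<omega>"
  using residual_eq[of i \<omega>] by (simp add: res_def \<Delta>_def rm_def)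

text \<open>The pathwise facts about the estimation error, the remainders and the gradients, under
  one common constant. On this event the remaining estimates for individual residuals are
  deterministic.\<close>

definition good :: "real \<Rightarrow> nat \<Rightarrow> 'a \<Rightarrow> bool" where
  "good K n \<omega> \<longleftrightarrow> norm (\<Delta> n \<omega>) \<le> K * real n powr (-1/2) \<and> (\<Sum>i=1..n. (rm n i \<omega>)\<^sup>2) \<le> K * real n powr (-2/3)
     \<and> (\<forall>i\<in>{1..n}. norm (gd i \<omega>) \<le> real n powr (9/20)) \<and> (\<Sum>i=1..n. (V (eps i \<omega>))\<^sup>2) / real n \<le> K
     \<and> (\<Sum>i=1..n. (norm (gd i \<omega>))\<^sup>2 * V (eps i \<omega>)) / real n \<le> K"

text \<open>The radius in the remainder condition is taken from the rate of the estimator, so that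
  on the event the estimator is among the values over which the supremum is formed.\<close>

lemma good_mostly: assumes e: "e > 0" shows "\<exists>K>0. mostly M e (good K)"
proof -
  have e5: "e / 5 > 0" using e by simp
  obtain C where C: "C > 0" "mostly M (e/5) (\<lambda>n \<omega>. ennreal (norm (\<theta>t n \<omega> - \<theta>)) \<le> ennreal (C * \<bar>real n powr (-1/2)\<bar>))"
    using bigO_probD[OF est_rate e5] by blast
  let ?S = "\<lambda>n \<omega>. SUP \<tau>\<in>{\<tau>. norm (\<tau> - \<theta>) \<le> C * real n powr (-1/2)}.
             ennreal (\<Sum>i=1..n. (r \<tau> (lag p X (int i - 1) \<omega>) - r \<theta> (lag p X (int i - 1) \<omega>)
                 - r_dot \<theta> (lag p X (int i - 1) \<omega>) \<bullet> (\<tau> - \<theta>))\<^sup>2)"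
  obtain K1 where K1: "K1 > 0" "mostly M (e/5) (\<lambda>n \<omega>. ?S n \<omega> \<le> ennreal (K1 * \<bar>real n powr (-2/3)\<bar>))"
    using bigO_probD[OF r_remainder e5] by blast
  obtain K2 where K2: "K2 > 0" "mostly M (e/5) (\<lambda>n \<omega>. (\<Sum>i=1..n. (V (eps i \<omega>))\<^sup>2) / real n \<le> K2)"
    using tight_V_sq[OF e5] by blast
  obtain K3 where K3: "K3 > 0" "mostly M (e/5) (\<lambda>n \<omega>. (\<Sum>i=1..n. (norm (gd i \<omega>))\<^sup>2 * V (eps i \<omega>)) / real n \<le> K3)"
    using tight_gd_V[OF e5] by blast
  define K where "K = max (max C K1) (max K2 K3)"
  have Kle: "C \<le> K" "K1 \<le> K" "K2 \<le> K" "K3 \<le> K" "K > 0" using C(1) by (auto simp: K_def)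
  note ev = mostly_conj[OF C(2) mostly_conj[OF K1(2) mostly_conj[OF max_gd[OF e5] mostly_conj[OF K2(2) K3(2)]]]]
  have "mostly M e (good K)"
  proof (rule mostly_mono[rotated, OF _ _ ev], (intro always_eventually allI ballI impI; elim conjE))
    fix n \<omega> assume 1: "ennreal (norm (\<theta>t n \<omega> - \<theta>)) \<le> ennreal (C * \<bar>real n powr (-1/2)\<bar>)"
      and 2: "?S n \<omega> \<le> ennreal (K1 * \<bar>real n powr (-2/3)\<bar>)"
      and 3: "\<forall>i\<in>{1..n}. norm (gd i \<omega>) \<le> real n powr (9/20)" and 4: "(\<Sum>i=1..n. (V (eps i \<omega>))\<^sup>2) / real n \<le> K2"
      and 5: "(\<Sum>i=1..n. (norm (gd i \<omega>))\<^sup>2 * V (eps i \<omega>)) / real n \<le> K3"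
    have C': "norm (\<theta>t n \<omega> - \<theta>) \<le> C * real n powr (-1/2)" using 1 C(1) by (simp add: ennreal_le_iff)
    have "ennreal (\<Sum>i=1..n. (rm n i \<omega>)\<^sup>2) \<le> ?S n \<omega>"
      using C' by (intro SUP_upper2[of "\<theta>t n \<omega>"]) (auto simp: rm_def rem_def Lg_def gd_def)
    then have "ennreal (\<Sum>i=1..n. (rm n i \<omega>)\<^sup>2) \<le> ennreal (K1 * \<bar>real n powr (-2/3)\<bar>)" using 2 by (rule order_trans)
    then have R: "(\<Sum>i=1..n. (rm n i \<omega>)\<^sup>2) \<le> K1 * real n powr (-2/3)" using K1(1) by (simp add: ennreal_le_iff)
    have "C * real n powr (-1/2) \<le> K * real n powr (-1/2)" "K1 * real n powr (-2/3) \<le> K * real n powr (-2/3)"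
      using Kle by (auto intro!: mult_right_mono)
    then show "good K n \<omega>" unfolding good_def \<Delta>_def using C' R 3 4 5 Kle by (intro conjI) (auto intro: order_trans)
  qed (use e in auto)
  then show ?thesis using Kle(5) by blast
qed

text \<open>Truncation level times estimation rate: 9/20 - 1/2 = -1/20. The gap below 1/2 is what
  makes all individual shifts vanish uniformly.\<close>

lemma good_inner: assumes "good K n \<omega>" "i \<in> {1..n}" shows "\<bar>gd i \<omega> \<bullet> \<Delta> n \<omega>\<bar> \<le> K * real n powr (-1/20)"
proof -
  have "\<bar>gd i \<omega> \<bullet> \<Delta> n \<omega>\<bar> \<le> norm (gd i \<omega>) * norm (\<Delta> n \<omega>)" by (rule Cauchy_Schwarz_ineq2)
  also have "\<dots> \<le> real n powr (9/20) * (K * real n powr (-1/2))" using assms by (intro mult_mono) (auto simp: good_def)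
  also have "\<dots> = K * (real n powr (9/20) * real n powr (-1/2))" by simp
  also have "real n powr (9/20) * real n powr (-1/2) = real n powr (-1/20)" by (simp only: powr_add[symmetric]) simp
  finally show ?thesis .
qed

text \<open>A single remainder is at most the root of the sum of squares.\<close>

lemma good_rm: assumes "good K n \<omega>" "i \<in> {1..n}" "K > 0" shows "\<bar>rm n i \<omega>\<bar> \<le> sqrt K * real n powr (-1/3)"
proof -
  have "(rm n i \<omega>)\<^sup>2 \<le> (\<Sum>i=1..n. (rm n i \<omega>)\<^sup>2)" using assms(2) by (intro member_le_sum) auto
  also have "\<dots> \<le> K * real n powr (-2/3)" using assms by (simp add: good_def)
  also have "\<dots> = (sqrt K * real n powr (-1/3))\<^sup>2"
  proof -
    have "(real n powr (-1/3))\<^sup>2 = real n powr (-2/3)" unfolding power2_eq_square powr_add[symmetric] by simp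
    then show ?thesis using assms(3) by (simp add: power_mult_distrib)
  qed
  finally show ?thesis using assms(3) by (simp add: abs_le_square_iff[symmetric])
qed

lemma good_close: assumes "\<eta> > 0" "K > 0"
  shows "\<forall>\<^sub>F n in sequentially. \<forall>\<omega>\<in>space M. good K n \<omega> \<longrightarrow> (\<forall>i\<in>{1..n}. \<bar>gd i \<omega> \<bullet> \<Delta> n \<omega>\<bar> \<le> \<eta> \<and> \<bar>rm n i \<omega>\<bar> \<le> \<eta>)"
proof -
  have "(\<lambda>n. K * real n powr (-1/20)) \<longlonglongrightarrow> K * 0" "(\<lambda>n. sqrt K * real n powr (-1/3)) \<longlonglongrightarrow> sqrt K * 0"
    by (intro tendsto_intros tendsto_neg_powr filterlim_real_sequentially, simp)+
  from order_tendstoD(2)[OF this(1), of \<eta>] order_tendstoD(2)[OF this(2), of \<eta>]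
  have "\<forall>\<^sub>F n in sequentially. K * real n powr (-1/20) < \<eta>" "\<forall>\<^sub>F n in sequentially. sqrt K * real n powr (-1/3) < \<eta>"
    using assms by simp_all
  then show ?thesis
  proof (eventually_elim, intro ballI impI)
    fix n \<omega> i assume "K * real n powr (-1/20) < \<eta>" "sqrt K * real n powr (-1/3) < \<eta>" "good K n \<omega>" "i \<in> {1..n}"
    then show "\<bar>gd i \<omega> \<bullet> \<Delta> n \<omega>\<bar> \<le> \<eta> \<and> \<bar>rm n i \<omega>\<bar> \<le> \<eta>"
      using good_inner[of K n \<omega> i] good_rm[of K n \<omega> i] assms by linarith
  qed
qed

lemma CS_sum: fixes x y :: "nat \<Rightarrow> real" assumes "(\<Sum>i\<in>I. (x i)\<^sup>2) \<le> A" "(\<Sum>i\<in>I. (y i)\<^sup>2) \<le> B" "0 \<le> A"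
  shows "(\<Sum>i\<in>I. \<bar>x i * y i\<bar>) \<le> sqrt A * sqrt B"
proof -
  have "(\<Sum>i\<in>I. \<bar>x i\<bar> * \<bar>y i\<bar>)\<^sup>2 \<le> (\<Sum>i\<in>I. \<bar>x i\<bar>\<^sup>2) * (\<Sum>i\<in>I. \<bar>y i\<bar>\<^sup>2)" by (rule Cauchy_Schwarz_ineq_sum)
  also have "\<dots> \<le> A * B" using assms by (intro mult_mono) (auto intro: sum_nonneg)
  finally have "\<bar>\<Sum>i\<in>I. \<bar>x i\<bar> * \<bar>y i\<bar>\<bar> \<le> sqrt (A * B)" by (metis real_sqrt_abs real_sqrt_le_iff)
  then show ?thesis by (simp add: abs_mult real_sqrt_mult)
qed

text \<open>In norm each kernel term moves by at most a multiple of V(eps i) |rm i| / b.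
  Cauchy-Schwarz over i combines the average of V^2 with the sum of squared remainders.\<close>

lemma remainder_bound:
  assumes g: "good K n \<omega>" and K: "K > 0" and n: "1 \<le> n" and \<omega>: "\<omega> \<in> space M" and b1: "b n \<le> 1"
    and c: "\<forall>i\<in>{1..n}. \<bar>gd i \<omega> \<bullet> \<Delta> n \<omega>\<bar> \<le> 1/2 \<and> \<bar>rm n i \<omega>\<bar> \<le> 1/2"
  shows "nV (\<lambda>y. ft n \<omega> y - (\<Sum>i=1..n. kb (b n) (y - eps i \<omega> + gd i \<omega> \<bullet> \<Delta> n \<omega>)) / real n)
    \<le> ennreal (2 * KK * cs * K * (real n powr (-1/2) * (real n powr (-1/3) / b n)))"
proof -
  have b0: "0 < b n" using b_pos n by simp
  have "ft n \<omega> y - (\<Sum>i=1..n. kb (b n) (y - eps i \<omega> + gd i \<omega> \<bullet> \<Delta> n \<omega>)) / real n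
      = (\<Sum>i=1..n. kb (b n) (y - eps i \<omega> + (gd i \<omega> \<bullet> \<Delta> n \<omega> + rm n i \<omega>)) - kb (b n) (y - eps i \<omega> + gd i \<omega> \<bullet> \<Delta> n \<omega>)) / real n" for y
    unfolding ft_def kde_def diff_divide_distrib[symmetric] sum_subtractf[symmetric]
  proof (intro arg_cong2[where f="(/)"] sum.cong refl)
    fix i assume "i \<in> {1..n}"
    then have "y - res n \<omega> i = y - eps i \<omega> + (gd i \<omega> \<bullet> \<Delta> n \<omega> + rm n i \<omega>)" using res_eq[OF _ \<omega>] by simp
    then show "kb (b n) (y - res n \<omega> i) - kb (b n) (y - eps i \<omega> + gd i \<omega> \<bullet> \<Delta> n \<omega>) =
      kb (b n) (y - eps i \<omega> + (gd i \<omega> \<bullet> \<Delta> n \<omega> + rm n i \<omega>)) - kb (b n) (y - eps i \<omega> + gd i \<omega> \<bullet> \<Delta> n \<omega>)" by (simp only:)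
  qed
  then have "nV (\<lambda>y. ft n \<omega> y - (\<Sum>i=1..n. kb (b n) (y - eps i \<omega> + gd i \<omega> \<bullet> \<Delta> n \<omega>)) / real n)
     \<le> ennreal ((\<Sum>i=1..n. 2 * KK * cs / b n * \<bar>V (eps i \<omega>) * rm n i \<omega>\<bar>) / real n)"
  proof (simp only:, intro nV_average)
    fix i assume i: "i \<in> {1..n}"
    have a: "\<bar>gd i \<omega> \<bullet> \<Delta> n \<omega> + rm n i \<omega>\<bar> \<le> 1" "\<bar>gd i \<omega> \<bullet> \<Delta> n \<omega>\<bar> \<le> 1" using c[rule_format, OF i] by linarith+
    have "nV (\<lambda>y. kb (b n) (y - eps i \<omega> + (gd i \<omega> \<bullet> \<Delta> n \<omega> + rm n i \<omega>)) - kb (b n) (y - eps i \<omega> + gd i \<omega> \<bullet> \<Delta> n \<omega>))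
       \<le> ennreal (2 * KK * cs * V (eps i \<omega>) / b n * \<bar>gd i \<omega> \<bullet> \<Delta> n \<omega> + rm n i \<omega> - gd i \<omega> \<bullet> \<Delta> n \<omega>\<bar>)"
      by (rule nV_kb_diff[OF b0 b1 a])
    also have "\<dots> = ennreal (2 * KK * cs / b n * \<bar>V (eps i \<omega>) * rm n i \<omega>\<bar>)" using V_nonneg[of "eps i \<omega>"] by (simp add: abs_mult mult_ac)
    finally show "nV (\<lambda>y. kb (b n) (y - eps i \<omega> + (gd i \<omega> \<bullet> \<Delta> n \<omega> + rm n i \<omega>)) - kb (b n) (y - eps i \<omega> + gd i \<omega> \<bullet> \<Delta> n \<omega>))
       \<le> ennreal (2 * KK * cs / b n * \<bar>V (eps i \<omega>) * rm n i \<omega>\<bar>)" .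
  qed (use KK(1) cs(1) b0 in auto)
  also have "\<dots> = ennreal (2 * KK * cs / b n * (\<Sum>i=1..n. \<bar>V (eps i \<omega>) * rm n i \<omega>\<bar>) / real n)" by (simp add: sum_distrib_left)
  also have "\<dots> \<le> ennreal (2 * KK * cs / b n * (sqrt (K * real n) * sqrt (K * real n powr (-2/3))) / real n)"
  proof (intro ennreal_leI divide_right_mono mult_left_mono CS_sum)
    show "(\<Sum>i=1..n. (V (eps i \<omega>))\<^sup>2) \<le> K * real n" using g n by (simp add: good_def divide_le_eq)
    show "(\<Sum>i=1..n. (rm n i \<omega>)\<^sup>2) \<le> K * real n powr (-2/3)" using g by (simp add: good_def)
  qed (use KK(1) cs(1) b0 K in auto)
  also have "2 * KK * cs / b n * (sqrt (K * real n) * sqrt (K * real n powr (-2/3))) / real n = 2 * KK * cs * K * (real n powr (-1/2) * (real n powr (-1/3) / b n))"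
  proof -
    have s1: "sqrt (K * real n powr (-2/3)) = sqrt K * real n powr (-1/3)"
      using powr_half_sqrt[of "real n powr (-2/3)"] by (simp add: real_sqrt_mult powr_powr)
    have s2: "sqrt (K * real n) / real n = sqrt K * real n powr (-1/2)"
      using n unfolding powr_neg_half real_sqrt_mult by (simp add: real_div_sqrt field_simps)
    have "2 * KK * cs / b n * (sqrt (K * real n) * sqrt (K * real n powr (-2/3))) / real n
      = 2 * KK * cs / b n * ((sqrt (K * real n) / real n) * sqrt (K * real n powr (-2/3)))" by simp
    also have "\<dots> = 2 * KK * cs * (sqrt K * sqrt K) * (real n powr (-1/2) * (real n powr (-1/3) / b n))"
      unfolding s1 s2 by (simp add: mult_ac)
    also have "sqrt K * sqrt K = K" using K by simp
    finally show ?thesis .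
  qed
  finally show ?thesis .
qed

text \<open>Dropping the remainders costs little by \<open>remainder_bound\<close>; what is left is
  linear in the gradients, and the uniform score bound is applied at the multiples u in [0,1] of the
  estimation error.\<close>

lemma ft_expansion:
  assumes \<epsilon>: "\<epsilon> > 0" and e: "e > 0"
  shows "mostly M e (\<lambda>n \<omega>. nV (\<lambda>y. ft n \<omega> y - fhat n \<omega> y - f' y * (\<mu> \<bullet> \<Delta> n \<omega>)) \<le> ennreal (\<epsilon> * real n powr (-1/2)))"
proof -
  have e2: "e / 2 > 0" using e by simp
  obtain K where K: "K > 0" "mostly M (e/2) (good K)" using good_mostly[OF e2] by blast
  define \<eta> where "\<eta> = \<epsilon> / (2 * real CARD('d) * K)"
  have \<eta>: "\<eta> > 0" "real CARD('d) * K * \<eta> = \<epsilon> / 2" using \<epsilon> K(1) by (auto simp: \<eta>_def)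
  have "mostly M (e/2 + e/2) (\<lambda>n \<omega>. good K n \<omega> \<and> (\<forall>s. norm s \<le> K * real n powr (-1/2) \<longrightarrow> (\<forall>j. nV (score_dev n \<omega> s j) \<le> ennreal \<eta>)))"
    using e by (intro mostly_conj K(2) score_dev_uniform[OF K(1) \<eta>(1) e2]) auto
  note ev = this
  have "(\<lambda>n. 2 * KK * cs * K * (real n powr (-1/3) / b n)) \<longlonglongrightarrow> 2 * KK * cs * K * 0" by (intro tendsto_mult tendsto_const rate_third)
  then have 1: "\<forall>\<^sub>F n in sequentially. 2 * KK * cs * K * (real n powr (-1/3) / b n) < \<epsilon> / 2" using \<epsilon> by (intro order_tendstoD) auto
  have h: "(1/2 :: real) > 0" by simp
  show ?thesis
  proof (rule mostly_mono[OF ev], use 1 good_close[OF h K(1)] b_small[OF zero_less_one] eventually_ge_at_top[of 1] in \<open>eventually_elim, intro ballI impI; elim conjE\<close>)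
    fix n \<omega> assume a: "2 * KK * cs * K * (real n powr (-1/3) / b n) < \<epsilon> / 2"
      and gc: "\<forall>\<omega>\<in>space M. good K n \<omega> \<longrightarrow> (\<forall>i\<in>{1..n}. \<bar>gd i \<omega> \<bullet> \<Delta> n \<omega>\<bar> \<le> 1/2 \<and> \<bar>rm n i \<omega>\<bar> \<le> 1/2)"
      and b: "0 < b n" "b n < 1" and n: "1 \<le> n" and \<omega>: "\<omega> \<in> space M" and g: "good K n \<omega>"
      and key: "\<forall>s. norm s \<le> K * real n powr (-1/2) \<longrightarrow> (\<forall>j. nV (score_dev n \<omega> s j) \<le> ennreal \<eta>)"
    define Lin where "Lin y = (\<Sum>i=1..n. kb (b n) (y - eps i \<omega> + gd i \<omega> \<bullet> \<Delta> n \<omega>)) / real n" for y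
    have [measurable]: "Lin \<in> borel_measurable borel" unfolding Lin_def[abs_def] by measurable
    have D: "norm (\<Delta> n \<omega>) \<le> K * real n powr (-1/2)" using g by (simp add: good_def)
    have 1: "nV (\<lambda>y. ft n \<omega> y - Lin y) \<le> ennreal (\<epsilon> / 2 * real n powr (-1/2))"
    proof -
      have "nV (\<lambda>y. ft n \<omega> y - Lin y) \<le> ennreal (2 * KK * cs * K * (real n powr (-1/2) * (real n powr (-1/3) / b n)))"
        unfolding Lin_def using b gc \<omega> g by (intro remainder_bound[OF g K(1) n \<omega>]) auto
      also have "2 * KK * cs * K * (real n powr (-1/2) * (real n powr (-1/3) / b n)) = (2 * KK * cs * K * (real n powr (-1/3) / b n)) * real n powr (-1/2)" by simp
      also have "ennreal \<dots> \<le> ennreal (\<epsilon> / 2 * real n powr (-1/2))" using a by (intro ennreal_leI mult_right_mono) auto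
      finally show ?thesis .
    qed
    have 2: "nV (\<lambda>y. Lin y - fhat n \<omega> y - f' y * (\<mu> \<bullet> \<Delta> n \<omega>)) \<le> ennreal (\<epsilon> / 2 * real n powr (-1/2))"
    proof -
      have "nV (\<lambda>y. Lin y - fhat n \<omega> y - f' y * (\<mu> \<bullet> \<Delta> n \<omega>)) \<le> ennreal (real CARD('d) * norm (\<Delta> n \<omega>) * \<eta>)"
        unfolding Lin_def fhat_def kde_def
      proof (rule linear_expansion[OF n])
        fix u j assume u: "0 \<le> (u::real)" "u \<le> 1"
        have "norm (u *\<^sub>R \<Delta> n \<omega>) \<le> 1 * norm (\<Delta> n \<omega>)" using u by (simp add: mult_left_le_one_le)
        then have "norm (u *\<^sub>R \<Delta> n \<omega>) \<le> K * real n powr (-1/2)" using D by linarith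
        then show "nV (score_dev n \<omega> (u *\<^sub>R \<Delta> n \<omega>) j) \<le> ennreal \<eta>" using key by blast
      qed (use \<eta> in simp)
      also have "\<dots> \<le> ennreal (real CARD('d) * (K * real n powr (-1/2)) * \<eta>)" using D \<eta>(1) by (intro ennreal_leI mult_right_mono mult_left_mono) auto
      also have "real CARD('d) * (K * real n powr (-1/2)) * \<eta> = (real CARD('d) * K * \<eta>) * real n powr (-1/2)" by simp
      finally show ?thesis unfolding \<eta>(2) .
    qed
    have "nV (\<lambda>y. ft n \<omega> y - fhat n \<omega> y - f' y * (\<mu> \<bullet> \<Delta> n \<omega>)) = nV (\<lambda>y. (ft n \<omega> y - Lin y) + (Lin y - fhat n \<omega> y - f' y * (\<mu> \<bullet> \<Delta> n \<omega>)))" by (intro arg_cong[where f=nV] ext) simp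
    also have "\<dots> \<le> ennreal (\<epsilon> / 2 * real n powr (-1/2)) + ennreal (\<epsilon> / 2 * real n powr (-1/2))"
      by (intro order_trans[OF nV_triangle] add_mono 1 2) measurable
    also have "\<dots> = ennreal (\<epsilon> * real n powr (-1/2))" using \<epsilon> by (subst ennreal_plus[symmetric]) (auto simp: algebra_simps)
    finally show "nV (\<lambda>y. ft n \<omega> y - fhat n \<omega> y - f' y * (\<mu> \<bullet> \<Delta> n \<omega>)) \<le> ennreal (\<epsilon> * real n powr (-1/2))" .
  qed simp
qed

text \<open>Four contributions: the expansion error and the drift f' times the estimation error,
  both of smaller order, then the variance and the bias, which determine the scale n^(-1/4).\<close>

lemma ft_consistency:
  assumes \<epsilon>: "\<epsilon> > 0" and e: "e > 0"
  shows "mostly M e (\<lambda>n \<omega>. nV (\<lambda>y. ft n \<omega> y - f y) \<le> ennreal (\<epsilon> * real n powr (-1/4)))"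
proof -
  have e3: "e / 3 > 0" and \<epsilon>4: "\<epsilon> / 4 > 0" using e \<epsilon> by auto
  obtain K where K: "K > 0" "mostly M (e/3) (good K)" using good_mostly[OF e3] by blast
  obtain Bf where Bf: "nV f' = ennreal Bf" "Bf \<ge> 0" using nVf' by (cases "nV f'") auto
  obtain C where C: "C \<ge> 0" "\<And>\<beta>. 0 < \<beta> \<Longrightarrow> \<beta> \<le> 1 \<Longrightarrow> nV (\<lambda>y. (\<integral>e. kb \<beta> (y - e) \<partial>F) - f y) \<le> ennreal (C * \<beta>)" using bias0 by blast
  have "mostly M (e/3 + (e/3 + e/3)) (\<lambda>n \<omega>. good K n \<omega> \<and> nV (\<lambda>y. ft n \<omega> y - fhat n \<omega> y - f' y * (\<mu> \<bullet> \<Delta> n \<omega>)) \<le> ennreal (\<epsilon> / 4 * real n powr (-1/2))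
      \<and> nV (\<lambda>y. fhat n \<omega> y - (\<integral>e. kb (b n) (y - e) \<partial>F)) \<le> ennreal (\<epsilon> / 4 * real n powr (-1/4)))"
    using e by (intro mostly_conj K(2) ft_expansion[OF \<epsilon>4 e3] fhat_variance[OF \<epsilon>4 e3]) auto
  note ev = this
  have "(\<lambda>n. C * (real n powr (1/4) * b n)) \<longlonglongrightarrow> C * 0" by (intro tendsto_mult tendsto_const rate_quarter)
  then have 1: "\<forall>\<^sub>F n in sequentially. C * (real n powr (1/4) * b n) < \<epsilon> / 4" using \<epsilon> by (intro order_tendstoD) auto
  have "(\<lambda>n. Bf * norm \<mu> * K * real n powr (-1/4)) \<longlonglongrightarrow> Bf * norm \<mu> * K * 0"
    by (intro tendsto_intros tendsto_neg_powr filterlim_real_sequentially) simp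
  then have 2: "\<forall>\<^sub>F n in sequentially. Bf * norm \<mu> * K * real n powr (-1/4) < \<epsilon> / 4" using \<epsilon> by (intro order_tendstoD) auto
  show ?thesis
  proof (rule mostly_mono[OF ev], use 1 2 b_small[OF zero_less_one] eventually_ge_at_top[of 1] in \<open>eventually_elim, intro ballI impI; elim conjE\<close>)
    fix n \<omega> assume a1: "C * (real n powr (1/4) * b n) < \<epsilon> / 4" and a2: "Bf * norm \<mu> * K * real n powr (-1/4) < \<epsilon> / 4"
      and b: "0 < b n" "b n < 1" and n: "1 \<le> n" and \<omega>: "\<omega> \<in> space M" and g: "good K n \<omega>"
      and E1: "nV (\<lambda>y. ft n \<omega> y - fhat n \<omega> y - f' y * (\<mu> \<bullet> \<Delta> n \<omega>)) \<le> ennreal (\<epsilon> / 4 * real n powr (-1/2))"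
      and E2: "nV (\<lambda>y. fhat n \<omega> y - (\<integral>e. kb (b n) (y - e) \<partial>F)) \<le> ennreal (\<epsilon> / 4 * real n powr (-1/4))"
    let ?c = "\<lambda>y. \<integral>e. kb (b n) (y - e) \<partial>F"
    have [measurable]: "?c \<in> borel_measurable borel" by (intro F.borel_measurable_lebesgue_integral) measurable
    let ?q = "real n powr (-1/4)"
    \<comment> \<open>Terms of order n^(-1/2) thus have a vanishing factor to spare on the scale
      n^(-1/4).\<close>
    have h: "real n powr (-1/2) = ?q * ?q" by (simp only: powr_add[symmetric]) simp
    have q1: "?q \<le> 1" using powr_mono[of "-1/4" 0 "real n"] n by simp
    have E1': "nV (\<lambda>y. ft n \<omega> y - fhat n \<omega> y - f' y * (\<mu> \<bullet> \<Delta> n \<omega>)) \<le> ennreal (\<epsilon> / 4 * ?q)"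
    proof (rule order_trans[OF E1 ennreal_leI])
      show "\<epsilon> / 4 * real n powr (-1/2) \<le> \<epsilon> / 4 * ?q"
        unfolding h using q1 \<epsilon> by (intro mult_left_mono mult_left_le) auto
    qed
    have E3: "nV (\<lambda>y. f' y * (\<mu> \<bullet> \<Delta> n \<omega>)) \<le> ennreal (\<epsilon> / 4 * ?q)"
    proof -
      have "nV (\<lambda>y. f' y * (\<mu> \<bullet> \<Delta> n \<omega>)) = ennreal \<bar>\<mu> \<bullet> \<Delta> n \<omega>\<bar> * ennreal Bf"
        using nV_cmult[of f' "\<mu> \<bullet> \<Delta> n \<omega>"] Bf by (simp add: mult.commute)
      also have "\<dots> \<le> ennreal (norm \<mu> * (K * real n powr (-1/2))) * ennreal Bf"
        using g by (intro mult_right_mono ennreal_leI order_trans[OF Cauchy_Schwarz_ineq2] mult_left_mono) (auto simp: good_def)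
      also have "\<dots> = ennreal ((Bf * norm \<mu> * K * ?q) * ?q)"
        unfolding h using Bf(2) K(1) by (subst ennreal_mult[symmetric]) (auto simp: mult_ac)
      also have "\<dots> \<le> ennreal (\<epsilon> / 4 * ?q)" using a2 by (intro ennreal_leI mult_right_mono) auto
      finally show ?thesis .
    qed
    have E4: "nV (\<lambda>y. ?c y - f y) \<le> ennreal (\<epsilon> / 4 * ?q)"
    proof -
      have "nV (\<lambda>y. ?c y - f y) \<le> ennreal (C * b n)" using b by (intro C(2)) auto
      also have "C * b n = (C * (real n powr (1/4) * b n)) * ?q"
      proof -
        have "real n powr (1/4) * ?q = 1" using n by (simp add: powr_add[symmetric])
        then show ?thesis by (simp add: mult_ac)
      qed
      also have "ennreal \<dots> \<le> ennreal (\<epsilon> / 4 * ?q)" using a1 by (intro ennreal_leI mult_right_mono) auto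
      finally show ?thesis .
    qed
    have "nV (\<lambda>y. ft n \<omega> y - f y) = nV (\<lambda>y. (ft n \<omega> y - fhat n \<omega> y - f' y * (\<mu> \<bullet> \<Delta> n \<omega>)) + (f' y * (\<mu> \<bullet> \<Delta> n \<omega>) + ((fhat n \<omega> y - ?c y) + (?c y - f y))))" by (intro arg_cong[where f=nV] ext) simp
    also have "\<dots> \<le> ennreal (\<epsilon> / 4 * ?q) + (ennreal (\<epsilon> / 4 * ?q) + (ennreal (\<epsilon> / 4 * ?q) + ennreal (\<epsilon> / 4 * ?q)))"
      by (intro order_trans[OF nV_triangle] add_mono E1' E2 E3 E4) measurable
    also have "\<dots> = ennreal (\<epsilon> * ?q)" using \<epsilon> by (simp add: ennreal_plus[symmetric] del: ennreal_plus)
    finally show "nV (\<lambda>y. ft n \<omega> y - f y) \<le> ennreal (\<epsilon> * real n powr (-1/4))" .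
  qed (use e in simp)
qed

end

section \<open>Empirical likelihood weights\<close>

text \<open>The difference of the two equations is \<open>l' - l\<close> times a sum of nonnegative
  terms, positive unless all \<open>e i\<close> vanish. It identifies the value selected by
  \<open>multiplier\<close> with a root found by continuity.\<close>

lemma valid_multiplier_unique:
  assumes v: "valid_multiplier n e l" "valid_multiplier n e l'" and nz: "(\<Sum>i=1..n. (e i)\<^sup>2) > 0"
  shows "l = l'"
proof -
  have pos: "0 < 1 + l * e i" "0 < 1 + l' * e i" if "i \<in> {1..n}" for i
    using v that by (auto simp: valid_multiplier_def)
  have s: "(\<Sum>i=1..n. e i / (1 + l * e i)) = 0" "(\<Sum>i=1..n. e i / (1 + l' * e i)) = 0"
    using v by (auto simp: valid_multiplier_def)
  have "e i / (1 + l * e i) - e i / (1 + l' * e i) = (l' - l) * ((e i)\<^sup>2 / ((1 + l * e i) * (1 + l' * e i)))" if "i \<in> {1..n}" for i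
    using pos[OF that] by (simp add: diff_frac_eq power2_eq_square algebra_simps)
  then have "(l' - l) * (\<Sum>i=1..n. (e i)\<^sup>2 / ((1 + l * e i) * (1 + l' * e i))) = (\<Sum>i=1..n. e i / (1 + l * e i) - e i / (1 + l' * e i))"
    by (simp add: sum_distrib_left)
  also have "\<dots> = 0" using s by (simp add: sum_subtractf)
  finally have z: "(l' - l) * (\<Sum>i=1..n. (e i)\<^sup>2 / ((1 + l * e i) * (1 + l' * e i))) = 0" .
  have nn: "0 \<le> (e i)\<^sup>2 / ((1 + l * e i) * (1 + l' * e i))" if "i \<in> {1..n}" for i
    using pos[OF that] by (intro divide_nonneg_pos mult_pos_pos) auto
  have "(\<Sum>i=1..n. (e i)\<^sup>2 / ((1 + l * e i) * (1 + l' * e i))) \<noteq> 0"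
  proof
    assume "(\<Sum>i=1..n. (e i)\<^sup>2 / ((1 + l * e i) * (1 + l' * e i))) = 0"
    then have "\<forall>i\<in>{1..n}. (e i)\<^sup>2 / ((1 + l * e i) * (1 + l' * e i)) = 0"
      using nn by (subst (asm) sum_nonneg_eq_0_iff) auto
    then have "\<forall>i\<in>{1..n}. e i = 0" using pos by (metis divide_eq_0_iff less_irrefl mult_eq_0_iff power_eq_0_iff)
    then show False using nz by simp
  qed
  then show ?thesis using z by simp
qed

text \<open>For |t| \<le> L all factors 1 + t e_i lie between 1/2 and 3/2, so the defining sum is
  continuous and changes sign between -L and L. The last bound comes from the second-order expansion
  of the equation at its root, where \<open>Mx\<close> pays for the cubic term.\<close>

lemma multiplier_bound:
  fixes n :: nat and e :: "nat \<Rightarrow> real" and L Mx :: real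
  defines "S2 \<equiv> (\<Sum>i=1..n. (e i)\<^sup>2) / real n" and "m1 \<equiv> (\<Sum>i=1..n. e i) / real n" and "l \<equiv> multiplier n e"
  assumes n: "1 \<le> n" and L: "L > 0" and Mx: "\<And>i. i \<in> {1..n} \<Longrightarrow> \<bar>e i\<bar> \<le> Mx" "L * Mx \<le> 1/2" and S2: "S2 > 0" and m1: "\<bar>m1\<bar> \<le> L * S2 / 2"
  shows "\<bar>l\<bar> \<le> L" "\<And>i. i \<in> {1..n} \<Longrightarrow> \<bar>l * e i\<bar> \<le> 1/2" "\<bar>m1 - l * S2\<bar> \<le> 2 * L\<^sup>2 * Mx * S2"
proof -
  have small: "\<bar>t * e i\<bar> \<le> 1/2" if "\<bar>t\<bar> \<le> L" "i \<in> {1..n}" for t i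
  proof -
    have "\<bar>t * e i\<bar> \<le> L * Mx" unfolding abs_mult using that Mx L by (intro mult_mono) auto
    then show ?thesis using Mx(2) by linarith
  qed
  have den: "0 < 1 + t * e i" "1 + t * e i \<le> 3/2" "1/2 \<le> 1 + t * e i" if "\<bar>t\<bar> \<le> L" "i \<in> {1..n}" for t i
    using small[OF that] by linarith+
  define g where "g t = (\<Sum>i=1..n. e i / (1 + t * e i))" for t
  \<comment> \<open>The linear terms add up to n m1; each quadratic term is at least half of t e_i^2
    in absolute value, and at |t| = L their sum outweighs n m1.\<close>
  have dec: "e i / (1 + t * e i) = e i - t * ((e i)\<^sup>2 / (1 + t * e i))" if "\<bar>t\<bar> \<le> L" "i \<in> {1..n}" for t i
    using den(1)[OF that] by (simp add: field_simps power2_eq_square)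
  have sq: "(e i)\<^sup>2 / 2 \<le> (e i)\<^sup>2 / (1 + t * e i)" if "\<bar>t\<bar> \<le> L" "i \<in> {1..n}" for t i
    using den[OF that] by (intro divide_left_mono) auto
  have nS: "(\<Sum>i=1..n. (e i)\<^sup>2) = real n * S2" "(\<Sum>i=1..n. e i) = real n * m1" using n by (auto simp: S2_def m1_def)
  have gL: "g L \<le> 0"
  proof -
    have "g L \<le> (\<Sum>i=1..n. e i - L * ((e i)\<^sup>2 / 2))"
      unfolding g_def
    proof (rule sum_mono)
      fix i assume i: "i \<in> {1..n}"
      have "L * ((e i)\<^sup>2 / 2) \<le> L * ((e i)\<^sup>2 / (1 + L * e i))" using L i by (intro mult_left_mono sq) auto
      then show "e i / (1 + L * e i) \<le> e i - L * ((e i)\<^sup>2 / 2)" using dec[of L i] i L by simp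
    qed
    also have "\<dots> = real n * (m1 - L * S2 / 2)" using nS by (simp add: sum_subtractf sum_distrib_left[symmetric] sum_divide_distrib[symmetric] algebra_simps)
    also have "\<dots> \<le> 0" using m1 by (intro mult_nonneg_nonpos) auto
    finally show ?thesis .
  qed
  have gmL: "0 \<le> g (- L)"
  proof -
    have "0 \<le> real n * (m1 + L * S2 / 2)" using m1 by (intro mult_nonneg_nonneg) auto
    also have "\<dots> = (\<Sum>i=1..n. e i + L * ((e i)\<^sup>2 / 2))" using nS by (simp add: sum.distrib sum_distrib_left[symmetric] sum_divide_distrib[symmetric] algebra_simps)
    also have "\<dots> \<le> g (- L)"
      unfolding g_def
    proof (rule sum_mono)
      fix i assume i: "i \<in> {1..n}"
      have "L * ((e i)\<^sup>2 / 2) \<le> L * ((e i)\<^sup>2 / (1 + (- L) * e i))" using L i by (intro mult_left_mono sq) auto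
      then show "e i + L * ((e i)\<^sup>2 / 2) \<le> e i / (1 + (- L) * e i)" using dec[of "- L" i] i L by simp
    qed
    finally show ?thesis .
  qed
  have cont: "continuous_on {- L..L} g"
    unfolding g_def
  proof (intro continuous_intros ballI)
    fix i t assume "i \<in> {1..n}" "t \<in> {- L..L}"
    then show "1 + t * e i \<noteq> 0" using den(1)[of t i] by (auto simp: abs_le_iff)
  qed
  obtain t where t: "- L \<le> t" "t \<le> L" "g t = 0"
    using IVT2'[of g L 0 "- L"] gL gmL cont L by auto
  have tL: "\<bar>t\<bar> \<le> L" using t by (simp add: abs_le_iff)
  have vt: "valid_multiplier n e t"
    using den(1)[OF tL] t(3) by (auto simp: valid_multiplier_def g_def)
  then have vl: "valid_multiplier n e l" unfolding l_def multiplier_def by (auto intro: someI_ex)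
  have "(\<Sum>i=1..n. (e i)\<^sup>2) > 0" using nS(1) S2 n by simp
  then have lt: "l = t" using valid_multiplier_unique[OF vl vt] by blast
  show lL: "\<bar>l\<bar> \<le> L" using lt tL by simp
  show "\<And>i. i \<in> {1..n} \<Longrightarrow> \<bar>l * e i\<bar> \<le> 1/2" using small[OF lL] by blast
  \<comment> \<open>Exact second-order form of the equation, with remainder l^2 e_i^3 / (1 + l
    e_i).\<close>
  have "0 = (\<Sum>i=1..n. e i - l * (e i)\<^sup>2 + l\<^sup>2 * (e i * ((e i)\<^sup>2 / (1 + l * e i))))"
  proof -
    have "0 = g l" using t lt by simp
    also have "\<dots> = (\<Sum>i=1..n. e i - l * (e i)\<^sup>2 + l\<^sup>2 * (e i * ((e i)\<^sup>2 / (1 + l * e i))))"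
      unfolding g_def
    proof (rule sum.cong[OF refl])
      fix i assume "i \<in> {1..n}"
      then have "1 + l * e i \<noteq> 0" using den(1)[OF lL, of i] by simp
      then show "e i / (1 + l * e i) = e i - l * (e i)\<^sup>2 + l\<^sup>2 * (e i * ((e i)\<^sup>2 / (1 + l * e i)))"
        by (simp add: field_simps power2_eq_square)
    qed
    finally show ?thesis .
  qed
  then have "0 = real n * m1 - l * (real n * S2) + l\<^sup>2 * (\<Sum>i=1..n. e i * ((e i)\<^sup>2 / (1 + l * e i)))"
    by (simp only: sum.distrib sum_subtractf sum_distrib_left[symmetric] nS)
  then have eq: "real n * (m1 - l * S2) = - (l\<^sup>2 * (\<Sum>i=1..n. e i * ((e i)\<^sup>2 / (1 + l * e i))))" by (simp add: algebra_simps)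
  then have "real n * \<bar>m1 - l * S2\<bar> = l\<^sup>2 * \<bar>\<Sum>i=1..n. e i * ((e i)\<^sup>2 / (1 + l * e i))\<bar>"
  proof -
    have "real n * \<bar>m1 - l * S2\<bar> = \<bar>real n * (m1 - l * S2)\<bar>" by (simp add: abs_mult)
    also have "\<dots> = l\<^sup>2 * \<bar>\<Sum>i=1..n. e i * ((e i)\<^sup>2 / (1 + l * e i))\<bar>" unfolding eq abs_minus_cancel abs_mult by simp
    finally show ?thesis .
  qed
  also have "\<dots> \<le> L\<^sup>2 * (\<Sum>i=1..n. Mx * (2 * (e i)\<^sup>2))"
  proof (intro mult_mono order_trans[OF sum_abs sum_mono])
    show "l\<^sup>2 \<le> L\<^sup>2" using lL L by (metis abs_ge_zero power2_abs power_mono)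
    fix i assume i: "i \<in> {1..n}"
    have "(e i)\<^sup>2 / (1 + l * e i) \<le> (e i)\<^sup>2 / (1/2)" using den[OF lL i] by (intro divide_left_mono) auto
    then have "\<bar>(e i)\<^sup>2 / (1 + l * e i)\<bar> \<le> 2 * (e i)\<^sup>2" using den(1)[OF lL i] by simp
    then show "\<bar>e i * ((e i)\<^sup>2 / (1 + l * e i))\<bar> \<le> Mx * (2 * (e i)\<^sup>2)"
      unfolding abs_mult[of "e i"] using Mx(1)[OF i] by (intro mult_mono) auto
  qed auto
  also have "\<dots> = real n * (2 * L\<^sup>2 * Mx * S2)" by (simp add: sum_distrib_left[symmetric] nS mult_ac)
  finally show "\<bar>m1 - l * S2\<bar> \<le> 2 * L\<^sup>2 * Mx * S2" using n by simp
qed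

context ar_kde_est
begin

definition fw :: "nat \<Rightarrow> 'a \<Rightarrow> real \<Rightarrow> real" where "fw n \<omega> = weighted_kde k (b n) n (res n \<omega>)"

lemma fw_measurable[measurable]: "fw n \<omega> \<in> borel_measurable borel"
  unfolding fw_def weighted_kde_def[abs_def] by measurable

text \<open>With e_i = y - (y - e_i), the second part is of order b since the kernel has support of
  radius b. The first is y times the density estimator: consistency handles |y| \<le> R + 2, the
  tails of the innovations and of \<open>f\<close> handle the rest.\<close>

lemma first_moment_bound:
  assumes n: "1 \<le> n" and bn: "0 < b n" "b n \<le> 1" and e: "\<And>i. i \<in> {1..n} \<Longrightarrow> \<bar>eps i \<omega> - e i\<bar> \<le> 1"
    and V4: "(\<Sum>i=1..n. (1 + \<bar>eps i \<omega>\<bar>) * V (eps i \<omega>)) / real n \<le> K4"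
    and tail: "(\<Sum>i=1..n. (1 + \<bar>eps i \<omega>\<bar>) * V (eps i \<omega>) * indicator {y. \<bar>y\<bar> > R} (eps i \<omega>)) / real n \<le> \<eta>" and R: "R \<ge> 0"
    and tailf: "(\<integral>y. (1 + \<bar>y\<bar>) * V y * indicator {y. \<bar>y\<bar> > R} y \<partial>F) \<le> \<eta>"
    and cons: "nV (\<lambda>y. kde k (b n) n e y - f y) \<le> ennreal \<delta>" "\<delta> \<ge> 0"
  shows "nV (\<lambda>y. (\<Sum>i=1..n. e i * kb (b n) (y - e i)) / real n - y * f y) \<le> ennreal (b n * (2 * KK * cs * K4) + (R + 2) * \<delta> + 2 * KK * cs * \<eta> + \<eta>)"
proof -
  have \<eta>0: "0 \<le> \<eta>" using V_nonneg by (intro order_trans[OF _ tail] divide_nonneg_nonneg sum_nonneg) (auto simp: indicator_def)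
  have K40: "0 \<le> K4" using V_nonneg by (intro order_trans[OF _ V4] divide_nonneg_nonneg sum_nonneg) auto
  define a where "a i = eps i \<omega> - e i" for i
  have ya: "y - e i = y - eps i \<omega> + a i" for y i by (simp add: a_def)
  have a1: "\<bar>a i\<bar> \<le> 1" if "i \<in> {1..n}" for i using e[OF that] by (simp add: a_def)
  define g where "g = kde k (b n) n e"
  have gm[measurable]: "g \<in> borel_measurable borel" unfolding g_def by measurable
  define A where "A y = (\<Sum>i=1..n. - ((y - e i) * kb (b n) (y - e i))) / real n" for y
  define B where "B y = (R + 2) * (g y - f y)" for y
  define Cg where "Cg y = (\<Sum>i=1..n. y * indicator {y. \<bar>y\<bar> > R + 2} y * kb (b n) (y - e i)) / real n" for y
  define D where "D y = y * indicator {y. \<bar>y\<bar> > R + 2} y * f y" for y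
  have [measurable]: "A \<in> borel_measurable borel" "B \<in> borel_measurable borel" "Cg \<in> borel_measurable borel" "D \<in> borel_measurable borel"
    unfolding A_def[abs_def] B_def[abs_def] Cg_def[abs_def] D_def[abs_def] by measurable
  define B' where "B' y = y * indicator {y. \<bar>y\<bar> \<le> R + 2} y * (g y - f y)" for y
  have [measurable]: "B' \<in> borel_measurable borel" unfolding B'_def[abs_def] by measurable
  \<comment> \<open>Inside the radius the difference of the densities is kept together; outside,
    both tails are estimated separately, because multiplication by y would spoil the consistency
    bound there.\<close>
  have dec: "(\<Sum>i=1..n. e i * kb (b n) (y - e i)) / real n - y * f y = A y + (B' y + (Cg y + - D y))" for y
  proof -
    have "(\<Sum>i=1..n. e i * kb (b n) (y - e i)) / real n = A y + y * g y"
      unfolding A_def g_def kde_def by (simp add: add_divide_distrib[symmetric] sum_distrib_left sum.distrib[symmetric] algebra_simps)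
    moreover have "y * g y = y * indicator {y. \<bar>y\<bar> \<le> R + 2} y * g y + Cg y"
      unfolding Cg_def g_def kde_def by (simp add: sum_distrib_left[symmetric] indicator_def)
    moreover have "y * f y = y * indicator {y. \<bar>y\<bar> \<le> R + 2} y * f y + D y" by (simp add: D_def indicator_def)
    ultimately show ?thesis by (simp add: B'_def right_diff_distrib)
  qed
  have nA: "nV A \<le> ennreal (b n * (2 * KK * cs * K4))"
  proof -
    have "nV A \<le> ennreal ((\<Sum>i=1..n. b n * (2 * KK * cs * ((1 + \<bar>eps i \<omega>\<bar>) * V (eps i \<omega>)))) / real n)"
      unfolding A_def
    proof (rule nV_average)
      fix i assume i: "i \<in> {1..n}"
      have "nV (\<lambda>y. - ((y - e i) * kb (b n) (y - e i))) \<le> nV (\<lambda>y. b n * kb (b n) (y - eps i \<omega> + a i))"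
      proof (rule nV_mono)
        fix y
        show "\<bar>- ((y - e i) * kb (b n) (y - e i))\<bar> \<le> \<bar>b n * kb (b n) (y - eps i \<omega> + a i)\<bar>"
        proof (cases "\<bar>(y - e i) / b n\<bar> \<le> 1")
          case True
          then have "\<bar>y - e i\<bar> \<le> b n" using bn by (simp add: divide_le_eq)
          then show ?thesis using bn by (simp add: abs_mult ya[symmetric] mult_right_mono)
        next
          case False
          then show ?thesis using k_supp[of "(y - e i) / b n"] by (simp add: scaled_kernel_def)
        qed
      qed
      also have "\<dots> \<le> ennreal (b n) * ennreal (2 * KK * cs * V (eps i \<omega>))"
        using bn by (subst nV_cmult) (measurable, simp, intro mult_left_mono nV_kb bn a1[OF i] zero_le)
      also have "\<dots> = ennreal (b n * (2 * KK * cs * V (eps i \<omega>)))" using bn KK(1) cs(1) V_nonneg by (simp add: ennreal_mult[symmetric])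
      also have "\<dots> \<le> ennreal (b n * (2 * KK * cs * ((1 + \<bar>eps i \<omega>\<bar>) * V (eps i \<omega>))))"
        using bn KK(1) cs(1) V_nonneg[of "eps i \<omega>"] by (intro ennreal_leI mult_left_mono) (auto simp: distrib_right)
      finally show "nV (\<lambda>y. - ((y - e i) * kb (b n) (y - e i))) \<le> ennreal (b n * (2 * KK * cs * ((1 + \<bar>eps i \<omega>\<bar>) * V (eps i \<omega>))))" .
    qed (use bn KK(1) cs(1) V_nonneg in auto)
    also have "\<dots> = ennreal (b n * (2 * KK * cs * ((\<Sum>i=1..n. (1 + \<bar>eps i \<omega>\<bar>) * V (eps i \<omega>)) / real n)))"
      by (simp only: sum_distrib_left[symmetric] times_divide_eq_right)
    also have "\<dots> \<le> ennreal (b n * (2 * KK * cs * K4))" using bn KK(1) cs(1) by (intro ennreal_leI mult_left_mono V4) auto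
    finally show ?thesis .
  qed
  have nB: "nV B' \<le> ennreal ((R + 2) * \<delta>)"
  proof -
    have "nV B' \<le> nV B"
      by (rule nV_mono) (use R in \<open>auto simp: B'_def B_def abs_mult indicator_def intro!: mult_right_mono\<close>)
    also have "\<dots> \<le> ennreal (R + 2) * ennreal \<delta>"
      unfolding B_def using R cons by (subst nV_cmult) (auto intro!: mult_left_mono simp: g_def)
    also have "\<dots> = ennreal ((R + 2) * \<delta>)" by (rule ennreal_mult[symmetric]) (use R cons in auto)
    finally show ?thesis .
  qed
  have nC: "nV Cg \<le> ennreal (2 * KK * cs * \<eta>)"
  proof -
    let ?I = "\<lambda>i. (1 + \<bar>eps i \<omega>\<bar>) * V (eps i \<omega>) * indicator {y. \<bar>y\<bar> > R} (eps i \<omega>)"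
    have "nV Cg \<le> ennreal ((\<Sum>i=1..n. 2 * KK * cs * ?I i) / real n)"
      unfolding Cg_def
    proof (rule nV_average)
      fix i assume i: "i \<in> {1..n}"
      have "nV (\<lambda>y. y * indicator {y. \<bar>y\<bar> > R + 2} y * kb (b n) (y - e i))
        \<le> (\<integral>\<^sup>+y. ennreal ((1 + \<bar>y\<bar>) * V y * \<bar>kb (b n) (y - eps i \<omega> + a i)\<bar>) * indicator {y. \<bar>y\<bar> > R} (eps i \<omega>) \<partial>lborel)"
        unfolding vnorm_def
      proof (rule nn_integral_mono)
        fix y
        show "ennreal (V y * \<bar>y * indicator {y. \<bar>y\<bar> > R + 2} y * kb (b n) (y - e i)\<bar>)
          \<le> ennreal ((1 + \<bar>y\<bar>) * V y * \<bar>kb (b n) (y - eps i \<omega> + a i)\<bar>) * indicator {y. \<bar>y\<bar> > R} (eps i \<omega>)"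
        proof (cases "\<bar>y\<bar> > R + 2 \<and> \<bar>(y - e i) / b n\<bar> \<le> 1")
          case True
          then have "\<bar>y - e i\<bar> \<le> b n" using bn by (simp add: divide_le_eq)
          \<comment> \<open>Kernel radius and residual error are each at most 1, which explains the
            margin 2 in the radius.\<close>
          then have "\<bar>eps i \<omega>\<bar> > R" using True bn e[OF i] by linarith
          moreover have "V y * (\<bar>y\<bar> * \<bar>kb (b n) (y - e i)\<bar>) \<le> (1 + \<bar>y\<bar>) * V y * \<bar>kb (b n) (y - e i)\<bar>"
            using V_nonneg[of y] by (simp add: algebra_simps)
          ultimately show ?thesis using True by (simp add: abs_mult ya[symmetric] ennreal_leI)
        next
          case False
          then show ?thesis using k_supp[of "(y - e i) / b n"] by (auto simp: scaled_kernel_def)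
        qed
      qed
      also have "\<dots> = (\<integral>\<^sup>+y. ennreal ((1 + \<bar>y\<bar>) * V y * \<bar>kb (b n) (y - eps i \<omega> + a i)\<bar>) \<partial>lborel) * indicator {y. \<bar>y\<bar> > R} (eps i \<omega>)"
        by (rule nn_integral_multc) measurable
      also have "\<dots> \<le> ennreal (2 * KK * cs * ((1 + \<bar>eps i \<omega>\<bar>) * V (eps i \<omega>))) * indicator {y. \<bar>y\<bar> > R} (eps i \<omega>)"
        by (intro mult_right_mono absV_kb bn a1[OF i]) simp
      also have "\<dots> = ennreal (2 * KK * cs * ?I i)" by (simp add: indicator_def)
      finally show "nV (\<lambda>y. y * indicator {y. \<bar>y\<bar> > R + 2} y * kb (b n) (y - e i)) \<le> ennreal (2 * KK * cs * ?I i)" .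
    qed (use KK(1) cs(1) V_nonneg in \<open>auto simp: indicator_def\<close>)
    also have "\<dots> = ennreal (2 * KK * cs * ((\<Sum>i=1..n. ?I i) / real n))"
      by (simp only: sum_distrib_left[symmetric] times_divide_eq_right)
    also have "\<dots> \<le> ennreal (2 * KK * cs * \<eta>)" using KK(1) cs(1) by (intro ennreal_leI mult_left_mono tail) auto
    finally show ?thesis .
  qed
  have nD: "nV (\<lambda>y. - D y) \<le> ennreal \<eta>"
  proof -
    have int: "integrable F (\<lambda>y. (1 + \<bar>y\<bar>) * V y * indicator {y. \<bar>y\<bar> > R} y)"
      by (rule F_mono[OF absV_F]) (auto simp: indicator_def V_nonneg)
    have "nV (\<lambda>y. - D y) \<le> (\<integral>\<^sup>+y. ennreal (f y) * ennreal ((1 + \<bar>y\<bar>) * V y * indicator {y. \<bar>y\<bar> > R} y) \<partial>lborel)"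
      unfolding vnorm_def
    proof (rule nn_integral_mono)
      fix y
      have "V y * \<bar>- D y\<bar> \<le> f y * ((1 + \<bar>y\<bar>) * V y * indicator {y. \<bar>y\<bar> > R} y)"
        using V_nonneg[of y] f_nonneg[of y] by (auto simp: D_def indicator_def abs_mult algebra_simps)
      then show "ennreal (V y * \<bar>- D y\<bar>) \<le> ennreal (f y) * ennreal ((1 + \<bar>y\<bar>) * V y * indicator {y. \<bar>y\<bar> > R} y)"
        using V_nonneg[of y] f_nonneg[of y] by (subst ennreal_mult[symmetric]) (auto intro!: ennreal_leI)
    qed
    also have "\<dots> = (\<integral>\<^sup>+y. ennreal ((1 + \<bar>y\<bar>) * V y * indicator {y. \<bar>y\<bar> > R} y) \<partial>F)"
      by (rule nn_integral_F[symmetric]) measurable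
    also have "\<dots> = ennreal (\<integral>y. (1 + \<bar>y\<bar>) * V y * indicator {y. \<bar>y\<bar> > R} y \<partial>F)"
      by (rule nn_integral_eq_integral[OF int]) (auto simp: V_nonneg)
    also have "\<dots> \<le> ennreal \<eta>" by (rule ennreal_leI[OF tailf])
    finally show ?thesis .
  qed
  have "nV (\<lambda>y. (\<Sum>i=1..n. e i * kb (b n) (y - e i)) / real n - y * f y) = nV (\<lambda>y. A y + (B' y + (Cg y + - D y)))" unfolding dec ..
  also have "\<dots> \<le> nV A + (nV B' + (nV Cg + nV (\<lambda>y. - D y)))"
    by (intro order_trans[OF nV_triangle] add_left_mono) measurable
  also have "\<dots> \<le> ennreal (b n * (2 * KK * cs * K4)) + (ennreal ((R + 2) * \<delta>) + (ennreal (2 * KK * cs * \<eta>) + ennreal \<eta>))"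
    by (intro add_mono nA nB nC nD)
  also have "\<dots> = ennreal (b n * (2 * KK * cs * K4) + (R + 2) * \<delta> + 2 * KK * cs * \<eta> + \<eta>)"
    using bn KK(1) cs(1) K40 R cons(2) \<eta>0 by (simp add: ennreal_plus[symmetric] add.assoc del: ennreal_plus)
  finally show ?thesis .
qed

text \<open>With x = lm e_i the weight is exactly 1 - x + x^2/(1 + x). The linear term yields the
  first moment estimator, close to y f(y); the quadratic term is of order L^2 times the largest
  residual.\<close>

lemma weighted_deterministic:
  assumes n: "1 \<le> n" and bn: "0 < b n" "b n \<le> 1" and cl: "\<And>i. i \<in> {1..n} \<Longrightarrow> \<bar>eps i \<omega> - res n \<omega> i\<bar> \<le> 1"
    and V4: "(\<Sum>i=1..n. (1 + \<bar>eps i \<omega>\<bar>) * V (eps i \<omega>)) / real n \<le> K4"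
    and lam: "lm = multiplier n (res n \<omega>)" "\<bar>lm\<bar> \<le> L" "\<And>i. i \<in> {1..n} \<Longrightarrow> \<bar>lm * res n \<omega> i\<bar> \<le> 1/2"
    and Mx: "\<And>i. i \<in> {1..n} \<Longrightarrow> \<bar>res n \<omega> i\<bar> \<le> Mx"
    and T1: "nV (\<lambda>y. (\<Sum>i=1..n. res n \<omega> i * kb (b n) (y - res n \<omega> i)) / real n - y * f y) \<le> ennreal t1" "0 \<le> t1"
    and c: "\<bar>A - lm\<bar> \<le> c" and By: "nV (\<lambda>y. y * f y) \<le> ennreal By" "0 \<le> By"
  shows "nV (\<lambda>y. fw n \<omega> y - ft n \<omega> y + A * (y * f y)) \<le> ennreal (L * t1 + c * By + L\<^sup>2 * (4 * Mx * KK * cs * K4))"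
proof -
  have K40: "0 \<le> K4" using V_nonneg by (intro order_trans[OF _ V4] divide_nonneg_nonneg sum_nonneg) auto
  have Mx0: "0 \<le> Mx" using Mx[of 1] n by (auto intro: order_trans[OF abs_ge_zero])
  define e where "e = res n \<omega>"
  define T where "T y = (\<Sum>i=1..n. e i * kb (b n) (y - e i)) / real n - y * f y" for y
  define T2 where "T2 y = (\<Sum>i=1..n. (e i)\<^sup>2 / (1 + lm * e i) * kb (b n) (y - e i)) / real n" for y
  have [measurable]: "T \<in> borel_measurable borel" "T2 \<in> borel_measurable borel" unfolding T_def[abs_def] T2_def[abs_def] by measurable
  have den: "1 + lm * e i \<ge> 1/2" if "i \<in> {1..n}" for i using lam(3)[OF that] unfolding e_def by linarith
  have dec: "fw n \<omega> y - ft n \<omega> y + A * (y * f y) = (- lm) * T y + ((A - lm) * (y * f y) + lm\<^sup>2 * T2 y)" for y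
  proof -
    have "fw n \<omega> y - ft n \<omega> y = (\<Sum>i=1..n. - lm * (e i * kb (b n) (y - e i)) + lm\<^sup>2 * ((e i)\<^sup>2 / (1 + lm * e i) * kb (b n) (y - e i))) / real n"
      unfolding fw_def ft_def weighted_kde_def kde_def el_weight_def diff_divide_distrib[symmetric] sum_subtractf[symmetric] e_def[symmetric] lam(1)[folded e_def, symmetric]
    proof (intro arg_cong2[where f="(/)"] sum.cong refl)
      fix i assume i: "i \<in> {1..n}"
      have "1 / (1 + lm * e i) = 1 - lm * e i + lm\<^sup>2 * ((e i)\<^sup>2 / (1 + lm * e i))"
        using den[OF i] by (simp add: field_simps power2_eq_square)
      then have "1 / (1 + lm * e i) * kb (b n) (y - e i) = (1 - lm * e i + lm\<^sup>2 * ((e i)\<^sup>2 / (1 + lm * e i))) * kb (b n) (y - e i)" by (simp only:)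
      then show "1 / (1 + lm * e i) * kb (b n) (y - e i) - kb (b n) (y - e i) = - lm * (e i * kb (b n) (y - e i)) + lm\<^sup>2 * ((e i)\<^sup>2 / (1 + lm * e i) * kb (b n) (y - e i))"
        by (simp only: left_diff_distrib distrib_right mult_1 mult.assoc)
    qed
    also have "\<dots> = (- lm) * (T y + y * f y) + lm\<^sup>2 * T2 y"
      unfolding T_def T2_def by (simp only: sum.distrib sum_distrib_left[symmetric] add_divide_distrib times_divide_eq_right diff_add_cancel)
    finally show ?thesis by (simp add: algebra_simps)
  qed
  have nT: "nV T \<le> ennreal t1" using T1(1) unfolding T_def[abs_def] e_def .
  have n1: "nV (\<lambda>y. (- lm) * T y) \<le> ennreal (L * t1)"
  proof -
    have "nV (\<lambda>y. (- lm) * T y) \<le> ennreal L * ennreal t1"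
      using lam(2) by (subst nV_cmult) (measurable, intro mult_mono ennreal_leI nT, auto)
    also have "\<dots> = ennreal (L * t1)" by (rule ennreal_mult[symmetric]) (use lam(2) T1(2) in auto)
    finally show ?thesis .
  qed
  have n2: "nV (\<lambda>y. (A - lm) * (y * f y)) \<le> ennreal (c * By)"
  proof -
    have "nV (\<lambda>y. (A - lm) * (y * f y)) \<le> ennreal c * ennreal By"
      using c By(1) by (subst nV_cmult) (measurable, intro mult_mono ennreal_leI, auto)
    also have "\<dots> = ennreal (c * By)" by (rule ennreal_mult[symmetric]) (use c By(2) in auto)
    finally show ?thesis .
  qed
  have n3: "nV T2 \<le> ennreal (4 * Mx * KK * cs * K4)"
  proof -
    have "nV T2 \<le> ennreal ((\<Sum>i=1..n. 4 * Mx * KK * cs * ((1 + \<bar>eps i \<omega>\<bar>) * V (eps i \<omega>))) / real n)"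
      unfolding T2_def
    proof (rule nV_average)
      fix i assume i: "i \<in> {1..n}"
      define a where "a = eps i \<omega> - e i"
      have a1: "\<bar>a\<bar> \<le> 1" using cl[OF i] by (simp add: a_def e_def)
      have ya: "y - e i = y - eps i \<omega> + a" for y by (simp add: a_def)
      have e1: "\<bar>e i\<bar> \<le> 1 + \<bar>eps i \<omega>\<bar>" using a1 unfolding a_def by linarith
      have eM: "\<bar>e i\<bar> \<le> Mx" using Mx[OF i] by (simp add: e_def)
      have "(e i)\<^sup>2 / (1 + lm * e i) \<le> (e i)\<^sup>2 / (1/2)" using den[OF i] by (intro divide_left_mono) auto
      also have "\<dots> = 2 * (\<bar>e i\<bar> * \<bar>e i\<bar>)" by (simp add: power2_eq_square)
      \<comment> \<open>One factor of the square is bounded by the maximum, the other by 1 + |eps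
        i|: the average of (1 + |eps i|) V(eps i) is under control, whereas a mean of the squared
        innovation times V is not assumed finite.\<close>
      also have "\<dots> \<le> 2 * (Mx * (1 + \<bar>eps i \<omega>\<bar>))" using eM e1 by (intro mult_left_mono mult_mono) auto
      finally have q: "\<bar>(e i)\<^sup>2 / (1 + lm * e i)\<bar> \<le> 2 * (Mx * (1 + \<bar>eps i \<omega>\<bar>))" using den[OF i] by simp
      have "nV (\<lambda>y. (e i)\<^sup>2 / (1 + lm * e i) * kb (b n) (y - e i)) = ennreal \<bar>(e i)\<^sup>2 / (1 + lm * e i)\<bar> * nV (\<lambda>y. kb (b n) (y - eps i \<omega> + a))"
        unfolding ya by (rule nV_cmult) measurable
      also have "\<dots> \<le> ennreal (2 * (Mx * (1 + \<bar>eps i \<omega>\<bar>))) * ennreal (2 * KK * cs * V (eps i \<omega>))"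
        by (intro mult_mono ennreal_leI q nV_kb bn a1) auto
      also have "\<dots> = ennreal (2 * (Mx * (1 + \<bar>eps i \<omega>\<bar>)) * (2 * KK * cs * V (eps i \<omega>)))"
        by (rule ennreal_mult[symmetric]) (use Mx0 KK(1) cs(1) V_nonneg in auto)
      also have "2 * (Mx * (1 + \<bar>eps i \<omega>\<bar>)) * (2 * KK * cs * V (eps i \<omega>)) = 4 * Mx * KK * cs * ((1 + \<bar>eps i \<omega>\<bar>) * V (eps i \<omega>))" by simp
      finally show "nV (\<lambda>y. (e i)\<^sup>2 / (1 + lm * e i) * kb (b n) (y - e i)) \<le> ennreal (4 * Mx * KK * cs * ((1 + \<bar>eps i \<omega>\<bar>) * V (eps i \<omega>)))" .
    qed (use Mx0 KK(1) cs(1) V_nonneg in auto)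
    also have "\<dots> = ennreal (4 * Mx * KK * cs * ((\<Sum>i=1..n. (1 + \<bar>eps i \<omega>\<bar>) * V (eps i \<omega>)) / real n))"
      by (simp only: sum_distrib_left[symmetric] times_divide_eq_right)
    also have "\<dots> \<le> ennreal (4 * Mx * KK * cs * K4)" using Mx0 KK(1) cs(1) by (intro ennreal_leI mult_left_mono V4) auto
    finally show ?thesis .
  qed
  have n3': "nV (\<lambda>y. lm\<^sup>2 * T2 y) \<le> ennreal (L\<^sup>2 * (4 * Mx * KK * cs * K4))"
  proof -
    have "lm\<^sup>2 \<le> L\<^sup>2" using lam(2) by (metis abs_ge_zero power2_abs power_mono)
    then have "nV (\<lambda>y. lm\<^sup>2 * T2 y) \<le> ennreal (L\<^sup>2) * ennreal (4 * Mx * KK * cs * K4)"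
      by (subst nV_cmult) (measurable, intro mult_mono ennreal_leI n3, auto)
    also have "\<dots> = ennreal (L\<^sup>2 * (4 * Mx * KK * cs * K4))" by (rule ennreal_mult[symmetric]) (use Mx0 KK(1) cs(1) K40 in auto)
    finally show ?thesis .
  qed
  have "nV (\<lambda>y. fw n \<omega> y - ft n \<omega> y + A * (y * f y)) \<le> ennreal (L * t1) + (ennreal (c * By) + ennreal (L\<^sup>2 * (4 * Mx * KK * cs * K4)))"
    unfolding dec by (intro order_trans[OF nV_triangle] add_mono n1 n2 n3') measurable
  also have "\<dots> = ennreal (L * t1 + c * By + L\<^sup>2 * (4 * Mx * KK * cs * K4))"
  proof -
    have "0 \<le> L * t1" "0 \<le> c * By" "0 \<le> L\<^sup>2 * (4 * Mx * KK * cs * K4)" using lam(2) T1(2) c By(2) Mx0 KK(1) cs(1) K40 by auto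
    then show ?thesis by (simp only: ennreal_plus[symmetric] add.assoc add_nonneg_nonneg)
  qed
  finally show ?thesis .
qed

lemma tight_absV: assumes "e > 0"
  shows "\<exists>K>0. mostly M e (\<lambda>n \<omega>. (\<Sum>i=1..n. (1 + \<bar>eps i \<omega>\<bar>) * V (eps i \<omega>)) / real n \<le> K)"
  using average_tight[of "\<lambda>z. (1 + \<bar>snd z\<bar>) * V (snd z)", OF _ _ assms] integrable_eps(1)[OF absV_F] by simp

lemma average_eps_sq: assumes "\<delta> > 0" "e > 0"
  shows "mostly M e (\<lambda>n \<omega>. \<bar>(\<Sum>i=1..n. (eps i \<omega>)\<^sup>2) / real n - \<sigma>\<^sup>2\<bar> \<le> \<delta>)"
  using average_converges[of "\<lambda>z. (snd z)\<^sup>2", OF _ _ assms] integrable_eps[OF sq_F, of 1] by (simp add: var_F)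

text \<open>Dominated by the integral of (1 + |y|) V f, which the moment of order \<alpha> > 1 makes
  finite.\<close>

lemma nV_yf: "nV (\<lambda>y. y * f y) < \<infinity>"
proof -
  have "nV (\<lambda>y. y * f y) \<le> (\<integral>\<^sup>+y. ennreal (norm ((1 + \<bar>y\<bar>) * V y * f y)) \<partial>lborel)"
    unfolding vnorm_def using V_nonneg f_nonneg
    by (intro nn_integral_mono ennreal_leI) (auto simp: abs_mult algebra_simps)
  also have "\<dots> < \<infinity>" using absVf_integrable by (simp add: integrable_iff_bounded)
  finally show ?thesis .
qed

text \<open>Residual moments are compared with innovation moments before
  \<open>multiplier_bound\<close> is applied. \<open>KL\<close> is chosen so that (KA + 1) n^(-1/2),
  a bound for the mean residual, equals L \<sigma>^2/4, which is at most L S2/2 once S2 is at least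
  half the variance.\<close>

lemma multiplier_close:
  assumes n: "4 \<le> n" and \<omega>: "\<omega> \<in> space M" and g: "good K n \<omega>" and K: "K > 0"
    and V4: "(\<Sum>i=1..n. (1 + \<bar>eps i \<omega>\<bar>) * V (eps i \<omega>)) / real n \<le> K4"
    and K5: "\<bar>(\<Sum>i=1..n. eps i \<omega>) / real n\<bar> \<le> K5 * real n powr (-1/2)"
    and av: "\<forall>j. \<bar>(\<Sum>i=1..n. gd i \<omega> $ j) / real n - \<mu> $ j\<bar> \<le> \<eta>"
    and sq: "\<bar>(\<Sum>i=1..n. (eps i \<omega>)\<^sup>2) / real n - \<sigma>\<^sup>2\<bar> \<le> \<eta>"
    and mx: "\<forall>i\<in>{1..n}. \<bar>eps i \<omega>\<bar> \<le> \<eta> * sqrt (real n)"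
    and cl: "\<forall>i\<in>{1..n}. \<bar>gd i \<omega> \<bullet> \<Delta> n \<omega>\<bar> \<le> \<eta> \<and> \<bar>rm n i \<omega>\<bar> \<le> \<eta>"
    and rt: "sqrt K * real n powr (-1/3) \<le> \<eta>"
    and KA: "KA = K5 + norm \<mu> * K" "KA \<ge> 0" and KL: "KL = 4 * (KA + 1) / \<sigma>\<^sup>2" and L: "L = KL * real n powr (-1/2)"
    and \<eta>: "0 < \<eta>" "\<eta> \<le> 1/2" "\<eta> * (5 + 4 * K4) \<le> \<sigma>\<^sup>2 / 2" "\<eta> * (real CARD('d) * K + 1) \<le> 1" "4 * KL * \<eta> \<le> 1"
  defines "lm \<equiv> multiplier n (res n \<omega>)" and "A \<equiv> ((\<Sum>i=1..n. eps i \<omega>) / real n - \<mu> \<bullet> \<Delta> n \<omega>) / \<sigma>\<^sup>2"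
  shows "\<bar>lm\<bar> \<le> L" "\<And>i. i \<in> {1..n} \<Longrightarrow> \<bar>lm * res n \<omega> i\<bar> \<le> 1/2" "\<And>i. i \<in> {1..n} \<Longrightarrow> \<bar>res n \<omega> i\<bar> \<le> 2 * \<eta> * sqrt (real n)"
    "\<bar>A - lm\<bar> \<le> (\<eta> * ((8 * KL\<^sup>2 * \<sigma>\<^sup>2 + real CARD('d) * K + 1 + KL * (5 + 4 * K4)) / \<sigma>\<^sup>2)) * real n powr (-1/2)"
proof -
  let ?q = "real n powr (-1/2)"
  have q: "?q = 1 / sqrt (real n)" by (rule powr_neg_half)
  have n0: "real n > 0" using n by simp
  have qq: "?q * sqrt (real n) = 1" "?q * ?q = 1 / real n" unfolding q using n0 by auto
  have q0: "?q > 0" using n0 by simp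
  have K40: "0 \<le> K4" using V_nonneg by (intro order_trans[OF _ V4] divide_nonneg_nonneg sum_nonneg) auto
  have s2: "\<sigma>\<^sup>2 > 0" by (rule \<sigma>_pos)
  have KL0: "KL > 0" using KA(2) s2 unfolding KL by (intro divide_pos_pos) auto
  define e where "e = res n \<omega>"
  define a where "a i = gd i \<omega> \<bullet> \<Delta> n \<omega> + rm n i \<omega>" for i
  have ea: "e i = eps i \<omega> - a i" if "i \<in> {1..n}" for i using res_eq[OF that \<omega>] by (simp add: e_def a_def)
  have a2: "\<bar>a i\<bar> \<le> 2 * \<eta>" if "i \<in> {1..n}" for i
    using cl[rule_format, OF that] unfolding a_def by linarith
  \<comment> \<open>From n = 4 on, a residual error of 2\<eta> is at most \<eta> times the root of n
    and merges with the bound on the innovations.\<close>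
  have sn: "2 \<le> sqrt (real n)" using n by (intro real_le_rsqrt) simp
  have eM: "\<bar>e i\<bar> \<le> 2 * \<eta> * sqrt (real n)" if i: "i \<in> {1..n}" for i
  proof -
    have "2 * \<eta> \<le> \<eta> * sqrt (real n)" using sn \<eta>(1) by (simp add: mult.commute)
    then show ?thesis using a2[OF i] mx[rule_format, OF i] ea[OF i] by linarith
  qed
  define S2 where "S2 = (\<Sum>i=1..n. (e i)\<^sup>2) / real n"
  define m1 where "m1 = (\<Sum>i=1..n. e i) / real n"
  define A0 where "A0 = (\<Sum>i=1..n. eps i \<omega>) / real n - \<mu> \<bullet> \<Delta> n \<omega>"
  have AA: "A = A0 / \<sigma>\<^sup>2" by (simp add: A_def A0_def)
  have dev: "\<bar>S2 - \<sigma>\<^sup>2\<bar> \<le> \<eta> * (5 + 4 * K4)"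
  proof -
    have "S2 - (\<Sum>i=1..n. (eps i \<omega>)\<^sup>2) / real n = (\<Sum>i=1..n. (e i)\<^sup>2 - (eps i \<omega>)\<^sup>2) / real n"
      by (simp add: S2_def sum_subtractf diff_divide_distrib)
    also have "\<bar>\<dots>\<bar> \<le> (\<Sum>i=1..n. 4 * \<eta> * ((1 + \<bar>eps i \<omega>\<bar>) * V (eps i \<omega>)) + 4 * \<eta>) / real n"
      unfolding abs_divide abs_of_nat
    proof (intro divide_right_mono order_trans[OF sum_abs sum_mono])
      fix i assume i: "i \<in> {1..n}"
      have "(e i)\<^sup>2 - (eps i \<omega>)\<^sup>2 = a i * (a i - 2 * eps i \<omega>)" unfolding ea[OF i] by (simp add: power2_eq_square algebra_simps)
      also have "\<bar>\<dots>\<bar> \<le> (2 * \<eta>) * (1 + 2 * \<bar>eps i \<omega>\<bar>)"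
        unfolding abs_mult using a2[OF i] \<eta>(1,2) by (intro mult_mono) auto
      also have "\<dots> \<le> 4 * \<eta> * ((1 + \<bar>eps i \<omega>\<bar>) * 1) + 4 * \<eta>" using \<eta>(1) by (simp add: algebra_simps)
      \<comment> \<open>Inserting the factor V \<ge> 1 allows the average bounded by
        \<open>K4\<close> to be used again.\<close>
      also have "\<dots> \<le> 4 * \<eta> * ((1 + \<bar>eps i \<omega>\<bar>) * V (eps i \<omega>)) + 4 * \<eta>"
        using \<eta>(1) V_ge_1[of "eps i \<omega>"] by (intro add_right_mono mult_left_mono) auto
      finally show "\<bar>(e i)\<^sup>2 - (eps i \<omega>)\<^sup>2\<bar> \<le> 4 * \<eta> * ((1 + \<bar>eps i \<omega>\<bar>) * V (eps i \<omega>)) + 4 * \<eta>" .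
    qed simp
    also have "\<dots> = 4 * \<eta> * ((\<Sum>i=1..n. (1 + \<bar>eps i \<omega>\<bar>) * V (eps i \<omega>)) / real n) + 4 * \<eta>"
      using n0 by (simp add: sum.distrib sum_distrib_left[symmetric] add_divide_distrib)
    also have "\<dots> \<le> 4 * \<eta> * K4 + 4 * \<eta>" using \<eta>(1) V4 by (intro add_right_mono mult_left_mono) auto
    finally show ?thesis using sq by (simp add: algebra_simps)
  qed
  have S2b: "\<sigma>\<^sup>2 / 2 \<le> S2" "S2 \<le> 2 * \<sigma>\<^sup>2" using dev \<eta>(3) s2 unfolding abs_le_iff by linarith+
  have D: "norm (\<Delta> n \<omega>) \<le> K * ?q" using g by (simp add: good_def)
  have m1A: "\<bar>m1 - A0\<bar> \<le> (\<eta> * (real CARD('d) * K + 1)) * ?q"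
  proof -
    define v where "v = (\<Sum>i=1..n. gd i \<omega>)"
    have "m1 = (\<Sum>i=1..n. eps i \<omega> - (gd i \<omega> \<bullet> \<Delta> n \<omega> + rm n i \<omega>)) / real n"
      unfolding m1_def using ea by (simp add: a_def)
    also have "\<dots> = (\<Sum>i=1..n. eps i \<omega>) / real n - (v \<bullet> \<Delta> n \<omega>) / real n - (\<Sum>i=1..n. rm n i \<omega>) / real n"
      by (simp add: sum_subtractf sum.distrib v_def inner_sum_left diff_divide_distrib add_divide_distrib)
    finally have "m1 - A0 = - (((1 / real n) *\<^sub>R v - \<mu>) \<bullet> \<Delta> n \<omega>) - (\<Sum>i=1..n. rm n i \<omega>) / real n"
      by (simp add: A0_def inner_diff_left)
    then have "\<bar>m1 - A0\<bar> \<le> \<bar>((1 / real n) *\<^sub>R v - \<mu>) \<bullet> \<Delta> n \<omega>\<bar> + \<bar>(\<Sum>i=1..n. rm n i \<omega>) / real n\<bar>" by linarith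
    also have "\<bar>((1 / real n) *\<^sub>R v - \<mu>) \<bullet> \<Delta> n \<omega>\<bar> \<le> (real CARD('d) * \<eta>) * (K * ?q)"
    proof (rule order_trans[OF Cauchy_Schwarz_ineq2 mult_mono[OF _ D]])
      have "norm ((1 / real n) *\<^sub>R v - \<mu>) \<le> (\<Sum>j\<in>UNIV. \<bar>((1 / real n) *\<^sub>R v - \<mu>) $ j\<bar>)" by (rule norm_le_l1_cart)
      also have "\<dots> \<le> (\<Sum>j\<in>(UNIV :: 'd set). \<eta>)"
        using av by (intro sum_mono) (simp add: v_def)
      finally show "norm ((1 / real n) *\<^sub>R v - \<mu>) \<le> real CARD('d) * \<eta>" by simp
    qed (use \<eta>(1) in auto)
    also have "\<bar>(\<Sum>i=1..n. rm n i \<omega>) / real n\<bar> \<le> \<eta> * ?q"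
    proof -
      have "\<bar>\<Sum>i=1..n. rm n i \<omega>\<bar> \<le> (\<Sum>i=1..n. \<bar>1 * rm n i \<omega>\<bar>)" using sum_abs[of "\<lambda>i. rm n i \<omega>" "{1..n}"] by simp
      also have "\<dots> \<le> sqrt (real n) * sqrt (K * real n powr (-2/3))"
        using g by (intro CS_sum) (auto simp: good_def)
      also have "sqrt (K * real n powr (-2/3)) = sqrt K * real n powr (-1/3)"
        using powr_half_sqrt[of "real n powr (-2/3)"] by (simp add: real_sqrt_mult powr_powr)
      also have "sqrt (real n) * (sqrt K * real n powr (-1/3)) \<le> sqrt (real n) * \<eta>" using rt by (intro mult_left_mono) auto
      finally have "\<bar>\<Sum>i=1..n. rm n i \<omega>\<bar> / real n \<le> sqrt (real n) * \<eta> / real n" using n0 by (simp add: divide_right_mono)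
      also have "\<dots> = \<eta> * ?q" unfolding q using n0 by (simp add: field_simps)
      finally show ?thesis by simp
    qed
    finally show ?thesis by (simp add: algebra_simps)
  qed
  have A0b: "\<bar>A0\<bar> \<le> KA * ?q"
  proof -
    have "\<bar>\<mu> \<bullet> \<Delta> n \<omega>\<bar> \<le> norm \<mu> * (K * ?q)" by (rule order_trans[OF Cauchy_Schwarz_ineq2 mult_left_mono[OF D norm_ge_zero]])
    then have "\<bar>A0\<bar> \<le> K5 * ?q + norm \<mu> * (K * ?q)" unfolding A0_def using K5 by linarith
    then show ?thesis by (simp add: KA(1) algebra_simps)
  qed
  have m1b: "\<bar>m1\<bar> \<le> (KA + 1) * ?q"
  proof -
    have "(\<eta> * (real CARD('d) * K + 1)) * ?q \<le> 1 * ?q" using \<eta>(4) by (intro mult_right_mono) auto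
    then have "\<bar>m1\<bar> \<le> KA * ?q + ?q" using m1A A0b by linarith
    then show ?thesis by (simp add: algebra_simps)
  qed
  have L0: "L > 0" using KL0 q0 by (simp add: L)
  have LM: "L * (2 * \<eta> * sqrt (real n)) \<le> 1/2"
  proof -
    have "L * (2 * \<eta> * sqrt (real n)) = 2 * KL * \<eta> * (?q * sqrt (real n))" by (simp add: L)
    also have "\<dots> \<le> 1/2" unfolding qq using \<eta>(5) by simp
    finally show ?thesis .
  qed
  have LS: "\<bar>m1\<bar> \<le> L * S2 / 2"
  proof -
    have "(KA + 1) * ?q = L * (\<sigma>\<^sup>2 / 2) / 2" unfolding L KL using s2 by simp
    also have "\<dots> \<le> L * S2 / 2" using S2b(1) L0 by (intro divide_right_mono mult_left_mono) auto
    finally show ?thesis using m1b by linarith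
  qed
  have S2p: "S2 > 0" using S2b(1) s2 by linarith
  have n1: "1 \<le> n" using n by simp
  note mb = multiplier_bound[OF n1 L0 eM LM S2p[unfolded S2_def] LS[unfolded S2_def m1_def]]
  have lm: "lm = multiplier n e" by (simp add: lm_def e_def)
  show l1: "\<bar>lm\<bar> \<le> L" unfolding lm by (rule mb(1))
  show "\<bar>lm * res n \<omega> i\<bar> \<le> 1/2" if "i \<in> {1..n}" for i using mb(2)[of i] that unfolding lm e_def by blast
  show "\<bar>res n \<omega> i\<bar> \<le> 2 * \<eta> * sqrt (real n)" if "i \<in> {1..n}" for i using eM[OF that] unfolding e_def .
  have l3: "\<bar>m1 - lm * S2\<bar> \<le> 2 * L\<^sup>2 * (2 * \<eta> * sqrt (real n)) * S2"
    unfolding m1_def S2_def lm by (rule mb(3))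
  have l3': "\<bar>m1 - lm * S2\<bar> \<le> (8 * KL\<^sup>2 * \<sigma>\<^sup>2 * \<eta>) * ?q"
  proof -
    have "2 * L\<^sup>2 * (2 * \<eta> * sqrt (real n)) * S2 \<le> 2 * L\<^sup>2 * (2 * \<eta> * sqrt (real n)) * (2 * \<sigma>\<^sup>2)"
      using S2b(2) \<eta>(1) by (intro mult_left_mono) auto
    also have "\<dots> = 8 * KL\<^sup>2 * \<sigma>\<^sup>2 * \<eta> * ?q * (?q * sqrt (real n))" by (simp add: L power2_eq_square)
    finally have "2 * L\<^sup>2 * (2 * \<eta> * sqrt (real n)) * S2 \<le> 8 * KL\<^sup>2 * \<sigma>\<^sup>2 * \<eta> * ?q" unfolding qq by (simp only: mult_1_right)
    with l3 show ?thesis by (rule order_trans)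
  qed
  have l4: "\<bar>lm * (\<sigma>\<^sup>2 - S2)\<bar> \<le> (KL * (\<eta> * (5 + 4 * K4))) * ?q"
  proof -
    have "\<bar>lm * (\<sigma>\<^sup>2 - S2)\<bar> \<le> L * (\<eta> * (5 + 4 * K4))" unfolding abs_mult using l1 dev L0 by (intro mult_mono) auto
    then show ?thesis by (simp add: L mult_ac)
  qed
  \<comment> \<open>The three differences are the expansion error of the multiplier equation, the
    error of the mean residual, and the error of the second moment.\<close>
  have "A0 - lm * \<sigma>\<^sup>2 = (m1 - lm * S2) - (m1 - A0) - lm * (\<sigma>\<^sup>2 - S2)" by (simp add: algebra_simps)
  then have "\<bar>A0 - lm * \<sigma>\<^sup>2\<bar> \<le> (8 * KL\<^sup>2 * \<sigma>\<^sup>2 * \<eta>) * ?q + (\<eta> * (real CARD('d) * K + 1)) * ?q + (KL * (\<eta> * (5 + 4 * K4))) * ?q"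
    using l3' l4 m1A by linarith
  also have "\<dots> = (\<eta> * (8 * KL\<^sup>2 * \<sigma>\<^sup>2 + real CARD('d) * K + 1 + KL * (5 + 4 * K4))) * ?q" by (simp add: algebra_simps)
  finally have "\<bar>A0 - lm * \<sigma>\<^sup>2\<bar> / \<sigma>\<^sup>2 \<le> (\<eta> * (8 * KL\<^sup>2 * \<sigma>\<^sup>2 + real CARD('d) * K + 1 + KL * (5 + 4 * K4))) * ?q / \<sigma>\<^sup>2"
    using s2 by (intro divide_right_mono) auto
  moreover have "\<bar>A - lm\<bar> = \<bar>A0 - lm * \<sigma>\<^sup>2\<bar> / \<sigma>\<^sup>2"
  proof -
    have "A - lm = (A0 - lm * \<sigma>\<^sup>2) / \<sigma>\<^sup>2" unfolding AA using s2 by (simp add: field_simps)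
    then show ?thesis using s2 by (simp add: abs_divide)
  qed
  ultimately show "\<bar>A - lm\<bar> \<le> (\<eta> * ((8 * KL\<^sup>2 * \<sigma>\<^sup>2 + real CARD('d) * K + 1 + KL * (5 + 4 * K4)) / \<sigma>\<^sup>2)) * ?q" by simp
qed

lemma fw_expansion:
  assumes \<epsilon>: "\<epsilon> > 0" and e: "e > 0"
  shows "mostly M e (\<lambda>n \<omega>. nV (\<lambda>y. fw n \<omega> y - ft n \<omega> y + ((\<Sum>i=1..n. eps i \<omega>) / real n - \<mu> \<bullet> \<Delta> n \<omega>) / \<sigma>\<^sup>2 * (y * f y)) \<le> ennreal (\<epsilon> * real n powr (-1/2)))"
proof -
  have e8: "e / 8 > 0" using e by simp
  obtain K where K: "K > 0" "mostly M (e/8) (good K)" using good_mostly[OF e8] by blast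
  obtain K4 where K4: "K4 > 0" "mostly M (e/8) (\<lambda>n \<omega>. (\<Sum>i=1..n. (1 + \<bar>eps i \<omega>\<bar>) * V (eps i \<omega>)) / real n \<le> K4)"
    using tight_absV[OF e8] by blast
  obtain K5 where K5: "K5 > 0" "mostly M (e/8) (\<lambda>n \<omega>. \<bar>(\<Sum>i=1..n. eps i \<omega>) / real n\<bar> \<le> K5 * real n powr (-1/2))"
    using mean_eps[OF e8] by blast
  obtain By where By: "nV (\<lambda>y. y * f y) = ennreal By" "By \<ge> 0" using nV_yf by (cases "nV (\<lambda>y. y * f y)") auto
  have s2: "\<sigma>\<^sup>2 > 0" by (rule \<sigma>_pos)
  define KA where "KA = K5 + norm \<mu> * K"
  have KA: "KA \<ge> 0" using K5(1) K(1) by (simp add: KA_def)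
  define KL where "KL = 4 * (KA + 1) / \<sigma>\<^sup>2"
  have KL: "KL > 0" using KA s2 unfolding KL_def by (intro divide_pos_pos) auto
  define C1 where "C1 = 3 + 2 * KK * cs"
  define C2 where "C2 = (8 * KL\<^sup>2 * \<sigma>\<^sup>2 + real CARD('d) * K + 1 + KL * (5 + 4 * K4)) / \<sigma>\<^sup>2"
  define C3 where "C3 = 8 * KL\<^sup>2 * KK * cs * K4"
  have C: "C1 > 0" "C2 \<ge> 0" "C3 \<ge> 0" using KK(1) cs(1) KL K(1) K4(1) s2 by (auto simp: C1_def C2_def C3_def intro!: add_pos_nonneg)
  define Big where "Big = KL * C1 + C2 * By + C3 + 1"
  have Big: "Big > 0" using C KL By(2) by (auto simp: Big_def intro!: add_nonneg_pos add_nonneg_nonneg mult_nonneg_nonneg)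
  \<comment> \<open>One entry for each condition: residual errors at most 1, the residual second
    moment, the mean residual, multiplier times residuals at most 1/2, and through
    \<open>Big\<close> the final error.\<close>
  define \<eta> where "\<eta> = min (min (1/2) (\<sigma>\<^sup>2 / (2 * (5 + 4 * K4)))) (min (min (1 / (real CARD('d) * K + 1)) (1 / (4 * KL))) (\<epsilon> / Big))"
  have p1: "0 < 5 + 4 * K4" using K4(1) by simp
  have p2: "0 < real CARD('d) * K + 1" using K(1) by (simp add: add_nonneg_pos)
  have \<eta>0: "\<eta> > 0" using s2 p1 p2 KL \<epsilon> Big by (simp add: \<eta>_def)
  have m: "\<eta> \<le> 1/2" "\<eta> \<le> \<sigma>\<^sup>2 / (2 * (5 + 4 * K4))" "\<eta> \<le> 1 / (real CARD('d) * K + 1)" "\<eta> \<le> 1 / (4 * KL)" "\<eta> \<le> \<epsilon> / Big"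
    unfolding \<eta>_def by linarith+
  have \<eta>: "\<eta> * (5 + 4 * K4) \<le> \<sigma>\<^sup>2 / 2" "\<eta> * (real CARD('d) * K + 1) \<le> 1" "4 * KL * \<eta> \<le> 1" "\<eta> * Big \<le> \<epsilon>"
  proof -
    have "\<eta> * (5 + 4 * K4) \<le> \<sigma>\<^sup>2 / (2 * (5 + 4 * K4)) * (5 + 4 * K4)" using m(2) p1 by (intro mult_right_mono) auto
    also have "\<dots> = \<sigma>\<^sup>2 / 2" using p1 by (simp add: field_simps)
    finally show "\<eta> * (5 + 4 * K4) \<le> \<sigma>\<^sup>2 / 2" .
    show "\<eta> * (real CARD('d) * K + 1) \<le> 1" using m(3) p2 by (simp add: pos_le_divide_eq)
    show "4 * KL * \<eta> \<le> 1" using m(4) KL by (simp add: pos_le_divide_eq mult.commute)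
    show "\<eta> * Big \<le> \<epsilon>" using m(5) Big by (simp add: pos_le_divide_eq)
  qed
  obtain R1 where R1: "R1 \<ge> 0" "(\<integral>y. (1 + \<bar>y\<bar>) * V y * indicator {y. \<bar>y\<bar> > R1} y \<partial>F) < \<eta>"
    using tail_small[OF absV_F _ _ \<eta>0] V_nonneg by auto
  obtain R2 where R2: "R2 \<ge> 0" "mostly M (e/8) (\<lambda>n \<omega>. (\<Sum>i=1..n. (1 + \<bar>eps i \<omega>\<bar>) * V (eps i \<omega>) * indicator {y. \<bar>y\<bar> > R2} (eps i \<omega>)) / real n \<le> \<eta>)"
    using tail_average[OF \<eta>0 e8] by blast
  \<comment> \<open>A common radius for the tail of the law and for the empirical tail.\<close>
  define R where "R = max R1 R2"
  have ind: "indicator {y. \<bar>y\<bar> > R} y \<le> (indicator {y. \<bar>y\<bar> > R1} y :: real)" "indicator {y. \<bar>y\<bar> > R} y \<le> (indicator {y. \<bar>y\<bar> > R2} y :: real)" for y :: real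
    by (auto simp: indicator_def R_def)
  have R0: "R \<ge> 0" using R1 by (simp add: R_def)
  have tailf: "(\<integral>y. (1 + \<bar>y\<bar>) * V y * indicator {y. \<bar>y\<bar> > R} y \<partial>F) \<le> \<eta>"
  proof -
    have int: "integrable F (\<lambda>y. (1 + \<bar>y\<bar>) * V y * indicator {y. \<bar>y\<bar> > t} y)" for t
      by (rule F_mono[OF absV_F]) (auto simp: indicator_def V_nonneg)
    have "(\<integral>y. (1 + \<bar>y\<bar>) * V y * indicator {y. \<bar>y\<bar> > R} y \<partial>F) \<le> (\<integral>y. (1 + \<bar>y\<bar>) * V y * indicator {y. \<bar>y\<bar> > R1} y \<partial>F)"
      using V_nonneg by (intro integral_mono int mult_left_mono ind) auto
    then show ?thesis using R1(2) by linarith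
  qed
  \<comment> \<open>Consistency with constant 1 suffices, since n^(-1/4) absorbs the fixed factor R
    + 2.\<close>
  have one: "(1::real) > 0" by simp
  note ev = mostly_conj[OF K(2) mostly_conj[OF K4(2) mostly_conj[OF K5(2) mostly_conj[OF average_gd_nth[OF \<eta>0 e8]
     mostly_conj[OF average_eps_sq[OF \<eta>0 e8] mostly_conj[OF max_eps[OF \<eta>0 e8] mostly_conj[OF R2(2) ft_consistency[OF one e8]]]]]]]]
  have "(\<lambda>n. (R + 2) * real n powr (-1/4)) \<longlonglongrightarrow> (R + 2) * 0" "(\<lambda>n. sqrt K * real n powr (-1/3)) \<longlonglongrightarrow> sqrt K * 0"
    by (intro tendsto_intros tendsto_neg_powr filterlim_real_sequentially, simp)+
  from order_tendstoD(2)[OF this(1), of \<eta>] order_tendstoD(2)[OF this(2), of \<eta>]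
  have l1: "\<forall>\<^sub>F n in sequentially. (R + 2) * real n powr (-1/4) < \<eta>" and l2: "\<forall>\<^sub>F n in sequentially. sqrt K * real n powr (-1/3) < \<eta>"
    using \<eta>0 by simp_all
  have c0: "0 < 2 * KK * cs * K4" using KK(1) cs(1) K4(1) by simp
  then have "\<eta> / (2 * KK * cs * K4) > 0" using \<eta>0 by simp
  then have "min 1 (\<eta> / (2 * KK * cs * K4)) > 0" by simp
  note l3 = b_small[OF this]
  show ?thesis
  proof (rule mostly_mono[rotated, OF _ _ ev], use l1 l2 l3 good_close[OF \<eta>0 K(1)] eventually_ge_at_top[of 4] in \<open>eventually_elim, intro ballI impI; elim conjE\<close>)
    fix n \<omega>
    assume n1: "(R + 2) * real n powr (-1/4) < \<eta>" and n2: "sqrt K * real n powr (-1/3) < \<eta>"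
      and b0: "0 < b n" and b1: "b n < min 1 (\<eta> / (2 * KK * cs * K4))"
      and cl: "\<forall>\<omega>\<in>space M. good K n \<omega> \<longrightarrow> (\<forall>i\<in>{1..n}. \<bar>gd i \<omega> \<bullet> \<Delta> n \<omega>\<bar> \<le> \<eta> \<and> \<bar>rm n i \<omega>\<bar> \<le> \<eta>)"
      and n4: "4 \<le> n" and \<omega>: "\<omega> \<in> space M" and g: "good K n \<omega>"
      and V4: "(\<Sum>i=1..n. (1 + \<bar>eps i \<omega>\<bar>) * V (eps i \<omega>)) / real n \<le> K4"
      and E5: "\<bar>(\<Sum>i=1..n. eps i \<omega>) / real n\<bar> \<le> K5 * real n powr (-1/2)"
      and av: "\<forall>j. \<bar>(\<Sum>i=1..n. gd i \<omega> $ j) / real n - \<mu> $ j\<bar> \<le> \<eta>"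
      and sq: "\<bar>(\<Sum>i=1..n. (eps i \<omega>)\<^sup>2) / real n - \<sigma>\<^sup>2\<bar> \<le> \<eta>"
      and mx: "\<forall>i\<in>{1..n}. \<bar>eps i \<omega>\<bar> \<le> \<eta> * sqrt (real n)"
      and tl: "(\<Sum>i=1..n. (1 + \<bar>eps i \<omega>\<bar>) * V (eps i \<omega>) * indicator {y. \<bar>y\<bar> > R2} (eps i \<omega>)) / real n \<le> \<eta>"
      and cons: "nV (\<lambda>y. ft n \<omega> y - f y) \<le> ennreal (1 * real n powr (-1/4))"
    let ?q = "real n powr (-1/2)"
    have n: "1 \<le> n" using n4 by simp
    have qs: "?q * sqrt (real n) = 1" unfolding powr_neg_half using n by simp
    have cl': "\<forall>i\<in>{1..n}. \<bar>gd i \<omega> \<bullet> \<Delta> n \<omega>\<bar> \<le> \<eta> \<and> \<bar>rm n i \<omega>\<bar> \<le> \<eta>" using cl \<omega> g by blast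
    have cl1: "\<bar>eps i \<omega> - res n \<omega> i\<bar> \<le> 1" if "i \<in> {1..n}" for i
      using cl'[rule_format, OF that] res_eq[OF that \<omega>] m(1) by linarith
    define A where "A = ((\<Sum>i=1..n. eps i \<omega>) / real n - \<mu> \<bullet> \<Delta> n \<omega>) / \<sigma>\<^sup>2"
    note mc = multiplier_close[OF n4 \<omega> g K(1) V4 E5 av sq mx cl' less_imp_le[OF n2] KA_def KA KL_def refl \<eta>0 m(1) \<eta>(1-3)]
    have tl': "(\<Sum>i=1..n. (1 + \<bar>eps i \<omega>\<bar>) * V (eps i \<omega>) * indicator {y. \<bar>y\<bar> > R} (eps i \<omega>)) / real n \<le> \<eta>"
      using V_nonneg by (intro order_trans[OF _ tl] divide_right_mono sum_mono mult_left_mono ind) auto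
    have T1: "nV (\<lambda>y. (\<Sum>i=1..n. res n \<omega> i * kb (b n) (y - res n \<omega> i)) / real n - y * f y) \<le> ennreal (C1 * \<eta>)"
    proof -
      have "nV (\<lambda>y. (\<Sum>i=1..n. res n \<omega> i * kb (b n) (y - res n \<omega> i)) / real n - y * f y)
        \<le> ennreal (b n * (2 * KK * cs * K4) + (R + 2) * real n powr (-1/4) + 2 * KK * cs * \<eta> + \<eta>)"
        using b1 cons by (intro first_moment_bound[OF n b0 _ cl1 V4 tl' R0 tailf]) (auto simp: ft_def)
      also have "\<dots> \<le> ennreal (C1 * \<eta>)"
      proof (rule ennreal_leI)
        have "b n * (2 * KK * cs * K4) \<le> \<eta>" using b1 c0 by (simp add: pos_less_divide_eq)
        then show "b n * (2 * KK * cs * K4) + (R + 2) * real n powr (-1/4) + 2 * KK * cs * \<eta> + \<eta> \<le> C1 * \<eta>"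
          using n1 unfolding C1_def distrib_right by linarith
      qed
      finally show ?thesis .
    qed
    have "nV (\<lambda>y. fw n \<omega> y - ft n \<omega> y + A * (y * f y)) \<le> ennreal ((KL * ?q) * (C1 * \<eta>) + (\<eta> * C2 * ?q) * By + (KL * ?q)\<^sup>2 * (4 * (2 * \<eta> * sqrt (real n)) * KK * cs * K4))"
    proof (rule weighted_deterministic[OF n b0 _ cl1 V4 refl _ _ _ T1])
      show "\<bar>multiplier n (res n \<omega>)\<bar> \<le> KL * ?q" by (rule mc(1))
      show "\<And>i. i \<in> {1..n} \<Longrightarrow> \<bar>multiplier n (res n \<omega>) * res n \<omega> i\<bar> \<le> 1 / 2" by (rule mc(2))
      show "\<And>i. i \<in> {1..n} \<Longrightarrow> \<bar>res n \<omega> i\<bar> \<le> 2 * \<eta> * sqrt (real n)" by (rule mc(3))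
      show "\<bar>A - multiplier n (res n \<omega>)\<bar> \<le> \<eta> * C2 * ?q" using mc(4) unfolding A_def C2_def .
    qed (use b1 C(1) \<eta>0 By in auto)
    also have "(KL * ?q) * (C1 * \<eta>) + (\<eta> * C2 * ?q) * By + (KL * ?q)\<^sup>2 * (4 * (2 * \<eta> * sqrt (real n)) * KK * cs * K4) = (\<eta> * (KL * C1 + C2 * By + C3)) * ?q"
    proof -
      have "(KL * ?q)\<^sup>2 * (4 * (2 * \<eta> * sqrt (real n)) * KK * cs * K4) = \<eta> * C3 * ?q * (?q * sqrt (real n))"
        by (simp add: C3_def power2_eq_square)
      then show ?thesis unfolding qs by (simp add: algebra_simps)
    qed
    also have "ennreal \<dots> \<le> ennreal (\<epsilon> * ?q)"
    proof (intro ennreal_leI mult_right_mono)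
      have "\<eta> * (KL * C1 + C2 * By + C3) \<le> \<eta> * Big" using \<eta>0 by (intro mult_left_mono) (auto simp: Big_def)
      then show "\<eta> * (KL * C1 + C2 * By + C3) \<le> \<epsilon>" using \<eta>(4) by linarith
    qed simp
    finally show "nV (\<lambda>y. fw n \<omega> y - ft n \<omega> y + ((\<Sum>i=1..n. eps i \<omega>) / real n - \<mu> \<bullet> \<Delta> n \<omega>) / \<sigma>\<^sup>2 * (y * f y)) \<le> ennreal (\<epsilon> * ?q)"
      unfolding A_def .
  qed (use e in auto)
qed

end

section \<open>Multilinear functionals\<close>

interpretation lborel_PiM: product_sigma_finite "\<lambda>_::nat. lborel :: real measure" ..

lemma borel_measurable_PiM_lborel:
  "borel_measurable (\<Pi>\<^sub>M j\<in>I. lborel) = borel_measurable (\<Pi>\<^sub>M j\<in>I. (borel :: real measure))"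
  by (intro measurable_cong_sets sets_PiM_cong) auto

text \<open>The majorant is a product over the coordinates, so Tonelli factorises its integral into
  the norms of the factors.\<close>

lemma (in weight) multilinear_bound:
  fixes I :: "nat set" and u :: "nat \<Rightarrow> real \<Rightarrow> real"
  assumes I: "finite I" and [measurable]: "h \<in> borel_measurable (\<Pi>\<^sub>M j\<in>I. lborel)"
    and hb: "\<And>y. y \<in> space (\<Pi>\<^sub>M j\<in>I. lborel) \<Longrightarrow> \<bar>h y\<bar> \<le> c * (\<Prod>j\<in>I. V (y j))" and c: "c \<ge> 0"
    and [measurable]: "\<And>j. u j \<in> borel_measurable borel"
    and u: "\<And>j. j \<in> I \<Longrightarrow> nV (u j) \<le> ennreal (B j)" and B: "\<And>j. j \<in> I \<Longrightarrow> 0 \<le> B j"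
  shows "integrable (\<Pi>\<^sub>M j\<in>I. lborel) (\<lambda>y. h y * (\<Prod>j\<in>I. u j (y j)))"
    and "\<bar>\<integral>y. h y * (\<Prod>j\<in>I. u j (y j)) \<partial>(\<Pi>\<^sub>M j\<in>I. lborel)\<bar> \<le> c * (\<Prod>j\<in>I. B j)"
proof -
  have [measurable]: "(\<lambda>y. \<Prod>j\<in>I. u j (y j)) \<in> borel_measurable (\<Pi>\<^sub>M j\<in>I. lborel)"
    using I by measurable
  have "(\<integral>\<^sup>+y. ennreal (norm (h y * (\<Prod>j\<in>I. u j (y j)))) \<partial>(\<Pi>\<^sub>M j\<in>I. lborel))
      \<le> (\<integral>\<^sup>+y. ennreal c * (\<Prod>j\<in>I. ennreal (V (y j) * \<bar>u j (y j)\<bar>)) \<partial>(\<Pi>\<^sub>M j\<in>I. lborel))"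
  proof (rule nn_integral_mono)
    fix y assume y: "y \<in> space (\<Pi>\<^sub>M j\<in>I. (lborel :: real measure))"
    have "norm (h y * (\<Prod>j\<in>I. u j (y j))) \<le> (c * (\<Prod>j\<in>I. V (y j))) * \<bar>\<Prod>j\<in>I. u j (y j)\<bar>"
      unfolding real_norm_def abs_mult using hb[OF y] by (intro mult_right_mono) auto
    also have "\<dots> = c * (\<Prod>j\<in>I. V (y j) * \<bar>u j (y j)\<bar>)" by (simp add: abs_prod prod.distrib)
    finally show "ennreal (norm (h y * (\<Prod>j\<in>I. u j (y j)))) \<le> ennreal c * (\<Prod>j\<in>I. ennreal (V (y j) * \<bar>u j (y j)\<bar>))"
      using c V_nonneg by (subst prod_ennreal) (auto simp: ennreal_mult[symmetric] prod_nonneg intro!: ennreal_leI)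
  qed
  also have "\<dots> = ennreal c * (\<integral>\<^sup>+y. (\<Prod>j\<in>I. ennreal (V (y j) * \<bar>u j (y j)\<bar>)) \<partial>(\<Pi>\<^sub>M j\<in>I. lborel))"
    using I by (intro nn_integral_cmult) measurable
  also have "(\<integral>\<^sup>+y. (\<Prod>j\<in>I. ennreal (V (y j) * \<bar>u j (y j)\<bar>)) \<partial>(\<Pi>\<^sub>M j\<in>I. lborel)) = (\<Prod>j\<in>I. nV (u j))"
    unfolding vnorm_def by (rule lborel_PiM.product_nn_integral_prod[OF I]) measurable
  also have "(\<Prod>j\<in>I. nV (u j)) \<le> (\<Prod>j\<in>I. ennreal (B j))"
    using I u by (induction I) (auto intro: mult_mono)
  also have "(\<Prod>j\<in>I. ennreal (B j)) = ennreal (\<Prod>j\<in>I. B j)" using B by (rule prod_ennreal)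
  finally have le: "(\<integral>\<^sup>+y. ennreal (norm (h y * (\<Prod>j\<in>I. u j (y j)))) \<partial>(\<Pi>\<^sub>M j\<in>I. lborel)) \<le> ennreal (c * (\<Prod>j\<in>I. B j))"
    using c B by (simp add: ennreal_mult prod_nonneg mult_left_mono)
  have lt: "(\<integral>\<^sup>+y. ennreal (norm (h y * (\<Prod>j\<in>I. u j (y j)))) \<partial>(\<Pi>\<^sub>M j\<in>I. lborel)) < \<infinity>"
    by (rule le_less_trans[OF le]) simp
  have meas: "(\<lambda>y. h y * (\<Prod>j\<in>I. u j (y j))) \<in> borel_measurable (\<Pi>\<^sub>M j\<in>I. lborel)" by measurable
  show int: "integrable (\<Pi>\<^sub>M j\<in>I. lborel) (\<lambda>y. h y * (\<Prod>j\<in>I. u j (y j)))"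
    using meas lt unfolding integrable_iff_bounded by blast
  have "ennreal (norm (\<integral>y. h y * (\<Prod>j\<in>I. u j (y j)) \<partial>(\<Pi>\<^sub>M j\<in>I. lborel))) \<le> ennreal (c * (\<Prod>j\<in>I. B j))"
    by (rule order_trans[OF integral_norm_bound_ennreal[OF int] le])
  then show "\<bar>\<integral>y. h y * (\<Prod>j\<in>I. u j (y j)) \<partial>(\<Pi>\<^sub>M j\<in>I. lborel)\<bar> \<le> c * (\<Prod>j\<in>I. B j)"
    using c B by (subst (asm) ennreal_le_iff) (auto intro!: mult_nonneg_nonneg prod_nonneg)
qed

text \<open>Fubini with the distinguished coordinate outermost, the order in which
  \<open>h_bar_j\<close> appears as the inner integral.\<close>

lemma PiM_integral_insert_rev:
  fixes I :: "nat set" and q :: "(nat \<Rightarrow> real) \<Rightarrow> real"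
  assumes I: "finite I" "i \<notin> I" and int: "integrable (\<Pi>\<^sub>M j\<in>insert i I. lborel) q"
  shows "(\<integral>y. q y \<partial>(\<Pi>\<^sub>M j\<in>insert i I. lborel)) = (\<integral>t. (\<integral>y. q (y(i := t)) \<partial>(\<Pi>\<^sub>M j\<in>I. lborel)) \<partial>lborel)"
proof -
  interpret I: finite_product_sigma_finite "\<lambda>_::nat. lborel :: real measure" I by standard (rule I)
  interpret P: pair_sigma_finite "\<Pi>\<^sub>M j\<in>I. (lborel :: real measure)" "lborel :: real measure" ..
  have [measurable]: "q \<in> borel_measurable (\<Pi>\<^sub>M j\<in>insert i I. lborel)" using int by auto
  have m: "(\<lambda>(y, t). q (y(i := t))) \<in> borel_measurable ((\<Pi>\<^sub>M j\<in>I. lborel) \<Otimes>\<^sub>M lborel)" by measurable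
  have "(\<integral>\<^sup>+z. ennreal (norm ((\<lambda>(y, t). q (y(i := t))) z)) \<partial>((\<Pi>\<^sub>M j\<in>I. lborel) \<Otimes>\<^sub>M lborel)) =
      (\<integral>\<^sup>+y. \<integral>\<^sup>+t. ennreal (norm (q (y(i := t)))) \<partial>lborel \<partial>(\<Pi>\<^sub>M j\<in>I. lborel))"
    using m by (subst lborel.nn_integral_fst[symmetric]) auto
  also have "\<dots> = (\<integral>\<^sup>+y. ennreal (norm (q y)) \<partial>(\<Pi>\<^sub>M j\<in>insert i I. lborel))"
    using I by (subst lborel_PiM.product_nn_integral_insert) auto
  also have "\<dots> < \<infinity>" using int by (simp add: integrable_iff_bounded)
  finally have "integrable ((\<Pi>\<^sub>M j\<in>I. lborel) \<Otimes>\<^sub>M lborel) (\<lambda>(y, t). q (y(i := t)))"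
    using m unfolding integrable_iff_bounded by blast
  from P.Fubini_integral[OF this] lborel_PiM.product_integral_insert[OF I int] show ?thesis by simp
qed

context weight
begin

text \<open>The weight of the norm and the bound on \<open>G\<close> match. Since the constant
  depends only on the bound, one estimate serves the whole family of functions at once.\<close>

lemma bounded_functional:
  fixes G u :: "real \<Rightarrow> real"
  assumes [measurable]: "G \<in> borel_measurable borel" "u \<in> borel_measurable borel"
    and G: "\<And>t. \<bar>G t\<bar> \<le> c * V t" and c: "c \<ge> 0" and u: "nV u \<le> ennreal x" and x: "x \<ge> 0"
  shows "integrable lborel (\<lambda>t. G t * u t)" "\<bar>\<integral>t. G t * u t \<partial>lborel\<bar> \<le> c * x"
proof -
  have "(\<integral>\<^sup>+t. ennreal (norm (G t * u t)) \<partial>lborel) \<le> (\<integral>\<^sup>+t. ennreal c * ennreal (V t * \<bar>u t\<bar>) \<partial>lborel)"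
  proof (rule nn_integral_mono)
    fix t
    have "norm (G t * u t) \<le> (c * V t) * \<bar>u t\<bar>" unfolding real_norm_def abs_mult using G by (intro mult_right_mono) auto
    then show "ennreal (norm (G t * u t)) \<le> ennreal c * ennreal (V t * \<bar>u t\<bar>)"
      using c V_nonneg by (subst ennreal_mult[symmetric]) (auto intro!: ennreal_leI simp: mult.assoc)
  qed
  also have "\<dots> = ennreal c * nV u" unfolding vnorm_def by (rule nn_integral_cmult) measurable
  also have "\<dots> \<le> ennreal (c * x)" using u c x by (simp add: ennreal_mult mult_left_mono)
  finally have le: "(\<integral>\<^sup>+t. ennreal (norm (G t * u t)) \<partial>lborel) \<le> ennreal (c * x)" .
  have "(\<integral>\<^sup>+t. ennreal (norm (G t * u t)) \<partial>lborel) < \<infinity>" by (rule le_less_trans[OF le]) simp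
  then show int: "integrable lborel (\<lambda>t. G t * u t)" by (intro integrableI_bounded) measurable
  have "ennreal (norm (\<integral>t. G t * u t \<partial>lborel)) \<le> ennreal (c * x)"
    by (rule order_trans[OF integral_norm_bound_ennreal[OF int] le])
  then show "\<bar>\<integral>t. G t * u t \<partial>lborel\<bar> \<le> c * x" using c x by (subst (asm) ennreal_le_iff) auto
qed

context
  fixes m :: nat and h :: "(nat \<Rightarrow> real) \<Rightarrow> real" and f :: "real \<Rightarrow> real" and A :: real
  assumes h_meas: "h \<in> borel_measurable (\<Pi>\<^sub>M j\<in>{1..m}. borel)"
    and h_bd: "\<And>y. y \<in> space (\<Pi>\<^sub>M j\<in>{1..m}. borel) \<Longrightarrow> \<bar>h y\<bar> \<le> (\<Prod>j=1..m. V (y j))"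
    and f_meas[measurable]: "f \<in> borel_measurable borel" and A1: "1 \<le> A" and nVA: "nV f \<le> ennreal A"
begin

lemma h_meas': "h \<in> borel_measurable (\<Pi>\<^sub>M j\<in>{1..m}. lborel)"
  using h_meas by (simp add: borel_measurable_PiM_lborel)

lemma h_bd': "y \<in> space (\<Pi>\<^sub>M j\<in>{1..m}. (lborel :: real measure)) \<Longrightarrow> \<bar>h y\<bar> \<le> 1 * (\<Prod>j=1..m. V (y j))"
  using h_bd by (simp add: space_PiM)

lemma h_bar_j_measurable: assumes j: "j \<in> {1..m}" shows "h_bar_j m f h j \<in> borel_measurable borel"
proof -
  interpret I: finite_product_sigma_finite "\<lambda>_::nat. lborel :: real measure" "{1..m} - {j}" by standard auto
  have ins: "insert j ({1..m} - {j}) = {1..m}" using j by auto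
  have [measurable]: "(\<lambda>z. h ((snd z)(j := fst z))) \<in> borel_measurable (borel \<Otimes>\<^sub>M (\<Pi>\<^sub>M k\<in>{1..m} - {j}. lborel))"
    by (rule measurable_compose[OF measurable_fun_upd[of "{1..m}" "{1..m} - {j}" j] h_meas']) (use ins in auto)
  show ?thesis unfolding h_bar_j_def[abs_def]
    by (intro I.borel_measurable_lebesgue_integral) (simp add: case_prod_unfold)
qed

text \<open>The other m - 1 coordinates are integrated against \<open>f\<close>, each at a cost of
  at most \<open>A\<close>; as \<open>A\<close> is at least 1, the exponent may be raised to
  m.\<close>

lemma h_bar_j_bound: assumes j: "j \<in> {1..m}" shows "\<bar>h_bar_j m f h j t\<bar> \<le> A ^ m * V t"
proof -
  have ins: "insert j ({1..m} - {j}) = {1..m}" using j by auto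
  have "\<bar>h_bar_j m f h j t\<bar> \<le> V t * (\<Prod>k\<in>{1..m} - {j}. A)"
    unfolding h_bar_j_def
  proof (rule multilinear_bound(2)[where u="\<lambda>_. f"])
    show "(\<lambda>y. h (y(j := t))) \<in> borel_measurable (\<Pi>\<^sub>M k\<in>{1..m} - {j}. lborel)"
      by (rule measurable_compose[OF measurable_fun_upd[of "{1..m}" "{1..m} - {j}" j] h_meas']) (use ins in auto)
    fix y assume y: "y \<in> space (\<Pi>\<^sub>M k\<in>{1..m} - {j}. (lborel :: real measure))"
    have "y(j := t) \<in> space (\<Pi>\<^sub>M k\<in>{1..m}. (lborel :: real measure))"
      using y j by (auto simp: space_PiM PiE_def extensional_def)
    from h_bd'[OF this] have "\<bar>h (y(j := t))\<bar> \<le> (\<Prod>k\<in>{1..m}. V ((y(j := t)) k))" by simp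
    also have "\<dots> = V t * (\<Prod>k\<in>{1..m} - {j}. V ((y(j := t)) k))" using j by (subst prod.remove[of _ j]) auto
    also have "(\<Prod>k\<in>{1..m} - {j}. V ((y(j := t)) k)) = (\<Prod>k\<in>{1..m} - {j}. V (y k))" by (intro prod.cong) auto
    finally show "\<bar>h (y(j := t))\<bar> \<le> V t * (\<Prod>k\<in>{1..m} - {j}. V (y k))" .
  qed (use nVA A1 V_nonneg in auto)
  also have "(\<Prod>k\<in>{1..m} - {j}. A) = A ^ (m - 1)" using j by simp
  also have "V t * A ^ (m - 1) \<le> V t * A ^ m" using A1 V_nonneg by (intro mult_left_mono power_increasing) auto
  finally show ?thesis by (simp add: mult.commute)
qed

lemma h_bar_measurable: "h_bar m f h \<in> borel_measurable borel"
  unfolding h_bar_def[abs_def] using h_bar_j_measurable by measurable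

lemma h_bar_bound: "\<bar>h_bar m f h t\<bar> \<le> (real m * A ^ m) * V t"
proof -
  have "\<bar>h_bar m f h t\<bar> \<le> (\<Sum>j=1..m. \<bar>h_bar_j m f h j t\<bar>)" unfolding h_bar_def by (rule sum_abs)
  also have "\<dots> \<le> (\<Sum>j=1..m. A ^ m * V t)" by (intro sum_mono h_bar_j_bound)
  finally show ?thesis by simp
qed

text \<open>The product of the factors f + \<delta> is expanded over the sets of coordinates that
  carry \<delta>. Singletons produce \<open>h_bar\<close>; two or more factors \<delta> give x^2
  because x \<le> 1, and 2^m counts the sets.\<close>

lemma psi_expansion:
  assumes [measurable]: "g \<in> borel_measurable borel" and x: "nV (\<lambda>y. g y - f y) \<le> ennreal x" "0 \<le> x" "x \<le> 1"
  shows "\<bar>psi m h g - psi m h f - (\<integral>t. h_bar m f h t * (g t - f t) \<partial>lborel)\<bar> \<le> 2 ^ m * A ^ m * x\<^sup>2"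
proof -
  define \<delta> where "\<delta> y = g y - f y" for y
  have [measurable]: "\<delta> \<in> borel_measurable borel" unfolding \<delta>_def[abs_def] by measurable
  have d: "nV \<delta> \<le> ennreal x" using x(1) by (simp add: \<delta>_def[abs_def])
  let ?I = "{1..m}"
  let ?P = "\<Pi>\<^sub>M j\<in>?I. (lborel :: real measure)"
  define u where "u S j = (if j \<in> S then \<delta> else f)" for S :: "nat set" and j
  define B where "B S j = (if j \<in> S then x else A)" for S :: "nat set" and j :: nat
  have um: "u S j \<in> borel_measurable borel" for S j by (simp add: u_def)
  have ub: "nV (u S j) \<le> ennreal (B S j)" "0 \<le> B S j" for S j using d nVA x A1 by (auto simp: u_def B_def)
  define T where "T S = (\<integral>y. h y * (\<Prod>j\<in>?I. u S j (y j)) \<partial>?P)" for S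
  have fin: "finite ?I" by simp
  note mb = multilinear_bound[OF fin h_meas' h_bd' zero_le_one um ub]
  have split: "(\<Prod>j\<in>?I. u S j (y j)) = (\<Prod>j\<in>S. \<delta> (y j)) * (\<Prod>j\<in>?I - S. f (y j))" if "S \<subseteq> ?I" for S y
  proof -
    have "(\<Prod>j\<in>?I. u S j (y j)) = (\<Prod>j\<in>?I. if j \<in> S then \<delta> (y j) else f (y j))" by (intro prod.cong) (auto simp: u_def)
    also have "\<dots> = (\<Prod>j\<in>?I \<inter> {j. j \<in> S}. \<delta> (y j)) * (\<Prod>j\<in>?I \<inter> - {j. j \<in> S}. f (y j))" by (rule prod.If_cases) simp
    also have "?I \<inter> {j. j \<in> S} = S" using that by auto
    also have "?I \<inter> - {j. j \<in> S} = ?I - S" by auto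
    finally show ?thesis .
  qed
  have "psi m h g = (\<integral>y. (\<Sum>S\<in>Pow ?I. h y * (\<Prod>j\<in>?I. u S j (y j))) \<partial>?P)"
    unfolding psi_def
  proof (intro Bochner_Integration.integral_cong refl)
    fix y
    have "(\<Prod>j\<in>?I. g (y j)) = (\<Prod>j\<in>?I. \<delta> (y j) + f (y j))" by (simp add: \<delta>_def)
    also have "\<dots> = (\<Sum>S\<in>Pow ?I. (\<Prod>j\<in>S. \<delta> (y j)) * (\<Prod>j\<in>?I - S. f (y j)))" by (rule prod_add) simp
    also have "\<dots> = (\<Sum>S\<in>Pow ?I. \<Prod>j\<in>?I. u S j (y j))" by (intro sum.cong refl split[symmetric]) auto
    finally show "h y * (\<Prod>j=1..m. g (y j)) = (\<Sum>S\<in>Pow ?I. h y * (\<Prod>j\<in>?I. u S j (y j)))"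
      by (simp only: sum_distrib_left)
  qed
  also have "\<dots> = (\<Sum>S\<in>Pow ?I. T S)" unfolding T_def by (rule Bochner_Integration.integral_sum) (rule mb(1))
  also have "Pow ?I = {{}} \<union> ((\<lambda>j. {j}) ` ?I \<union> {S\<in>Pow ?I. 2 \<le> card S})" (is "_ = _ \<union> (?S1 \<union> ?R)")
  proof (intro equalityI subsetI)
    fix S assume S: "S \<in> Pow ?I"
    then have fS: "finite S" using finite_subset by auto
    consider "card S = 0" | "card S = 1" | "2 \<le> card S" by linarith
    then show "S \<in> {{}} \<union> (?S1 \<union> ?R)"
      using S fS by cases (auto simp: card_1_singleton_iff One_nat_def)
  qed auto
  also have "(\<Sum>S\<in>{{}} \<union> (?S1 \<union> ?R). T S) = T {} + ((\<Sum>S\<in>?S1. T S) + (\<Sum>S\<in>?R. T S))"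
    by (subst sum.union_disjoint; (subst sum.union_disjoint)?) auto
  also have "T {} = psi m h f" by (simp add: T_def u_def psi_def)
  also have "(\<Sum>S\<in>?S1. T S) = (\<Sum>j\<in>?I. T {j})" by (subst sum.reindex) (auto simp: inj_on_def)
  also have "(\<Sum>j\<in>?I. T {j}) = (\<integral>t. h_bar m f h t * \<delta> t \<partial>lborel)"
  proof -
    have "T {j} = (\<integral>t. h_bar_j m f h j t * \<delta> t \<partial>lborel)" if j: "j \<in> ?I" for j
    proof -
      have ins: "insert j (?I - {j}) = ?I" using j by auto
      have int: "integrable ?P (\<lambda>y. h y * (\<Prod>k\<in>?I. u {j} k (y k)))" by (rule mb(1))
      have "T {j} = (\<integral>y. h y * (\<delta> (y j) * (\<Prod>k\<in>?I - {j}. f (y k))) \<partial>?P)"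
        unfolding T_def using j by (simp add: split)
      also have "\<dots> = (\<integral>t. (\<integral>y. h (y(j := t)) * (\<delta> ((y(j := t)) j) * (\<Prod>k\<in>?I - {j}. f ((y(j := t)) k))) \<partial>(\<Pi>\<^sub>M k\<in>?I - {j}. lborel)) \<partial>lborel)"
        using PiM_integral_insert_rev[of "?I - {j}" j "\<lambda>y. h y * (\<delta> (y j) * (\<Prod>k\<in>?I - {j}. f (y k)))", unfolded ins] int j
        by (simp add: split)
      also have "\<dots> = (\<integral>t. h_bar_j m f h j t * \<delta> t \<partial>lborel)"
      proof (intro Bochner_Integration.integral_cong refl)
        fix t
        have "(\<integral>y. h (y(j := t)) * (\<delta> ((y(j := t)) j) * (\<Prod>k\<in>?I - {j}. f ((y(j := t)) k))) \<partial>(\<Pi>\<^sub>M k\<in>?I - {j}. lborel))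
          = (\<integral>y. (h (y(j := t)) * (\<Prod>k\<in>?I - {j}. f (y k))) * \<delta> t \<partial>(\<Pi>\<^sub>M k\<in>?I - {j}. lborel))"
          by (intro Bochner_Integration.integral_cong refl) (simp add: mult_ac cong: prod.cong_simp)
        then show "(\<integral>y. h (y(j := t)) * (\<delta> ((y(j := t)) j) * (\<Prod>k\<in>?I - {j}. f ((y(j := t)) k))) \<partial>(\<Pi>\<^sub>M k\<in>?I - {j}. lborel)) = h_bar_j m f h j t * \<delta> t"
          by (simp add: h_bar_j_def)
      qed
      finally show ?thesis .
    qed
    then have "(\<Sum>j\<in>?I. T {j}) = (\<Sum>j\<in>?I. \<integral>t. h_bar_j m f h j t * \<delta> t \<partial>lborel)" by (rule sum.cong[OF refl])
    also have "\<dots> = (\<integral>t. (\<Sum>j\<in>?I. h_bar_j m f h j t * \<delta> t) \<partial>lborel)"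
      by (rule Bochner_Integration.integral_sum[symmetric], rule bounded_functional(1)[OF _ _ h_bar_j_bound _ d x(2)]) (use A1 h_bar_j_measurable in auto)
    finally show ?thesis by (simp add: h_bar_def sum_distrib_right)
  qed
  finally have eq: "psi m h g - psi m h f - (\<integral>t. h_bar m f h t * \<delta> t \<partial>lborel) = (\<Sum>S\<in>?R. T S)" by simp
  have "\<bar>\<Sum>S\<in>?R. T S\<bar> \<le> (\<Sum>S\<in>?R. \<bar>T S\<bar>)" by (rule sum_abs)
  also have "\<dots> \<le> (\<Sum>S\<in>?R. A ^ m * x\<^sup>2)"
  proof (rule sum_mono)
    fix S assume S: "S \<in> ?R"
    have "\<bar>T S\<bar> \<le> 1 * (\<Prod>j\<in>?I. B S j)" unfolding T_def by (rule mb(2))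
    also have "1 * (\<Prod>j\<in>?I. B S j) = (\<Prod>j\<in>?I \<inter> {j. j \<in> S}. x) * (\<Prod>j\<in>?I \<inter> - {j. j \<in> S}. A)"
      unfolding B_def by (subst prod.If_cases) auto
    also have "?I \<inter> {j. j \<in> S} = S" using S by auto
    also have "(\<Prod>j\<in>S. x) * (\<Prod>j\<in>?I \<inter> - {j. j \<in> S}. A) = x ^ card S * A ^ card (?I \<inter> - {j. j \<in> S})" by simp
    also have "\<dots> \<le> x ^ 2 * A ^ card ?I"
      using S x A1 by (intro mult_mono power_decreasing power_increasing card_mono) auto
    finally show "\<bar>T S\<bar> \<le> A ^ m * x\<^sup>2" by (simp add: mult.commute)
  qed
  also have "\<dots> = real (card ?R) * (A ^ m * x\<^sup>2)" by simp
  also have "\<dots> \<le> real (card (Pow ?I)) * (A ^ m * x\<^sup>2)"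
    using A1 by (intro mult_right_mono) (auto intro!: card_mono simp del: card_Pow)
  also have "\<dots> = 2 ^ m * A ^ m * x\<^sup>2" by (simp add: card_Pow)
  finally show ?thesis unfolding eq[unfolded \<delta>_def] .
qed

end

end

context ar_kde
begin

section \<open>Exact identities behind the two expansions\<close>

context
  fixes G :: "real \<Rightarrow> real" and C :: real
  assumes G_meas[measurable]: "G \<in> borel_measurable borel" and G_bd: "\<And>t. \<bar>G t\<bar> \<le> C * V t" and C: "0 \<le> C"
begin

lemma G_integrable:
  assumes [measurable]: "u \<in> borel_measurable borel" and "nV u < \<infinity>"
  shows "integrable lborel (\<lambda>t. G t * u t)"
proof -
  obtain x where "nV u = ennreal x" "0 \<le> x" using assms(2) by (cases "nV u") auto
  then show ?thesis by (intro bounded_functional(1)[OF G_meas assms(1) G_bd C, of x]) simp_all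
qed

text \<open>With f' = -l f, the centring constant multiplies the integral of f', which
  vanishes.\<close>

lemma score_star: "innov_mean f (\<lambda>y. g_star f G y * l y) = - (\<integral>y. G y * f' y \<partial>lborel)"
proof -
  have "innov_mean f (\<lambda>y. g_star f G y * l y) = (\<integral>y. - (G y * f' y) + innov_mean f G * f' y \<partial>lborel)"
    unfolding innov_mean_def[of f "\<lambda>y. g_star f G y * l y"]
    by (intro Bochner_Integration.integral_cong refl) (simp add: g_star_def f'_eq algebra_simps)
  also have "\<dots> = - (\<integral>y. G y * f' y \<partial>lborel)"
    using G_integrable[OF f'_measurable nVf'] f'_integrable
    by (subst Bochner_Integration.integral_add) (auto simp: integral_f')
  finally show ?thesis .
qed

text \<open>Compared with the star version, the linear correction contributes through the integral
  of y f', which equals -1.\<close>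

lemma score_sharp:
  "innov_mean f (\<lambda>y. g_sharp f \<sigma> G y * l y) = - (\<integral>y. G y * f' y \<partial>lborel) - innov_mean f (\<lambda>x. x * G x) / \<sigma>\<^sup>2"
proof -
  define a where "a = innov_mean f (\<lambda>x. x * G x) / \<sigma>\<^sup>2"
  have "innov_mean f (\<lambda>y. g_sharp f \<sigma> G y * l y) = (\<integral>y. (- (G y * f' y) + innov_mean f G * f' y) + a * (y * f' y) \<partial>lborel)"
    unfolding innov_mean_def[of f "\<lambda>y. g_sharp f \<sigma> G y * l y"]
    by (intro Bochner_Integration.integral_cong refl) (simp add: g_sharp_def a_def[symmetric] f'_eq algebra_simps)
  also have "\<dots> = (- (\<integral>y. G y * f' y \<partial>lborel) + innov_mean f G * 0) + a * (-1)"
    using G_integrable[OF f'_measurable nVf'] f'_integrable yf'_integrable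
    by (simp add: integral_f' integral_yf')
  finally show ?thesis by (simp add: a_def)
qed

text \<open>Pure algebra once the integrals may be split: sample averages, means and the smoothing
  term cancel, and what is left are two errors that are small in norm. \<open>P\<close> and
  \<open>Q\<close> stand for the two values of the functional.\<close>

lemma expansion_star:
  assumes [measurable]: "g \<in> borel_measurable borel" and n: "1 \<le> n" and g: "nV (\<lambda>y. g y - f y) < \<infinity>"
    and fh: "nV (\<lambda>y. g y - fhat n \<omega> y - f' y * c) < \<infinity>"
  shows "P - Q - (\<Sum>i=1..n. g_star f G (eps i \<omega>)) / real n + innov_mean f (\<lambda>y. g_star f G y * l y) * c
      - U_stat k (b n) n (\<lambda>i. eps i \<omega>) G
    = (P - Q - (\<integral>t. G t * (g t - f t) \<partial>lborel)) + (\<integral>t. G t * (g t - fhat n \<omega> t - f' t * c) \<partial>lborel)"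
    "integrable lborel (\<lambda>t. G t * g t)" "integrable lborel (\<lambda>t. G t * fhat n \<omega> t)"
proof -
  have 1: "integrable lborel (\<lambda>t. G t * f t)" "integrable lborel (\<lambda>t. G t * f' t)"
    "integrable lborel (\<lambda>t. G t * (g t - f t))" "integrable lborel (\<lambda>t. G t * (g t - fhat n \<omega> t - f' t * c))"
    by (rule G_integrable, measurable, rule nVf nVf' g fh)+
  show 2: "integrable lborel (\<lambda>t. G t * g t)"
    using Bochner_Integration.integrable_add[OF 1(3,1)] by (simp add: algebra_simps)
  have "integrable lborel (\<lambda>t. G t * g t - G t * f' t * c - G t * (g t - fhat n \<omega> t - f' t * c))"
    using 1(2,4) 2 by auto
  then show 3: "integrable lborel (\<lambda>t. G t * fhat n \<omega> t)" by (simp add: algebra_simps)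
  have "(\<integral>t. G t * (g t - f t) \<partial>lborel) = (\<integral>t. G t * g t \<partial>lborel) - (\<integral>t. G t * f t \<partial>lborel)"
    unfolding right_diff_distrib by (rule Bochner_Integration.integral_diff[OF 2 1(1)])
  moreover have "(\<integral>t. G t * (g t - fhat n \<omega> t - f' t * c) \<partial>lborel)
      = (\<integral>t. G t * g t \<partial>lborel) - (\<integral>t. G t * fhat n \<omega> t \<partial>lborel) - (\<integral>t. G t * f' t \<partial>lborel) * c"
    unfolding right_diff_distrib mult.assoc[symmetric] using 1(2) 2 3 by simp
  moreover have "(\<Sum>i=1..n. g_star f G (eps i \<omega>)) / real n = (\<Sum>i=1..n. G (eps i \<omega>)) / real n - (\<integral>t. G t * f t \<partial>lborel)"
    using n by (simp add: g_star_def innov_mean_def sum_subtractf diff_divide_distrib)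
  ultimately show "P - Q - (\<Sum>i=1..n. g_star f G (eps i \<omega>)) / real n + innov_mean f (\<lambda>y. g_star f G y * l y) * c
      - U_stat k (b n) n (\<lambda>i. eps i \<omega>) G
    = (P - Q - (\<integral>t. G t * (g t - f t) \<partial>lborel)) + (\<integral>t. G t * (g t - fhat n \<omega> t - f' t * c) \<partial>lborel)"
    unfolding score_star U_stat_def fhat_def by simp
qed

text \<open>The weight correction integrates to E[x G(x)]/\<sigma>^2 times the mean innovation minus
  \<open>c\<close>, which is exactly the amount by which the linear term and the score term change
  from star to sharp.\<close>

lemma expansion_sharp:
  assumes [measurable]: "g \<in> borel_measurable borel" "v \<in> borel_measurable borel" and n: "1 \<le> n"
    and g: "nV (\<lambda>y. g y - f y) < \<infinity>" and fh: "nV (\<lambda>y. g y - fhat n \<omega> y - f' y * c) < \<infinity>"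
    and v: "nV (\<lambda>y. v y - g y + ((\<Sum>i=1..n. eps i \<omega>) / real n - c) / \<sigma>\<^sup>2 * (y * f y)) < \<infinity>"
    and yf: "nV (\<lambda>y. y * f y) < \<infinity>"
  shows "P - Q - (\<Sum>i=1..n. g_sharp f \<sigma> G (eps i \<omega>)) / real n + innov_mean f (\<lambda>y. g_sharp f \<sigma> G y * l y) * c
      - U_stat k (b n) n (\<lambda>i. eps i \<omega>) G
    = (P - Q - (\<integral>t. G t * (v t - f t) \<partial>lborel))
      + (\<integral>t. G t * (v t - g t + ((\<Sum>i=1..n. eps i \<omega>) / real n - c) / \<sigma>\<^sup>2 * (t * f t)) \<partial>lborel)
      + (\<integral>t. G t * (g t - fhat n \<omega> t - f' t * c) \<partial>lborel)"
proof -
  define s where "s = ((\<Sum>i=1..n. eps i \<omega>) / real n - c) / \<sigma>\<^sup>2"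
  note gi = expansion_star[OF assms(1) n g fh]
  have 1: "integrable lborel (\<lambda>t. G t * f t)" "integrable lborel (\<lambda>t. G t * (t * f t))"
    "integrable lborel (\<lambda>t. G t * (v t - g t + s * (t * f t)))"
    by (rule G_integrable, measurable, rule nVf yf v[folded s_def])+
  have "integrable lborel (\<lambda>t. G t * (v t - g t + s * (t * f t)) + G t * g t - s * (G t * (t * f t)))"
    using 1(2,3) gi(2) by auto
  then have 2: "integrable lborel (\<lambda>t. G t * v t)" by (simp add: algebra_simps)
  have i1: "(\<integral>t. G t * (v t - f t) \<partial>lborel) = (\<integral>t. G t * v t \<partial>lborel) - (\<integral>t. G t * f t \<partial>lborel)"
    unfolding right_diff_distrib using 1(1) 2 by simp
  have i2: "(\<integral>t. G t * (v t - g t + s * (t * f t)) \<partial>lborel)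
      = (\<integral>t. G t * v t \<partial>lborel) - (\<integral>t. G t * g t \<partial>lborel) + s * innov_mean f (\<lambda>x. x * G x)"
  proof -
    have "(\<integral>t. G t * (v t - g t + s * (t * f t)) \<partial>lborel) = (\<integral>t. G t * v t - G t * g t + s * (G t * (t * f t)) \<partial>lborel)"
      by (simp add: algebra_simps)
    also have "\<dots> = (\<integral>t. G t * v t \<partial>lborel) - (\<integral>t. G t * g t \<partial>lborel) + s * (\<integral>t. G t * (t * f t) \<partial>lborel)"
      using 1(2) 2 gi(2) by simp
    finally show ?thesis by (simp add: innov_mean_def mult_ac)
  qed
  have i3: "(\<integral>t. G t * (g t - f t) \<partial>lborel) = (\<integral>t. G t * g t \<partial>lborel) - (\<integral>t. G t * f t \<partial>lborel)"
    unfolding right_diff_distrib using 1(1) gi(2) by simp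
  have s3: "(\<Sum>i=1..n. g_sharp f \<sigma> G (eps i \<omega>)) / real n
      = (\<Sum>i=1..n. g_star f G (eps i \<omega>)) / real n - innov_mean f (\<lambda>x. x * G x) / \<sigma>\<^sup>2 * ((\<Sum>i=1..n. eps i \<omega>) / real n)"
  proof -
    have "g_sharp f \<sigma> G y = g_star f G y - innov_mean f (\<lambda>x. x * G x) / \<sigma>\<^sup>2 * y" for y
      by (simp add: g_sharp_def g_star_def)
    then show ?thesis by (simp only: sum_subtractf diff_divide_distrib sum_distrib_left[symmetric] times_divide_eq_right)
  qed
  have s4: "innov_mean f (\<lambda>y. g_sharp f \<sigma> G y * l y) = innov_mean f (\<lambda>y. g_star f G y * l y) - innov_mean f (\<lambda>x. x * G x) / \<sigma>\<^sup>2"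
    unfolding score_sharp score_star ..
  have s5: "s * innov_mean f (\<lambda>x. x * G x) = innov_mean f (\<lambda>x. x * G x) / \<sigma>\<^sup>2 * ((\<Sum>i=1..n. eps i \<omega>) / real n) - innov_mean f (\<lambda>x. x * G x) / \<sigma>\<^sup>2 * c"
    by (simp add: s_def algebra_simps diff_divide_distrib)
  show ?thesis
    unfolding s_def[symmetric] s3 s4 i2 s5 i1 left_diff_distrib using gi(1)[of P Q] unfolding i3 by linarith
qed

end

end

context ar_kde_est
begin

lemma mean_shift: assumes e: "e > 0"
  shows "\<exists>K>0. mostly M e (\<lambda>n \<omega>. \<bar>((\<Sum>i=1..n. eps i \<omega>) / real n - \<mu> \<bullet> \<Delta> n \<omega>) / \<sigma>\<^sup>2\<bar> \<le> K * real n powr (-1/2))"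
proof -
  have e2: "e / 2 > 0" using e by simp
  obtain K1 where K1: "K1 > 0" "mostly M (e/2) (\<lambda>n \<omega>. \<bar>(\<Sum>i=1..n. eps i \<omega>) / real n\<bar> \<le> K1 * real n powr (-1/2))"
    using mean_eps[OF e2] by blast
  obtain K2 where K2: "K2 > 0" "mostly M (e/2) (good K2)" using good_mostly[OF e2] by blast
  have "mostly M (e/2 + e/2) (\<lambda>n \<omega>. \<bar>(\<Sum>i=1..n. eps i \<omega>) / real n\<bar> \<le> K1 * real n powr (-1/2) \<and> good K2 n \<omega>)"
    using e2 by (intro mostly_conj K1(2) K2(2)) auto
  then have "mostly M e (\<lambda>n \<omega>. \<bar>((\<Sum>i=1..n. eps i \<omega>) / real n - \<mu> \<bullet> \<Delta> n \<omega>) / \<sigma>\<^sup>2\<bar> \<le> ((K1 + norm \<mu> * K2) / \<sigma>\<^sup>2) * real n powr (-1/2))"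
  proof (rule mostly_mono, (intro always_eventually allI ballI impI; elim conjE))
    fix n \<omega> assume 1: "\<bar>(\<Sum>i=1..n. eps i \<omega>) / real n\<bar> \<le> K1 * real n powr (-1/2)" and 2: "good K2 n \<omega>"
    have "\<bar>\<mu> \<bullet> \<Delta> n \<omega>\<bar> \<le> norm \<mu> * (K2 * real n powr (-1/2))"
      using 2 by (intro order_trans[OF Cauchy_Schwarz_ineq2] mult_left_mono) (auto simp: good_def)
    with 1 have "\<bar>(\<Sum>i=1..n. eps i \<omega>) / real n - \<mu> \<bullet> \<Delta> n \<omega>\<bar> \<le> (K1 + norm \<mu> * K2) * real n powr (-1/2)"
      unfolding distrib_right mult.assoc by linarith
    then have "\<bar>(\<Sum>i=1..n. eps i \<omega>) / real n - \<mu> \<bullet> \<Delta> n \<omega>\<bar> / \<sigma>\<^sup>2 \<le> (K1 + norm \<mu> * K2) * real n powr (-1/2) / \<sigma>\<^sup>2"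
      by (rule divide_right_mono) simp
    then show "\<bar>((\<Sum>i=1..n. eps i \<omega>) / real n - \<mu> \<bullet> \<Delta> n \<omega>) / \<sigma>\<^sup>2\<bar> \<le> ((K1 + norm \<mu> * K2) / \<sigma>\<^sup>2) * real n powr (-1/2)"
      unfolding abs_divide abs_power2 by simp
  qed (use e in simp)
  moreover have "(K1 + norm \<mu> * K2) / \<sigma>\<^sup>2 > 0" using K1(1) K2(1) \<sigma>_pos by (intro divide_pos_pos add_pos_nonneg) auto
  ultimately show ?thesis by blast
qed

text \<open>The weights change the estimator by O_p(n^(-1/2)) in norm, so the rate of the unweighted
  estimator is kept.\<close>

lemma fw_consistency:
  assumes \<epsilon>: "\<epsilon> > 0" and e: "e > 0"
  shows "mostly M e (\<lambda>n \<omega>. nV (\<lambda>y. fw n \<omega> y - f y) \<le> ennreal (\<epsilon> * real n powr (-1/4)))"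
proof -
  have e3: "e / 3 > 0" and \<epsilon>3: "\<epsilon> / 3 > 0" using e \<epsilon> by auto
  obtain K where K: "K > 0" "mostly M (e/3) (\<lambda>n \<omega>. \<bar>((\<Sum>i=1..n. eps i \<omega>) / real n - \<mu> \<bullet> \<Delta> n \<omega>) / \<sigma>\<^sup>2\<bar> \<le> K * real n powr (-1/2))"
    using mean_shift[OF e3] by blast
  obtain Y where Y: "nV (\<lambda>y. y * f y) = ennreal Y" "Y \<ge> 0" using nV_yf by (cases "nV (\<lambda>y. y * f y)") auto
  let ?s = "\<lambda>n \<omega>. ((\<Sum>i=1..n. eps i \<omega>) / real n - \<mu> \<bullet> \<Delta> n \<omega>) / \<sigma>\<^sup>2"
  have "mostly M (e/3 + (e/3 + e/3)) (\<lambda>n \<omega>. \<bar>?s n \<omega>\<bar> \<le> K * real n powr (-1/2)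
      \<and> nV (\<lambda>y. fw n \<omega> y - ft n \<omega> y + ?s n \<omega> * (y * f y)) \<le> ennreal (\<epsilon> / 3 * real n powr (-1/2))
      \<and> nV (\<lambda>y. ft n \<omega> y - f y) \<le> ennreal (\<epsilon> / 3 * real n powr (-1/4)))"
    using e by (intro mostly_conj K(2) fw_expansion[OF \<epsilon>3 e3] ft_consistency[OF \<epsilon>3 e3]) auto
  note ev = this
  have "(\<lambda>n. Y * K * real n powr (-1/4)) \<longlonglongrightarrow> Y * K * 0"
    by (intro tendsto_intros tendsto_neg_powr filterlim_real_sequentially) simp
  then have lim: "\<forall>\<^sub>F n in sequentially. Y * K * real n powr (-1/4) < \<epsilon> / 3" using \<epsilon> by (intro order_tendstoD) auto
  show ?thesis
  proof (rule mostly_mono[OF ev], use lim eventually_ge_at_top[of 1] in \<open>eventually_elim, intro ballI impI; elim conjE\<close>)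
    fix n \<omega> assume a: "Y * K * real n powr (-1/4) < \<epsilon> / 3" and n: "1 \<le> (n::nat)"
      and s: "\<bar>?s n \<omega>\<bar> \<le> K * real n powr (-1/2)"
      and E1: "nV (\<lambda>y. fw n \<omega> y - ft n \<omega> y + ?s n \<omega> * (y * f y)) \<le> ennreal (\<epsilon> / 3 * real n powr (-1/2))"
      and E2: "nV (\<lambda>y. ft n \<omega> y - f y) \<le> ennreal (\<epsilon> / 3 * real n powr (-1/4))"
    let ?q = "real n powr (-1/4)"
    have h: "real n powr (-1/2) = ?q * ?q" by (simp only: powr_add[symmetric]) simp
    have q1: "?q \<le> 1" using powr_mono[of "-1/4" 0 "real n"] n by simp
    have E1': "nV (\<lambda>y. fw n \<omega> y - ft n \<omega> y + ?s n \<omega> * (y * f y)) \<le> ennreal (\<epsilon> / 3 * ?q)"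
    proof (rule order_trans[OF E1 ennreal_leI])
      show "\<epsilon> / 3 * real n powr (-1/2) \<le> \<epsilon> / 3 * ?q"
        unfolding h using q1 \<epsilon> by (intro mult_left_mono mult_left_le) auto
    qed
    have E3: "nV (\<lambda>y. - ?s n \<omega> * (y * f y)) \<le> ennreal (\<epsilon> / 3 * ?q)"
    proof -
      have "nV (\<lambda>y. - ?s n \<omega> * (y * f y)) = ennreal \<bar>?s n \<omega>\<bar> * ennreal Y"
        unfolding Y(1)[symmetric] using nV_cmult[of "\<lambda>y. y * f y" "- ?s n \<omega>"] by (simp only: abs_minus_cancel) measurable
      also have "\<dots> \<le> ennreal (K * real n powr (-1/2)) * ennreal Y" using s by (intro mult_right_mono ennreal_leI) auto
      also have "\<dots> = ennreal ((Y * K * ?q) * ?q)"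
        unfolding h using Y(2) K(1) by (subst ennreal_mult[symmetric]) (auto simp: mult_ac)
      also have "\<dots> \<le> ennreal (\<epsilon> / 3 * ?q)" using a by (intro ennreal_leI mult_right_mono) auto
      finally show ?thesis .
    qed
    have E32: "nV (\<lambda>y. - ?s n \<omega> * (y * f y) + (ft n \<omega> y - f y)) \<le> ennreal (\<epsilon> / 3 * ?q) + ennreal (\<epsilon> / 3 * ?q)"
      by (rule order_trans[OF nV_triangle add_mono[OF E3 E2]]) measurable
    have "nV (\<lambda>y. fw n \<omega> y - f y) = nV (\<lambda>y. (fw n \<omega> y - ft n \<omega> y + ?s n \<omega> * (y * f y)) + (- ?s n \<omega> * (y * f y) + (ft n \<omega> y - f y)))"
      by (intro arg_cong[where f=nV] ext) simp
    also have "\<dots> \<le> ennreal (\<epsilon> / 3 * ?q) + (ennreal (\<epsilon> / 3 * ?q) + ennreal (\<epsilon> / 3 * ?q))"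
      by (rule order_trans[OF nV_triangle add_mono[OF E1' E32]]) measurable
    also have "\<dots> = ennreal (\<epsilon> * ?q)" using \<epsilon> by (simp add: ennreal_plus[symmetric] del: ennreal_plus)
    finally show "nV (\<lambda>y. fw n \<omega> y - f y) \<le> ennreal (\<epsilon> * real n powr (-1/4))" .
  qed (use e in simp)
qed

text \<open>The constants \<open>C\<close> and \<open>C2\<close> bound all members of the family at
  once, so one event serves the whole supremum, whatever the size of the family.\<close>

lemma expansion:
  fixes H :: "((nat \<Rightarrow> real) \<Rightarrow> real) set"
  assumes Hm: "\<And>h. h \<in> H \<Longrightarrow> h \<in> borel_measurable (\<Pi>\<^sub>M j\<in>{1..m}. borel)"
    and Hb: "\<And>h y. h \<in> H \<Longrightarrow> y \<in> space (\<Pi>\<^sub>M j\<in>{1..m}. borel) \<Longrightarrow> \<bar>h y\<bar> \<le> (\<Prod>j=1..m. V (y j))"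
  shows "smallo_prob M
      (\<lambda>n \<omega>. SUP h\<in>H. ennreal \<bar>psi m h (ft n \<omega>) - psi m h f
          - (\<Sum>i=1..n. g_star f (h_bar m f h) (eps i \<omega>)) / real n
          + B_vec f l \<mu> (g_star f (h_bar m f h)) \<bullet> \<Delta> n \<omega>
          - U_stat k (b n) n (\<lambda>i. eps i \<omega>) (h_bar m f h)\<bar>) (\<lambda>n. real n powr (-1/2))" (is ?star)
    and "smallo_prob M
      (\<lambda>n \<omega>. SUP h\<in>H. ennreal \<bar>psi m h (fw n \<omega>) - psi m h f
          - (\<Sum>i=1..n. g_sharp f \<sigma> (h_bar m f h) (eps i \<omega>)) / real n
          + B_vec f l \<mu> (g_sharp f \<sigma> (h_bar m f h)) \<bullet> \<Delta> n \<omega>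
          - U_stat k (b n) n (\<lambda>i. eps i \<omega>) (h_bar m f h)\<bar>) (\<lambda>n. real n powr (-1/2))" (is ?sharp)
proof -
  \<comment> \<open>Enlarged to at least 1, since the multilinear bounds raise it to the power
    m.\<close>
  obtain A where A: "1 \<le> A" "nV f \<le> ennreal A"
  proof (cases "nV f")
    case (real x)
    then show ?thesis by (intro that[of "max 1 x"]) (auto intro: ennreal_leI)
  qed (use nVf in simp)
  define C where "C = real m * A ^ m"
  define C2 where "C2 = 2 ^ m * A ^ m"
  have C0: "0 \<le> C" "0 \<le> C2" using A(1) by (auto simp: C_def C2_def)
  have G: "h_bar m f h \<in> borel_measurable borel" "\<bar>h_bar m f h t\<bar> \<le> C * V t" if "h \<in> H" for h t
    unfolding C_def
    using h_bar_measurable[OF Hm[OF that] Hb[OF that] f_measurable A] h_bar_bound[OF Hm[OF that] Hb[OF that] f_measurable A]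
    by blast+
  have R: "\<bar>psi m h g - psi m h f - (\<integral>t. h_bar m f h t * (g t - f t) \<partial>lborel)\<bar> \<le> C2 * x\<^sup>2"
    if "h \<in> H" "g \<in> borel_measurable borel" "nV (\<lambda>y. g y - f y) \<le> ennreal x" "0 \<le> x" "x \<le> 1" for h g x
    unfolding C2_def by (rule psi_expansion[OF Hm[OF that(1)] Hb[OF that(1)] f_measurable A that(2-5)])
  have B: "B_vec f l \<mu> g \<bullet> \<Delta> n \<omega> = innov_mean f (\<lambda>y. g y * l y) * (\<mu> \<bullet> \<Delta> n \<omega>)" for g n \<omega>
    by (simp add: B_vec_def)
  have sq: "(d * real n powr (-1/4))\<^sup>2 = d\<^sup>2 * real n powr (-1/2)" for d :: real and n :: nat
    by (simp add: power_mult_distrib power2_eq_square powr_add[symmetric])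
  let ?s = "\<lambda>n \<omega>. ((\<Sum>i=1..n. eps i \<omega>) / real n - \<mu> \<bullet> \<Delta> n \<omega>) / \<sigma>\<^sup>2"
  \<comment> \<open>The functional contributes a quadratic error C2 d^2, the estimators at most two
    linear errors C d; for d \<le> 1 the total is at most linear in d.\<close>
  have "\<exists>d>0. d \<le> 1 \<and> C2 * d\<^sup>2 + 2 * (C * d) \<le> c" if c: "c > 0" for c
  proof -
    define d where "d = min 1 (c / (C2 + 2 * C + 1))"
    have D: "C2 + 2 * C + 1 > 0" using C0 by linarith
    then have "d \<le> c / (C2 + 2 * C + 1)" "0 < d" "d \<le> 1" using c by (auto simp: d_def)
    with D have d: "0 < d" "d \<le> 1" "d * (C2 + 2 * C + 1) \<le> c" by (auto simp: pos_le_divide_eq)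
    have "C2 * d\<^sup>2 \<le> C2 * d" using d C0 by (intro mult_left_mono) (auto simp: power2_eq_square intro: mult_left_le)
    then have "C2 * d\<^sup>2 + 2 * (C * d) \<le> d * (C2 + 2 * C + 1)" using d(1) by (simp add: algebra_simps)
    then show ?thesis using d by (intro exI[of _ d]) auto
  qed
  note small = this
  show ?star
  proof (rule smallo_probI)
    fix e c :: real assume e: "e > 0" and c: "c > 0"
    obtain d where d: "d > 0" "d \<le> 1" "C2 * d\<^sup>2 + 2 * (C * d) \<le> c" using small[OF c] by blast
    have "e / 2 > 0" using e by simp
    then have ev: "mostly M (e/2 + e/2) (\<lambda>n \<omega>. nV (\<lambda>y. ft n \<omega> y - f y) \<le> ennreal (d * real n powr (-1/4))
        \<and> nV (\<lambda>y. ft n \<omega> y - fhat n \<omega> y - f' y * (\<mu> \<bullet> \<Delta> n \<omega>)) \<le> ennreal (d * real n powr (-1/2)))"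
      using d(1) by (intro mostly_conj ft_consistency ft_expansion) auto
    show "mostly M e (\<lambda>n \<omega>. (SUP h\<in>H. ennreal \<bar>psi m h (ft n \<omega>) - psi m h f
          - (\<Sum>i=1..n. g_star f (h_bar m f h) (eps i \<omega>)) / real n
          + B_vec f l \<mu> (g_star f (h_bar m f h)) \<bullet> \<Delta> n \<omega>
          - U_stat k (b n) n (\<lambda>i. eps i \<omega>) (h_bar m f h)\<bar>) \<le> ennreal (c * real n powr (-1/2)))"
    proof (rule mostly_mono[OF ev], use eventually_ge_at_top[of 1] in \<open>eventually_elim, intro ballI impI; elim conjE\<close>)
      fix n \<omega> assume n: "1 \<le> (n::nat)" and 1: "nV (\<lambda>y. ft n \<omega> y - f y) \<le> ennreal (d * real n powr (-1/4))"
        and 2: "nV (\<lambda>y. ft n \<omega> y - fhat n \<omega> y - f' y * (\<mu> \<bullet> \<Delta> n \<omega>)) \<le> ennreal (d * real n powr (-1/2))"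
      have x: "0 \<le> d * real n powr (-1/4)" "d * real n powr (-1/4) \<le> 1"
        using d powr_mono[of "-1/4" 0 "real n"] n by (auto intro!: mult_le_one)
      show "(SUP h\<in>H. ennreal \<bar>psi m h (ft n \<omega>) - psi m h f
          - (\<Sum>i=1..n. g_star f (h_bar m f h) (eps i \<omega>)) / real n
          + B_vec f l \<mu> (g_star f (h_bar m f h)) \<bullet> \<Delta> n \<omega>
          - U_stat k (b n) n (\<lambda>i. eps i \<omega>) (h_bar m f h)\<bar>) \<le> ennreal (c * real n powr (-1/2))"
      proof (rule SUP_least, rule ennreal_leI)
        fix h assume h: "h \<in> H"
        have fin: "nV (\<lambda>y. ft n \<omega> y - f y) < \<infinity>" "nV (\<lambda>y. ft n \<omega> y - fhat n \<omega> y - f' y * (\<mu> \<bullet> \<Delta> n \<omega>)) < \<infinity>"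
          using 1 2 by (auto intro: le_less_trans)
        note E = expansion_star[OF G(1,2)[OF h] C0(1) ft_measurable n fin]
        have b1: "\<bar>psi m h (ft n \<omega>) - psi m h f - (\<integral>t. h_bar m f h t * (ft n \<omega> t - f t) \<partial>lborel)\<bar> \<le> C2 * (d\<^sup>2 * real n powr (-1/2))"
          using R[OF h ft_measurable 1 x] unfolding sq .
        have b2: "\<bar>\<integral>t. h_bar m f h t * (ft n \<omega> t - fhat n \<omega> t - f' t * (\<mu> \<bullet> \<Delta> n \<omega>)) \<partial>lborel\<bar> \<le> C * (d * real n powr (-1/2))"
          using d by (intro bounded_functional(2)[OF G(1)[OF h] _ G(2)[OF h] C0(1) 2]) auto
        have "C2 * (d\<^sup>2 * real n powr (-1/2)) + C * (d * real n powr (-1/2)) \<le> (C2 * d\<^sup>2 + 2 * (C * d)) * real n powr (-1/2)"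
          using C0 d by (simp add: algebra_simps)
        also have "\<dots> \<le> c * real n powr (-1/2)" using d by (intro mult_right_mono) auto
        finally show "\<bar>psi m h (ft n \<omega>) - psi m h f
          - (\<Sum>i=1..n. g_star f (h_bar m f h) (eps i \<omega>)) / real n
          + B_vec f l \<mu> (g_star f (h_bar m f h)) \<bullet> \<Delta> n \<omega>
          - U_stat k (b n) n (\<lambda>i. eps i \<omega>) (h_bar m f h)\<bar> \<le> c * real n powr (-1/2)"
          unfolding B E(1) using b1 b2 by linarith
      qed
    qed (use e in simp)
  qed
  show ?sharp
  proof (rule smallo_probI)
    fix e c :: real assume e: "e > 0" and c: "c > 0"
    obtain d where d: "d > 0" "d \<le> 1" "C2 * d\<^sup>2 + 2 * (C * d) \<le> c" using small[OF c] by blast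
    have "e / 4 > 0" using e by simp
    then have ev: "mostly M (e/4 + (e/4 + (e/4 + e/4))) (\<lambda>n \<omega>. nV (\<lambda>y. fw n \<omega> y - f y) \<le> ennreal (d * real n powr (-1/4))
        \<and> nV (\<lambda>y. fw n \<omega> y - ft n \<omega> y + ?s n \<omega> * (y * f y)) \<le> ennreal (d * real n powr (-1/2))
        \<and> nV (\<lambda>y. ft n \<omega> y - f y) \<le> ennreal (d * real n powr (-1/4))
        \<and> nV (\<lambda>y. ft n \<omega> y - fhat n \<omega> y - f' y * (\<mu> \<bullet> \<Delta> n \<omega>)) \<le> ennreal (d * real n powr (-1/2)))"
      using d(1) by (intro mostly_conj fw_consistency fw_expansion ft_consistency ft_expansion) auto
    show "mostly M e (\<lambda>n \<omega>. (SUP h\<in>H. ennreal \<bar>psi m h (fw n \<omega>) - psi m h f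
          - (\<Sum>i=1..n. g_sharp f \<sigma> (h_bar m f h) (eps i \<omega>)) / real n
          + B_vec f l \<mu> (g_sharp f \<sigma> (h_bar m f h)) \<bullet> \<Delta> n \<omega>
          - U_stat k (b n) n (\<lambda>i. eps i \<omega>) (h_bar m f h)\<bar>) \<le> ennreal (c * real n powr (-1/2)))"
    proof (rule mostly_mono[OF ev], use eventually_ge_at_top[of 1] in \<open>eventually_elim, intro ballI impI; elim conjE\<close>)
      fix n \<omega> assume n: "1 \<le> (n::nat)" and 1: "nV (\<lambda>y. fw n \<omega> y - f y) \<le> ennreal (d * real n powr (-1/4))"
        and 3: "nV (\<lambda>y. fw n \<omega> y - ft n \<omega> y + ?s n \<omega> * (y * f y)) \<le> ennreal (d * real n powr (-1/2))"
        and 4: "nV (\<lambda>y. ft n \<omega> y - f y) \<le> ennreal (d * real n powr (-1/4))"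
        and 2: "nV (\<lambda>y. ft n \<omega> y - fhat n \<omega> y - f' y * (\<mu> \<bullet> \<Delta> n \<omega>)) \<le> ennreal (d * real n powr (-1/2))"
      have x: "0 \<le> d * real n powr (-1/4)" "d * real n powr (-1/4) \<le> 1"
        using d powr_mono[of "-1/4" 0 "real n"] n by (auto intro!: mult_le_one)
      show "(SUP h\<in>H. ennreal \<bar>psi m h (fw n \<omega>) - psi m h f
          - (\<Sum>i=1..n. g_sharp f \<sigma> (h_bar m f h) (eps i \<omega>)) / real n
          + B_vec f l \<mu> (g_sharp f \<sigma> (h_bar m f h)) \<bullet> \<Delta> n \<omega>
          - U_stat k (b n) n (\<lambda>i. eps i \<omega>) (h_bar m f h)\<bar>) \<le> ennreal (c * real n powr (-1/2))"
      proof (rule SUP_least, rule ennreal_leI)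
        fix h assume h: "h \<in> H"
        have fin: "nV (\<lambda>y. ft n \<omega> y - f y) < \<infinity>" "nV (\<lambda>y. ft n \<omega> y - fhat n \<omega> y - f' y * (\<mu> \<bullet> \<Delta> n \<omega>)) < \<infinity>"
          "nV (\<lambda>y. fw n \<omega> y - ft n \<omega> y + ?s n \<omega> * (y * f y)) < \<infinity>"
          using 2 3 4 by (auto intro: le_less_trans)
        note E = expansion_sharp[OF G(1,2)[OF h] C0(1) ft_measurable fw_measurable n fin nV_yf]
        have b1: "\<bar>psi m h (fw n \<omega>) - psi m h f - (\<integral>t. h_bar m f h t * (fw n \<omega> t - f t) \<partial>lborel)\<bar> \<le> C2 * (d\<^sup>2 * real n powr (-1/2))"
          using R[OF h fw_measurable 1 x] unfolding sq .
        have b2: "\<bar>\<integral>t. h_bar m f h t * (ft n \<omega> t - fhat n \<omega> t - f' t * (\<mu> \<bullet> \<Delta> n \<omega>)) \<partial>lborel\<bar> \<le> C * (d * real n powr (-1/2))"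
          using d by (intro bounded_functional(2)[OF G(1)[OF h] _ G(2)[OF h] C0(1) 2]) auto
        have b3: "\<bar>\<integral>t. h_bar m f h t * (fw n \<omega> t - ft n \<omega> t + ?s n \<omega> * (t * f t)) \<partial>lborel\<bar> \<le> C * (d * real n powr (-1/2))"
          using d by (intro bounded_functional(2)[OF G(1)[OF h] _ G(2)[OF h] C0(1) 3]) auto
        have "C2 * (d\<^sup>2 * real n powr (-1/2)) + 2 * (C * (d * real n powr (-1/2))) = (C2 * d\<^sup>2 + 2 * (C * d)) * real n powr (-1/2)"
          by (simp add: algebra_simps)
        also have "\<dots> \<le> c * real n powr (-1/2)" using d by (intro mult_right_mono) auto
        finally show "\<bar>psi m h (fw n \<omega>) - psi m h f
          - (\<Sum>i=1..n. g_sharp f \<sigma> (h_bar m f h) (eps i \<omega>)) / real n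
          + B_vec f l \<mu> (g_sharp f \<sigma> (h_bar m f h)) \<bullet> \<Delta> n \<omega>
          - U_stat k (b n) n (\<lambda>i. eps i \<omega>) (h_bar m f h)\<bar> \<le> c * real n powr (-1/2)"
          unfolding B E using b1 b2 b3 by linarith
      qed
    qed (use e in simp)
  qed
qed

end

theorem theorem2p1:
  fixes M :: "'a measure"
    and X :: "int \<Rightarrow> 'a \<Rightarrow> real"
    and eps :: "nat \<Rightarrow> 'a \<Rightarrow> real"
    and r :: "real^'d \<Rightarrow> (nat \<Rightarrow> real) \<Rightarrow> real"
    and r_dot :: "real^'d \<Rightarrow> (nat \<Rightarrow> real) \<Rightarrow> real^'d"
    and \<theta> :: "real^'d"
    and \<theta>_est :: "nat \<Rightarrow> (int \<Rightarrow> real) \<Rightarrow> real^'d"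
    and \<theta>_tilde :: "nat \<Rightarrow> 'a \<Rightarrow> real^'d"
    and f f' l k V :: "real \<Rightarrow> real"
    and \<sigma> \<alpha> d_star :: real
    and b :: "nat \<Rightarrow> real"
    and p m :: nat
    and \<H> :: "((nat \<Rightarrow> real) \<Rightarrow> real) set"
  assumes model: "nonlinear_ar M p X eps r \<theta> f \<sigma>"
    and est_measurable: "\<And>n. \<theta>_est n \<in> borel_measurable (\<Pi>\<^sub>M i\<in>{1 - int p..int n}. borel)"
    and est: "\<And>n \<omega>. \<theta>_tilde n \<omega> = \<theta>_est n (sample p X n \<omega>)"
    and est_rate: "bigO_prob M (\<lambda>n \<omega>. ennreal (norm (\<theta>_tilde n \<omega> - \<theta>))) (\<lambda>n. real n powr (-1/2))"
    and m: "1 \<le> m"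
    and H_measurable: "\<And>h. h \<in> \<H> \<Longrightarrow> h \<in> borel_measurable (\<Pi>\<^sub>M j\<in>{1..m}. borel)"
    and H_bound: "\<And>h y. h \<in> \<H> \<Longrightarrow> y \<in> space (\<Pi>\<^sub>M j\<in>{1..m}. borel) \<Longrightarrow>
          \<bar>h y\<bar> \<le> (\<Prod>j=1..m. V (y j))"
    and f_ac: "abs_continuous_on UNIV f"
    and f'_measurable: "f' \<in> borel_measurable borel"
    and f_deriv: "AE y in lborel. (f has_real_derivative f' y) (at y)"
    and l: "\<And>y. l y = - f' y / f y"
    and fisher: "integrable lborel (\<lambda>y. (l y)\<^sup>2 * f y)"
    and kernel: "kernel_C2 k"
    and b_pos: "\<And>n. 1 \<le> n \<Longrightarrow> 0 < b n"
    and b_upper: "(\<lambda>n. real n * b n ^ 4) \<longlonglongrightarrow> 0"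
    and d_star: "d_star = (50 + 20 * real CARD('d)) / (14 + 5 * real CARD('d))"
    and b_lower: "filterlim (\<lambda>n. real n * b n powr d_star) at_top sequentially"
    and r_gradient: "\<And>\<tau> x. x \<in> space (\<Pi>\<^sub>M j\<in>{1..p}. borel) \<Longrightarrow>
          GDERIV (\<lambda>t. r t x) \<tau> :> r_dot \<tau> x"
    and r_gradient_cont: "\<And>x. x \<in> space (\<Pi>\<^sub>M j\<in>{1..p}. borel) \<Longrightarrow>
          continuous_on UNIV (\<lambda>\<tau>. r_dot \<tau> x)"
    and r_remainder: "\<And>C. bigO_prob M
          (\<lambda>n \<omega>. SUP \<tau>\<in>{\<tau>. norm (\<tau> - \<theta>) \<le> C * real n powr (-1/2)}.
             ennreal (\<Sum>i=1..n.
               (r \<tau> (lag p X (int i - 1) \<omega>) - r \<theta> (lag p X (int i - 1) \<omega>)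
                 - r_dot \<theta> (lag p X (int i - 1) \<omega>) \<bullet> (\<tau> - \<theta>))\<^sup>2))
          (\<lambda>n. real n powr (-2/3))"
    and r_moment: "integrable M (\<lambda>\<omega>. norm (r_dot \<theta> (lag p X 0 \<omega>)) powr (5/2))"
    and r_posdef: "pos_definite
          (\<chi> i j. \<integral>\<omega>. r_dot \<theta> (lag p X 0 \<omega>) $ i * r_dot \<theta> (lag p X 0 \<omega>) $ j \<partial>M)"
    and V_measurable: "V \<in> borel_measurable borel"
    and V_ge_1: "\<And>y. 1 \<le> V y"
    and \<alpha>: "1 < \<alpha>"
    and V_moment: "integrable lborel (\<lambda>y. (1 + \<bar>y\<bar>) powr \<alpha> * (V y)\<^sup>2 * f y)"
    and D_bounded: "\<And>K. compact K \<Longrightarrow> \<exists>c::real. \<forall>s\<in>K. growth_modulus V s \<le> ennreal c"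
    and D_zero: "(growth_modulus V \<longlongrightarrow> 0) (at 0)"
  shows "smallo_prob M
      (\<lambda>n \<omega>. SUP h\<in>\<H>. ennreal \<bar>
          psi m h (kde k (b n) n (residual p r X (\<theta>_tilde n \<omega>) \<omega>)) - psi m h f
          - (\<Sum>i=1..n. g_star f (h_bar m f h) (eps i \<omega>)) / real n
          + B_vec f l (\<integral>\<omega>'. r_dot \<theta> (lag p X 0 \<omega>') \<partial>M) (g_star f (h_bar m f h))
              \<bullet> (\<theta>_tilde n \<omega> - \<theta>)
          - U_stat k (b n) n (\<lambda>i. eps i \<omega>) (h_bar m f h)\<bar>)
      (\<lambda>n. real n powr (-1/2))
    \<and> smallo_prob M
      (\<lambda>n \<omega>. SUP h\<in>\<H>. ennreal \<bar>
          psi m h (weighted_kde k (b n) n (residual p r X (\<theta>_tilde n \<omega>) \<omega>)) - psi m h f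
          - (\<Sum>i=1..n. g_sharp f \<sigma> (h_bar m f h) (eps i \<omega>)) / real n
          + B_vec f l (\<integral>\<omega>'. r_dot \<theta> (lag p X 0 \<omega>') \<partial>M) (g_sharp f \<sigma> (h_bar m f h))
              \<bullet> (\<theta>_tilde n \<omega> - \<theta>)
          - U_stat k (b n) n (\<lambda>i. eps i \<omega>) (h_bar m f h)\<bar>)
      (\<lambda>n. real n powr (-1/2))"
proof -
  have "ar_kde_est M p X eps r \<theta> f \<sigma> V r_dot f' l k \<alpha> b \<theta>_tilde"
    by (intro ar_kde_est.intro ar_kde.intro weight.intro ar_kde_axioms.intro ar_kde_est_axioms.intro model
        V_measurable V_ge_1 D_bounded D_zero f_ac f'_measurable f_deriv l fisher kernel b_pos b_upper
        b_lower[unfolded d_star] r_gradient r_remainder r_moment \<alpha> V_moment est_rate)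
  then interpret ar_kde_est M p X eps r \<theta> f \<sigma> V r_dot f' l k \<alpha> b \<theta>_tilde .
  \<comment> \<open>The lag vector at time 0 is the covariate of the first observation, so both
    means of the gradient agree.\<close>
  have mu: "(\<integral>\<omega>'. r_dot \<theta> (lag p X 0 \<omega>') \<partial>M) = \<mu>" by (simp add: \<mu>_def gd1)
  show ?thesis
    unfolding mu
    by (intro conjI expansion[of \<H> m, unfolded ft_def fw_def res_def \<Delta>_def] H_measurable H_bound)
qed

end
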